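(* Let $0<\gamma<1/2$ and let $f$ be a Holland map in $Hol(\gamma,\rho)$ (see context), with $\mu$ its unique invariant probability absolutely continuous with respect to Lebesgue measure. Then for any Hölder continuous observable $\varphi:[0,1]\to\mathbb R$ with $\int\varphi\,d\mu=0$, the series $$\sigma^2(\varphi)=\mathrm{Var}(\varphi)+2\sum_{k\ge1}\mathrm{Cov}(\varphi,\varphi\circ f^k)$$ converges absolutely (variance and covariances with respect to $\mu$), and $$W_n(\varphi)\to\sigma(\varphi)W\quad\text{in distribution in }\mathcal H^0_{1/2-\gamma}[0,1],$$ where $W$ is a standard Brownian motion and $W_n(\varphi)$ is regarded as a random process on $([0,1],\mu)$.
   Context: **Holland maps.** For $\gamma>0$, $f$ is in $Hol(\gamma,\rho)$ if $f:[0,1]\to[0,1]$ is given by $f(x)=x(1+x^\gamma\rho(x))$ for $0\le x\le1/2$ (with $f(0)=0$) and $f(x)=2x-1$ for $1/2<x\le1$, where: $\rho$ is positive, of class $C^2$ on $(0,1)$ and slowly varying at $0$ (i.e. $\rho(\lambda x)/\rho(x)\to1$ as $x\to0^+$ for every $\lambda>0$); $x\rho'(x)=o(\rho(x))$ and $x^2\rho''(x)=o(\rho(x))$ as $x\to0$; $f(1/2)=1$ and $f'(x)>1$ for all $x\ne0,1/2$; $\rho(x)\to0$ as $x\to0$. For $\gamma<1$ such a map has a unique $f$-invariant probability absolutely continuous with respect to Lebesgue measure. **Birkhoff process.** $S_n(\varphi)=\sum_{k=0}^{n-1}\varphi\circ f^k$ ($S_0=0$), and for $n\ge1$, $t\in[0,1]$,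 $$W_n(\varphi)(t)=n^{-1/2}\big(S_{\lfloor nt\rfloor}(\varphi)+(nt-\lfloor nt\rfloor)\varphi\circ f^{\lfloor nt\rfloor}\big).$$ **Hölder space.** For $\eta\in(0,1)$ and $x:[0,1]\to\mathbb R$, $w_\eta(x,\delta)=\sup_{0<|s-t|<\delta}|x(s)-x(t)|/|s-t|^\eta$ and $w_\eta(x)=\sup_{s\ne t}|x(s)-x(t)|/|s-t|^\eta$. $\mathcal H_\eta[0,1]=\{x:w_\eta(x)<\infty\}$, and $\mathcal H^0_\eta[0,1]=\{x\in\mathcal H_\eta[0,1]:\lim_{\delta\to0}w_\eta(x,\delta)=0\}$ with norm $\|x\|_\eta=w_\eta(x,1)+|x(0)|$ is a separable Banach space. *)

theory Defs
  imports "HOL-Probability.Probability" "HOL-Library.Landau_Symbols"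
begin

definition slowly_varying_at_0 :: "(real \<Rightarrow> real) \<Rightarrow> bool" where
  "slowly_varying_at_0 \<rho> \<longleftrightarrow>
     (\<forall>c>0. ((\<lambda>x. \<rho> (c * x) / \<rho> x) \<longlongrightarrow> 1) (at_right 0))"

definition C2_on_unit_interval :: "(real \<Rightarrow> real) \<Rightarrow> bool" where
  "C2_on_unit_interval \<rho> \<longleftrightarrow>
     (\<forall>x\<in>{0<..<1}. \<rho> differentiable (at x) \<and> deriv \<rho> differentiable (at x)) \<and>
     continuous_on {0<..<1} (deriv (deriv \<rho>))"

text \<open>
  Maps of the unit interval are total functions on the reals of which only the restriction to
  \<open>{0..1}\<close> is constrained; hence the derivative of \<open>f\<close> is taken within \<open>{0..1}\<close>
  (it is one-sided at the point 1).
\<close>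

definition holland_map :: "real \<Rightarrow> (real \<Rightarrow> real) \<Rightarrow> (real \<Rightarrow> real) \<Rightarrow> bool" where
  "holland_map \<gamma> \<rho> f \<longleftrightarrow>
     \<gamma> > 0 \<and>
     f \<in> {0..1} \<rightarrow> {0..1} \<and>
     f 0 = 0 \<and>
     (\<forall>x. 0 < x \<and> x \<le> 1/2 \<longrightarrow> f x = x * (1 + x powr \<gamma> * \<rho> x)) \<and>
     (\<forall>x. 1/2 < x \<and> x \<le> 1 \<longrightarrow> f x = 2 * x - 1) \<and>
     (\<forall>x\<in>{0<..<1}. \<rho> x > 0) \<and>
     C2_on_unit_interval \<rho> \<and>
     slowly_varying_at_0 \<rho> \<and>
     (\<lambda>x. x * deriv \<rho> x) \<in> o[at_right 0](\<rho>) \<and>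
     (\<lambda>x. x\<^sup>2 * deriv (deriv \<rho>) x) \<in> o[at_right 0](\<rho>) \<and>
     f (1/2) = 1 \<and>
     (\<forall>x\<in>{0..1} - {0, 1/2}. \<exists>D>1. (f has_real_derivative D) (at x within {0..1})) \<and>
     (\<rho> \<longlongrightarrow> 0) (at_right 0)"

definition acip :: "(real \<Rightarrow> real) \<Rightarrow> real measure \<Rightarrow> bool" where
  "acip f \<mu> \<longleftrightarrow>
     prob_space \<mu> \<and>
     sets \<mu> = sets (restrict_space borel {0..1}) \<and>
     f \<in> \<mu> \<rightarrow>\<^sub>M \<mu> \<and>
     distr \<mu> \<mu> f = \<mu> \<and>
     absolutely_continuous (restrict_space lborel {0..1}) \<mu>"

definition holder_continuous_on :: "real set \<Rightarrow> (real \<Rightarrow> real) \<Rightarrow> bool" where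
  "holder_continuous_on S \<phi> \<longleftrightarrow>
     (\<exists>\<alpha> C. 0 < \<alpha> \<and> \<alpha> \<le> 1 \<and> (\<forall>x\<in>S. \<forall>y\<in>S. \<bar>\<phi> x - \<phi> y\<bar> \<le> C * \<bar>x - y\<bar> powr \<alpha>))"

definition covariance :: "'a measure \<Rightarrow> ('a \<Rightarrow> real) \<Rightarrow> ('a \<Rightarrow> real) \<Rightarrow> real" where
  "covariance M X Y =
     (\<integral>\<omega>. (X \<omega> - (\<integral>\<omega>'. X \<omega>' \<partial>M)) * (Y \<omega> - (\<integral>\<omega>'. Y \<omega>' \<partial>M)) \<partial>M)"

definition asymptotic_variance :: "real measure \<Rightarrow> (real \<Rightarrow> real) \<Rightarrow> (real \<Rightarrow> real) \<Rightarrow> real" where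
  "asymptotic_variance \<mu> f \<phi> =
     covariance \<mu> \<phi> \<phi> + 2 * (\<Sum>k. covariance \<mu> \<phi> (\<phi> \<circ> (f ^^ Suc k)))"

definition birkhoff_sum :: "(real \<Rightarrow> real) \<Rightarrow> (real \<Rightarrow> real) \<Rightarrow> nat \<Rightarrow> real \<Rightarrow> real" where
  "birkhoff_sum f \<phi> n x = (\<Sum>k<n. \<phi> ((f ^^ k) x))"

definition birkhoff_process ::
    "(real \<Rightarrow> real) \<Rightarrow> (real \<Rightarrow> real) \<Rightarrow> nat \<Rightarrow> real \<Rightarrow> real \<Rightarrow> real" where
  "birkhoff_process f \<phi> n t x =
     (let m = nat \<lfloor>real n * t\<rfloor>
      in (birkhoff_sum f \<phi> m x + (real n * t - real m) * \<phi> ((f ^^ m) x)) / sqrt (real n))"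

definition holder_modulus :: "real \<Rightarrow> (real \<Rightarrow> real) \<Rightarrow> real \<Rightarrow> ennreal" where
  "holder_modulus \<eta> x \<delta> =
     (SUP (s, t) \<in> {(s, t). s \<in> {0..1} \<and> t \<in> {0..1} \<and> 0 < \<bar>s - t\<bar> \<and> \<bar>s - t\<bar> < \<delta>}.
        ennreal (\<bar>x s - x t\<bar> / \<bar>s - t\<bar> powr \<eta>))"

definition holder_seminorm :: "real \<Rightarrow> (real \<Rightarrow> real) \<Rightarrow> ennreal" where
  "holder_seminorm \<eta> x =
     (SUP (s, t) \<in> {(s, t). s \<in> {0..1} \<and> t \<in> {0..1} \<and> s \<noteq> t}.
        ennreal (\<bar>x s - x t\<bar> / \<bar>s - t\<bar> powr \<eta>))"

text \<open>
  Functions on the unit interval, as points of a function space, are represented by functions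
  that are \<open>extensional\<close> on \<open>{0..1}\<close>.
\<close>

definition holder_space :: "real \<Rightarrow> (real \<Rightarrow> real) set" where
  "holder_space \<eta> = {x \<in> extensional {0..1}. holder_seminorm \<eta> x < \<infinity>}"

definition holder0_space :: "real \<Rightarrow> (real \<Rightarrow> real) set" where
  "holder0_space \<eta> = {x \<in> holder_space \<eta>. (holder_modulus \<eta> x \<longlongrightarrow> 0) (at_right 0)}"

definition holder_norm :: "real \<Rightarrow> (real \<Rightarrow> real) \<Rightarrow> real" where
  "holder_norm \<eta> x = enn2real (holder_modulus \<eta> x 1) + \<bar>x 0\<bar>"

definition holder_dist :: "real \<Rightarrow> (real \<Rightarrow> real) \<Rightarrow> (real \<Rightarrow> real) \<Rightarrow> real" where
  "holder_dist \<eta> x y = holder_norm \<eta> (\<lambda>t. x t - y t)"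

lemma holder_modulus_bound:
  assumes "holder_seminorm \<eta> x < \<infinity>"
  shows "holder_modulus \<eta> x \<delta> < \<infinity>"
proof -
  have "holder_modulus \<eta> x \<delta> \<le> holder_seminorm \<eta> x"
    unfolding holder_modulus_def holder_seminorm_def by (rule SUP_subset_mono) auto
  then show ?thesis using assms by (simp add: order_le_less_trans)
qed

lemma holder_modulus_add:
  "holder_modulus \<eta> (\<lambda>t. x t + y t) \<delta> \<le> holder_modulus \<eta> x \<delta> + holder_modulus \<eta> y \<delta>"
  unfolding holder_modulus_def
proof (rule SUP_least, clarify)
  fix s t :: real
  let ?A = "{(s, t). s \<in> {0..1::real} \<and> t \<in> {0..1} \<and> 0 < \<bar>s - t\<bar> \<and> \<bar>s - t\<bar> < \<delta>}"
  let ?q = "\<lambda>x (s, t). ennreal (\<bar>x s - x t\<bar> / \<bar>s - t\<bar> powr \<eta>)"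
  assume st: "s \<in> {0..1}" "t \<in> {0..1}" "0 < \<bar>s - t\<bar>" "\<bar>s - t\<bar> < \<delta>"
  have "\<bar>x s + y s - (x t + y t)\<bar> / \<bar>s - t\<bar> powr \<eta>
      \<le> \<bar>x s - x t\<bar> / \<bar>s - t\<bar> powr \<eta> + \<bar>y s - y t\<bar> / \<bar>s - t\<bar> powr \<eta>"
    by (simp add: add_divide_distrib[symmetric] divide_right_mono)
  then have "?q (\<lambda>t. x t + y t) (s, t) \<le> ?q x (s, t) + ?q y (s, t)"
    by (simp add: ennreal_plus[symmetric] del: ennreal_plus)
  also have "\<dots> \<le> (SUP p\<in>?A. ?q x p) + (SUP p\<in>?A. ?q y p)"
    using st by (intro add_mono SUP_upper) auto
  finally show "ennreal (\<bar>x s + y s - (x t + y t)\<bar> / \<bar>s - t\<bar> powr \<eta>)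
      \<le> (SUP p\<in>?A. ?q x p) + (SUP p\<in>?A. ?q y p)" by simp
qed

lemma holder_modulus_uminus: "holder_modulus \<eta> (\<lambda>t. - x t) \<delta> = holder_modulus \<eta> x \<delta>"
  unfolding holder_modulus_def by (simp add: abs_minus_commute)

lemma holder_modulus_diff:
  "holder_modulus \<eta> (\<lambda>t. x t - y t) \<delta> \<le> holder_modulus \<eta> x \<delta> + holder_modulus \<eta> y \<delta>"
  using holder_modulus_add[of \<eta> x "\<lambda>t. - y t" \<delta>] by (simp add: holder_modulus_uminus)

lemma Metric_space_holder0: "Metric_space (holder0_space \<eta>) (holder_dist \<eta>)"
proof
  fix x y :: "real \<Rightarrow> real"
  show "0 \<le> holder_dist \<eta> x y"
    by (simp add: holder_dist_def holder_norm_def)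
  show "holder_dist \<eta> x y = holder_dist \<eta> y x"
    using holder_modulus_uminus[of \<eta> "\<lambda>t. x t - y t" 1]
    by (simp add: holder_dist_def holder_norm_def abs_minus_commute)
next
  fix x y :: "real \<Rightarrow> real"
  assume "x \<in> holder0_space \<eta>" "y \<in> holder0_space \<eta>"
  then have ext: "x \<in> extensional {0..1}" "y \<in> extensional {0..1}"
    and fin: "holder_modulus \<eta> x 1 < \<infinity>" "holder_modulus \<eta> y 1 < \<infinity>"
    by (auto simp: holder0_space_def holder_space_def intro: holder_modulus_bound[simplified])
  let ?z = "\<lambda>t. x t - y t"
  have "holder_modulus \<eta> ?z 1 < \<infinity>"
    using holder_modulus_diff[of \<eta> x y 1] fin by (simp add: order_le_less_trans)
  show "holder_dist \<eta> x y = 0 \<longleftrightarrow> x = y"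
  proof
    assume "holder_dist \<eta> x y = 0"
    then have "enn2real (holder_modulus \<eta> ?z 1) + \<bar>?z 0\<bar> = 0"
      by (simp add: holder_dist_def holder_norm_def)
    moreover have "0 \<le> enn2real (holder_modulus \<eta> ?z 1)" by simp
    ultimately have "enn2real (holder_modulus \<eta> ?z 1) = 0" and z0: "?z 0 = 0"
      by linarith+
    with \<open>holder_modulus \<eta> ?z 1 < \<infinity>\<close> have m0: "holder_modulus \<eta> ?z 1 = 0"
      by (auto simp: enn2real_eq_0_iff)
    have eq: "?z s = ?z t" if "s \<in> {0..1}" "t \<in> {0..1}" "0 < \<bar>s - t\<bar>" "\<bar>s - t\<bar> < 1" for s t
    proof -
      have "ennreal (\<bar>?z s - ?z t\<bar> / \<bar>s - t\<bar> powr \<eta>) \<le> holder_modulus \<eta> ?z 1"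
        unfolding holder_modulus_def using that by (intro SUP_upper2[of "(s, t)"]) auto
      then have "\<bar>?z s - ?z t\<bar> / \<bar>s - t\<bar> powr \<eta> \<le> 0"
        using m0 by (simp add: ennreal_eq_0_iff)
      moreover have "0 < \<bar>s - t\<bar> powr \<eta>" using that by simp
      ultimately show ?thesis by (simp add: divide_le_0_iff)
    qed
    have "?z t = 0" if "t \<in> {0..1}" for t
    proof (cases "t = 0 \<or> t = 1")
      case True
      have "?z (1/2) = ?z 0" "?z 1 = ?z (1/2)" by (rule eq; simp)+
      with True z0 show ?thesis by auto
    next
      case False
      with that have "?z t = ?z 0" by (intro eq) auto
      with z0 show ?thesis by simp
    qed
    then show "x = y"
      using ext by (intro extensionalityI[of _ "{0..1}"]) auto
  next
    assume "x = y"
    then have "holder_modulus \<eta> ?z 1 \<le> 0"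
      unfolding holder_modulus_def by (intro SUP_least) auto
    with \<open>x = y\<close> show "holder_dist \<eta> x y = 0"
      by (simp add: holder_dist_def holder_norm_def)
  qed
next
  fix x y z :: "real \<Rightarrow> real"
  assume "x \<in> holder0_space \<eta>" "y \<in> holder0_space \<eta>" "z \<in> holder0_space \<eta>"
  then have fin: "holder_modulus \<eta> x 1 < \<infinity>" "holder_modulus \<eta> y 1 < \<infinity>" "holder_modulus \<eta> z 1 < \<infinity>"
    by (auto simp: holder0_space_def holder_space_def intro: holder_modulus_bound[simplified])
  let ?m = "\<lambda>x y. holder_modulus \<eta> (\<lambda>t. x t - y t) 1"
  have "?m x y < \<infinity>" "?m y z < \<infinity>"
    using holder_modulus_diff[of \<eta> x y 1] holder_modulus_diff[of \<eta> y z 1] fin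
    by (simp_all add: order_le_less_trans)
  moreover have "?m x z \<le> ?m x y + ?m y z"
    using holder_modulus_add[of \<eta> "\<lambda>t. x t - y t" "\<lambda>t. y t - z t" 1] by simp
  ultimately have "enn2real (?m x z) \<le> enn2real (?m x y) + enn2real (?m y z)"
    by (metis enn2real_mono enn2real_plus ennreal_add_less_top infinity_ennreal_def)
  then show "holder_dist \<eta> x z \<le> holder_dist \<eta> x y + holder_dist \<eta> y z"
    by (simp add: holder_dist_def holder_norm_def)
qed

definition holder0_topology :: "real \<Rightarrow> (real \<Rightarrow> real) topology" where
  "holder0_topology \<eta> = Metric_space.mtopology (holder0_space \<eta>) (holder_dist \<eta>)"

lemma topspace_holder0_topology [simp]: "topspace (holder0_topology \<eta>) = holder0_space \<eta>"
  by (simp add: holder0_topology_def Metric_space.topspace_mtopology[OF Metric_space_holder0])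

definition borel_of_topology :: "'a topology \<Rightarrow> 'a measure" where
  "borel_of_topology T = sigma (topspace T) {U. openin T U}"

definition converges_in_distribution ::
    "'s topology \<Rightarrow> 'a measure \<Rightarrow> (nat \<Rightarrow> 'a \<Rightarrow> 's) \<Rightarrow> 'b measure \<Rightarrow> ('b \<Rightarrow> 's) \<Rightarrow> bool" where
  "converges_in_distribution T M X N Y \<longleftrightarrow>
     (\<forall>n. X n \<in> M \<rightarrow>\<^sub>M borel_of_topology T) \<and>
     Y \<in> N \<rightarrow>\<^sub>M borel_of_topology T \<and>
     (\<forall>F. continuous_map T euclideanreal F \<and> bounded (F ` topspace T) \<longrightarrow>
        (\<lambda>n. \<integral>\<omega>. F (X n \<omega>) \<partial>M) \<longlonglongrightarrow> (\<integral>\<omega>. F (Y \<omega>) \<partial>N))"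

definition standard_brownian_motion :: "'a measure \<Rightarrow> (real \<Rightarrow> 'a \<Rightarrow> real) \<Rightarrow> bool" where
  "standard_brownian_motion N W \<longleftrightarrow>
     prob_space N \<and>
     (\<forall>t\<in>{0..1}. W t \<in> borel_measurable N) \<and>
     (AE \<omega> in N. W 0 \<omega> = 0) \<and>
     (\<forall>\<omega>\<in>space N. continuous_on {0..1} (\<lambda>t. W t \<omega>)) \<and>
     (\<forall>s t. 0 \<le> s \<and> s < t \<and> t \<le> 1 \<longrightarrow>
        distributed N lborel (\<lambda>\<omega>. W t \<omega> - W s \<omega>) (normal_density 0 (sqrt (t - s)))) \<and>
     (\<forall>(\<tau> :: nat \<Rightarrow> real) m. 0 \<le> \<tau> 0 \<and> (\<forall>i<m. \<tau> i \<le> \<tau> (Suc i)) \<and> \<tau> m \<le> 1 \<longrightarrow>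
        prob_space.indep_vars N (\<lambda>_. borel) (\<lambda>i \<omega>. W (\<tau> (Suc i)) \<omega> - W (\<tau> i) \<omega>) {..<m})"

end

theory Submission
 imports Defs "HOL-Real_Asymp.Real_Asymp"
begin

text \<open>
The map has a neutral fixed point at 0, where orbits linger; everything depends on how fast the
memory of the starting point is nevertheless lost.

\<^bold>\<open>Dynamics.\<close> Densities are pushed forward by the transfer operator \<open>Pop\<close>. It preserves a cone of
densities whose logarithm is Hoelder in a coordinate, \<open>chart\<close>, that sends 0 to minus infinity: the map
expands this coordinate by enough to pay for its distortion. Fix \<open>s > \<gamma>\<close>. In the cone a bound
\<open>u x \<le> A * x powr - s\<close> with large \<open>A\<close> persists (\<open>domination\<close>), so a density keeps little mass near 0, and all
mass outside an interval of length of order \<open>N powr - (1 / s)\<close> visits the right half within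
\<open>N\<close> steps (\<open>visits\<close>, \<open>g_pow_decay\<close>). The linear branch turns mass in the right half into a uniform
lower bound, and the constants below it can be removed from two densities at once. This coupling
leaves a mass of order at most \<open>n powr - ((1 - s) / s)\<close> after \<open>n\<close> steps (\<open>coupling_rate\<close>). As \<open>\<gamma> < 1/2\<close>, for
\<open>s\<close> close to \<open>\<gamma>\<close> the exponent exceeds \<open>1 / (2 * \<gamma>)\<close>. Hence correlations of a Hoelder
observable of mean zero with any bounded function decay at this rate (\<open>holland_decay_of_correlations\<close>),
and the invariant measure is mixing, uniformly in the function of the future (\<open>holland_mixing\<close>).

\<^bold>\<open>Probability.\<close> From these two properties alone, decay with an exponent \<open>\<beta> > 1\<close> and uniform mixing,
one obtains: moments \<open>E \<bar>S n\<bar> powr p \<le> K * n powr (p / 2)\<close> for \<open>2 < p < 2 * \<beta>\<close> (\<open>moment_bound\<close>);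
a central limit theorem for one block that holds uniformly in bounded weights depending on the orbit
after the block (\<open>block_clt\<close>), by replacing one summand at a time; and, peeling off blocks one after the
other, the joint convergence of increments to independent Gaussian variables (\<open>blocks_limit\<close>).

\<^bold>\<open>Hoelder space.\<close> It suffices to test weak convergence on bounded Lipschitz functions
(\<open>weak_convergence_from_lipschitz\<close>). The process is compared with its dyadic polygons of a fixed level,
which depend on finitely many increments. The error is controlled by the increments on all finer levels
(\<open>polygon_approx\<close>), and these are small with large probability, uniformly in \<open>n\<close>, as soon as
\<open>p * (1/2 - \<eta>) > 1\<close> (\<open>rough_unlikely\<close>). For \<open>\<eta> = 1/2 - \<gamma>\<close> this says \<open>p > 1 / \<gamma>\<close>, which the
bound \<open>\<beta> > 1 / (2 * \<gamma>)\<close> permits.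
\<close>

section \<open>A cone of densities with Hoelder logarithm\<close>

text \<open>The power admits Hoelder densities; the linear term makes the modulus grow with slope at least 1, so
that an expansion of distances, multiplied by the constant of the cone, can absorb distortion.\<close>
definition modulus_fn :: "real => real => real" where
 "modulus_fn \<alpha> d = d + d powr \<alpha>"

lemma modulus_fn_nonneg: "0 <= d ==> 0 <= modulus_fn \<alpha> d"
 by (simp add: modulus_fn_def)

lemma modulus_fn_mono:
 "0 < \<alpha> ==> 0 <= d ==> d <= d' ==> modulus_fn \<alpha> d <= modulus_fn \<alpha> d'"
 by (auto simp: modulus_fn_def intro!: add_mono powr_mono2)

lemma modulus_fn_gain:
 "0 < \<alpha> ==> 0 <= d ==> d <= d' ==> modulus_fn \<alpha> d + (d' - d) <= modulus_fn \<alpha> d'"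
 by (auto simp: modulus_fn_def intro!: powr_mono2)

lemma modulus_fn_contract:
 assumes "0 < \<alpha>" "\<alpha> <= 1" "0 <= d" "d <= r * d'" "0 < r" "r <= 1"
 shows "modulus_fn \<alpha> d <= r powr \<alpha> * modulus_fn \<alpha> d'"
proof -
 have d': "0 <= d'" using assms by (meson order_trans zero_le_mult_iff not_less)
 have "modulus_fn \<alpha> d <= modulus_fn \<alpha> (r * d')"
  using assms by (intro modulus_fn_mono) auto
 also have "... = r * d' + r powr \<alpha> * d' powr \<alpha>"
  using assms d' by (simp add: modulus_fn_def powr_mult)
 also have "r * d' <= r powr \<alpha> * d'"
 proof (rule mult_right_mono[OF _ d'])
  have "r powr 1 <= r powr \<alpha>" using assms by (intro powr_mono') auto
  then show "r <= r powr \<alpha>" using assms by simp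
 qed
 finally show ?thesis by (simp add: modulus_fn_def distrib_left)
qed

text \<open>The logarithm turns expansion at the neutral fixed point into a gain of the order of the distortion
there. The second term has increasing derivative \<open>K * (1 + x)\<close>, and a map lying above the diagonal
therefore expands it even where its own derivative is 1.\<close>
definition chart :: "real => real => real" where
 "chart K x = ln x + K * (x + x\<^sup>2 / 2)"

lemma chart_mono:
 assumes "0 <= K" "0 < x" "x <= y"
 shows "chart K x <= chart K y"
 unfolding chart_def using assms by (intro add_mono mult_left_mono) (auto intro!: power_mono)

text \<open>The inverse of the right branch contracts the chart; this lowers the constant of the cone and
makes room for subtracting constants.\<close>
lemma chart_expand:
 assumes K: "0 <= K" and x: "0 < x" "x <= y" "y <= 1"
 shows "chart K ((y+1)/2) - chart K ((x+1)/2) <= 3/4 * (chart K y - chart K x)"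
proof -
 let ?h = "\<lambda>z. 3/4 * chart K z - chart K ((z+1)/2)"
 have "?h x <= ?h y"
 proof (rule DERIV_nonneg_imp_nondecreasing[OF x(2)])
  fix z assume z: "x <= z" "z <= y"
  then have z0: "0 < z" "z <= 1" using x by auto
  have "(?h has_real_derivative 3/4*(1/z + K*(1+z)) - (1/(z+1) + K*(1/2+(z+1)/4))) (at z)"
   unfolding chart_def using z0
   by (auto intro!: derivative_eq_intros simp: divide_simps) (auto simp: algebra_simps power2_eq_square)
  moreover have "0 <= 3/4*(1/z + K*(1+z)) - (1/(z+1) + K*(1/2+(z+1)/4))"
  proof -
   have "1/(z+1) <= 3/4*(1/z)" using z0 by (simp add: field_simps)
   moreover have "K * (1/2+(z+1)/4) <= K * (3/4*(1+z))"
    using K z0 by (intro mult_left_mono) auto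
   moreover have "3/4*(1/z + K*(1+z)) = 3/4*(1/z) + K * (3/4*(1+z))" by simp
   ultimately show ?thesis by linarith
  qed
  ultimately show "\<exists>y. (?h has_real_derivative y) (at z) \<and> 0 <= y" by blast
 qed
 then show ?thesis by (simp add: algebra_simps)
qed

definition hcone :: "real => real => real => (real => real) => bool" where
 "hcone K \<alpha> a u \<longleftrightarrow> (\<forall>x\<in>{0<..1}. 0 <= u x) \<and>
   (\<forall>x\<in>{0<..1}. \<forall>y\<in>{0<..1}. u x <= exp (a * modulus_fn \<alpha> \<bar>chart K x - chart K y\<bar>) * u y)"

lemma hcone_nonneg: "hcone K \<alpha> a u ==> 0 < x ==> x <= 1 ==> 0 <= u x"
 by (simp add: hcone_def)

lemma hconeD: "hcone K \<alpha> a u ==> 0 < x ==> x <= 1 ==> 0 < y ==> y <= 1 ==>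
  u x <= exp (a * modulus_fn \<alpha> \<bar>chart K x - chart K y\<bar>) * u y"
 by (simp add: hcone_def)

lemma hcone_add:
 assumes "hcone K \<alpha> a u" "hcone K \<alpha> a v"
 shows "hcone K \<alpha> a (\<lambda>x. u x + v x)"
 using assms unfolding hcone_def
 by (auto simp: distrib_left intro!: add_mono)

lemma hcone_mult:
 assumes "hcone K \<alpha> a u" "hcone K \<alpha> b v"
 shows "hcone K \<alpha> (a + b) (\<lambda>x. u x * v x)"
 unfolding hcone_def
proof (intro conjI ballI)
 fix x y :: real assume xy: "x \<in> {0<..1}" "y \<in> {0<..1}"
 have "u x * v x <= (exp (a * modulus_fn \<alpha> \<bar>chart K x - chart K y\<bar>) * u y) *
   (exp (b * modulus_fn \<alpha> \<bar>chart K x - chart K y\<bar>) * v y)"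
  using assms xy by (intro mult_mono) (auto simp: hcone_def)
 then show "u x * v x <= exp ((a+b) * modulus_fn \<alpha> \<bar>chart K x - chart K y\<bar>) * (u y * v y)"
  by (simp add: distrib_right exp_add mult_ac)
qed (use assms in \<open>auto simp: hcone_def\<close>)

lemma hcone_const: "0 <= c ==> 0 <= a ==> hcone K \<alpha> a (\<lambda>_. c)"
 unfolding hcone_def
 by (auto intro!: mult_right_mono[of 1 "exp t" c for t, unfolded mult_1_left] mult_nonneg_nonneg modulus_fn_nonneg)

lemma hcone_mono:
 assumes "hcone K \<alpha> a u" "a <= b" shows "hcone K \<alpha> b u"
 unfolding hcone_def
proof (intro conjI ballI)
 fix x y :: real assume xy: "x \<in> {0<..1}" "y \<in> {0<..1}"
 have "u x <= exp (a * modulus_fn \<alpha> \<bar>chart K x - chart K y\<bar>) * u y"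
  using assms xy by (auto simp: hcone_def)
 also have "... <= exp (b * modulus_fn \<alpha> \<bar>chart K x - chart K y\<bar>) * u y"
  using assms xy by (intro mult_right_mono) (auto simp: hcone_def intro!: mult_right_mono modulus_fn_nonneg)
 finally show "u x <= exp (b * modulus_fn \<alpha> \<bar>chart K x - chart K y\<bar>) * u y" .
qed (use assms in \<open>auto simp: hcone_def\<close>)

lemma hcone_compare:
 assumes u: "hcone K \<alpha> a u" and par: "0 <= K" "0 < \<alpha>" "0 <= a"
  and t: "0 < t" "t <= x" "x <= 1" "t <= y" "y <= 1"
 shows "u x <= exp (a * modulus_fn \<alpha> (chart K 1 - chart K t)) * u y"
proof -
 have c: "chart K t <= chart K x" "chart K x <= chart K 1" "chart K t <= chart K y" "chart K y <= chart K 1"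
  using par t by (auto intro!: chart_mono)
 have "u x <= exp (a * modulus_fn \<alpha> \<bar>chart K x - chart K y\<bar>) * u y"
  using u t by (auto intro: hconeD)
 also have "... <= exp (a * modulus_fn \<alpha> (chart K 1 - chart K t)) * u y"
  using par t c hcone_nonneg[OF u, of y]
  by (intro mult_right_mono) (auto intro!: mult_left_mono modulus_fn_mono)
 finally show ?thesis .
qed

lemma hcone_continuous:
 assumes u: "hcone K \<alpha> a u" and \<alpha>: "0 < \<alpha>"
 shows "continuous_on {0<..1} u"
 unfolding continuous_on_def
proof
 fix y :: real assume y: "y \<in> {0<..1}"
 let ?F = "at y within {0<..1}"
 let ?E = "\<lambda>x. exp (a * modulus_fn \<alpha> \<bar>chart K x - chart K y\<bar>)"
 have "((\<lambda>x. chart K x - chart K y) \<longlongrightarrow> chart K y - chart K y) ?F"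
  unfolding chart_def using y by (intro tendsto_intros) auto
 then have d0: "((\<lambda>x. \<bar>chart K x - chart K y\<bar>) \<longlongrightarrow> 0) ?F"
  using tendsto_rabs by fastforce
 have "((\<lambda>x. modulus_fn \<alpha> \<bar>chart K x - chart K y\<bar>) \<longlongrightarrow> 0 + 0 powr \<alpha>) ?F"
  unfolding modulus_fn_def using \<alpha>
  by (intro tendsto_intros tendsto_powr' d0 tendsto_const) auto
 then have E: "(?E \<longlongrightarrow> exp (a * 0)) ?F"
  by (intro tendsto_intros) auto
 have ev: "eventually (\<lambda>x. x \<in> {0<..1}) ?F"
  by (simp add: eventually_at_filter)
 show "(u \<longlongrightarrow> u y) ?F"
 proof (rule tendsto_sandwich)
  show "eventually (\<lambda>x. u y / ?E x <= u x) ?F"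
   using ev
  proof eventually_elim
   case (elim x)
   then have "u y <= ?E x * u x"
    using hconeD[OF u, of y x] y by (auto simp: abs_minus_commute)
   then show ?case by (simp add: field_simps)
  qed
  show "eventually (\<lambda>x. u x <= ?E x * u y) ?F"
   using ev by eventually_elim (use hconeD[OF u] y in auto)
  show "((\<lambda>x. u y / ?E x) \<longlongrightarrow> u y) ?F"
   using tendsto_divide[OF tendsto_const[of "u y"] E] by simp
  show "((\<lambda>x. ?E x * u y) \<longlongrightarrow> u y) ?F"
   using tendsto_mult[OF E tendsto_const[of "u y"]] by simp
 qed
qed

lemma hcone_cmult:
 assumes "hcone K \<alpha> a u" "0 <= c"
 shows "hcone K \<alpha> a (\<lambda>x. c * u x)"
 using assms unfolding hcone_def
 by (auto simp: mult.left_commute intro!: mult_left_mono)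

text \<open>If \<open>c\<close> is at most the share \<open>1 - r\<close> of \<open>u\<close>, then \<open>ln (u - c)\<close> varies at most \<open>1 / r\<close> times as
fast as \<open>ln u\<close>: the constants \<open>r * a\<close> and \<open>a\<close> leave exactly this room.\<close>
lemma hcone_subtract:
 assumes u: "hcone K \<alpha> (r * a) u" and r: "0 <= r" "r <= 1" "0 <= a"
  and c: "!!x. 0 < x ==> x <= 1 ==> c <= (1 - r) * u x" "0 <= c"
 shows "hcone K \<alpha> a (\<lambda>x. u x - c)"
 unfolding hcone_def
proof (intro conjI ballI)
 fix x :: real assume x: "x \<in> {0<..1}"
 have "c <= (1 - r) * u x" using c x by auto
 also have "... <= 1 * u x" using hcone_nonneg[OF u] x r by (intro mult_right_mono) auto
 finally show "0 <= u x - c" by simp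
next
 fix x y :: real assume xy: "x \<in> {0<..1}" "y \<in> {0<..1}"
 define T where "T = a * modulus_fn \<alpha> \<bar>chart K x - chart K y\<bar>"
 have T: "0 <= T" using r by (simp add: T_def modulus_fn_nonneg)
 have 1: "u x <= exp (r * T) * u y"
  using hconeD[OF u, of x y] xy by (simp add: T_def mult_ac)
 have conv: "exp (r * T) <= r * exp T + (1 - r)"
  using convex_onD[OF exp_convex, of r 0 T] r by (simp add: add.commute)
 have uy: "0 <= u y" using hcone_nonneg[OF u] xy by auto
 have "c * (exp T - 1) <= (1 - r) * u y * (exp T - 1)"
  using c(1)[of y] xy T by (intro mult_right_mono) auto
 also have "... = ((1 - r) * (exp T - 1)) * u y" by (simp add: mult_ac)
 also have "... <= (exp T - exp (r * T)) * u y"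
  using conv uy by (intro mult_right_mono) (auto simp: algebra_simps)
 finally have "u x - c <= exp T * (u y - c)" using 1 by (simp add: algebra_simps)
 then show "u x - c <= exp (a * modulus_fn \<alpha> \<bar>chart K x - chart K y\<bar>) * (u y - c)"
  by (simp add: T_def)
qed

section \<open>Transfer operators of intermittent maps\<close>

text \<open>Functions are considered on \<open>{0<..1}\<close>, since densities may blow up at 0.\<close>
abbreviation unit_leb :: "real measure" where
 "unit_leb \<equiv> restrict_space lborel {0<..1}"

abbreviation leb_int :: "(real => real) => real" (binder "LEB " 10) where
 "leb_int u \<equiv> integral\<^sup>L unit_leb u"

lemma space_unit_leb [simp]: "space unit_leb = {0<..1}"
 by (simp add: space_restrict_space)

lemma prob_space_unit_leb: "prob_space unit_leb"
 by (rule prob_spaceI) (simp add: emeasure_restrict_space)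

lemma sets_unit_leb_iff: "A \<in> sets unit_leb \<longleftrightarrow> A \<subseteq> {0<..1} \<and> A \<in> sets borel"
 by (subst sets_restrict_space_iff) auto

lemma continuous_on_measurable_unit_leb:
 fixes u :: "real => real"
 shows "continuous_on {0<..1} u ==> u \<in> borel_measurable unit_leb"
 using borel_measurable_continuous_on_restrict[of "{0<..1}" u]
 by (simp add: measurable_cong_sets[OF sets_restrict_space_cong[OF sets_lborel] refl])

lemma hcone_measurable: "hcone K \<alpha> a u ==> 0 < \<alpha> ==> u \<in> borel_measurable unit_leb"
 by (intro continuous_on_measurable_unit_leb hcone_continuous)

text \<open>\<open>F\<close> is the left branch and \<open>D\<close> its derivative. The distortion of \<open>F\<close> is paid by the gain of \<open>F\<close>
in the chart. \<open>drift\<close> bounds from below the speed at which orbits leave 0, and \<open>escape\<close> says that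
near 0 the function \<open>x powr - s\<close> is a strict supersolution for the transfer operator of \<open>F\<close>.\<close>
locale intermittent_map =
 fixes f F D :: "real => real" and K q s c b c1 :: real
 assumes F_lim: "(F \<longlongrightarrow> 0) (at_right 0)"
  and F_half: "F (1/2) = 1"
  and F_deriv: "!!x. 0 < x ==> x <= 1/2 ==> (F has_real_derivative D x) (at x)"
  and D_cont: "continuous_on {0<..1/2} D"
  and D_ge: "!!x. 0 < x ==> x <= 1/2 ==> 1 <= D x"
  and f_left: "!!x. 0 < x ==> x <= 1/2 ==> f x = F x"
  and f_right: "!!x. 1/2 < x ==> x <= 1 ==> f x = 2 * x - 1"
  and K_nonneg: "0 <= K"
  and q_pos: "0 < q"
  and distortion: "!!x y. 0 < x ==> x <= y ==> y <= 1/2 ==>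
    \<bar>ln (D y) - ln (D x)\<bar> <= q * ((chart K (F y) - chart K (F x)) - (chart K y - chart K x))"
  and c_pos: "0 < c"
  and drift: "!!x. 0 < x ==> x <= 1/2 ==> x * (1 + c * x powr s) <= F x"
  and s_bounds: "0 < s" "s < 1"
  and b_pos: "0 < b" and c1_pos: "0 < c1"
  and escape: "!!x. 0 < x ==> x <= b ==> x <= 1/2 ==> c1 <= F x powr - s - x powr - s / D x"
begin

lemma F_strict_mono: "0 < x ==> x < y ==> y <= 1/2 ==> F x < F y"
 by (rule DERIV_pos_imp_increasing) (force intro: F_deriv less_le_trans[OF _ D_ge])+

lemma F_pos:
 assumes "0 < x" "x <= 1/2" shows "x < F x"
proof -
 have "x * 1 < x * (1 + c * x powr s)"
  using assms c_pos by (intro mult_strict_left_mono) auto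
 then show ?thesis using drift[OF assms] by simp
qed

lemma F_le_1: "0 < x ==> x <= 1/2 ==> F x <= 1"
 using F_strict_mono[of x "1/2"] F_half by (metis less_eq_real_def)

definition g :: "real => real" where
 "g x = (THE y. 0 < y \<and> y <= 1/2 \<and> F y = x)"

lemma g_ex:
 assumes "0 < x" "x <= 1"
 shows "\<exists>!y. 0 < y \<and> y <= 1/2 \<and> F y = x"
proof -
 have "eventually (\<lambda>e. F e < x) (at_right 0)"
  using F_lim assms(1) by (rule order_tendstoD)
 moreover have "eventually (\<lambda>e. 0 < e \<and> e < (1/2::real)) (at_right 0)"
  by (auto simp: eventually_at_right_field intro!: exI[of _ "1/2"])
 ultimately have "eventually (\<lambda>e. F e < x \<and> 0 < e \<and> e < (1/2::real)) (at_right 0)"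
  by eventually_elim auto
 then obtain e where e: "F e < x" "0 < e" "e < 1/2"
  by (metis (mono_tags, lifting) eventually_happens trivial_limit_at_right_real)
 have "\<exists>y. e <= y \<and> y <= 1/2 \<and> F y = x"
 proof (rule IVT')
  show "continuous_on {e..1/2} F"
   using e by (intro continuous_at_imp_continuous_on ballI DERIV_isCont[OF F_deriv]) auto
 qed (use e assms F_half in auto)
 moreover have "y = y'" if "0 < y" "y <= 1/2" "0 < y'" "y' <= 1/2" "F y = F y'" for y y'
  using F_strict_mono[of y y'] F_strict_mono[of y' y] that by force
 ultimately show ?thesis using e by (metis less_le_trans)
qed

lemma g_props:
 assumes "0 < x" "x <= 1"
 shows "0 < g x" "g x <= 1/2" "F (g x) = x"
 using theI'[OF g_ex[OF assms]] unfolding g_def by auto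

lemma g_F: "0 < y ==> y <= 1/2 ==> g (F y) = y"
 unfolding g_def using F_pos[of y] F_le_1[of y] by (intro the1_equality[OF g_ex]) auto

lemma g_mono: "0 < x ==> x <= y ==> y <= 1 ==> g x <= g y"
 using F_strict_mono[of "g y" "g x"] g_props[of x] g_props[of y] by (cases "g x <= g y") auto

lemma g_le: "0 < x ==> x <= 1 ==> g x < x"
 using F_pos[of "g x"] g_props[of x] by auto

text \<open>Contributions of the left and the right branch to the density of the image measure, and their sum,
the transfer operator of \<open>f\<close>.\<close>
definition Lop :: "(real => real) => real => real" where "Lop u x = u (g x) / D (g x)"
definition Bop :: "(real => real) => real => real" where "Bop u x = u ((x + 1) / 2) / 2"
definition Pop :: "(real => real) => real => real" where "Pop u x = Lop u x + Bop u x"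

text \<open>The chart distance of two points exceeds that of their preimages by the gain of \<open>F\<close>; by
\<open>modulus_fn_gain\<close>, \<open>a \<ge> q\<close> times this gain outweighs the distortion of \<open>F\<close>.\<close>
lemma Lop_hcone:
 assumes u: "hcone K \<alpha> a u" and \<alpha>: "0 < \<alpha>" and a: "q <= a"
 shows "hcone K \<alpha> a (Lop u)"
 unfolding hcone_def
proof (intro conjI ballI)
 fix x :: real assume "x \<in> {0<..1}"
 then show "0 <= Lop u x"
  using hcone_nonneg[OF u, of "g x"] g_props[of x] D_ge[of "g x"] by (auto simp: Lop_def)
next
 fix x y :: real assume xy: "x \<in> {0<..1}" "y \<in> {0<..1}"
 let ?d = "\<bar>chart K x - chart K y\<bar>" and ?d' = "\<bar>chart K (g x) - chart K (g y)\<bar>"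
 have gx: "0 < g x" "g x <= 1/2" "F (g x) = x" "1 <= D (g x)"
  and gy: "0 < g y" "g y <= 1/2" "F (g y) = y" "1 <= D (g y)"
  using xy g_props[of x] g_props[of y] D_ge by auto
 have q0: "0 <= q * (?d - ?d') \<and> \<bar>ln (D (g y)) - ln (D (g x))\<bar> <= q * (?d - ?d')"
 proof (cases "x <= y")
  case True
  then have "chart K (g x) <= chart K (g y)" "chart K x <= chart K y"
   using xy gx gy K_nonneg by (auto intro!: chart_mono g_mono)
  then have "?d = chart K y - chart K x" "?d' = chart K (g y) - chart K (g x)" by auto
  moreover have "g x <= g y" using g_mono[of x y] True xy by auto
  ultimately show ?thesis
   using distortion[of "g x" "g y"] gx gy by auto
 next
  case False
  then have "chart K (g y) <= chart K (g x)" "chart K y <= chart K x"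
   using xy gx gy K_nonneg by (auto intro!: chart_mono g_mono)
  then have "?d = chart K x - chart K y" "?d' = chart K (g x) - chart K (g y)" by auto
  moreover have "g y <= g x" using g_mono[of y x] False xy by auto
  ultimately show ?thesis
   using distortion[of "g y" "g x"] gx gy by auto
 qed
 have dd: "?d' <= ?d" using q0 q_pos by (simp add: zero_le_mult_iff)
 have "Lop u x <= (exp (a * modulus_fn \<alpha> ?d') * u (g y)) / D (g x)"
  unfolding Lop_def using hconeD[OF u, of "g x" "g y"] gx gy by (intro divide_right_mono) auto
 also have "... = exp (a * modulus_fn \<alpha> ?d') * (D (g y) / D (g x)) * Lop u y"
  using gx gy by (simp add: Lop_def field_simps)
 also have "D (g y) / D (g x) = exp (ln (D (g y)) - ln (D (g x)))"
  using gx gy by (simp add: exp_diff)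
 also have "exp (a * modulus_fn \<alpha> ?d') * exp (ln (D (g y)) - ln (D (g x))) * Lop u y
   <= exp (a * modulus_fn \<alpha> ?d') * exp (a * (?d - ?d')) * Lop u y"
 proof (intro mult_right_mono mult_left_mono)
  have "ln (D (g y)) - ln (D (g x)) <= q * (?d - ?d')" using q0 by linarith
  also have "... <= a * (?d - ?d')" using dd a by (intro mult_right_mono) auto
  finally show "exp (ln (D (g y)) - ln (D (g x))) <= exp (a * (?d - ?d'))" by simp
  show "0 <= Lop u y" using hcone_nonneg[OF u, of "g y"] gy by (auto simp: Lop_def)
 qed auto
 also have "exp (a * modulus_fn \<alpha> ?d') * exp (a * (?d - ?d')) = exp (a * (modulus_fn \<alpha> ?d' + (?d - ?d')))"
  by (simp add: exp_add[symmetric] distrib_left)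
 also have "... * Lop u y <= exp (a * modulus_fn \<alpha> ?d) * Lop u y"
 proof (intro mult_right_mono)
  show "exp (a * (modulus_fn \<alpha> ?d' + (?d - ?d'))) <= exp (a * modulus_fn \<alpha> ?d)"
   using modulus_fn_gain[OF \<alpha> _ dd] a q_pos by (auto intro!: mult_left_mono)
  show "0 <= Lop u y" using hcone_nonneg[OF u, of "g y"] gy by (auto simp: Lop_def)
 qed
 finally show "Lop u x <= exp (a * modulus_fn \<alpha> ?d) * Lop u y" .
qed

lemma Bop_hcone:
 assumes u: "hcone K \<alpha> a u" and \<alpha>: "0 < \<alpha>" "\<alpha> <= 1" and a: "0 <= a"
 shows "hcone K \<alpha> ((3/4) powr \<alpha> * a) (Bop u)"
 unfolding hcone_def
proof (intro conjI ballI)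
 fix x :: real assume "x \<in> {0<..1}"
 then show "0 <= Bop u x"
  using hcone_nonneg[OF u, of "(x+1)/2"] by (auto simp: Bop_def)
next
 fix x y :: real assume xy: "x \<in> {0<..1}" "y \<in> {0<..1}"
 let ?x = "(x+1)/2" and ?y = "(y+1)/2"
 let ?d = "\<bar>chart K x - chart K y\<bar>" and ?d' = "\<bar>chart K ?x - chart K ?y\<bar>"
 have "?d' <= 3/4 * ?d"
 proof (cases "x <= y")
  case True
  then show ?thesis
   using xy chart_expand[OF K_nonneg, of x y] chart_mono[OF K_nonneg, of x y] chart_mono[OF K_nonneg, of ?x ?y] by auto
 next
  case False
  then show ?thesis
   using xy chart_expand[OF K_nonneg, of y x] chart_mono[OF K_nonneg, of y x] chart_mono[OF K_nonneg, of ?y ?x] by auto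
 qed
 then have m: "modulus_fn \<alpha> ?d' <= (3/4) powr \<alpha> * modulus_fn \<alpha> ?d"
  using \<alpha> by (intro modulus_fn_contract) auto
 have "Bop u x <= exp (a * modulus_fn \<alpha> ?d') * Bop u y"
  using hconeD[OF u, of ?x ?y] xy by (auto simp: Bop_def)
 also have "... <= exp ((3/4) powr \<alpha> * a * modulus_fn \<alpha> ?d) * Bop u y"
  using xy mult_left_mono[OF m a] hcone_nonneg[OF u, of ?y]
  by (intro mult_right_mono) (auto simp: Bop_def mult_ac)
 finally show "Bop u x <= exp ((3/4) powr \<alpha> * a * modulus_fn \<alpha> ?d) * Bop u y" .
qed

lemma Bop_hcone':
 assumes u: "hcone K \<alpha> a u" and \<alpha>: "0 < \<alpha>" "\<alpha> <= 1" and a: "0 <= a"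
 shows "hcone K \<alpha> a (Bop u)"
proof (rule hcone_mono[OF Bop_hcone[OF assms]])
 have "(3/4) powr \<alpha> <= (3/4::real) powr 0" using \<alpha> by (intro powr_mono') auto
 then show "(3/4) powr \<alpha> * a <= a" using a by (simp add: mult_left_le_one_le)
qed

lemma Pop_hcone:
 assumes "hcone K \<alpha> a u" "0 < \<alpha>" "\<alpha> <= 1" "q <= a"
 shows "hcone K \<alpha> a (Pop u)"
 unfolding Pop_def using assms q_pos by (intro hcone_add Lop_hcone Bop_hcone') auto

lemma borel_measurable_unit_leb_id [measurable]:
 "(\<lambda>x::real. x) \<in> borel_measurable (restrict_space borel {0<..1})"
 by (intro measurable_restrict_space1) auto

lemma f_measurable [measurable]: "f \<in> unit_leb \<rightarrow>\<^sub>M unit_leb"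
proof -
 have F: "continuous_on {0<..1/2} F"
  by (intro continuous_at_imp_continuous_on ballI DERIV_isCont[OF F_deriv]) auto
 have "(\<lambda>x. if x <= 1/2 then F x else 2 * x - 1) \<in> borel_measurable unit_leb"
 proof (rule measurable_If_restrict_space_iff[THEN iffD2, OF _ conjI])
  show "{x \<in> space unit_leb. x <= 1/2} \<in> sets unit_leb"
   by (auto simp: sets_unit_leb_iff Collect_conj_eq)
  have *: "{0<..1} \<inter> {x. x <= 1/2} = {0<..1/2::real}" by auto
  have "F \<in> borel_measurable (restrict_space borel {0<..1/2})"
   by (intro borel_measurable_continuous_on_restrict F)
  moreover have "restrict_space unit_leb {x. x <= 1/2} = restrict_space lborel {0<..1/2}"
   by (subst restrict_restrict_space) (simp_all only: *, auto)
  ultimately show "F \<in> borel_measurable (restrict_space unit_leb {x. x <= 1/2})"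
   by (simp only: measurable_cong_sets[OF sets_restrict_space_cong[OF sets_lborel] refl])
  show "(\<lambda>x. 2 * x - 1) \<in> borel_measurable (restrict_space unit_leb {x. \<not> x <= 1/2})"
   by (intro measurable_restrict_space1 continuous_on_measurable_unit_leb continuous_intros)
 qed
 then have "f \<in> borel_measurable unit_leb"
  by (rule measurable_cong[THEN iffD1, rotated]) (auto simp: f_left f_right)
 then have "f \<in> unit_leb \<rightarrow>\<^sub>M lborel" by simp
 then show ?thesis
 proof (rule measurable_restrict_space2[rotated])
  show "f \<in> space unit_leb \<rightarrow> {0<..1}"
  proof
   fix x assume "x \<in> space unit_leb"
   then show "f x \<in> {0<..1}"
    using f_left[of x] f_right[of x] F_pos[of x] F_le_1[of x] by (cases "x <= 1/2") auto
  qed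
 qed
qed

lemma measurable_piece:
 assumes "u \<in> borel_measurable unit_leb" "A \<in> sets unit_leb" "B \<in> sets borel"
 shows "(\<lambda>y. ennreal (u y) * indicator B y * indicator A (f y)) \<in> borel_measurable unit_leb"
proof (intro borel_measurable_times_ennreal)
 show "(\<lambda>y. indicator A (f y)) \<in> borel_measurable unit_leb"
  by (rule measurable_compose[OF f_measurable borel_measurable_indicator[OF assms(2)]])
 show "indicator B \<in> borel_measurable unit_leb"
  using assms(3) by (intro measurable_restrict_space1) auto
qed (use assms in measurable)

lemma Lop_emeasure:
 assumes u: "hcone K \<alpha> a u" and \<alpha>: "0 < \<alpha>" and a: "q <= a"
  and A: "A \<in> sets unit_leb"
 shows "(\<integral>\<^sup>+x. ennreal (Lop u x) * indicator A x \<partial>unit_leb) =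
     (\<integral>\<^sup>+y. ennreal (u y) * indicator {..1/2} y * indicator A (f y) \<partial>unit_leb)"
proof -
 have Lc: "hcone K \<alpha> a (Lop u)" by (rule Lop_hcone[OF u \<alpha> a])
 have [measurable]: "u \<in> borel_measurable unit_leb" "Lop u \<in> borel_measurable unit_leb"
  using hcone_measurable[OF u \<alpha>] hcone_measurable[OF Lc \<alpha>] by auto
 note A[measurable]
 have M2m: "(\<lambda>y. ennreal (u y) * indicator {..1/2} y * indicator A (f y)) \<in> borel_measurable unit_leb"
  by (rule measurable_piece) (use A in auto)
 define M1 where "M1 = density unit_leb (\<lambda>x. ennreal (Lop u x) * indicator A x)"
 define M2 where "M2 = density unit_leb (\<lambda>y. ennreal (u y) * indicator {..1/2} y * indicator A (f y))"
 define e where "e n = 1 / (real n + 2)" for n :: nat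
 have e: "0 < e n" "e n <= 1/2" for n by (auto simp: e_def field_simps)
 have e_dec: "e n <= e m" if "m <= n" for m n
  using that by (auto simp: e_def field_simps)
 have e_lim: "e \<longlonglongrightarrow> 0" unfolding e_def by real_asymp
 have F_e: "0 < F (e n)" "F (e n) <= 1" for n
  using F_pos[OF e] F_le_1[OF e] e by (auto intro: less_trans)
 have step: "emeasure M1 {F (e n)..1} = emeasure M2 {e n..1/2}" for n
 proof -
  define h where "h = (\<lambda>x. Lop u x * indicator A x * indicator {0<..1} x)"
  have h: "h \<in> borel_measurable borel"
  proof -
   have "(\<lambda>x. Lop u x * indicator A x) \<in> borel_measurable unit_leb" by measurable
   then have "(\<lambda>x. indicator {0<..1} x *\<^sub>R (Lop u x * indicator A x)) \<in> borel_measurable lborel"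
    by (subst (asm) borel_measurable_restrict_space_iff) auto
   then show ?thesis by (simp add: h_def mult_ac)
  qed
  have "emeasure M1 {F (e n)..1} = (\<integral>\<^sup>+x. ennreal (Lop u x) * indicator A x * indicator {F (e n)..1} x \<partial>unit_leb)"
   unfolding M1_def using F_e[of n] by (subst emeasure_density) (auto simp: sets_unit_leb_iff)
  also have "... = (\<integral>\<^sup>+x. ennreal (h x * indicator {F (e n)..F (1/2)} x) \<partial>lborel)"
   using F_e[of n] by (subst nn_integral_restrict_space)
    (auto simp: F_half h_def indicator_def intro!: nn_integral_cong)
  also have "... = (\<integral>\<^sup>+x. ennreal (h (F x) * D x * indicator {e n..1/2} x) \<partial>lborel)"
   using h e[of n] D_ge
   by (intro nn_integral_substitution F_deriv continuous_on_subset[OF D_cont])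
     (auto simp: set_borel_measurable_def intro: order_trans[OF zero_le_one])
  also have "... = (\<integral>\<^sup>+y. ennreal (u y) * indicator {..1/2} y * indicator A (f y) * indicator {e n..1/2} y \<partial>unit_leb)"
   using e[of n]
  proof (subst nn_integral_restrict_space, simp, intro nn_integral_cong, goal_cases)
   case (1 x)
   have "h (F x) * D x = u x * indicator A (F x)" if "e n <= x" "x <= 1/2"
    using that e[of n] g_F[of x] F_pos[of x] F_le_1[of x] D_ge[of x]
    by (auto simp: h_def Lop_def indicator_def)
   then show ?case using e[of n] by (auto simp: indicator_def f_left)
  qed
  also have "... = emeasure M2 {e n..1/2}"
   unfolding M2_def using e[of n] M2m by (subst emeasure_density) (auto simp: sets_unit_leb_iff)
  finally show ?thesis .
 qed
 have U1: "(\<Union>n. {F (e n)..1}) = {0<..1}"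
 proof (intro equalityI subsetI)
  fix x :: real assume "x \<in> {0<..1}"
  then have x: "0 < x" "x <= 1" by auto
  have "eventually (\<lambda>n. e n < g x) sequentially"
   using e_lim g_props(1)[OF x] by (rule order_tendstoD)
  then obtain n where "e n < g x" by (auto simp: eventually_sequentially)
  then have "F (e n) < x" using F_strict_mono[of "e n" "g x"] e g_props[OF x] by auto
  then show "x \<in> (\<Union>n. {F (e n)..1})" using x by (auto intro!: exI[of _ n])
 next
  fix x :: real assume "x \<in> (\<Union>n. {F (e n)..1})"
  then obtain n where "F (e n) <= x" "x <= 1" by auto
  then show "x \<in> {0<..1}" using F_e(1)[of n] by auto
 qed
 have U2: "(\<Union>n. {e n..1/2}) = {0<..1/2}"
 proof (intro equalityI subsetI)
  fix x :: real assume x: "x \<in> {0<..1/2}"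
  then have "eventually (\<lambda>n. e n < x) sequentially"
   using e_lim by (intro order_tendstoD) auto
  then obtain n where "e n < x" by (auto simp: eventually_sequentially)
  then show "x \<in> (\<Union>n. {e n..1/2})" using x by (auto intro!: exI[of _ n])
 next
  fix x :: real assume "x \<in> (\<Union>n. {e n..1/2})"
  then obtain n where "e n <= x" "x <= 1/2" by auto
  then show "x \<in> {0<..1/2}" using e(1)[of n] by auto
 qed
 have Fe_dec: "F (e n) <= F (e m)" if "m <= n" for m n
  using F_strict_mono[of "e n" "e m"] e_dec[OF that] e by (cases "e n = e m") auto
 have F_e': "0 < x" if "F (e n) <= x" for n x using F_e(1)[of n] that by simp
 have e': "0 < x" if "e n <= x" for n x using e(1)[of n] that by simp
 have "emeasure M1 {0<..1} = (SUP n. emeasure M1 {F (e n)..1})"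
  unfolding U1[symmetric] using F_e'
  by (intro SUP_emeasure_incseq[symmetric]) (auto simp: M1_def sets_unit_leb_iff incseq_def intro: Fe_dec order_trans)
 also have "... = (SUP n. emeasure M2 {e n..1/2})" by (simp add: step)
 also have "... = emeasure M2 {0<..1/2}"
  unfolding U2[symmetric] using e'
  by (intro SUP_emeasure_incseq) (auto simp: M2_def sets_unit_leb_iff incseq_def intro: e_dec order_trans)
 finally have eq: "emeasure M1 {0<..1} = emeasure M2 {0<..1/2}" .
 have "emeasure M1 {0<..1} = (\<integral>\<^sup>+x. ennreal (Lop u x) * indicator A x \<partial>unit_leb)"
  unfolding M1_def by (subst emeasure_density) (auto simp: sets_unit_leb_iff indicator_def intro!: nn_integral_cong)
 moreover have "emeasure M2 {0<..1/2} = (\<integral>\<^sup>+y. ennreal (u y) * indicator {..1/2} y * indicator A (f y) \<partial>unit_leb)"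
  unfolding M2_def using M2m by (subst emeasure_density) (auto simp: sets_unit_leb_iff indicator_def intro!: nn_integral_cong)
 ultimately show ?thesis using eq by simp
qed

lemma Bop_emeasure:
 assumes u: "hcone K \<alpha> a u" and \<alpha>: "0 < \<alpha>" "\<alpha> <= 1" and a: "0 <= a"
  and A: "A \<in> sets unit_leb"
 shows "(\<integral>\<^sup>+x. ennreal (Bop u x) * indicator A x \<partial>unit_leb) =
     (\<integral>\<^sup>+y. ennreal (u y) * indicator {1/2<..} y * indicator A (f y) \<partial>unit_leb)"
proof -
 have [measurable]: "u \<in> borel_measurable unit_leb"
  using hcone_measurable[OF u \<alpha>(1)] .
 note A[measurable]
 define h where "h = (\<lambda>y. ennreal (u y * indicator {1/2<..} y * indicator A (2 * y - 1) * indicator {0<..1} y))"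
 have A': "A \<subseteq> {0<..1}" "A \<in> sets borel" using A by (auto simp: sets_unit_leb_iff)
 have h: "h \<in> borel_measurable borel"
 proof -
  have "(\<lambda>x. indicator {0<..1} x *\<^sub>R u x) \<in> borel_measurable lborel"
   using \<open>u \<in> borel_measurable unit_leb\<close> by (subst (asm) borel_measurable_restrict_space_iff) auto
  then have [measurable]: "(\<lambda>x. u x * indicator {0<..1} x) \<in> borel_measurable borel" by (simp add: mult_ac)
  have "(\<lambda>y. ennreal ((u y * indicator {0<..1} y) * indicator {1/2<..} y * indicator A (2 * y - 1))) \<in> borel_measurable borel"
   using A'(2) by measurable
  then show ?thesis by (simp add: h_def mult_ac)
 qed
 have "(\<integral>\<^sup>+y. ennreal (u y) * indicator {1/2<..} y * indicator A (f y) \<partial>unit_leb) = (\<integral>\<^sup>+y. h y \<partial>lborel)"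
  by (subst nn_integral_restrict_space) (auto simp: h_def indicator_def f_right intro!: nn_integral_cong)
 also have "... = ennreal \<bar>1/2\<bar> * (\<integral>\<^sup>+x. h (1/2 + 1/2 * x) \<partial>lborel)"
  using h by (intro nn_integral_real_affine) auto
 also have "... = (\<integral>\<^sup>+x. ennreal \<bar>1/2\<bar> * h (1/2 + 1/2 * x) \<partial>lborel)"
  using h by (subst nn_integral_cmult) auto
 also have "... = (\<integral>\<^sup>+x. ennreal (Bop u x) * indicator A x \<partial>unit_leb)"
 proof (subst nn_integral_restrict_space, simp, intro nn_integral_cong, goal_cases)
  case (1 x)
  have half2: "2 * ((x + 1) / 2) - 1 = x" by (simp add: field_simps)
  have half: "1/2 + 1/2 * x = (x+1)/2" by (simp add: field_simps)
  have "0 <= u ((x+1)/2)" if "x \<in> A" using that A' hcone_nonneg[OF u, of "(x+1)/2"] by auto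
  moreover have "ennreal \<bar>1/2\<bar> * ennreal z = ennreal (z / 2)" if "0 <= z" for z
   using ennreal_mult[of "1/2" z] that by simp
  ultimately show ?case using A'(1)
   unfolding half by (auto simp: h_def half2 Bop_def indicator_def simp del: abs_divide abs_numeral times_divide_eq_right)
 qed
 finally show ?thesis by simp
qed

lemma Pop_distr:
 assumes u: "hcone K \<alpha> a u" and \<alpha>: "0 < \<alpha>" "\<alpha> <= 1" and a: "q <= a"
 shows "distr (density unit_leb u) unit_leb f = density unit_leb (Pop u)"
proof (rule measure_eqI)
 have Lc: "hcone K \<alpha> a (Lop u)" by (rule Lop_hcone[OF u \<alpha>(1) a])
 have Bc: "hcone K \<alpha> a (Bop u)" using q_pos a by (intro Bop_hcone'[OF u \<alpha>]) auto
 have [measurable]: "u \<in> borel_measurable unit_leb" "Lop u \<in> borel_measurable unit_leb"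
    "Bop u \<in> borel_measurable unit_leb" "Pop u \<in> borel_measurable unit_leb"
  using hcone_measurable[OF u \<alpha>(1)] hcone_measurable[OF Lc \<alpha>(1)] hcone_measurable[OF Bc \<alpha>(1)]
   hcone_measurable[OF Pop_hcone[OF u \<alpha> a] \<alpha>(1)] by auto
 fix A assume "A \<in> sets (distr (density unit_leb u) unit_leb f)"
 then have A[measurable]: "A \<in> sets unit_leb" by simp
 have "emeasure (distr (density unit_leb u) unit_leb f) A = (\<integral>\<^sup>+y. ennreal (u y) * indicator (f -` A \<inter> {0<..1}) y \<partial>unit_leb)"
  using measurable_sets[OF f_measurable A]
  by (subst emeasure_distr) (auto simp: emeasure_density)
 also have "... = (\<integral>\<^sup>+y. ennreal (u y) * indicator {..1/2} y * indicator A (f y) + ennreal (u y) * indicator {1/2<..} y * indicator A (f y) \<partial>unit_leb)"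
  by (intro nn_integral_cong) (auto simp: indicator_def)
 also have "... = (\<integral>\<^sup>+y. ennreal (u y) * indicator {..1/2} y * indicator A (f y) \<partial>unit_leb) + (\<integral>\<^sup>+y. ennreal (u y) * indicator {1/2<..} y * indicator A (f y) \<partial>unit_leb)"
  using A by (intro nn_integral_add measurable_piece) auto
 also have "... = (\<integral>\<^sup>+x. ennreal (Lop u x) * indicator A x \<partial>unit_leb) + (\<integral>\<^sup>+x. ennreal (Bop u x) * indicator A x \<partial>unit_leb)"
  using q_pos a by (simp add: Lop_emeasure[OF u \<alpha>(1) a A] Bop_emeasure[OF u \<alpha> _ A])
 also have "... = (\<integral>\<^sup>+x. ennreal (Lop u x) * indicator A x + ennreal (Bop u x) * indicator A x \<partial>unit_leb)"
  by (subst nn_integral_add) auto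
 also have "... = (\<integral>\<^sup>+x. ennreal (Pop u x) * indicator A x \<partial>unit_leb)"
  using hcone_nonneg[OF Lc] hcone_nonneg[OF Bc]
  by (intro nn_integral_cong) (auto simp: Pop_def indicator_def)
 also have "... = emeasure (density unit_leb (Pop u)) A"
  by (subst emeasure_density) auto
 finally show "emeasure (distr (density unit_leb u) unit_leb f) A = emeasure (density unit_leb (Pop u)) A" .
qed simp

end

context intermittent_map begin

lemma Lop_distr:
 assumes u: "hcone K \<alpha> a u" and \<alpha>: "0 < \<alpha>" and a: "q <= a"
 shows "distr (density unit_leb (\<lambda>x. u x * indicator {..1/2} x)) unit_leb f = density unit_leb (Lop u)"
proof (rule measure_eqI)
 have Lc: "hcone K \<alpha> a (Lop u)" by (rule Lop_hcone[OF u \<alpha>(1) a])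
 have [measurable]: "u \<in> borel_measurable unit_leb" "Lop u \<in> borel_measurable unit_leb"
  using hcone_measurable[OF u \<alpha>(1)] hcone_measurable[OF Lc \<alpha>(1)] by auto
 fix A assume "A \<in> sets (distr (density unit_leb (\<lambda>x. u x * indicator {..1/2} x)) unit_leb f)"
 then have A[measurable]: "A \<in> sets unit_leb" by simp
 have "emeasure (distr (density unit_leb (\<lambda>x. u x * indicator {..1/2} x)) unit_leb f) A =
   (\<integral>\<^sup>+y. ennreal (u y * indicator {..1/2} y) * indicator (f -` A \<inter> {0<..1}) y \<partial>unit_leb)"
  using measurable_sets[OF f_measurable A]
  by (subst emeasure_distr) (auto simp: emeasure_density)
 also have "... = (\<integral>\<^sup>+x. ennreal (Lop u x) * indicator A x \<partial>unit_leb)"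
  unfolding Lop_emeasure[OF u \<alpha>(1) a A] by (intro nn_integral_cong) (auto simp: indicator_def)
 also have "... = emeasure (density unit_leb (Lop u)) A"
  by (subst emeasure_density) auto
 finally show "emeasure (distr (density unit_leb (\<lambda>x. u x * indicator {..1/2} x)) unit_leb f) A = emeasure (density unit_leb (Lop u)) A" .
qed simp

lemma half_measurable [measurable]:
 "indicator {..1/2::real} \<in> borel_measurable unit_leb" "indicator {1/2::real<..} \<in> borel_measurable unit_leb"
 "indicator {..t::real} \<in> borel_measurable unit_leb"
 by (intro measurable_restrict_space1; simp)+

lemma Lop_integral:
 fixes G :: "real => real"
 assumes u: "hcone K \<alpha> a u" and \<alpha>: "0 < \<alpha>" and a: "q <= a" and G[measurable]: "G \<in> borel_measurable unit_leb"
 shows "(LEB x. Lop u x * G x) = (LEB x. u x * indicator {..1/2} x * G (f x))"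
proof -
 have Lc: "hcone K \<alpha> a (Lop u)" by (rule Lop_hcone[OF u \<alpha>(1) a])
 have [measurable]: "u \<in> borel_measurable unit_leb" "Lop u \<in> borel_measurable unit_leb"
  using hcone_measurable[OF u \<alpha>(1)] hcone_measurable[OF Lc \<alpha>(1)] by auto
 have "(LEB x. Lop u x * G x) = (\<integral>x. G x \<partial>density unit_leb (Lop u))"
  using hcone_nonneg[OF Lc] by (subst integral_density) auto
 also have "... = (LEB x. u x * indicator {..1/2} x * G (f x))"
  unfolding Lop_distr[OF u \<alpha> a, symmetric] using hcone_nonneg[OF u]
  by (subst integral_distr, simp, simp) (subst integral_density; auto)
 finally show ?thesis .
qed

lemma Pop_integral:
 fixes G :: "real => real"
 assumes u: "hcone K \<alpha> a u" and \<alpha>: "0 < \<alpha>" "\<alpha> <= 1" and a: "q <= a" and G[measurable]: "G \<in> borel_measurable unit_leb"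
 shows "(LEB x. Pop u x * G x) = (LEB x. u x * G (f x))"
proof -
 note Pc = Pop_hcone[OF u \<alpha> a]
 have [measurable]: "u \<in> borel_measurable unit_leb" "Pop u \<in> borel_measurable unit_leb"
  using hcone_measurable[OF u \<alpha>(1)] hcone_measurable[OF Pc \<alpha>(1)] by auto
 have "(LEB x. Pop u x * G x) = (\<integral>x. G x \<partial>density unit_leb (Pop u))"
  using hcone_nonneg[OF Pc] by (subst integral_density) auto
 also have "... = (LEB x. u x * G (f x))"
  unfolding Pop_distr[OF u \<alpha> a, symmetric] using hcone_nonneg[OF u]
  by (subst integral_distr, simp, simp) (subst integral_density; auto)
 finally show ?thesis .
qed

lemma Pop_integrable:
 assumes u: "hcone K \<alpha> a u" and \<alpha>: "0 < \<alpha>" "\<alpha> <= 1" and a: "q <= a" and i: "integrable unit_leb u"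
 shows "integrable unit_leb (Pop u)"
proof -
 note Pc = Pop_hcone[OF u \<alpha> a]
 have [measurable]: "u \<in> borel_measurable unit_leb" "Pop u \<in> borel_measurable unit_leb"
  using hcone_measurable[OF u \<alpha>(1)] hcone_measurable[OF Pc \<alpha>(1)] by auto
 have AE: "AE x in unit_leb. 0 <= u x" "AE x in unit_leb. 0 <= Pop u x"
  using hcone_nonneg[OF u] hcone_nonneg[OF Pc] by auto
 have i1: "integrable (density unit_leb u) (\<lambda>_. 1::real)"
 proof (rule iffD2[OF integrable_density[OF _ _ AE(1)]])
  show "integrable unit_leb (\<lambda>x. u x *\<^sub>R (1::real))" by (simp only: real_scaleR_def mult_1_right i)
 qed measurable
 have "integrable (distr (density unit_leb u) unit_leb f) (\<lambda>_. 1::real)"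
  by (rule iffD2[OF integrable_distr_eq[where f = "\<lambda>_. 1::real"] i1]) measurable
 then have "integrable (density unit_leb (Pop u)) (\<lambda>_. 1::real)"
  by (simp only: Pop_distr[OF u \<alpha> a])
 then have "integrable unit_leb (\<lambda>x. Pop u x *\<^sub>R (1::real))"
  by (rule iffD1[OF integrable_density[OF _ _ AE(2)], rotated -1]) measurable
 then show ?thesis by (simp only: real_scaleR_def mult_1_right)
qed

lemma Pop_split:
 assumes u: "hcone K \<alpha> a u" and \<alpha>: "0 < \<alpha>" "\<alpha> <= 1" and a: "q <= a" and i: "integrable unit_leb u"
 shows "integrable unit_leb (Lop u)" "integrable unit_leb (Bop u)"
proof -
 have Lc: "hcone K \<alpha> a (Lop u)" by (rule Lop_hcone[OF u \<alpha>(1) a])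
 have Bc: "hcone K \<alpha> a (Bop u)" using q_pos a by (intro Bop_hcone'[OF u \<alpha>]) auto
 show "integrable unit_leb (Lop u)" "integrable unit_leb (Bop u)"
  by (rule Bochner_Integration.integrable_bound[OF Pop_integrable[OF assms]];
    use hcone_measurable[OF Lc \<alpha>(1)] hcone_measurable[OF Bc \<alpha>(1)] hcone_nonneg[OF Lc] hcone_nonneg[OF Bc]
    in \<open>auto simp: Pop_def\<close>)+
qed

lemma Pop_linear:
 "Pop (\<lambda>x. u x + v x) = (\<lambda>x. Pop u x + Pop v x)" "Pop (\<lambda>x. u x - v x) = (\<lambda>x. Pop u x - Pop v x)"
 "Pop (\<lambda>x. r * u x) = (\<lambda>x. r * Pop u x)"
 by (auto simp: Pop_def Lop_def Bop_def add_divide_distrib diff_divide_distrib distrib_left)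

lemma Pop_pow_linear:
 "(Pop ^^ n) (\<lambda>x. u x + v x) = (\<lambda>x. (Pop ^^ n) u x + (Pop ^^ n) v x)"
 "(Pop ^^ n) (\<lambda>x. u x - v x) = (\<lambda>x. (Pop ^^ n) u x - (Pop ^^ n) v x)"
 "(Pop ^^ n) (\<lambda>x. r * u x) = (\<lambda>x. r * (Pop ^^ n) u x)"
 by (induction n) (simp_all add: Pop_linear)

end

section \<open>Mass near the neutral fixed point\<close>

locale intermittent_cone = intermittent_map +
 fixes \<alpha> a :: real
 assumes \<alpha>: "0 < \<alpha>" "\<alpha> <= 1" and qa: "q <= a"
begin

lemma a_pos: "0 < a" using q_pos qa by simp

definition pcone :: "(real => real) => bool" where
 "pcone u \<longleftrightarrow> hcone K \<alpha> a u \<and> integrable unit_leb u"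

lemma cone_nonneg: "pcone u ==> 0 < x ==> x <= 1 ==> 0 <= u x"
 by (auto simp: pcone_def hcone_nonneg)

lemma cone_Pop: "pcone u ==> pcone (Pop u)" and cone_Lop: "pcone u ==> pcone (Lop u)" and cone_Bop: "pcone u ==> pcone (Bop u)"
 using Pop_hcone[OF _ \<alpha> qa] Lop_hcone[OF _ \<alpha>(1) qa] Bop_hcone'[OF _ \<alpha>] Pop_integrable[OF _ \<alpha> qa] Pop_split[OF _ \<alpha> qa] a_pos
 by (auto simp: pcone_def)

lemma cone_Pop_pow: "pcone u ==> pcone ((Pop ^^ n) u)"
 by (induction n) (auto intro: cone_Pop)

lemma cone_integrable [intro]: "pcone u ==> integrable unit_leb u" by (simp add: pcone_def)
lemma cone_measurable: "pcone u ==> u \<in> borel_measurable unit_leb" by (auto intro: borel_measurable_integrable)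

lemma f_pow_measurable [measurable]: "f ^^ n \<in> unit_leb \<rightarrow>\<^sub>M unit_leb"
 by (induction n) (auto simp: id_def[symmetric] o_def intro: measurable_compose)

lemma Pop_pow_integral:
 fixes G :: "real => real"
 assumes "pcone u" "G \<in> borel_measurable unit_leb"
 shows "(LEB x. (Pop ^^ n) u x * G x) = (LEB x. u x * G ((f ^^ n) x))"
 using assms
proof (induction n arbitrary: u)
 case (Suc n)
 have "(LEB x. (Pop ^^ Suc n) u x * G x) = (LEB x. (Pop ^^ n) (Pop u) x * G x)"
  by (simp add: funpow_swap1)
 also have "... = (LEB x. Pop u x * G ((f ^^ n) x))"
  using Suc by (intro Suc.IH cone_Pop) auto
 also have "... = (LEB x. u x * G ((f ^^ n) (f x)))"
  using Suc.prems by (intro Pop_integral[OF _ \<alpha> qa]) (auto simp: pcone_def intro: measurable_compose[OF f_pow_measurable])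
 finally show ?case by (simp add: funpow_swap1)
qed simp

lemma Pop_pow_mass: "pcone u ==> (LEB x. (Pop ^^ n) u x) = (LEB x. u x)"
 using Pop_pow_integral[of u "\<lambda>_. 1" n] by simp

text \<open>The mass in the right half, on which one application of \<open>f\<close> acts linearly.\<close>
definition Yint :: "(real => real) => real" where
 "Yint u = (LEB x. u x * indicator {1/2<..} x)"

text \<open>A bound for the oscillation of densities of the cone on the right half.\<close>
definition EY :: real where "EY = exp (a * modulus_fn \<alpha> (chart K 1 - chart K (1/2)))"

lemma EY_ge_1: "1 <= EY"
 using a_pos chart_mono[OF K_nonneg, of "1/2" 1] by (auto simp: EY_def intro!: mult_nonneg_nonneg modulus_fn_nonneg)

lemma pcone_const: "0 <= r ==> pcone (\<lambda>_. r)"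
 using hcone_const[of r a K \<alpha>] a_pos prob_space_unit_leb
 by (auto simp: pcone_def prob_space_def intro!: finite_measure.integrable_const)

lemma integrable_cone_indicator:
 assumes "pcone u" "B \<in> sets borel" shows "integrable unit_leb (\<lambda>x. u x * indicator B x)"
proof -
 have [measurable]: "u \<in> borel_measurable unit_leb" "indicator B \<in> borel_measurable unit_leb"
  using assms cone_measurable by (auto intro!: measurable_restrict_space1)
 show ?thesis
 proof (rule Bochner_Integration.integrable_bound[OF cone_integrable[OF assms(1)]])
  show "(\<lambda>x. u x * indicator B x) \<in> borel_measurable unit_leb" by measurable
 qed (auto simp: indicator_def)
qed

lemma Yint_nonneg: "pcone u ==> 0 <= Yint u"
 unfolding Yint_def by (intro integral_nonneg_AE AE_I2) (auto simp: indicator_def cone_nonneg)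

lemma Yint_le_mass: "pcone u ==> Yint u <= (LEB x. u x)"
 unfolding Yint_def by (intro integral_mono integrable_cone_indicator) (auto simp: indicator_def cone_nonneg)

lemma Yint_const: "Yint (\<lambda>_. r) = r / 2"
proof -
 have "Yint (\<lambda>_. r) = r * (LEB x. indicator {1/2<..} x)" by (simp add: Yint_def)
 also have "(LEB x. indicator {1/2<..} x) = measure lborel {1/2<..1::real}"
 proof -
  have "{0<..1} \<inter> {1/2<..} = {1/2<..1::real}" by auto
  then show ?thesis
   by (subst integral_restrict_space) (auto simp: indicator_inter_arith[symmetric])
 qed
 finally show ?thesis by simp
qed

lemma Yint_le:
 assumes u: "pcone u" and y: "1/2 < y" "y <= 1"
 shows "Yint u <= EY * u y / 2"
proof -
 have "Yint u <= Yint (\<lambda>_. EY * u y)"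
  unfolding Yint_def
 proof (intro integral_mono integrable_cone_indicator u)
  fix x :: real assume "x \<in> space unit_leb"
  then show "u x * indicator {1/2<..} x <= EY * u y * indicator {1/2<..} x"
   using hcone_compare[of K \<alpha> a u "1/2" x y] u y K_nonneg \<alpha> a_pos
   by (auto simp: indicator_def EY_def pcone_def)
 qed (use cone_nonneg[OF u, of y] y EY_ge_1 in \<open>auto intro!: pcone_const\<close>)
 then show ?thesis by (simp add: Yint_const)
qed

lemma Bop_ge:
 assumes u: "pcone u" and x: "0 < x" "x <= 1"
 shows "Yint u / EY <= Bop u x"
 using Yint_le[OF u, of "(x+1)/2"] x EY_ge_1 by (auto simp: Bop_def field_simps)

lemma Yint_mono:
 assumes "pcone u" "pcone v" "!!x. 0 < x ==> x <= 1 ==> u x <= v x" shows "Yint u <= Yint v"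
 unfolding Yint_def using assms by (intro integral_mono integrable_cone_indicator) (auto simp: indicator_def)

text \<open>Away from 0 the chart has bounded diameter, so the values of \<open>u\<close> are comparable with each other.\<close>
lemma cone_le_Yint:
 assumes u: "pcone u" and t: "0 < t" "t <= 1/2" "t <= x" "x <= 1"
 shows "u x <= 2 * exp (a * modulus_fn \<alpha> (chart K 1 - chart K t)) * Yint u"
proof -
 let ?E = "exp (a * modulus_fn \<alpha> (chart K 1 - chart K t))"
 have "u x / 2 = Yint (\<lambda>_. u x)" by (simp add: Yint_const)
 also have "... <= Yint (\<lambda>y. ?E * u y)"
  unfolding Yint_def
 proof (intro integral_mono)
  fix y :: real assume "y \<in> space unit_leb"
  then show "u x * indicator {1/2<..} y <= ?E * u y * indicator {1/2<..} y"
   using hcone_compare[of K \<alpha> a u t x y] u t K_nonneg \<alpha> a_pos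
   by (auto simp: indicator_def pcone_def)
 next
  show "integrable unit_leb (\<lambda>x. ?E * u x * indicator {1/2<..} x)"
   using integrable_cone_indicator[OF u, of "{1/2<..}"] by (auto simp: mult.assoc)
 next
  show "integrable unit_leb (\<lambda>y. u x * indicator {1/2<..} y)"
   using cone_nonneg[OF u, of x] t by (intro integrable_cone_indicator pcone_const) auto
 qed
 also have "... = ?E * Yint u" by (simp add: Yint_def mult.assoc)
 finally show ?thesis by simp
qed

lemma cone_le_mass:
 assumes u: "pcone u" and t: "0 < t" "t <= 1/2" "t <= x" "x <= 1"
 shows "u x <= 2 * exp (a * modulus_fn \<alpha> (chart K 1 - chart K t)) * (LEB x. u x)"
 by (rule order_trans[OF cone_le_Yint[OF assms] mult_left_mono[OF Yint_le_mass[OF u]]]) simp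

lemma F_le_iff:
 assumes "0 < x" "x <= 1/2" "0 < t" "t <= 1"
 shows "F x <= t \<longleftrightarrow> x <= g t"
proof
 assume "F x <= t"
 then show "x <= g t"
  using F_strict_mono[of "g t" x] g_props[of t] assms by (cases "x <= g t") auto
next
 assume "x <= g t"
 then show "F x <= t"
  using F_strict_mono[of x "g t"] g_props[of t] assms by (cases "x = g t") auto
qed

lemma Lop_pow_mass_step:
 assumes u: "pcone u" and t: "0 < t" "t <= 1"
 shows "(LEB x. Lop u x * indicator {..t} x) = (LEB x. u x * indicator {..g t} x)"
proof -
 have "(LEB x. Lop u x * indicator {..t} x) = (LEB x. u x * indicator {..1/2} x * indicator {..t} (f x))"
  using u by (intro Lop_integral[OF _ \<alpha>(1) qa]) (auto simp: pcone_def)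
 also have "... = (LEB x. u x * indicator {..g t} x)"
 proof (intro Bochner_Integration.integral_cong refl)
  fix x :: real assume "x \<in> space unit_leb"
  then have x: "0 < x" "x <= 1" by auto
  show "u x * indicator {..1/2} x * indicator {..t} (f x) = u x * indicator {..g t} x"
  proof (cases "x <= 1/2")
   case True
   then have "F x <= t \<longleftrightarrow> x <= g t"
    using F_le_iff[OF x(1) True t] by simp
   then show ?thesis using True x f_left[of x] by (auto simp: indicator_def)
  next
   case False
   then show ?thesis using g_props[OF t] by (auto simp: indicator_def)
  qed
 qed
 finally show ?thesis .
qed

lemma integral_powr_near_0:
 assumes "0 < t" "t <= 1"
 shows "(\<integral>\<^sup>+x. ennreal (x powr - s) * indicator {..t} x \<partial>unit_leb) = ennreal (t powr (1 - s) / (1 - s))"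
proof -
 have "((\<lambda>x. x powr - s) has_integral (t powr (- s + 1) / (- s + 1))) {0..t}"
  using s_bounds assms by (intro has_integral_powr_from_0) auto
 then have "(\<integral>\<^sup>+x. ennreal (x powr - s) * indicator {0..t} x \<partial>lborel) = ennreal (t powr (1 - s) / (1 - s))"
  by (subst nn_integral_has_integral_lebesgue') auto
 then show ?thesis using assms
  by (subst nn_integral_restrict_space)
    (auto simp: indicator_def elim!: trans[rotated] intro!: nn_integral_cong)
qed

definition dominated :: "real => (real => real) => bool" where
 "dominated A u \<longleftrightarrow> (\<forall>x. 0 < x \<and> x <= 1 --> u x <= A * x powr - s)"

lemma dominated_integrable:
 assumes h: "hcone K \<alpha> a u" and d: "dominated A u"
 shows "pcone u"
proof -
 have m: "u \<in> borel_measurable unit_leb" using hcone_measurable[OF h \<alpha>(1)] .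
 have "(\<integral>\<^sup>+x. ennreal (norm (u x)) \<partial>unit_leb) <= (\<integral>\<^sup>+x. ennreal \<bar>A\<bar> * (ennreal (x powr - s) * indicator {..1} x) \<partial>unit_leb)"
 proof (intro nn_integral_mono)
  fix x assume "x \<in> space unit_leb"
  then have x: "0 < x" "x <= 1" by auto
  have "u x <= A * x powr - s" using d x by (auto simp: dominated_def)
  also have "... <= \<bar>A\<bar> * x powr - s" by (intro mult_right_mono) auto
  finally show "ennreal (norm (u x)) <= ennreal \<bar>A\<bar> * (ennreal (x powr - s) * indicator {..1} x)"
   using x hcone_nonneg[OF h x] by (auto simp: ennreal_mult[symmetric])
 qed
 also have "... = ennreal \<bar>A\<bar> * ennreal (1 powr (1 - s) / (1 - s))"
  by (subst nn_integral_cmult) (auto simp: integral_powr_near_0 intro!: borel_measurable_times_ennreal)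
 also have "... < \<infinity>" by (simp add: ennreal_mult_less_top)
 finally show ?thesis using m h by (auto simp: pcone_def integrable_iff_bounded)
qed

lemma dominated_mass_near_0:
 assumes u: "pcone u" and d: "dominated A u" and t: "0 < t" "t <= 1" and A: "0 <= A"
 shows "(LEB x. u x * indicator {..t} x) <= A * t powr (1 - s) / (1 - s)"
proof -
 have "ennreal (LEB x. u x * indicator {..t} x) = (\<integral>\<^sup>+x. ennreal (u x * indicator {..t} x) \<partial>unit_leb)"
  using cone_nonneg[OF u] by (intro nn_integral_eq_integral[symmetric] integrable_cone_indicator u) auto
 also have "... <= (\<integral>\<^sup>+x. ennreal A * (ennreal (x powr - s) * indicator {..t} x) \<partial>unit_leb)"
 proof (intro nn_integral_mono)
  fix x assume "x \<in> space unit_leb"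
  then have x: "0 < x" "x <= 1" by auto
  have "u x <= A * x powr - s" using d x by (auto simp: dominated_def)
  then show "ennreal (u x * indicator {..t} x) <= ennreal A * (ennreal (x powr - s) * indicator {..t} x)"
   using A by (auto simp: ennreal_mult[symmetric] indicator_def)
 qed
 also have "... = ennreal A * ennreal (t powr (1 - s) / (1 - s))"
  using t by (subst nn_integral_cmult) (auto simp: integral_powr_near_0 intro!: borel_measurable_times_ennreal)
 also have "... = ennreal (A * t powr (1 - s) / (1 - s))"
  using A s_bounds by (simp add: ennreal_mult[symmetric])
 finally show ?thesis using A s_bounds by (subst (asm) ennreal_le_iff) auto
qed

text \<open>Below a threshold \<open>t\<close>, the left branch turns the bound \<open>A * x powr - s\<close> into itself minus
\<open>A * c1\<close> by \<open>escape\<close>, and for large \<open>A\<close> this slack covers the bounded contribution of the right branch.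
Above \<open>t\<close> a density of the cone is bounded by a multiple of its mass.\<close>
lemma domination:
 obtains A0 where "1 <= A0"
  "!!A u. A0 <= A ==> pcone u ==> (LEB x. u x) <= 1 ==> dominated A u ==> dominated A (Pop u)"
proof -
 define t where "t = min b (1/2)"
 have t: "0 < t" "t <= 1/2" "t <= b" using b_pos by (auto simp: t_def)
 define E where "E = 2 * exp (a * modulus_fn \<alpha> (chart K 1 - chart K t))"
 define A0 where "A0 = max 1 (max E (EY / c1))"
 show ?thesis
 proof
  show "1 <= A0" by (simp add: A0_def)
  fix A u assume A: "A0 <= A" and u: "pcone u" and m: "(LEB x. u x) <= 1" and d: "dominated A u"
  show "dominated A (Pop u)"
   unfolding dominated_def
  proof (intro allI impI, elim conjE)
   fix x :: real assume x: "0 < x" "x <= 1"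
   show "Pop u x <= A * x powr - s"
   proof (cases "t <= x")
    case True
    have "Pop u x <= E * (LEB x. Pop u x)"
     unfolding E_def using t True x by (intro cone_le_mass cone_Pop u) auto
    also have "... <= E * 1" using m Pop_pow_mass[OF u, of 1] by (intro mult_left_mono) (auto simp: E_def)
    also have "... <= A * 1" using A by (auto simp: A0_def)
    also have "... <= A * x powr - s"
     using A x s_bounds powr_mono'[of "-s" 0 x] by (intro mult_left_mono) (auto simp: A0_def)
    finally show ?thesis .
   next
    case False
    let ?y = "g x"
    have y: "0 < ?y" "?y <= 1/2" "F ?y = x" "?y <= b"
     using g_props[OF x] g_le[OF x] False t by auto
    have D: "1 <= D ?y" using D_ge y by auto
    have "Lop u x <= A * (?y powr - s / D ?y)"
     using d y D by (auto simp: Lop_def dominated_def intro!: divide_right_mono)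
    also have "... <= A * (x powr - s - c1)"
     using escape[of ?y] y A by (intro mult_left_mono) (auto simp: A0_def)
    finally have L: "Lop u x <= A * x powr - s - A * c1" by (simp add: algebra_simps)
    have "Bop u x <= EY"
    proof -
     have "u ((x+1)/2) <= 2 * EY * (LEB x. u x)"
      unfolding EY_def using x by (intro cone_le_mass u) auto
     also have "... <= 2 * EY * 1" using m EY_ge_1 by (intro mult_left_mono) auto
     finally show ?thesis by (simp add: Bop_def)
    qed
    also have "EY <= A0 * c1"
    proof -
     have "EY / c1 <= A0" by (simp add: A0_def)
     then show ?thesis using c1_pos by (simp add: divide_le_eq)
    qed
    also have "... <= A * c1" using A c1_pos by (intro mult_right_mono) auto
    finally show ?thesis using L by (simp add: Pop_def)
   qed
  qed
 qed
qed

text \<open>Domination leaves at most half of the mass below some \<open>t\<close>; the rest is spread over \<open>{t..1}\<close> with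
comparable values, so a definite part lies in the right half.\<close>
lemma Yint_lower:
 assumes A: "1 <= A"
 obtains cL where "0 < cL"
  "!!u. pcone u ==> dominated A u ==> (LEB x. u x) = 1 ==> cL <= Yint u"
proof -
 define t where "t = min (1/2) (((1 - s) / (2 * A)) powr (1 / (1 - s)))"
 have t: "0 < t" "t <= 1/2" using s_bounds A by (auto simp: t_def)
 have "A * t powr (1 - s) / (1 - s) <= 1/2"
 proof -
  have "t powr (1 - s) <= (((1 - s) / (2 * A)) powr (1 / (1 - s))) powr (1 - s)"
   using t s_bounds by (intro powr_mono2) (auto simp: t_def)
  also have "... = (1 - s) / (2 * A)" using s_bounds A by (simp add: powr_powr)
  finally show ?thesis using s_bounds A by (simp add: field_simps)
 qed
 note tA = this
 define E where "E = exp (a * modulus_fn \<alpha> (chart K 1 - chart K t))"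
 have E: "0 < E" by (simp add: E_def)
 show ?thesis
 proof
  show "0 < 1 / (4 * E)" using E by simp
  fix u assume u: "pcone u" and d: "dominated A u" and m: "(LEB x. u x) = 1"
  have "(LEB x. u x * indicator {..t} x) <= 1/2"
   by (rule order_trans[OF dominated_mass_near_0[OF u d t(1)] tA]) (use t A in auto)
  then have "1/2 <= 1 - (LEB x. u x * indicator {..t} x)" by simp
  also have "... = (LEB x. u x - u x * indicator {..t} x)"
   using m integrable_cone_indicator[OF u, of "{..t}"] cone_integrable[OF u]
   by (subst Bochner_Integration.integral_diff) auto
  also have "... <= (LEB x. 2 * E * Yint u)"
  proof (intro integral_mono)
   fix x :: real assume x: "x \<in> space unit_leb"
   show "u x - u x * indicator {..t} x <= 2 * E * Yint u"
   proof (cases "x <= t")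
    case False
    then show ?thesis using cone_le_Yint[OF u t, of x] x by (simp add: E_def)
   qed (use Yint_nonneg[OF u] E in auto)
  next
   show "integrable unit_leb (\<lambda>x. u x - u x * indicator {..t} x)"
    using integrable_cone_indicator[OF u, of "{..t}"] cone_integrable[OF u] by auto
   show "integrable unit_leb (\<lambda>x. 2 * E * Yint u)"
    using Yint_nonneg[OF u] E by (intro cone_integrable pcone_const) auto
  qed
  also have "... = 2 * E * Yint u"
   using prob_space.prob_space[OF prob_space_unit_leb] by simp
  finally show "1 / (4 * E) <= Yint u" using E by (simp add: field_simps)
 qed
qed

lemma Pop_pow_dominated:
 assumes A0: "!!A u. A0 <= A ==> pcone u ==> (LEB x. u x) <= 1 ==> dominated A u ==> dominated A (Pop u)"
  and "A0 <= A" "pcone u" "(LEB x. u x) <= 1" "dominated A u"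
 shows "dominated A ((Pop ^^ n) u)"
proof (induction n)
 case (Suc n)
 show ?case
  unfolding funpow.simps o_def using Suc assms(2-4) Pop_pow_mass[OF assms(3), of n]
  by (intro A0 cone_Pop_pow) auto
qed (use assms in auto)

lemma dominated_const_1: "1 <= A ==> dominated A (\<lambda>_. 1)"
proof -
 assume A: "1 <= A"
 have "1 <= A * x powr - s" if "0 < x" "x <= 1" for x
 proof -
  have "1 <= x powr - s" using powr_mono'[of "-s" 0 x] that s_bounds by simp
  then show ?thesis using A by (smt (verit) mult_le_cancel_right1)
 qed
 then show ?thesis by (auto simp: dominated_def)
qed

lemma Yint_linear:
 "pcone u ==> pcone v ==> Yint (\<lambda>x. u x + v x) = Yint u + Yint v"
 "Yint (\<lambda>x. r * u x) = r * Yint u"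
 unfolding Yint_def
 by (simp_all add: distrib_right Bochner_Integration.integral_add integrable_cone_indicator mult.assoc)

lemma g_pow_bounds: "0 < (g ^^ n) 1 \<and> (g ^^ n) 1 <= 1"
proof (induction n)
 case (Suc n)
 then show ?case using g_props[of "(g ^^ n) 1"] by auto
qed simp

lemma Pop_pow_mono:
 assumes u: "pcone u" and r: "0 <= r" "!!x. 0 < x ==> x <= 1 ==> r <= u x" and x: "0 < x" "x <= 1"
 shows "r * (Pop ^^ n) (\<lambda>_. 1) x <= (Pop ^^ n) u x"
 using x
proof (induction n arbitrary: x)
 case (Suc n)
 have gx: "0 < g x" "g x <= 1" "1 <= D (g x)" using g_props[of x] D_ge[of "g x"] Suc.prems by auto
 have "r * ((Pop ^^ n) (\<lambda>_. 1) (g x) / D (g x)) <= (Pop ^^ n) u (g x) / D (g x)"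
  using Suc.IH[of "g x"] gx divide_right_mono[of _ _ "D (g x)"] by fastforce
 moreover have "r * ((Pop ^^ n) (\<lambda>_. 1) ((x+1)/2) / 2) <= (Pop ^^ n) u ((x+1)/2) / 2"
  using Suc.IH[of "(x+1)/2"] Suc.prems by simp
 moreover have "(Pop ^^ Suc n) v x = (Pop ^^ n) v (g x) / D (g x) + (Pop ^^ n) v ((x+1)/2) / 2" for v
  by (simp add: Pop_def[of "(Pop ^^ n) v"] Lop_def Bop_def)
 ultimately show ?case by (simp add: distrib_left)
qed (use r in auto)

text \<open>A point stays in the left half for \<open>N\<close> steps exactly if it lies below \<open>(g ^^ N) 1\<close>. All other mass
passes through the right half; when it does, its image dominates a constant density, and the
images of constants have the share \<open>cL\<close> in the right half at all later times.\<close>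
lemma visits:
 assumes cL: "!!n. cL <= Yint ((Pop ^^ n) (\<lambda>_. 1))" "0 <= cL" and u: "pcone u"
 shows "cL / EY * ((LEB x. u x) - (LEB x. u x * indicator {..(g ^^ N) 1} x)) <= Yint ((Pop ^^ N) u)"
 using u
proof (induction N arbitrary: u)
 case 0
 have "(LEB x. u x * indicator {..1} x) = (LEB x. u x)"
  by (intro Bochner_Integration.integral_cong) auto
 then show ?case using Yint_nonneg[OF 0] by simp
next
 case (Suc N)
 note u = Suc.prems
 let ?t = "(g ^^ N) 1"
 have Lu: "pcone (Lop u)" and Bu: "pcone (Bop u)" using u cone_Lop cone_Bop by auto
 have "(LEB x. u x) = (LEB x. u x * indicator {..1/2} x + u x * indicator {1/2<..} x)"
  by (intro Bochner_Integration.integral_cong) (auto simp: indicator_def)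
 also have "... = (LEB x. u x * indicator {..1/2} x) + Yint u"
  unfolding Yint_def using integrable_cone_indicator[OF u] by (intro Bochner_Integration.integral_add) auto
 also have "(LEB x. u x * indicator {..1/2} x) = (LEB x. Lop u x)"
  using Lop_integral[of \<alpha> a u "\<lambda>_. 1"] u \<alpha> qa by (simp add: pcone_def)
 finally have m: "(LEB x. u x) = (LEB x. Lop u x) + Yint u" .
 have t: "(LEB x. Lop u x * indicator {..?t} x) = (LEB x. u x * indicator {..(g ^^ Suc N) 1} x)"
  using Lop_pow_mass_step[OF u, of ?t] g_pow_bounds by simp
 have "cL / EY * Yint u <= Yint u / EY * Yint ((Pop ^^ N) (\<lambda>_. 1))"
  using mult_right_mono[OF cL(1)[of N] Yint_nonneg[OF u]] EY_ge_1 by (simp add: divide_simps mult_ac)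
 also have "... = Yint (\<lambda>x. Yint u / EY * (Pop ^^ N) (\<lambda>_. 1) x)" by (simp only: Yint_linear)
 also have "... <= Yint ((Pop ^^ N) (Bop u))"
 proof (intro Yint_mono cone_Pop_pow Bu)
  have "pcone (\<lambda>x. (Pop ^^ N) (\<lambda>_. Yint u / EY * 1) x)"
   using Yint_nonneg[OF u] EY_ge_1 by (intro cone_Pop_pow pcone_const) auto
  then show "pcone (\<lambda>x. Yint u / EY * (Pop ^^ N) (\<lambda>_. 1) x)" by (simp only: Pop_pow_linear)
  show "Yint u / EY * (Pop ^^ N) (\<lambda>_. 1) x <= (Pop ^^ N) (Bop u) x" if "0 < x" "x <= 1" for x
   using Bop_ge[OF u] that Yint_nonneg[OF u] EY_ge_1 by (intro Pop_pow_mono Bu) auto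
 qed
 finally have B: "cL / EY * Yint u <= Yint ((Pop ^^ N) (Bop u))" .
 have "(Pop ^^ Suc N) u = (Pop ^^ N) (\<lambda>x. Lop u x + Bop u x)"
  unfolding funpow_Suc_right o_def by (simp add: Pop_def[abs_def])
 also have "... = (\<lambda>x. (Pop ^^ N) (Lop u) x + (Pop ^^ N) (Bop u) x)" by (rule Pop_pow_linear)
 finally have "Yint ((Pop ^^ Suc N) u) = Yint ((Pop ^^ N) (Lop u)) + Yint ((Pop ^^ N) (Bop u))"
  using Lu Bu by (simp add: Yint_linear cone_Pop_pow)
 moreover have "cL / EY * ((LEB x. Lop u x) - (LEB x. Lop u x * indicator {..?t} x)) <= Yint ((Pop ^^ N) (Lop u))"
  by (rule Suc.IH[OF Lu])
 ultimately show ?case using B m t by (simp add: algebra_simps)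
qed

text \<open>By \<open>drift\<close>, each step backwards along the left branch increases \<open>x powr - s\<close> by at least a fixed amount.\<close>
lemma g_pow_decay:
 obtains C where "0 < C" "!!n. ((g ^^ n) 1) powr s <= C / (real n + 1)"
proof -
 define d where "d = min c 1 * s / 4"
 have "min c 1 * s <= 1 * 1" using c_pos s_bounds by (intro mult_mono) auto
 then have d: "0 < d" "d <= 1" using c_pos s_bounds by (auto simp: d_def)
 have step: "x powr - s + d <= (g x) powr - s" if x: "0 < x" "x <= 1" for x
 proof -
  let ?y = "g x"
  have y: "0 < ?y" "?y <= 1/2" "F ?y = x" using g_props[OF x] by auto
  define w where "w = min c 1 * ?y powr s"
  have ys: "?y powr s <= 1" using powr_mono2[of s ?y 1] y s_bounds by simp
  have w: "0 < w" "w <= 1" using y c_pos ys by (auto simp: w_def min_def intro: mult_le_one)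
  have "w <= c * ?y powr s" unfolding w_def by (intro mult_right_mono) auto
  then have "?y * (1 + w) <= ?y * (1 + c * ?y powr s)" using y by (intro mult_left_mono) auto
  also have "... <= x" using drift[of ?y] y by simp
  finally have "?y * (1 + w) <= x" .
  then have "x powr - s <= (?y * (1 + w)) powr - s"
   using y w s_bounds x by (intro powr_mono2') auto
  also have "... = ?y powr - s * (1 + w) powr - s" using y w by (simp add: powr_mult)
  also have "... <= ?y powr - s * (1 - s * w / 4)"
  proof (intro mult_left_mono)
   have "s * w / 2 <= s * ln (1 + w)"
   proof -
    have "w / 2 <= w / (1 + w)" using w by (simp add: field_simps)
    also have "... <= ln (1 + w)" using ln_add_one_self_le_self2[of "- w / (1+w)"] w
     ln_le_minus_one[of "1 / (1 + w)"] by (simp add: ln_div field_simps)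
    finally show ?thesis using s_bounds by simp
   qed
   then have "exp (- s * ln (1 + w)) <= exp (- (s * w / 2))" by simp
   also have "... <= 1 - s * w / 4"
   proof -
    have "exp (- (s * w / 2)) <= 1 / (1 + s * w / 2)"
     using exp_ge_add_one_self[of "s * w / 2"] s_bounds w
     unfolding exp_minus inverse_eq_divide by (intro divide_left_mono) (auto intro!: mult_pos_pos add_pos_pos)
    also have "... <= 1 - s * w / 4"
    proof -
     have "0 <= s * w" "s * w <= 1" using s_bounds w by (auto intro: mult_le_one)
     then have "s * w * (s * w) <= 1 * (s * w)" by (intro mult_right_mono) auto
     then have "1 <= (1 - s * w / 4) * (1 + s * w / 2)" using \<open>0 <= s * w\<close> by (simp add: algebra_simps)
     moreover have "0 < 1 + s * w / 2" using s_bounds w by (auto intro: add_pos_nonneg)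
     ultimately show ?thesis by (simp add: divide_le_eq)
    qed
    finally show ?thesis .
   qed
   finally show "(1 + w) powr - s <= 1 - s * w / 4" using w by (simp add: powr_def)
  qed auto
  also have "... = ?y powr - s - d"
  proof -
   have "?y powr - s * (s * w / 4) = d * (?y powr - s * ?y powr s)" by (simp add: w_def d_def)
   also have "?y powr - s * ?y powr s = 1" using y by (simp add: powr_add[symmetric])
   finally show ?thesis by (simp add: algebra_simps)
  qed
  finally show ?thesis by simp
 qed
 have lower: "1 + d * real n <= ((g ^^ n) 1) powr - s" for n
 proof (induction n)
  case (Suc n)
  then show ?case using step[of "(g ^^ n) 1"] g_pow_bounds[of n] by (simp add: algebra_simps)
 qed simp
 show ?thesis
 proof
  show "0 < 1 / d" using d by simp
  fix n
  have "d * (real n + 1) <= ((g ^^ n) 1) powr - s" using lower[of n] d by (simp add: algebra_simps)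
  then have "d * (real n + 1) <= 1 / ((g ^^ n) 1) powr s" by (simp add: powr_minus divide_inverse)
  then have "((g ^^ n) 1) powr s * (d * (real n + 1)) <= 1"
   using g_pow_bounds[of n] by (simp add: le_divide_eq mult.commute)
  then show "((g ^^ n) 1) powr s <= 1 / d / (real n + 1)"
   using d by (simp add: le_divide_eq mult_ac)
 qed
qed

section \<open>Coupling\<close>

definition \<tau> :: real where "\<tau> = (3/4) powr \<alpha>"

lemma \<tau>_bounds: "0 <= \<tau>" "\<tau> < 1"
 using powr_less_mono'[of "3/4" 0 \<alpha>] \<alpha> by (auto simp: \<tau>_def)

text \<open>A constant that may be removed from the images of both densities without leaving the
cone: the right branch has lowered the cone constant by the factor \<open>\<tau>\<close>, and
\<open>hcone_subtract\<close> applies to \<open>Bop\<close>.\<close>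
definition share :: "(real => real) \<times> (real => real) => real" where
 "share p = (1 - \<tau>) / EY * min (Yint (fst p)) (Yint (snd p))"

definition couple :: "(real => real) \<times> (real => real) => (real => real) \<times> (real => real)" where
 "couple p = ((\<lambda>x. Pop (fst p) x - share p), (\<lambda>x. Pop (snd p) x - share p))"

lemma couple_sel:
 "fst (couple p) = (\<lambda>x. Pop (fst p) x - share p)" "snd (couple p) = (\<lambda>x. Pop (snd p) x - share p)"
 by (simp_all add: couple_def)

lemma pcone_add: "pcone u ==> pcone v ==> pcone (\<lambda>x. u x + v x)"
 by (auto simp: pcone_def intro: hcone_add)

lemma pcone_Pop_minus:
 assumes u: "pcone u" and k: "0 <= k" "k <= (1 - \<tau>) / EY * Yint u"
 shows "pcone (\<lambda>x. Pop u x - k)"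
proof -
 have "hcone K \<alpha> a (\<lambda>x. Bop u x - k)"
 proof (rule hcone_subtract)
  show "hcone K \<alpha> (\<tau> * a) (Bop u)"
   using Bop_hcone[OF _ \<alpha>, of a u] u a_pos by (auto simp: \<tau>_def pcone_def)
  show "k <= (1 - \<tau>) * Bop u x" if "0 < x" "x <= 1" for x
  proof -
   have "k <= (1 - \<tau>) * (Yint u / EY)" using k by simp
   also have "... <= (1 - \<tau>) * Bop u x" using Bop_ge[OF u that] \<tau>_bounds by (intro mult_left_mono) auto
   finally show ?thesis .
  qed
 qed (use \<tau>_bounds a_pos k in auto)
 moreover have "integrable unit_leb (\<lambda>x. Bop u x - k)"
  using cone_integrable[OF cone_Bop[OF u]] cone_integrable[OF pcone_const[OF k(1)]] by auto
 ultimately have "pcone (\<lambda>x. Lop u x + (Bop u x - k))"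
  using cone_Lop[OF u] by (intro pcone_add) (auto simp: pcone_def)
 then show ?thesis by (simp add: Pop_def[abs_def] algebra_simps)
qed

lemma share_bounds:
 assumes "pcone (fst p)" "pcone (snd p)"
 shows "0 <= share p" "share p <= (1 - \<tau>) / EY * Yint (fst p)" "share p <= (1 - \<tau>) / EY * Yint (snd p)"
 using \<tau>_bounds EY_ge_1 Yint_nonneg[OF assms(1)] Yint_nonneg[OF assms(2)]
 by (auto simp: share_def intro!: mult_nonneg_nonneg divide_right_mono mult_left_mono)

lemma couple_step:
 assumes "pcone (fst p)" "pcone (snd p)"
 shows "pcone (fst (couple p))" "pcone (snd (couple p))"
  "(LEB x. fst (couple p) x) = (LEB x. fst p x) - share p"
  "(LEB x. snd (couple p) x) = (LEB x. snd p x) - share p"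
proof -
 note sb = share_bounds[OF assms]
 show "pcone (fst (couple p))" "pcone (snd (couple p))"
  using pcone_Pop_minus assms sb by (auto simp: couple_sel)
 have *: "(LEB x. Pop u x - share p) = (LEB x. u x) - share p" if "pcone u" for u
  using cone_integrable[OF cone_Pop[OF that]] cone_integrable[OF pcone_const[OF sb(1)]] Pop_pow_mass[OF that, of 1]
   prob_space.prob_space[OF prob_space_unit_leb]
  by (subst Bochner_Integration.integral_diff) auto
 show "(LEB x. fst (couple p) x) = (LEB x. fst p x) - share p"
  "(LEB x. snd (couple p) x) = (LEB x. snd p x) - share p"
  using * assms by (auto simp: couple_sel)
qed

lemma couple_pow_pcone:
 "pcone (fst p) ==> pcone (snd p) ==> pcone (fst ((couple ^^ n) p)) \<and> pcone (snd ((couple ^^ n) p))"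
 by (induction n) (auto intro: couple_step)

lemma couple_pow_diff:
 "fst ((couple ^^ n) p) x - snd ((couple ^^ n) p) x = (Pop ^^ n) (fst p) x - (Pop ^^ n) (snd p) x"
proof (induction n arbitrary: x)
 case (Suc n)
 have "(\<lambda>x. fst ((couple ^^ n) p) x - snd ((couple ^^ n) p) x) = (\<lambda>x. (Pop ^^ n) (fst p) x - (Pop ^^ n) (snd p) x)"
  using Suc by auto
 then have "Pop (\<lambda>x. fst ((couple ^^ n) p) x - snd ((couple ^^ n) p) x) x = Pop (\<lambda>x. (Pop ^^ n) (fst p) x - (Pop ^^ n) (snd p) x) x"
  by simp
 then show ?case by (simp add: couple_sel Pop_linear)
qed simp

text \<open>What is left, plus a part \<open>R\<close> common to both, makes up the image of the original densities.
Estimates for the images under \<open>Pop\<close> carry over to what is left in this way.\<close>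
lemma couple_remainder:
 assumes "pcone (fst p)" "pcone (snd p)"
 shows "\<exists>R. pcone R \<and> (Pop ^^ n) (fst p) = (\<lambda>x. fst ((couple ^^ n) p) x + R x)
   \<and> (Pop ^^ n) (snd p) = (\<lambda>x. snd ((couple ^^ n) p) x + R x)"
proof (induction n)
 case 0
 show ?case by (intro exI[of _ "\<lambda>_. 0"]) (auto simp: pcone_const)
next
 case (Suc n)
 then obtain R where R: "pcone R" "(Pop ^^ n) (fst p) = (\<lambda>x. fst ((couple ^^ n) p) x + R x)"
   "(Pop ^^ n) (snd p) = (\<lambda>x. snd ((couple ^^ n) p) x + R x)" by auto
 have "pcone (\<lambda>x. share ((couple ^^ n) p) + Pop R x)"
  using couple_pow_pcone[OF assms, of n] R by (intro pcone_add pcone_const share_bounds cone_Pop) auto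
 then show ?case using R
  by (intro exI[of _ "\<lambda>x. share ((couple ^^ n) p) + Pop R x"]) (auto simp: couple_sel Pop_linear)
qed

text \<open>Use the alternative with \<open>N\<close> of the order \<open>\<eta> * n\<close>. Either the bound holds at once, or it is inherited
from \<open>n' \<ge> (1 - 2 * \<eta>) * n\<close>, where \<open>\<eta>\<close> is chosen such that the gain \<open>1 - \<delta>\<close> makes up for the factor
\<open>(1 - 2 * \<eta>) powr - \<beta>\<close>.\<close>
lemma power_decay_from_dichotomy:
 fixes C \<delta> \<beta> :: real
 assumes C: "0 <= C" and \<delta>: "0 < \<delta>" "\<delta> < 1" and \<beta>: "0 < \<beta>"
 shows "\<exists>K. \<forall>m :: nat => real. (\<forall>n. 0 <= m n) --> (\<forall>n. m (Suc n) <= m n) --> m 0 <= 1 -->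
   (\<forall>n N. m n <= C * (real N + 1) powr - \<beta> \<or> m (n + N + 1) <= (1 - \<delta>) * m n) -->
   (\<forall>n\<ge>1. m n <= K * real n powr - \<beta>)"
proof -
 define \<eta> where "\<eta> = (1 - (1 - \<delta>) powr (1 / \<beta>)) / 2"
 have "(1 - \<delta>) powr (1 / \<beta>) < 1" "0 < (1 - \<delta>) powr (1 / \<beta>)"
  using powr_less_mono2[of "1 / \<beta>" "1 - \<delta>" 1] \<delta> \<beta> by auto
 then have \<eta>: "0 < \<eta>" "\<eta> < 1/2" by (auto simp: \<eta>_def)
 have "1 - 2 * \<eta> = (1 - \<delta>) powr (1 / \<beta>)" by (simp add: \<eta>_def field_simps)
 then have "(1 - 2 * \<eta>) powr \<beta> = ((1 - \<delta>) powr (1 / \<beta>)) powr \<beta>" by (simp only:)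
 also have "... = 1 - \<delta>" using \<delta> \<beta> by (simp add: powr_powr)
 finally have \<eta>_pow: "(1 - 2 * \<eta>) powr \<beta> = 1 - \<delta>" .
 define K where "K = max (C * \<eta> powr - \<beta>) (\<eta> powr - \<beta>)"
 have K0: "0 < K" using \<eta> by (auto simp: K_def less_max_iff_disj)
 show ?thesis
 proof (intro exI[of _ K] allI impI)
  fix m :: "nat => real" and n :: nat
  assume pos: "\<forall>n. 0 <= m n" and dec: "\<forall>n. m (Suc n) <= m n" and m0: "m 0 <= 1"
   and dich: "\<forall>n N. m n <= C * (real N + 1) powr - \<beta> \<or> m (n + N + 1) <= (1 - \<delta>) * m n"
   and "1 <= n"
  have anti: "m k <= m j" if "j <= k" for j k
   using lift_Suc_antimono_le[of m j k] dec that by auto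
  show "m n <= K * real n powr - \<beta>"
   using \<open>1 <= n\<close>
  proof (induction n rule: less_induct)
   case (less n)
   show ?case
   proof (cases "real n <= 1 / \<eta>")
    case True
    have "m n <= 1" using anti[of 0 n] m0 by simp
    also have "1 = \<eta> powr - \<beta> * (1 / \<eta>) powr - \<beta>" using \<eta> by (simp add: powr_mult[symmetric])
    also have "... <= K * real n powr - \<beta>"
     using True less.prems \<eta> \<beta> K0 by (intro mult_mono powr_mono2') (auto simp: K_def)
    finally show ?thesis .
   next
    case False
    then have n: "1 < \<eta> * real n" using \<eta> by (simp add: field_simps)
    define N where "N = nat \<lfloor>\<eta> * real n\<rfloor>"
    have N: "real N <= \<eta> * real n" "\<eta> * real n <= real N + 1"
     using n by (auto simp: N_def)
    have "real N + 1 <= 2 * \<eta> * real n" using N n by simp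
    also have "... < 1 * real n" using \<eta> less.prems by (intro mult_strict_right_mono) auto
    finally have Nn: "N + 1 < n" by linarith
    define n' where "n' = n - (N + 1)"
    have n': "n' + N + 1 = n" "1 <= n'" "n' < n" "(1 - 2 * \<eta>) * real n <= real n'"
     using Nn \<open>real N + 1 <= 2 * \<eta> * real n\<close> by (auto simp: n'_def algebra_simps of_nat_diff)
    show ?thesis
    proof (cases "m n' <= C * (real N + 1) powr - \<beta>")
     case True
     have "m n <= m n'" using anti n' by auto
     also have "... <= C * (real N + 1) powr - \<beta>" by (rule True)
     also have "... <= C * (\<eta> * real n) powr - \<beta>"
      using N n \<beta> C by (intro mult_left_mono powr_mono2') auto
     also have "... = C * \<eta> powr - \<beta> * real n powr - \<beta>" using \<eta> by (simp add: powr_mult)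
     also have "... <= K * real n powr - \<beta>" by (intro mult_right_mono) (auto simp: K_def)
     finally show ?thesis .
    next
     case False
     then have "m n <= (1 - \<delta>) * m n'" using dich n' by metis
     also have "... <= (1 - \<delta>) * (K * real n' powr - \<beta>)"
      using less.IH[of n'] n' \<delta> by (intro mult_left_mono) auto
     also have "... <= (1 - \<delta>) * (K * ((1 - 2 * \<eta>) * real n) powr - \<beta>)"
      using n' \<delta> \<eta> K0 \<beta> less.prems by (intro mult_left_mono powr_mono2') auto
     also have "... = (1 - \<delta>) * (1 - 2 * \<eta>) powr - \<beta> * (K * real n powr - \<beta>)"
      using \<eta> by (simp add: powr_mult)
     also have "(1 - \<delta>) * (1 - 2 * \<eta>) powr - \<beta> = 1"
      using \<eta>_pow \<eta> \<delta> by (simp add: powr_minus)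
     finally show ?thesis by simp
    qed
   qed
  qed
 qed
qed

text \<open>Let \<open>m k\<close> be the mass left after \<open>k\<close> steps. Unless it is below twice the mass that domination admits
below \<open>(g ^^ N) 1\<close>, half of it visits the right half within \<open>N\<close> steps, so that either a definite share has been
matched on the way or is matched in the next step. This is the alternative of
\<open>power_decay_from_dichotomy\<close>.\<close>
theorem coupling_rate:
 "\<exists>C. \<forall>u v n G. pcone u --> pcone v --> dominated A u --> dominated A v -->
   (LEB x. u x) = 1 --> (LEB x. v x) = 1 --> 1 <= n -->
   G \<in> borel_measurable unit_leb --> (\<forall>x\<in>{0<..1}. \<bar>G x\<bar> <= 1) -->
   \<bar>(LEB x. u x * G ((f ^^ n) x)) - (LEB x. v x * G ((f ^^ n) x))\<bar>
    <= C * real n powr - ((1 - s) / s)"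
proof -
 define \<beta> where "\<beta> = (1 - s) / s"
 have \<beta>: "0 < \<beta>" using s_bounds by (simp add: \<beta>_def)
 obtain A0 where A0: "1 <= A0"
  and dom: "!!A u. A0 <= A ==> pcone u ==> (LEB x. u x) <= 1 ==> dominated A u ==> dominated A (Pop u)"
  using domination by blast
 define B where "B = max A A0"
 have B: "1 <= B" "A0 <= B" using A0 by (auto simp: B_def)
 obtain cL where cL: "0 < cL"
  "!!u. pcone u ==> dominated B u ==> (LEB x. u x) = 1 ==> cL <= Yint u"
  using Yint_lower[OF B(1)] by blast
 have mass1: "(LEB x. 1) = (1::real)"
  using prob_space.prob_space[OF prob_space_unit_leb] by simp
 have one: "pcone (\<lambda>_. 1)" "dominated B (\<lambda>_. 1)"
  using pcone_const[of 1] dominated_const_1[OF B(1)] by auto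
 have cL1: "cL <= Yint ((Pop ^^ n) (\<lambda>_. 1))" for n
 proof (intro cL cone_Pop_pow one)
  show "dominated B ((Pop ^^ n) (\<lambda>_. 1))"
   by (rule Pop_pow_dominated[of A0, OF dom]) (use one B mass1 in auto)
 qed (use one mass1 in \<open>auto simp: Pop_pow_mass\<close>)
 have "cL <= 1" using cL1[of 0] Yint_le_mass[OF one(1)] mass1 by simp
 obtain C0 where C0: "0 < C0" "!!n. ((g ^^ n) 1) powr s <= C0 / (real n + 1)"
  using g_pow_decay by blast
 define c2 where "c2 = (1 - \<tau>) / EY"
 define c3 where "c3 = cL / EY"
 have c2: "0 < c2" "c2 <= 1" using \<tau>_bounds EY_ge_1 by (auto simp: c2_def divide_le_eq)
 have c3: "0 < c3" "c3 <= 1" using cL \<open>cL <= 1\<close> EY_ge_1 by (auto simp: c3_def divide_le_eq)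
 define \<delta> where "\<delta> = c2 * c3 / 4"
 have "c2 * c3 <= 1 * c3" using c2 c3 by (intro mult_right_mono) auto
 then have "\<delta> <= c3 / 4" "0 < \<delta>" using c2 c3 by (auto simp: \<delta>_def)
 then have \<delta>: "0 < \<delta>" "\<delta> < 1" "\<delta> <= c3 / 4" using c3 by auto
 define C1' where "C1' = B / (1 - s) * C0 powr \<beta>"
 define C1 where "C1 = 2 * C1'"
 have C1: "0 <= C1" using B s_bounds by (auto simp: C1_def C1'_def)
 obtain C2 where C2: "!!m :: nat => real. (\<forall>n. 0 <= m n) ==> (\<forall>n. m (Suc n) <= m n) ==> m 0 <= 1 ==>
   (\<forall>n N. m n <= C1 * (real N + 1) powr - \<beta> \<or> m (n + N + 1) <= (1 - \<delta>) * m n) ==>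
   (\<forall>n\<ge>1. m n <= C2 * real n powr - \<beta>)"
  using power_decay_from_dichotomy[OF C1 \<delta>(1,2) \<beta>] by blast
 show ?thesis
 proof (intro exI[of _ "2 * C2"] allI impI)
  fix u v and n :: nat and G :: "real => real"
  assume u: "pcone u" "dominated A u" "(LEB x. u x) = 1"
   and v: "pcone v" "dominated A v" "(LEB x. v x) = 1"
   and n: "1 <= n" and G: "G \<in> borel_measurable unit_leb" "\<forall>x\<in>{0<..1}. \<bar>G x\<bar> <= 1"
  have dB: "dominated B w" if "dominated A w" for w
   unfolding dominated_def
  proof (intro allI impI)
   fix x :: real assume "0 < x \<and> x <= 1"
   then have "w x <= A * x powr - s" using that by (auto simp: dominated_def)
   also have "... <= B * x powr - s" by (intro mult_right_mono) (auto simp: B_def)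
   finally show "w x <= B * x powr - s" .
  qed
  define p where "p n = (couple ^^ n) (u, v)" for n :: nat
  define m where "m n = (LEB x. fst (p n) x)" for n :: nat
  have pc: "pcone (fst (p n))" "pcone (snd (p n))" for n
   using couple_pow_pcone[of "(u, v)" n] u v by (auto simp: p_def)
  have p_Suc: "p (Suc n) = couple (p n)" for n by (simp add: p_def)
  have m_snd: "(LEB x. snd (p n) x) = m n" for n :: nat
  proof (induction n)
   case (Suc n)
   then show ?case using couple_step[OF pc(1)[of n] pc(2)[of n]] by (simp add: m_def p_Suc)
  qed (simp add: m_def p_def u v)
  have m_Suc: "m (Suc n) = m n - share (p n)" for n
   using couple_step(3)[OF pc(1)[of n] pc(2)[of n]] by (simp add: m_def p_Suc)
  have share0: "0 <= share (p n)" for n by (rule share_bounds[OF pc])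
  have m_nonneg: "0 <= m n" for n
   unfolding m_def using cone_nonneg[OF pc(1)] by (intro integral_nonneg_AE AE_I2) auto
  have p_add: "p (k + j) = (couple ^^ j) (p k)" for k j
   unfolding p_def by (metis add.commute comp_apply funpow_add)
  have p_dom: "dominated B (fst (p k))" "dominated B (snd (p k))" for k
  proof -
   obtain R where R: "pcone R" "(Pop ^^ k) u = (\<lambda>x. fst (p k) x + R x)"
     "(Pop ^^ k) v = (\<lambda>x. snd (p k) x + R x)"
    using couple_remainder[of "(u, v)" k] u v by (auto simp: p_def)
   have "dominated B ((Pop ^^ k) u)" "dominated B ((Pop ^^ k) v)"
    by (rule Pop_pow_dominated[of A0, OF dom]; use u v dB B in simp)+
   then show "dominated B (fst (p k))" "dominated B (snd (p k))"
    using cone_nonneg[OF R(1)] unfolding R(2,3) dominated_def by force+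
  qed
  \<comment> \<open>mass that avoids the right half for N steps started below (g ^^ N) 1, where domination admits at most half of m k; R is the part matched meanwhile\<close>
  have main: "c3 * m k / 2 <= Yint w + (m k - m (k + N))"
   if small: "\<not> m k <= C1 * (real N + 1) powr - \<beta>"
    and w: "pcone w0" "pcone w" "pcone R" "(Pop ^^ N) w0 = (\<lambda>x. w x + R x)" "dominated B w0"
     "(LEB x. w0 x) = m k" "(LEB x. w x) = m (k + N)" for k N w0 w R
  proof -
   have gN: "0 < (g ^^ N) 1" "(g ^^ N) 1 <= 1" using g_pow_bounds by auto
   have "(LEB x. w0 x * indicator {..(g ^^ N) 1} x) <= B * ((g ^^ N) 1) powr (1 - s) / (1 - s)"
    using w gN B by (intro dominated_mass_near_0) auto
   also have "((g ^^ N) 1) powr (1 - s) = (((g ^^ N) 1) powr s) powr \<beta>"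
    using s_bounds by (simp add: powr_powr \<beta>_def)
   also have "B * ... / (1 - s) <= B * (C0 / (real N + 1)) powr \<beta> / (1 - s)"
    using C0 B s_bounds \<beta> by (intro divide_right_mono mult_left_mono powr_mono2) auto
   also have "... = C1 * (real N + 1) powr - \<beta> / 2"
   proof -
    have "(C0 / (real N + 1)) powr \<beta> = C0 powr \<beta> * (real N + 1) powr - \<beta>"
     using C0(1) by (simp add: powr_divide powr_minus_divide)
    then show ?thesis by (simp add: C1_def) (simp add: C1'_def)
   qed
   also have "... <= m k / 2" using small by simp
   finally have "c3 * (m k - m k / 2) <= c3 * (m k - (LEB x. w0 x * indicator {..(g ^^ N) 1} x))"
    using c3 by (intro mult_left_mono) auto
   also have "... <= Yint ((Pop ^^ N) w0)"
    using visits[OF cL1 _ w(1), of N] cL w(6) by (simp add: c3_def)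
   also have "... = Yint w + Yint R" unfolding w(4) using w by (simp add: Yint_linear)
   also have "Yint R <= (LEB x. R x)" using w by (intro Yint_le_mass)
   also have "(LEB x. R x) = m k - m (k + N)"
   proof -
    have "m k = (LEB x. (Pop ^^ N) w0 x)" using Pop_pow_mass[OF w(1)] w(6) by simp
    also have "... = m (k + N) + (LEB x. R x)"
     unfolding w(4) using w(2,3,7) by (simp add: Bochner_Integration.integral_add cone_integrable)
    finally show ?thesis by simp
   qed
   finally show ?thesis by simp
  qed
  have anti: "m k <= m j" if "j <= k" for j k
   using lift_Suc_antimono_le[of m j k] share0 that by (auto simp: m_Suc)
  have dich: "m k <= C1 * (real N + 1) powr - \<beta> \<or> m (k + N + 1) <= (1 - \<delta>) * m k" for k N
  proof (cases "m k <= C1 * (real N + 1) powr - \<beta>")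
   case False
   obtain R where R: "pcone R" "(Pop ^^ N) (fst (p k)) = (\<lambda>x. fst (p (k + N)) x + R x)"
     "(Pop ^^ N) (snd (p k)) = (\<lambda>x. snd (p (k + N)) x + R x)"
    using couple_remainder[OF pc(1)[of k] pc(2)[of k], of N] by (auto simp: p_add)
   have 1: "c3 * m k / 2 <= Yint (fst (p (k + N))) + (m k - m (k + N))"
    using main[OF False pc(1) pc(1) R(1,2) p_dom(1)] by (simp add: m_def)
   have 2: "c3 * m k / 2 <= Yint (snd (p (k + N))) + (m k - m (k + N))"
    using main[OF False pc(2) pc(2) R(1,3) p_dom(2)] by (simp add: m_snd)
   have "\<delta> * m k <= m k - m (k + N + 1)"
   proof (cases "c3 * m k / 4 <= m k - m (k + N)")
    case True
    have "\<delta> * m k <= c3 / 4 * m k" using \<delta> m_nonneg by (intro mult_right_mono) auto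
    also have "... <= m k - m (k + N)" using True by simp
    also have "... <= m k - m (k + N + 1)" using anti[of "k + N" "k + N + 1"] by simp
    finally show ?thesis .
   next
    case False
    then have "c3 * m k / 4 <= min (Yint (fst (p (k + N)))) (Yint (snd (p (k + N))))"
     using 1 2 by simp
    then have "c2 * (c3 * m k / 4) <= share (p (k + N))"
     unfolding share_def c2_def[symmetric] using c2 by (intro mult_left_mono) auto
    then have "\<delta> * m k <= m (k + N) - m (k + N + 1)" using m_Suc[of "k + N"] by (simp add: \<delta>_def)
    also have "... <= m k - m (k + N + 1)" using anti[of k "k + N"] by simp
    finally show ?thesis .
   qed
   then show ?thesis by (simp add: algebra_simps)
  qed simp
  have "m 0 <= 1" by (simp add: m_def p_def u)
  then have rate: "m n <= C2 * real n powr - \<beta>"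
   using C2[of m] m_nonneg dich share0 n by (auto simp: m_Suc)
  have Gm: "integrable unit_leb (\<lambda>x. w x * G x)" "\<bar>LEB x. w x * G x\<bar> <= (LEB x. w x)" if "pcone w" for w
  proof -
   have [measurable]: "w \<in> borel_measurable unit_leb" using cone_measurable[OF that] .
   have bd: "\<bar>w x * G x\<bar> <= w x" if x: "x \<in> {0<..1}" for x
    using G(2) x cone_nonneg[OF \<open>pcone w\<close>, of x] mult_left_mono[of "\<bar>G x\<bar>" 1 "w x"] by (auto simp: abs_mult)
   show "integrable unit_leb (\<lambda>x. w x * G x)"
    using G(1) bd cone_nonneg[OF that]
    by (intro Bochner_Integration.integrable_bound[OF cone_integrable[OF that]]) auto
   then show "\<bar>LEB x. w x * G x\<bar> <= (LEB x. w x)"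
    using bd by (intro order_trans[OF integral_abs_bound] integral_mono cone_integrable[OF that]) auto
  qed
  have "(LEB x. u x * G ((f ^^ n) x)) - (LEB x. v x * G ((f ^^ n) x)) =
    (LEB x. (Pop ^^ n) u x * G x) - (LEB x. (Pop ^^ n) v x * G x)"
   using u v G by (simp add: Pop_pow_integral)
  also have "... = (LEB x. ((Pop ^^ n) u x - (Pop ^^ n) v x) * G x)"
   using Gm(1)[OF cone_Pop_pow] u v by (simp add: left_diff_distrib Bochner_Integration.integral_diff)
  also have "... = (LEB x. (fst (p n) x - snd (p n) x) * G x)"
   using couple_pow_diff[of n "(u, v)"] by (simp add: p_def)
  also have "... = (LEB x. fst (p n) x * G x) - (LEB x. snd (p n) x * G x)"
   using Gm(1)[OF pc(1)] Gm(1)[OF pc(2)] by (simp add: left_diff_distrib Bochner_Integration.integral_diff)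
  also have "\<bar>...\<bar> <= m n + m n"
   using Gm(2)[OF pc(1), of n] Gm(2)[OF pc(2), of n] m_snd[of n] by (simp add: m_def)
  finally show "\<bar>(LEB x. u x * G ((f ^^ n) x)) - (LEB x. v x * G ((f ^^ n) x))\<bar>
    <= 2 * C2 * real n powr - ((1 - s) / s)"
   using rate by (simp add: \<beta>_def)
 qed
qed

end

section \<open>Exactness and decay of correlations\<close>

context intermittent_cone
begin

lemma chart_dist_ge:
 assumes "0 < x" "x <= 1" "0 < y" "y <= 1"
 shows "\<bar>x - y\<bar> <= \<bar>chart K x - chart K y\<bar>"
proof -
 have *: "y - x <= chart K y - chart K x" if "0 < x" "x <= y" "y <= 1" for x y
 proof -
  have "y - x <= ln y - ln x"
  proof -
   have "ln (x / y) <= x / y - 1" using that by (intro ln_le_minus_one) auto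
   then have "1 - x / y <= ln y - ln x" using that by (simp add: ln_div)
   moreover have "y - x <= (y - x) / y" using that by (simp add: le_divide_eq mult_left_le)
   ultimately show ?thesis using that by (simp add: diff_divide_distrib)
  qed
  moreover have "K * (x + x\<^sup>2 / 2) <= K * (y + y\<^sup>2 / 2)"
   using that K_nonneg by (intro mult_left_mono add_mono divide_right_mono power_mono) auto
  ultimately show ?thesis by (simp add: chart_def)
 qed
 show ?thesis using *[of x y] *[of y x] assms by (cases "x <= y") auto
qed

lemma holder_le_at_1:
 fixes \<psi> :: "real => real"
 assumes C: "0 <= C" and hol: "!!x y. 0 < x ==> x <= 1 ==> 0 < y ==> y <= 1 ==> \<bar>\<psi> x - \<psi> y\<bar> <= C * \<bar>x - y\<bar> powr \<alpha>"
  and x: "0 < x" "x <= 1"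
 shows "\<bar>\<psi> x\<bar> <= \<bar>\<psi> 1\<bar> + C"
proof -
 have "\<bar>\<psi> x - \<psi> 1\<bar> <= C * \<bar>x - 1\<bar> powr \<alpha>" using hol[of x 1] x by simp
 also have "... <= C * 1" using x \<alpha> C by (intro mult_left_mono powr_le1) auto
 finally show ?thesis by linarith
qed

text \<open>Distances in the chart are at least the usual ones, and adding a large constant flattens the logarithm.\<close>
lemma holder_shift_hcone:
 fixes \<psi> :: "real => real"
 assumes C: "0 <= C" and hol: "!!x y. 0 < x ==> x <= 1 ==> 0 < y ==> y <= 1 ==> \<bar>\<psi> x - \<psi> y\<bar> <= C * \<bar>x - y\<bar> powr \<alpha>"
  and e: "0 < e" and M: "\<bar>\<psi> 1\<bar> + C + C / e <= M"
 shows "hcone K \<alpha> e (\<lambda>x. \<psi> x + M)"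
proof -
 have low: "C / e <= \<psi> x + M" if "0 < x" "x <= 1" for x
  using holder_le_at_1[OF C _ that, of \<psi>] hol M by fastforce
 show ?thesis
  unfolding hcone_def
 proof (intro conjI ballI)
  fix x :: real assume "x \<in> {0<..1}"
  then show "0 <= \<psi> x + M" using low[of x] C e by (auto intro: order_trans[of _ "C / e"])
 next
  fix x y :: real assume xy: "x \<in> {0<..1}" "y \<in> {0<..1}"
  define d where "d = \<bar>chart K x - chart K y\<bar>"
  have d: "\<bar>x - y\<bar> <= d" using chart_dist_ge xy by (auto simp: d_def)
  have "\<psi> x - \<psi> y <= C * \<bar>x - y\<bar> powr \<alpha>" using hol[of x y] xy by auto
  also have "... <= C * modulus_fn \<alpha> d"
   using powr_mono2[of \<alpha> "\<bar>x - y\<bar>" d] \<alpha> d C by (intro mult_left_mono) (auto simp: modulus_fn_def)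
  also have "... = C / e * (e * modulus_fn \<alpha> d)" using e by simp
  also have "... <= (\<psi> y + M) * (e * modulus_fn \<alpha> d)"
   using low[of y] xy e d by (intro mult_right_mono mult_nonneg_nonneg modulus_fn_nonneg) (auto simp: d_def)
  finally have "\<psi> x + M <= (\<psi> y + M) * (1 + e * modulus_fn \<alpha> d)" by (simp add: algebra_simps)
  also have "... <= (\<psi> y + M) * exp (e * modulus_fn \<alpha> d)"
   using low[of y] xy C e by (intro mult_left_mono exp_ge_add_one_self) (auto intro: order_trans[of _ "C / e"])
  finally show "\<psi> x + M <= exp (e * modulus_fn \<alpha> \<bar>chart K x - chart K y\<bar>) * (\<psi> y + M)"
   by (simp add: d_def mult.commute)
 qed
qed

text \<open>Only bounds and measurability are asked of functions of the future, so that decay against them is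
decay in the norm of \<open>L\<^sup>1\<close>.\<close>
definition test_fun :: "(real => real) => bool" where
 "test_fun G \<longleftrightarrow> G \<in> borel_measurable unit_leb \<and> (\<forall>x\<in>{0<..1}. \<bar>G x\<bar> <= 1)"

lemma test_fun_pow: "test_fun G ==> test_fun (\<lambda>x. G ((f ^^ n) x))"
 unfolding test_fun_def using measurable_space[OF f_pow_measurable, of _ n]
 by (auto intro: measurable_compose[OF f_pow_measurable])

lemma test_fun_integral:
 assumes "integrable unit_leb \<psi>" "test_fun G"
 shows "integrable unit_leb (\<lambda>x. \<psi> x * G x)" "\<bar>LEB x. \<psi> x * G x\<bar> <= (LEB x. \<bar>\<psi> x\<bar>)"
proof -
 have [measurable]: "\<psi> \<in> borel_measurable unit_leb" "G \<in> borel_measurable unit_leb"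
  using assms by (auto simp: test_fun_def)
 have bd: "\<bar>\<psi> x * G x\<bar> <= \<bar>\<psi> x\<bar>" if "x \<in> {0<..1}" for x
  using assms(2) that mult_left_mono[of "\<bar>G x\<bar>" 1 "\<bar>\<psi> x\<bar>"] by (auto simp: abs_mult test_fun_def)
 show i: "integrable unit_leb (\<lambda>x. \<psi> x * G x)"
 proof (rule Bochner_Integration.integrable_bound[OF assms(1)])
  show "(\<lambda>x. \<psi> x * G x) \<in> borel_measurable unit_leb" by measurable
 qed (use bd in auto)
 show "\<bar>LEB x. \<psi> x * G x\<bar> <= (LEB x. \<bar>\<psi> x\<bar>)"
  using bd i assms(1) by (intro order_trans[OF integral_abs_bound] integral_mono) auto
qed

lemma integrable_unit_const: "integrable unit_leb (\<lambda>_. r::real)"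
 using prob_space_unit_leb by (auto simp: prob_space_def intro: finite_measure.integrable_const)

lemma measure_unit_leb [simp]: "measure unit_leb {0<..1} = 1"
 using prob_space.prob_space[OF prob_space_unit_leb] by simp

lemma unit_mass: "(LEB x. r) = (r::real)"
 by simp

abbreviation memory :: "(real => real) => nat => (real => real) => real" where
 "memory \<psi> n G \<equiv> \<bar>(LEB x. \<psi> x * G ((f ^^ n) x)) - (LEB x. \<psi> x) * (LEB x. G ((f ^^ n) x))\<bar>"

text \<open>Because of the uniformity in \<open>G\<close> this says that \<open>f ^^ n\<close> transports \<open>\<psi>\<close> and its mean to densities whose
distance in \<open>L\<^sup>1\<close> tends to 0. For all integrable \<open>\<psi>\<close>, this is exactness of \<open>f\<close>.\<close>
definition forgets :: "(real => real) => bool" where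
 "forgets \<psi> \<longleftrightarrow> (\<forall>e>0. \<exists>n0. \<forall>n\<ge>n0. \<forall>G. test_fun G -->
   memory \<psi> n G <= e)"

lemma forgetsD:
 "forgets \<psi> ==> 0 < e ==> \<exists>n0. \<forall>n\<ge>n0. \<forall>G. test_fun G -->
   memory \<psi> n G <= e"
 by (simp add: forgets_def)

lemma forgets_close:
 assumes \<psi>: "integrable unit_leb \<psi>"
  and close: "!!e. 0 < e ==> \<exists>\<psi>'. integrable unit_leb \<psi>' \<and> forgets \<psi>' \<and> (LEB x. \<bar>\<psi> x - \<psi>' x\<bar>) <= e"
 shows "forgets \<psi>"
 unfolding forgets_def
proof (intro allI impI)
 fix e :: real assume e: "0 < e"
 obtain \<psi>' where \<psi>': "integrable unit_leb \<psi>'" "forgets \<psi>'" "(LEB x. \<bar>\<psi> x - \<psi>' x\<bar>) <= e / 3"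
  using close[of "e / 3"] e by auto
 obtain n0 where n0: "!!n G. n >= n0 ==> test_fun G ==>
   memory \<psi>' n G <= e / 3"
  using forgetsD[OF \<psi>'(2), of "e / 3"] e by auto
 show "\<exists>n0. \<forall>n\<ge>n0. \<forall>G. test_fun G -->
   memory \<psi> n G <= e"
 proof (intro exI[of _ n0] allI impI)
  fix n G assume n: "n0 <= n" and G: "test_fun G"
  note Gn = test_fun_pow[OF G, of n]
  let ?G = "\<lambda>x. G ((f ^^ n) x)"
  have i: "integrable unit_leb (\<lambda>x. \<psi> x - \<psi>' x)" using \<psi> \<psi>'(1) by auto
  have "(LEB x. (\<psi> x - \<psi>' x) * ?G x) = (LEB x. \<psi> x * ?G x) - (LEB x. \<psi>' x * ?G x)"
   using test_fun_integral(1)[OF \<psi> Gn] test_fun_integral(1)[OF \<psi>'(1) Gn] by (simp add: left_diff_distrib)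
  then have 1: "\<bar>(LEB x. \<psi> x * ?G x) - (LEB x. \<psi>' x * ?G x)\<bar> <= e / 3"
   using test_fun_integral(2)[OF i Gn] \<psi>'(3) by simp
  have "test_fun (\<lambda>_. 1)" by (auto simp: test_fun_def)
  from test_fun_integral(2)[OF i this]
  have 2: "\<bar>(LEB x. \<psi> x) - (LEB x. \<psi>' x)\<bar> <= e / 3"
   using \<psi> \<psi>'(1,3) by simp
  have 3: "\<bar>LEB x. ?G x\<bar> <= 1"
   using test_fun_integral(2)[OF integrable_unit_const[of 1] Gn] by (simp add: unit_mass)
  have "\<bar>((LEB x. \<psi> x) - (LEB x. \<psi>' x)) * (LEB x. ?G x)\<bar> <= e / 3 * 1"
   unfolding abs_mult using 2 3 e by (intro mult_mono) auto
  then show "\<bar>(LEB x. \<psi> x * ?G x) - (LEB x. \<psi> x) * (LEB x. ?G x)\<bar> <= e"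
   using 1 n0[OF n G] unfolding left_diff_distrib by linarith
 qed
qed

lemma forgets_add:
 assumes "integrable unit_leb \<psi>" "integrable unit_leb \<psi>'" "forgets \<psi>" "forgets \<psi>'"
 shows "forgets (\<lambda>x. \<psi> x + \<psi>' x)"
 unfolding forgets_def
proof (intro allI impI)
 fix e :: real assume e: "0 < e"
 obtain n0 where n0: "!!n G. n >= n0 ==> test_fun G ==>
   memory \<psi> n G <= e / 2"
  using forgetsD[OF assms(3), of "e / 2"] e by auto
 obtain n1 where n1: "!!n G. n >= n1 ==> test_fun G ==>
   memory \<psi>' n G <= e / 2"
  using forgetsD[OF assms(4), of "e / 2"] e by auto
 show "\<exists>n0. \<forall>n\<ge>n0. \<forall>G. test_fun G -->
   memory (\<lambda>x. \<psi> x + \<psi>' x) n G <= e"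
 proof (intro exI[of _ "max n0 n1"] allI impI)
  fix n G assume n: "max n0 n1 <= n" and G: "test_fun G"
  note Gn = test_fun_pow[OF G, of n]
  have e1: "(LEB x. (\<psi> x + \<psi>' x) * G ((f ^^ n) x)) = (LEB x. \<psi> x * G ((f ^^ n) x)) + (LEB x. \<psi>' x * G ((f ^^ n) x))"
   using test_fun_integral(1)[OF assms(1) Gn] test_fun_integral(1)[OF assms(2) Gn] by (simp add: distrib_right)
  have e2: "(LEB x. \<psi> x + \<psi>' x) = (LEB x. \<psi> x) + (LEB x. \<psi>' x)"
   using assms by simp
  show "memory (\<lambda>x. \<psi> x + \<psi>' x) n G <= e"
   using n0[OF _ G, of n] n1[OF _ G, of n] n unfolding e1 e2 by (subst distrib_right) linarith
 qed
qed

lemma forgets_cmult: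
 assumes "forgets \<psi>" shows "forgets (\<lambda>x. r * \<psi> x)"
 unfolding forgets_def
proof (intro allI impI)
 fix e :: real assume e: "0 < e"
 then have "0 < e / (\<bar>r\<bar> + 1)" by simp
 then obtain n0 where n0: "!!n G. n >= n0 ==> test_fun G ==>
   memory \<psi> n G <= e / (\<bar>r\<bar> + 1)"
  using forgetsD[OF assms] by blast
 show "\<exists>n0. \<forall>n\<ge>n0. \<forall>G. test_fun G -->
   memory (\<lambda>x. r * \<psi> x) n G <= e"
 proof (intro exI[of _ n0] allI impI)
  fix n G assume n: "n0 <= n" and G: "test_fun G"
  have "memory (\<lambda>x. r * \<psi> x) n G
   = \<bar>r\<bar> * memory \<psi> n G"
   by (simp only: mult.assoc integral_mult_right_zero right_diff_distrib[symmetric] abs_mult)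
  also have "... <= (\<bar>r\<bar> + 1) * (e / (\<bar>r\<bar> + 1))" using n0[OF n G] by (intro mult_mono) auto
  finally show "memory (\<lambda>x. r * \<psi> x) n G <= e"
   by simp
 qed
qed

lemma forgets_const: "forgets (\<lambda>_. r)"
 unfolding forgets_def by simp

lemma forgets_holder:
 fixes \<psi> :: "real => real"
 assumes C: "0 <= C" and hol: "!!x y. 0 < x ==> x <= 1 ==> 0 < y ==> y <= 1 ==> \<bar>\<psi> x - \<psi> y\<bar> <= C * \<bar>x - y\<bar> powr \<alpha>"
 shows "integrable unit_leb \<psi> \<and> forgets \<psi>"
proof -
 define M where "M = \<bar>\<psi> 1\<bar> + C + C / a + 1"
 have bnd: "\<bar>\<psi> x\<bar> <= \<bar>\<psi> 1\<bar> + C" if "0 < x" "x <= 1" for x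
  by (rule holder_le_at_1[OF C _ that]) (fact hol)
 have h: "hcone K \<alpha> a (\<lambda>x. \<psi> x + M)"
  by (rule holder_shift_hcone[OF C hol a_pos]) (auto simp: M_def)
 have Ca: "0 <= C / a" using C a_pos by simp
 have ge1: "1 <= \<psi> x + M" if "0 < x" "x <= 1" for x using bnd[OF that] Ca unfolding M_def by linarith
 have M0: "0 <= M" using C Ca by (simp add: M_def)
 define B where "B = 2 * M"
 have le: "\<psi> x + M <= B" if "0 < x" "x <= 1" for x
  using abs_le_D1[OF bnd[OF that]] Ca C by (simp add: M_def B_def)
 have B: "1 <= B" using ge1[of 1] le[of 1] by simp
 have domB: "dominated B (\<lambda>_. 1)" by (rule dominated_const_1[OF B])
 have pw: "1 <= x powr - s" if "0 < x" "x <= 1" for x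
  using powr_mono'[of "-s" 0 x] that s_bounds by simp
 have dom: "dominated B (\<lambda>x. \<psi> x + M)"
  unfolding dominated_def using le pw B by (auto intro: order_trans[OF le] mult_left_mono[of 1 _ B, simplified])
 have pc: "pcone (\<lambda>x. \<psi> x + M)" by (rule dominated_integrable[OF h dom])
 have \<psi>: "integrable unit_leb \<psi>"
  using Bochner_Integration.integrable_diff[OF cone_integrable[OF pc] integrable_unit_const[of M]] by simp
 define m where "m = (LEB x. \<psi> x + M)"
 have "(LEB x. 1) <= m"
  unfolding m_def using ge1 by (intro integral_mono integrable_unit_const cone_integrable[OF pc]) auto
 then have m: "1 <= m" by (simp add: unit_mass)
 define u where "u = (\<lambda>x. 1 / m * (\<psi> x + M))"
 have pu: "pcone u"
  using hcone_cmult[OF h, of "1 / m"] cone_integrable[OF pc] m by (auto simp: pcone_def u_def)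
 have du: "dominated B u"
  unfolding dominated_def
 proof (intro allI impI, elim conjE)
  fix x :: real assume x: "0 < x" "x <= 1"
  have "u x <= 1 * (\<psi> x + M)" unfolding u_def using m ge1[OF x] by (intro mult_right_mono) auto
  then show "u x <= B * x powr - s" using dom x by (auto simp: dominated_def)
 qed
 have mu: "(LEB x. u x) = 1" using m by (simp add: u_def m_def)
 obtain R where R: "!!u v n G. pcone u ==> pcone v ==> dominated B u ==> dominated B v ==>
   (LEB x. u x) = 1 ==> (LEB x. v x) = 1 ==> 1 <= n ==>
   G \<in> borel_measurable unit_leb ==> (\<forall>x\<in>{0<..1}. \<bar>G x\<bar> <= 1) ==>
   \<bar>(LEB x. u x * G ((f ^^ n) x)) - (LEB x. v x * G ((f ^^ n) x))\<bar>
    <= R * real n powr - ((1 - s) / s)"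
  using coupling_rate[of B] by blast
 have fu: "forgets u"
  unfolding forgets_def
 proof (intro allI impI)
  fix e :: real assume e: "0 < e"
  have "(\<lambda>n. R * real n powr - ((1 - s) / s)) \<longlonglongrightarrow> R * 0"
   using s_bounds by (intro tendsto_intros tendsto_neg_powr filterlim_real_sequentially) auto
  then have "eventually (\<lambda>n. R * real n powr - ((1 - s) / s) < e) sequentially"
   using e by (intro order_tendstoD(2)[of _ "R * 0"]) auto
  then obtain n0 where n0: "!!n. n >= n0 ==> R * real n powr - ((1 - s) / s) < e"
   by (auto simp: eventually_sequentially)
  show "\<exists>n0. \<forall>n\<ge>n0. \<forall>G. test_fun G -->
   memory u n G <= e"
  proof (intro exI[of _ "max 1 n0"] allI impI)
   fix n G assume n: "max 1 n0 <= n" and G: "test_fun G"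
   have "\<bar>(LEB x. u x * G ((f ^^ n) x)) - (LEB x. 1 * G ((f ^^ n) x))\<bar>
     <= R * real n powr - ((1 - s) / s)"
    using n G pu du mu domB by (intro R) (auto simp: test_fun_def unit_mass intro!: pcone_const)
   then show "memory u n G <= e"
    using n0[of n] n by (simp add: mu)
  qed
 qed
 have "forgets (\<lambda>x. m * u x + (- M))"
  using forgets_add[OF _ _ forgets_cmult[OF fu, of m] forgets_const[of "- M"]] cone_integrable[OF pu] integrable_unit_const
  by auto
 moreover have "(\<lambda>x. m * u x + (- M)) = \<psi>" using m by (auto simp: u_def)
 ultimately show ?thesis using \<psi> by simp
qed

lemma forgets_atMost: "forgets (indicator {..t})"
proof (rule forgets_close)
 show "integrable unit_leb (indicat_real {..t})"
  using integrable_cone_indicator[OF pcone_const[of 1], of "{..t}"] by simp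
 fix e :: real assume e: "0 < e"
 obtain k where k: "1 / real (Suc k) < e" using nat_approx_posE[OF e] by blast
 define r where "r = real (Suc k)"
 have r: "0 < r" "1 / r < e" using k by (auto simp: r_def)
 define \<psi> where "\<psi> x = max 0 (min 1 (1 - r * (x - t)))" for x
 have lip: "\<bar>\<psi> x - \<psi> y\<bar> <= r * \<bar>x - y\<bar>" for x y
 proof -
  have "\<bar>\<psi> x - \<psi> y\<bar> <= \<bar>(1 - r * (x - t)) - (1 - r * (y - t))\<bar>" by (auto simp: \<psi>_def)
  also have "... = \<bar>r * (y - x)\<bar>" by (simp add: algebra_simps)
  finally show ?thesis using r by (simp add: abs_mult abs_minus_commute)
 qed
 have "integrable unit_leb \<psi> \<and> forgets \<psi>"
 proof (rule forgets_holder)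
  show "0 <= r" using r by simp
  fix x y :: real assume xy: "0 < x" "x <= 1" "0 < y" "y <= 1"
  have "\<bar>x - y\<bar> powr 1 <= \<bar>x - y\<bar> powr \<alpha>" using xy \<alpha> by (intro powr_mono') auto
  then show "\<bar>\<psi> x - \<psi> y\<bar> <= r * \<bar>x - y\<bar> powr \<alpha>"
   using lip[of x y] r by (auto intro: order_trans mult_left_mono)
 qed
 moreover have "(LEB x. \<bar>indicator {..t} x - \<psi> x\<bar>) <= e"
 proof -
  have "(LEB x. \<bar>indicator {..t} x - \<psi> x\<bar>) <= (LEB x. indicator {t<..t + 1/r} x)"
  proof (rule integral_mono)
   show "integrable unit_leb (\<lambda>x. \<bar>indicator {..t} x - \<psi> x\<bar>)"
    using integrable_cone_indicator[OF pcone_const[of 1], of "{..t}"] calculation by auto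
   show "integrable unit_leb (indicat_real {t<..t + 1/r})"
    using integrable_cone_indicator[OF pcone_const[of 1], of "{t<..t + 1/r}"] by simp
   fix x :: real
   consider "x <= t" | "t < x" "x <= t + 1/r" | "t + 1/r < x" by linarith
   then show "\<bar>indicator {..t} x - \<psi> x\<bar> <= indicator {t<..t + 1/r} x"
   proof cases
    case 1
    then have "r * (x - t) <= 0" using r by (simp add: mult_le_0_iff)
    then show ?thesis using 1 by (simp add: \<psi>_def)
   next
    case 3
    then have "1 < r * (x - t)" using r by (simp add: field_simps)
    moreover have "t < x" using 3 r by (auto intro: less_trans[of t "t + 1/r"])
    ultimately show ?thesis using 3 by (simp add: \<psi>_def)
   qed (auto simp: \<psi>_def)
  qed
  also have "... = measure lborel ({0<..1} \<inter> {t<..t + 1/r})"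
   by (subst integral_restrict_space) (auto simp: indicator_inter_arith[symmetric])
  also have "... <= measure lborel {t<..t + 1/r}"
   using r by (intro measure_mono_fmeasurable) (auto simp: fmeasurable_def)
  also have "... = 1 / r" using r by simp
  finally show ?thesis using r by simp
 qed
 ultimately show "\<exists>\<psi>'. integrable unit_leb \<psi>' \<and> forgets \<psi>' \<and> (LEB x. \<bar>indicat_real {..t} x - \<psi>' x\<bar>) <= e"
  by blast
qed

lemma integrable_unit_indicator: "A \<in> sets borel ==> integrable unit_leb (indicat_real A)"
 using integrable_cone_indicator[OF pcone_const[of 1], of A] by simp

lemma forgets_borel:
 assumes "A \<in> sets borel" shows "forgets (indicat_real A)"
proof -
 have A: "A \<in> sigma_sets UNIV (range atMost)"
  using assms by (simp add: borel_eq_atMost)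
 have gen: "Int_stable (range (atMost :: real => real set))" "range (atMost :: real => real set) \<subseteq> Pow UNIV"
  by (auto simp: Int_stable_def)
 from gen A show ?thesis
 proof (induction rule: sigma_sets_induct_disjoint)
  case (basic A) then show ?case using forgets_atMost by auto
 next
  case empty show ?case using forgets_const[of 0] by simp
 next
  case (compl A)
  then have "A \<in> sets borel" by (simp add: borel_eq_atMost)
  then have "forgets (\<lambda>x. 1 + (-1) * indicat_real A x)"
   using compl(2) by (intro forgets_add forgets_const forgets_cmult integrable_unit_const integrable_mult_right integrable_unit_indicator) auto
  moreover have "(\<lambda>x. 1 + (-1) * indicat_real A x) = indicat_real (UNIV - A)" by (auto simp: indicator_def)
  ultimately show ?case by simp
 next
  case (union A)
  then have A: "A i \<in> sets borel" for i by (auto simp: borel_eq_atMost)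
  have part: "forgets (\<lambda>x. \<Sum>i<n. indicat_real (A i) x) \<and> integrable unit_leb (\<lambda>x. \<Sum>i<n. indicat_real (A i) x)" for n
  proof (induction n)
   case 0 then show ?case using forgets_const[of 0] by simp
  next
   case (Suc n) then show ?case using union(3) A by (auto intro!: forgets_add integrable_unit_indicator)
  qed
  have sums: "(\<lambda>n. \<Sum>i<n. indicat_real (A i) x) \<longlonglongrightarrow> indicat_real (\<Union>i. A i) x" for x
   using indicator_sums[of A x] union(1) by (auto simp: sums_def disjoint_family_on_def)
  have bnd: "\<bar>\<Sum>i<n. indicat_real (A i) x\<bar> <= 1" for n x
  proof -
   have "(\<Sum>i<n. indicat_real (A i) x) = indicat_real (\<Union>i<n. A i) x"
    using union(1) by (intro indicator_UN_disjoint[symmetric]) (auto simp: disjoint_family_on_def)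
   then show ?thesis by (auto simp: indicator_def)
  qed
  show ?case
  proof (rule forgets_close)
   show i: "integrable unit_leb (indicat_real (\<Union>i. A i))"
    using A by (intro integrable_unit_indicator) auto
   have "(\<lambda>n. LEB x. \<bar>indicat_real (\<Union>i. A i) x - (\<Sum>i<n. indicat_real (A i) x)\<bar>) \<longlonglongrightarrow> (LEB x. 0)"
   proof (rule integral_dominated_convergence[where w = "\<lambda>_. 2"])
    show "AE x in unit_leb. (\<lambda>n. \<bar>indicat_real (\<Union>i. A i) x - (\<Sum>i<n. indicat_real (A i) x)\<bar>) \<longlonglongrightarrow> 0"
    proof (rule AE_I2)
     fix x :: real
     have "(\<lambda>n. \<bar>indicat_real (\<Union>i. A i) x - (\<Sum>i<n. indicat_real (A i) x)\<bar>) \<longlonglongrightarrow>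
       \<bar>indicat_real (\<Union>i. A i) x - indicat_real (\<Union>i. A i) x\<bar>"
      by (intro tendsto_rabs tendsto_diff tendsto_const sums)
     then show "(\<lambda>n. \<bar>indicat_real (\<Union>i. A i) x - (\<Sum>i<n. indicat_real (A i) x)\<bar>) \<longlonglongrightarrow> 0"
      by simp
    qed
    show "AE x in unit_leb. norm (\<bar>indicat_real (\<Union>i. A i) x - (\<Sum>i<n. indicat_real (A i) x)\<bar>) <= 2" for n
    proof (rule AE_I2)
     fix x
     have "\<bar>indicat_real (\<Union>i. A i) x\<bar> <= 1" by (simp add: indicator_def)
     then show "norm (\<bar>indicat_real (\<Union>i. A i) x - (\<Sum>i<n. indicat_real (A i) x)\<bar>) <= 2"
      using bnd[where n = n and x = x] unfolding real_norm_def by linarith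
    qed
   qed (use i part integrable_unit_const in \<open>auto intro!: borel_measurable_abs borel_measurable_diff\<close>)
   then have lim: "(\<lambda>n. LEB x. \<bar>indicat_real (\<Union>i. A i) x - (\<Sum>i<n. indicat_real (A i) x)\<bar>) \<longlonglongrightarrow> 0"
    by simp
   fix e :: real assume "0 < e"
   then obtain n where "(LEB x. \<bar>indicat_real (\<Union>i. A i) x - (\<Sum>i<n. indicat_real (A i) x)\<bar>) < e"
    using order_tendstoD(2)[OF lim] by (auto simp: eventually_sequentially)
   then show "\<exists>\<psi>'. integrable unit_leb \<psi>' \<and> forgets \<psi>' \<and> (LEB x. \<bar>indicat_real (\<Union>i. A i) x - \<psi>' x\<bar>) <= e"
    using part by (intro exI[of _ "\<lambda>x. \<Sum>i<n. indicat_real (A i) x"]) auto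
  qed
 qed
qed

text \<open>The property is closed in \<open>L\<^sup>1\<close>, and Hoelder functions have it by \<open>coupling_rate\<close>.\<close>
lemma forgets_integrable:
 assumes "integrable unit_leb \<psi>" shows "forgets \<psi>"
 using assms
proof (induction rule: integrable_induct)
 case (base A c)
 then have "A \<in> sets borel" by (auto simp: sets_unit_leb_iff)
 then show ?case using forgets_cmult[OF forgets_borel, of A c] by (simp add: mult.commute)
next
 case (add f g) then show ?case by (intro forgets_add)
next
 case (lim h t)
 show ?case
 proof (rule forgets_close[OF lim(4)])
  fix e :: real assume e: "0 < e"
  have [measurable]: "h \<in> borel_measurable unit_leb" "!!n. t n \<in> borel_measurable unit_leb"
   using lim(1,4) by auto
  have "(\<lambda>n. LEB x. \<bar>h x - t n x\<bar>) \<longlonglongrightarrow> (LEB x. 0)"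
  proof (rule integral_dominated_convergence[where w = "\<lambda>x. 3 * \<bar>h x\<bar>"])
   show "AE x in unit_leb. (\<lambda>n. \<bar>h x - t n x\<bar>) \<longlonglongrightarrow> 0"
   proof (rule AE_I2)
    fix x assume "x \<in> space unit_leb"
    from tendsto_rabs[OF tendsto_diff[OF tendsto_const lim(2)[OF this]], of "h x"]
    show "(\<lambda>n. \<bar>h x - t n x\<bar>) \<longlonglongrightarrow> 0" by simp
   qed
   show "AE x in unit_leb. norm \<bar>h x - t n x\<bar> <= 3 * \<bar>h x\<bar>" for n
   proof (rule AE_I2)
    fix x assume "x \<in> space unit_leb"
    from lim(3)[OF this, of n] show "norm \<bar>h x - t n x\<bar> <= 3 * \<bar>h x\<bar>" by simp
   qed
   show "integrable unit_leb (\<lambda>x. 3 * \<bar>h x\<bar>)" using lim(4) by simp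
  qed measurable
  then have L: "(\<lambda>n. LEB x. \<bar>h x - t n x\<bar>) \<longlonglongrightarrow> 0" by simp
  obtain n where "(LEB x. \<bar>h x - t n x\<bar>) < e"
   using order_tendstoD(2)[OF L e] by (auto simp: eventually_sequentially)
  then show "\<exists>\<psi>'. integrable unit_leb \<psi>' \<and> forgets \<psi>' \<and> (LEB x. \<bar>h x - \<psi>' x\<bar>) <= e"
   using lim(1,5) by (intro exI[of _ "t n"]) auto
 qed
qed

lemma test_fun_mult: "test_fun G ==> test_fun H ==> test_fun (\<lambda>x. G x * H x)"
 unfolding test_fun_def by (auto simp: abs_mult intro: mult_le_one)

context
 fixes h :: "real => real"
 assumes h_int: "integrable unit_leb h" and h_mass: "(LEB x. h x) = 1"
  and h_inv: "!!G. test_fun G ==> (LEB x. h x * G (f x)) = (LEB x. h x * G x)"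
begin

lemma h_inv_pow: "test_fun G ==> (LEB x. h x * G ((f ^^ n) x)) = (LEB x. h x * G x)"
proof (induction n)
 case (Suc n)
 then show ?case using h_inv[OF test_fun_pow[OF Suc.prems, of n]] by (simp add: funpow_swap1)
qed simp

text \<open>\<open>forgets\<close> applied to the invariant density itself.\<close>
lemma lebesgue_converges:
 assumes G: "test_fun G"
 shows "(\<lambda>n. LEB x. G ((f ^^ n) x)) \<longlonglongrightarrow> (LEB x. h x * G x)"
proof (rule LIMSEQ_I)
 fix e :: real assume e: "0 < e"
 obtain n0 where n0: "!!n G. n >= n0 ==> test_fun G ==>
   memory h n G <= e / 2"
  using forgetsD[OF forgets_integrable[OF h_int], of "e / 2"] e by auto
 show "\<exists>no. \<forall>n\<ge>no. norm ((LEB x. G ((f ^^ n) x)) - (LEB x. h x * G x)) < e"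
 proof (intro exI[of _ n0] allI impI)
  fix n assume "n0 <= n"
  from n0[OF this G] show "norm ((LEB x. G ((f ^^ n) x)) - (LEB x. h x * G x)) < e"
   using e by (simp add: h_mass h_inv_pow[OF G] abs_minus_commute)
 qed
qed

lemma invariant_mixing:
 assumes \<psi>: "test_fun \<psi>" and e: "0 < e"
 shows "\<exists>n0. \<forall>n\<ge>n0. \<forall>G. test_fun G -->
   \<bar>(LEB x. h x * (\<psi> x * G ((f ^^ n) x))) - (LEB x. h x * \<psi> x) * (LEB x. h x * G x)\<bar> <= e"
proof -
 define \<kappa> where "\<kappa> = (LEB x. h x * \<psi> x)"
 have i: "integrable unit_leb (\<lambda>x. h x * \<psi> x - \<kappa> * h x)"
  using test_fun_integral(1)[OF h_int \<psi>] h_int by auto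
 obtain n0 where n0: "!!n G. n >= n0 ==> test_fun G ==>
   memory (\<lambda>x. h x * \<psi> x - \<kappa> * h x) n G <= e"
  using forgetsD[OF forgets_integrable[OF i], of e] e by auto
 have zero: "(LEB x. h x * \<psi> x - \<kappa> * h x) = 0"
  using test_fun_integral(1)[OF h_int \<psi>] h_int h_mass by (simp add: \<kappa>_def)
 show ?thesis
 proof (intro exI[of _ n0] allI impI)
  fix n G assume n: "n0 <= n" and G: "test_fun G"
  note Gn = test_fun_pow[OF G, of n]
  have "(LEB x. (h x * \<psi> x - \<kappa> * h x) * G ((f ^^ n) x)) =
    (LEB x. h x * (\<psi> x * G ((f ^^ n) x)) - \<kappa> * (h x * G ((f ^^ n) x)))"
   by (simp add: algebra_simps)
  also have "... = (LEB x. h x * (\<psi> x * G ((f ^^ n) x))) - \<kappa> * (LEB x. h x * G ((f ^^ n) x))"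
   using test_fun_integral(1)[OF h_int test_fun_mult[OF \<psi> Gn]] test_fun_integral(1)[OF h_int Gn]
   by simp
  also have "... = (LEB x. h x * (\<psi> x * G ((f ^^ n) x))) - \<kappa> * (LEB x. h x * G x)"
   by (simp add: h_inv_pow[OF G])
  finally show "\<bar>(LEB x. h x * (\<psi> x * G ((f ^^ n) x))) - (LEB x. h x * \<psi> x) * (LEB x. h x * G x)\<bar> <= e"
   using n0[OF n G] unfolding zero by (simp add: \<kappa>_def)
 qed
qed

text \<open>The invariant density \<open>h\<close> is only known to be integrable, so the coupling is run with the images
\<open>P1 m\<close> of the constant density 1, which lie in the cone and are dominated uniformly in \<open>m\<close>:
\<open>(\<psi> + M) * P1 m\<close>, normalised, is compared with \<open>P1 m\<close>. Letting \<open>m\<close> tend to infinity replaces \<open>P1 m\<close>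
by \<open>h\<close>.\<close>
lemma invariant_decay:
 fixes \<psi> :: "real => real"
 assumes qa1: "q + 1 <= a"
  and C: "0 <= C" and hol: "!!x y. 0 < x ==> x <= 1 ==> 0 < y ==> y <= 1 ==> \<bar>\<psi> x - \<psi> y\<bar> <= C * \<bar>x - y\<bar> powr \<alpha>"
  and mean: "(LEB x. h x * \<psi> x) = 0"
 shows "\<exists>R. \<forall>n G. 1 <= n --> test_fun G -->
   \<bar>LEB x. h x * (\<psi> x * G ((f ^^ n) x))\<bar> <= R * real n powr - ((1 - s) / s)"
proof -
 \<comment> \<open>the value demanded by \<open>holder_shift_hcone\<close> for the constant 1, increased so that \<psi> + M is at least 1\<close>
 define M where "M = \<bar>\<psi> 1\<bar> + C + C / 1 + 1"
 have bnd: "\<bar>\<psi> x\<bar> <= \<bar>\<psi> 1\<bar> + C" if "0 < x" "x <= 1" for x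
  by (rule holder_le_at_1[OF C _ that]) (fact hol)
 have hM: "hcone K \<alpha> 1 (\<lambda>x. \<psi> x + M)"
  by (rule holder_shift_hcone[OF C hol]) (auto simp: M_def)
 have ge1: "1 <= \<psi> x + M" if "0 < x" "x <= 1" for x using bnd[OF that] C unfolding M_def by linarith
 have M0: "0 < M" using C by (simp add: M_def)
 define B where "B = 2 * M"
 have le: "\<psi> x + M <= B" if "0 < x" "x <= 1" for x
  using abs_le_D1[OF bnd[OF that]] C by (simp add: M_def B_def)
 have B: "1 <= B" using ge1[of 1] le[of 1] by simp
 obtain A0 where A0: "1 <= A0"
  and dom: "!!A u. A0 <= A ==> pcone u ==> (LEB x. u x) <= 1 ==> dominated A u ==> dominated A (Pop u)"
  using domination by blast
 define P1 where "P1 m = (Pop ^^ m) (\<lambda>_. 1)" for m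
 have P1_dom: "dominated A0 (P1 m)" for m
  unfolding P1_def by (rule Pop_pow_dominated[of A0, OF dom]) (use A0 pcone_const[of 1] dominated_const_1[OF A0] in auto)
 have P1_h: "hcone K \<alpha> q (P1 m)" for m
  unfolding P1_def
 proof (induction m)
  case 0 show ?case using hcone_const[of 1 q] q_pos by simp
 next
  case (Suc m) then show ?case using Pop_hcone[OF _ \<alpha>, of q] by simp
 qed
 have P1_c: "pcone (P1 m)" for m unfolding P1_def by (intro cone_Pop_pow pcone_const) auto
 have P1_m: "(LEB x. P1 m x) = 1" for m unfolding P1_def using Pop_pow_mass[OF pcone_const[of 1]] by simp
 define u where "u m x = (\<psi> x + M) * P1 m x" for m x
 define A where "A = B * A0"
 have A: "A0 <= A" using B A0 mult_right_mono[of 1 B A0] by (simp add: A_def)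
 have u_dom: "dominated A (u m)" for m
  unfolding dominated_def
 proof (intro allI impI, elim conjE)
  fix x :: real assume x: "0 < x" "x <= 1"
  have "u m x <= B * P1 m x"
   unfolding u_def using le[OF x] cone_nonneg[OF P1_c x] by (intro mult_right_mono) auto
  also have "... <= B * (A0 * x powr - s)"
   using P1_dom[of m] x B by (intro mult_left_mono) (auto simp: dominated_def)
  finally show "u m x <= A * x powr - s" by (simp add: A_def)
 qed
 have u_h: "hcone K \<alpha> a (u m)" for m
  unfolding u_def by (rule hcone_mono[OF hcone_mult[OF hM P1_h]]) (use qa1 in simp)
 have u_c: "pcone (u m)" for m by (rule dominated_integrable[OF u_h u_dom])
 define c where "c m = (LEB x. u m x)" for m
 have c1: "1 <= c m" for m
 proof -
  have "(LEB x. P1 m x) <= c m"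
   unfolding c_def
  proof (intro integral_mono cone_integrable P1_c u_c)
   fix x assume "x \<in> space unit_leb"
   then show "P1 m x <= u m x"
    using ge1[of x] cone_nonneg[OF P1_c, of x m] mult_right_mono[of 1 "\<psi> x + M" "P1 m x"] by (auto simp: u_def)
  qed
  then show ?thesis by (simp add: P1_m)
 qed
 obtain R where R: "!!u v n G. pcone u ==> pcone v ==> dominated A u ==> dominated A v ==>
   (LEB x. u x) = 1 ==> (LEB x. v x) = 1 ==> 1 <= n ==>
   G \<in> borel_measurable unit_leb ==> (\<forall>x\<in>{0<..1}. \<bar>G x\<bar> <= 1) ==>
   \<bar>(LEB x. u x * G ((f ^^ n) x)) - (LEB x. v x * G ((f ^^ n) x))\<bar>
    <= R * real n powr - ((1 - s) / s)"
  using coupling_rate[of A] by blast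
 define \<Psi> where "\<Psi> x = (\<psi> x + M) / B" for x
 have \<Psi>: "test_fun \<Psi>"
  unfolding test_fun_def
 proof (intro conjI ballI)
  show "\<Psi> \<in> borel_measurable unit_leb" unfolding \<Psi>_def[abs_def] using hcone_measurable[OF hM \<alpha>(1)] by auto
  fix x :: real assume "x \<in> {0<..1}"
  then show "\<bar>\<Psi> x\<bar> <= 1" using ge1[of x] le[of x] B by (auto simp: \<Psi>_def)
 qed
 show ?thesis
 proof (intro exI[of _ "M * R"] allI impI)
  fix n :: nat and G assume n: "1 <= n" and G: "test_fun G"
  note Gn = test_fun_pow[OF G, of n]
  have step: "\<bar>(LEB x. u m x * G ((f ^^ n) x)) - c m * (LEB x. P1 m x * G ((f ^^ n) x))\<bar>
    <= c m * (R * real n powr - ((1 - s) / s))" for m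
  proof -
   define v where "v = (\<lambda>x. 1 / c m * u m x)"
   have v: "pcone v"
    using hcone_cmult[OF u_h, of "1 / c m" m] c1[of m] cone_integrable[OF u_c, of m] by (auto simp: v_def pcone_def)
   have vd: "dominated A v"
    unfolding dominated_def
   proof (intro allI impI, elim conjE)
    fix x :: real assume x: "0 < x" "x <= 1"
    have "v x <= 1 * u m x" unfolding v_def using c1[of m] cone_nonneg[OF u_c x] by (intro mult_right_mono) auto
    then show "v x <= A * x powr - s" using u_dom[of m] x by (auto simp: dominated_def)
   qed
   have Pd: "dominated A (P1 m)"
    unfolding dominated_def
   proof (intro allI impI, elim conjE)
    fix x :: real assume x: "0 < x" "x <= 1"
    then have "P1 m x <= A0 * x powr - s" using P1_dom[of m] by (auto simp: dominated_def)
    also have "... <= A * x powr - s" using A by (intro mult_right_mono) auto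
    finally show "P1 m x <= A * x powr - s" .
   qed
   have vm: "(LEB x. v x) = 1" using c1[of m] by (simp add: v_def c_def)
   have "\<bar>(LEB x. v x * G ((f ^^ n) x)) - (LEB x. P1 m x * G ((f ^^ n) x))\<bar> <= R * real n powr - ((1 - s) / s)"
    using G by (intro R v P1_c vd Pd vm P1_m n) (auto simp: test_fun_def)
   then have "c m * \<bar>(LEB x. v x * G ((f ^^ n) x)) - (LEB x. P1 m x * G ((f ^^ n) x))\<bar> <= c m * (R * real n powr - ((1 - s) / s))"
    using c1[of m] by (intro mult_left_mono) auto
   moreover have "c m * \<bar>(LEB x. v x * G ((f ^^ n) x)) - (LEB x. P1 m x * G ((f ^^ n) x))\<bar>
    = \<bar>c m * (LEB x. v x * G ((f ^^ n) x)) - c m * (LEB x. P1 m x * G ((f ^^ n) x))\<bar>"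
    using c1[of m] by (simp add: right_diff_distrib[symmetric] abs_mult)
   moreover have "c m * (LEB x. v x * G ((f ^^ n) x)) = (LEB x. u m x * G ((f ^^ n) x))"
    using c1[of m] by (simp add: v_def mult.assoc)
   ultimately show ?thesis by simp
  qed
  have P1_test: "(LEB x. P1 m x * H x) = (LEB x. H ((f ^^ m) x))" if "test_fun H" for m H
   unfolding P1_def using Pop_pow_integral[OF pcone_const[of 1], of H m] that by (auto simp: test_fun_def)
  have u_eq: "(LEB x. u m x * H x) = B * (LEB x. \<Psi> ((f ^^ m) x) * H ((f ^^ m) x))" if H: "test_fun H" for m H
  proof -
   have "(LEB x. u m x * H x) = (LEB x. B * (P1 m x * (\<Psi> x * H x)))"
    using B by (intro Bochner_Integration.integral_cong) (auto simp: u_def \<Psi>_def field_simps)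
   then show ?thesis using P1_test[OF test_fun_mult[OF \<Psi> H]] by simp
  qed
  have one: "test_fun (\<lambda>_. 1)" by (auto simp: test_fun_def)
  have hM_eq: "B * (LEB x. h x * (\<Psi> x * H x)) = (LEB x. h x * (\<psi> x * H x)) + M * (LEB x. h x * H x)"
   if H: "test_fun H" for H
  proof -
   have i1: "integrable unit_leb (\<lambda>x. h x * (\<Psi> x * H x))" using test_fun_integral(1)[OF h_int test_fun_mult[OF \<Psi> H]] .
   have i2: "integrable unit_leb (\<lambda>x. h x * H x)" using test_fun_integral(1)[OF h_int H] .
   have "(LEB x. h x * (\<psi> x * H x)) = (LEB x. B * (h x * (\<Psi> x * H x)) - M * (h x * H x))"
    using B by (intro Bochner_Integration.integral_cong) (auto simp: \<Psi>_def field_simps)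
   then show ?thesis using i1 i2 by simp
  qed
  have lim1: "(\<lambda>m. LEB x. u m x * G ((f ^^ n) x)) \<longlonglongrightarrow> B * (LEB x. h x * (\<Psi> x * G ((f ^^ n) x)))"
   unfolding u_eq[OF Gn] by (intro tendsto_mult tendsto_const lebesgue_converges test_fun_mult \<Psi> Gn)
  have lim2: "c \<longlonglongrightarrow> M"
  proof -
   have "(\<lambda>m. LEB x. u m x * 1) \<longlonglongrightarrow> B * (LEB x. h x * (\<Psi> x * 1))"
    unfolding u_eq[OF one] by (intro tendsto_mult tendsto_const lebesgue_converges test_fun_mult \<Psi> one)
   also have "B * (LEB x. h x * (\<Psi> x * 1)) = M" unfolding hM_eq[OF one] using mean h_mass by simp
   finally show ?thesis by (simp add: c_def[abs_def])
  qed
  have lim3: "(\<lambda>m. LEB x. P1 m x * G ((f ^^ n) x)) \<longlonglongrightarrow> (LEB x. h x * G ((f ^^ n) x))"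
   unfolding P1_test[OF Gn] by (rule lebesgue_converges[OF Gn])
  have "\<bar>B * (LEB x. h x * (\<Psi> x * G ((f ^^ n) x))) - M * (LEB x. h x * G ((f ^^ n) x))\<bar> <= M * (R * real n powr - ((1 - s) / s))"
  proof (rule LIMSEQ_le)
   show "(\<lambda>m. \<bar>(LEB x. u m x * G ((f ^^ n) x)) - c m * (LEB x. P1 m x * G ((f ^^ n) x))\<bar>) \<longlonglongrightarrow>
    \<bar>B * (LEB x. h x * (\<Psi> x * G ((f ^^ n) x))) - M * (LEB x. h x * G ((f ^^ n) x))\<bar>"
    by (intro tendsto_intros lim1 lim2 lim3)
   show "(\<lambda>m. c m * (R * real n powr - ((1 - s) / s))) \<longlonglongrightarrow> M * (R * real n powr - ((1 - s) / s))"
    by (intro tendsto_intros lim2)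
  qed (use step in auto)
  then show "\<bar>LEB x. h x * (\<psi> x * G ((f ^^ n) x))\<bar> <= M * R * real n powr - ((1 - s) / s)"
   unfolding hM_eq[OF Gn] by simp
 qed
qed

end

end

section \<open>Holland maps near the fixed point\<close>

text \<open>Write \<open>F x = x * (1 + w x)\<close>. Near 0, the conditions on the derivatives of \<open>\<rho>\<close> make the gain of \<open>F\<close> in
the chart and its distortion both of the order \<open>w x / x\<close> per unit length, and \<open>w\<close> dominates
\<open>x powr s\<close> because \<open>\<rho>\<close> varies slowly and \<open>s > \<gamma>\<close>. Away from 0 compactness is enough, with \<open>K\<close> large.\<close>
lemma holland_intermittent_map:
 assumes H: "holland_map \<gamma> \<rho> f" and s: "\<gamma> < s" "s < 1"
 shows "\<exists>F D K q c b c1. intermittent_map f F D K q s c b c1"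
proof -
 have \<gamma>: "0 < \<gamma>" "\<gamma> < 1" using H s by (auto simp: holland_map_def)
 have f_left: "f x = x * (1 + x powr \<gamma> * \<rho> x)" if "0 < x" "x <= 1/2" for x
  using H that by (auto simp: holland_map_def)
 have f_right: "f x = 2 * x - 1" if "1/2 < x" "x <= 1" for x
  using H that by (auto simp: holland_map_def)
 have \<rho>_pos: "0 < \<rho> x" if "0 < x" "x < 1" for x using H that by (auto simp: holland_map_def)
 have C2: "C2_on_unit_interval \<rho>" using H by (auto simp: holland_map_def)
 have \<rho>1: "(\<rho> has_real_derivative deriv \<rho> x) (at x)" and \<rho>2: "(deriv \<rho> has_real_derivative deriv (deriv \<rho>) x) (at x)"
  if "0 < x" "x < 1" for x
  using C2 that by (auto simp: C2_on_unit_interval_def DERIV_deriv_iff_real_differentiable)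
 have \<rho>2_cont: "continuous_on {0<..<1} (deriv (deriv \<rho>))" using C2 by (auto simp: C2_on_unit_interval_def)
 have small1: "(\<lambda>x. x * deriv \<rho> x) \<in> o[at_right 0](\<rho>)" and small2: "(\<lambda>x. x\<^sup>2 * deriv (deriv \<rho>) x) \<in> o[at_right 0](\<rho>)"
  and \<rho>_lim: "(\<rho> \<longlongrightarrow> 0) (at_right 0)" and f_half: "f (1/2) = 1"
  using H by (auto simp: holland_map_def)
 define F where "F x = x * (1 + x powr \<gamma> * \<rho> x)" for x
 define D where "D x = 1 + (1 + \<gamma>) * (x powr \<gamma> * \<rho> x) + x powr \<gamma> * (x * deriv \<rho> x)" for x
 define D2 where "D2 x = x powr \<gamma> / x * (\<gamma> * (1 + \<gamma>) * \<rho> x + 2 * (1 + \<gamma>) * (x * deriv \<rho> x) + x\<^sup>2 * deriv (deriv \<rho>) x)" for x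
 have F_deriv: "(F has_real_derivative D x) (at x)" if "0 < x" "x < 1" for x
 proof -
  have "(F has_real_derivative 1 * (1 + x powr \<gamma> * \<rho> x) + x * (\<gamma> * x powr (\<gamma> - 1) * \<rho> x + x powr \<gamma> * deriv \<rho> x)) (at x)"
   unfolding F_def[abs_def] using that
   by (auto intro!: derivative_eq_intros \<rho>1)
  also have "x powr (\<gamma> - 1) = x powr \<gamma> / x" using that by (simp add: powr_diff)
  also have "1 * (1 + x powr \<gamma> * \<rho> x) + x * (\<gamma> * (x powr \<gamma> / x) * \<rho> x + x powr \<gamma> * deriv \<rho> x) = D x"
   using that by (simp add: D_def field_simps)
  finally show ?thesis .
 qed
 have D_deriv: "(D has_real_derivative D2 x) (at x)" if "0 < x" "x < 1" for x
 proof -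
  have "(D has_real_derivative (1 + \<gamma>) * (\<gamma> * x powr (\<gamma> - 1) * \<rho> x + x powr \<gamma> * deriv \<rho> x)
    + (\<gamma> * x powr (\<gamma> - 1) * (x * deriv \<rho> x) + x powr \<gamma> * (deriv \<rho> x + x * deriv (deriv \<rho>) x))) (at x)"
   unfolding D_def[abs_def] using that
   by (auto intro!: derivative_eq_intros \<rho>1 \<rho>2) (simp add: algebra_simps)
  also have "x powr (\<gamma> - 1) = x powr \<gamma> / x" using that by (simp add: powr_diff)
  also have "(1 + \<gamma>) * (\<gamma> * (x powr \<gamma> / x) * \<rho> x + x powr \<gamma> * deriv \<rho> x)
    + (\<gamma> * (x powr \<gamma> / x) * (x * deriv \<rho> x) + x powr \<gamma> * (deriv \<rho> x + x * deriv (deriv \<rho>) x)) = D2 x"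
   using that by (simp add: D2_def field_simps power2_eq_square)
  finally show ?thesis .
 qed
 have D_cont: "continuous_on {0<..<1} D"
  by (intro continuous_at_imp_continuous_on ballI DERIV_isCont[OF D_deriv]) auto
 have D_gt: "1 < D x" if x: "0 < x" "x < 1/2" for x
 proof -
  have "x \<in> {0..1} - {0, 1/2}" using x by auto
  then obtain d where d: "1 < d" "(f has_real_derivative d) (at x within {0..1})"
   using H unfolding holland_map_def by blast
  have "at x within {0..1} = at x" using x by (intro at_within_interior) auto
  then have "(f has_real_derivative d) (at x)" using d by simp
  moreover have "eventually (\<lambda>y. f y = F y) (nhds x)"
   using eventually_nhds_in_open[of "{0<..<1/2}" x] x by (auto elim!: eventually_mono simp: F_def f_left)
  ultimately have "(F has_real_derivative d) (at x)"
   by (subst (asm) DERIV_cong_ev) auto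
  then have "d = D x" using F_deriv[of x] x by (intro DERIV_unique) auto
  then show ?thesis using d by simp
 qed
 have D_ge: "1 <= D x" if x: "0 < x" "x <= 1/2" for x
 proof (cases "x = 1/2")
  case True
  have "(D \<longlongrightarrow> D (1/2)) (at_left (1/2))"
   using DERIV_isCont[OF D_deriv, of "1/2"] by (simp add: isCont_def filterlim_at_split)
  moreover have "eventually (\<lambda>x::real. x \<in> {0<..<1/2}) (at_left (1/2))"
   by (rule eventually_at_left_real) simp
  then have "eventually (\<lambda>x. 1 <= D x) (at_left (1/2))"
   by eventually_elim (simp only: less_imp_le[OF D_gt] greaterThanLessThan_iff)
  ultimately show ?thesis unfolding True by (intro tendsto_lowerbound) auto
 qed (use D_gt[of x] x in auto)
 \<comment> \<open>the bound s - \<gamma> serves the comparison of w with a power, the bound \<gamma> / 2 keeps D - 1 of the order of w\<close>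
 define e0 where "e0 = min (\<gamma> / 2) (s - \<gamma>)"
 have e0: "0 < e0" "e0 <= \<gamma> / 2" "e0 <= s - \<gamma>" using \<gamma> s by (auto simp: e0_def min_def)
 have ev1: "eventually (\<lambda>x. \<bar>x * deriv \<rho> x\<bar> <= e0 * \<bar>\<rho> x\<bar>) (at_right 0)"
  using landau_o.smallD[OF small1 e0(1)] by simp
 have ev2: "eventually (\<lambda>x. \<bar>x\<^sup>2 * deriv (deriv \<rho>) x\<bar> <= 1 * \<bar>\<rho> x\<bar>) (at_right 0)"
  using landau_o.smallD[OF small2, of 1] by simp
 have ev3: "eventually (\<lambda>x. \<rho> x < (1 - s) / 2) (at_right 0)"
  using \<rho>_lim s by (intro order_tendstoD) auto
 have ev4: "eventually (\<lambda>x. 0 < x \<and> x < (1/2::real)) (at_right 0)"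
  by (auto simp: eventually_at_right_field intro!: exI[of _ "1/2"])
 have "eventually (\<lambda>x. \<bar>x * deriv \<rho> x\<bar> <= e0 * \<bar>\<rho> x\<bar> \<and> \<bar>x\<^sup>2 * deriv (deriv \<rho>) x\<bar> <= \<bar>\<rho> x\<bar> \<and> \<rho> x < (1 - s) / 2 \<and> 0 < x \<and> x < 1/2) (at_right 0)"
  using ev1 ev2 ev3 ev4 by eventually_elim auto
 then obtain r0 where r0: "0 < r0" "!!x. 0 < x ==> x < r0 ==> \<bar>x * deriv \<rho> x\<bar> <= e0 * \<bar>\<rho> x\<bar> \<and> \<bar>x\<^sup>2 * deriv (deriv \<rho>) x\<bar> <= \<bar>\<rho> x\<bar> \<and> \<rho> x < (1 - s) / 2 \<and> x < 1/2"
  by (auto simp: eventually_at_right_field)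
 define r where "r = r0 / 2"
 have r: "0 < r" "r < 1/2" using r0(1) r0(2)[of r] by (auto simp: r_def)
 define w where "w x = x powr \<gamma> * \<rho> x" for x
 have near: "\<bar>x * deriv \<rho> x\<bar> <= e0 * \<rho> x" "\<bar>x\<^sup>2 * deriv (deriv \<rho>) x\<bar> <= \<rho> x" "w x <= (1 - s) / 2" "0 < w x"
  if x: "0 < x" "x <= r" for x
 proof -
  have x1: "x < r0" "x < 1" using x r by (auto simp: r_def)
  have p: "0 < \<rho> x" using \<rho>_pos x x1 by auto
  show "\<bar>x * deriv \<rho> x\<bar> <= e0 * \<rho> x" "\<bar>x\<^sup>2 * deriv (deriv \<rho>) x\<bar> <= \<rho> x"
   using r0(2)[OF x(1) x1(1)] p by auto
  have "x powr \<gamma> <= 1" using x x1 \<gamma> by (intro powr_le1) auto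
  then have "w x <= 1 * \<rho> x" unfolding w_def using p by (intro mult_right_mono) auto
  then show "w x <= (1 - s) / 2" using r0(2)[OF x(1) x1(1)] by auto
  show "0 < w x" using p x by (simp add: w_def)
 qed
 have w_cont: "continuous_on {0<..<1} w"
 proof -
  have "continuous_on {0<..<1} \<rho>"
   by (intro continuous_at_imp_continuous_on ballI DERIV_isCont[OF \<rho>1]) auto
  then show ?thesis unfolding w_def[abs_def] by (intro continuous_intros) auto
 qed
 have w_pos: "0 < w x" if "0 < x" "x < 1" for x using that \<rho>_pos by (simp add: w_def)
 obtain m0 where m0: "0 < m0" "!!x. r <= x ==> x <= 1/2 ==> m0 <= w x"
 proof -
  have "\<exists>x\<in>{r..1/2}. \<forall>y\<in>{r..1/2}. w x <= w y"
   using r by (intro continuous_attains_inf continuous_on_subset[OF w_cont]) auto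
  then obtain x where x: "x \<in> {r..1/2}" "\<forall>y\<in>{r..1/2}. w x <= w y" by blast
  show ?thesis by (rule that[of "w x"]) (use x r w_pos[of x] in auto)
 qed
 obtain B where B: "!!x. r <= x ==> x <= 1/2 ==> \<bar>D2 x\<bar> <= B"
 proof -
  have "continuous_on {r..1/2} D2"
   unfolding D2_def[abs_def] using r
   by (intro continuous_intros continuous_on_subset[OF \<rho>2_cont]
     continuous_at_imp_continuous_on[of _ \<rho>] continuous_at_imp_continuous_on[of _ "deriv \<rho>"] ballI
     DERIV_isCont[OF \<rho>1] DERIV_isCont[OF \<rho>2]) auto
  then have "bounded (D2 ` {r..1/2})" by (intro compact_imp_bounded compact_continuous_image) auto
  then obtain B where "\<forall>x\<in>{r..1/2}. \<bar>D2 x\<bar> <= B" by (auto simp: bounded_iff)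
  then show ?thesis by (intro that[of B]) (simp del: atLeastatMost_empty_iff)
 qed
 \<comment> \<open>the product \<rho> y * y powr - e0 is decreasing\<close>
 define cr where "cr = \<rho> r * r powr - e0"
 have cr: "0 < cr" using \<rho>_pos[of r] r by (simp add: cr_def)
 have potter: "cr * x powr s <= w x" if x: "0 < x" "x <= r" for x
 proof -
  have "\<rho> r * r powr - e0 <= \<rho> x * x powr - e0"
  proof (rule DERIV_nonpos_imp_nonincreasing[OF x(2)])
   fix y assume y: "x <= y" "y <= r"
   then have y0: "0 < y" "y < 1" using x r by auto
   have "((\<lambda>y. \<rho> y * y powr - e0) has_real_derivative (deriv \<rho> y * y powr - e0 + \<rho> y * (- e0 * y powr (- e0 - 1)))) (at y)"
    using y0 by (auto intro!: derivative_eq_intros \<rho>1)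
   moreover have "deriv \<rho> y * y powr - e0 + \<rho> y * (- e0 * y powr (- e0 - 1)) = y powr (- e0 - 1) * (y * deriv \<rho> y - e0 * \<rho> y)"
   proof -
    have "y powr - e0 = y powr (- e0 - 1) * y" using y0 by (simp add: powr_diff)
    then show ?thesis by (simp add: algebra_simps)
   qed
   moreover have "... <= 0"
    using near(1)[of y] y0 y by (intro mult_nonneg_nonpos) auto
   ultimately show "\<exists>d. ((\<lambda>y. \<rho> y * y powr - e0) has_real_derivative d) (at y) \<and> d <= 0" by auto
  qed
  then have "cr * x powr e0 <= \<rho> x * (x powr - e0 * x powr e0)"
   unfolding cr_def mult.assoc[symmetric] by (intro mult_right_mono) auto
  also have "x powr - e0 * x powr e0 = 1" using x by (simp add: powr_add[symmetric])
  finally have "x powr \<gamma> * (cr * x powr e0) <= x powr \<gamma> * (\<rho> x * 1)" by (intro mult_left_mono) auto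
  then have "cr * x powr (\<gamma> + e0) <= w x" by (simp add: w_def powr_add mult_ac)
  moreover have "x powr s <= x powr (\<gamma> + e0)" using x r e0 by (intro powr_mono') auto
  ultimately show ?thesis using cr by (auto intro: order_trans[OF mult_left_mono])
 qed
 define c where "c = min cr m0"
 have c: "0 < c" using cr m0 by (simp add: c_def)
 have w_lower: "c * x powr s <= w x" if x: "0 < x" "x <= 1/2" for x
 proof (cases "x <= r")
  case True
  have "c * x powr s <= cr * x powr s" by (intro mult_right_mono) (auto simp: c_def)
  then show ?thesis using potter[OF x(1) True] by simp
 next
  case False
  have "c * x powr s <= m0 * 1"
   using x s \<gamma> m0 by (intro mult_mono powr_le1) (auto simp: c_def)
  then show ?thesis using m0(2)[of x] False x by simp
 qed
 have F_w: "F x = x * (1 + w x)" for x by (simp add: F_def w_def)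
 have D_w: "D x = 1 + (1 + \<gamma>) * w x + x powr \<gamma> * (x * deriv \<rho> x)" for x by (simp add: D_def w_def)
 have xd: "\<bar>x powr \<gamma> * (x * deriv \<rho> x)\<bar> <= \<gamma> / 2 * w x" if x: "0 < x" "x <= r" for x
 proof -
  have "\<bar>x powr \<gamma> * (x * deriv \<rho> x)\<bar> = x powr \<gamma> * \<bar>x * deriv \<rho> x\<bar>" by (simp add: abs_mult)
  also have "... <= x powr \<gamma> * (\<gamma> / 2 * \<rho> x)"
   using near(1)[OF x] e0 \<rho>_pos[of x] x r by (intro mult_left_mono order_trans[OF near(1)[OF x]] mult_right_mono) auto
  finally show ?thesis by (simp add: w_def mult_ac)
 qed
 have D_low: "1 + (1 + \<gamma> / 2) * w x <= D x" if x: "0 < x" "x <= r" for x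
  using xd[OF x] unfolding D_w by (simp add: algebra_simps abs_le_iff)
 \<comment> \<open>on {r..1/2} one has F y - y >= r * m0, so the second part of the chart gains at least 1 + 1 / r, of which the logarithm may lose 1 / r\<close>
 define K where "K = (1 + 1 / r) / (r * m0)"
 have K: "0 <= K" using r m0 by (simp add: K_def)
 define q where "q = max (20 / \<gamma>) B"
 have q: "0 < q" "20 / \<gamma> <= q" "B <= q" using \<gamma> by (auto simp: q_def less_max_iff_disj)
 have gain: "\<bar>D2 y / D y\<bar> <= q * ((1 / F y + K * (1 + F y)) * D y - (1 / y + K * (1 + y)))" if y: "0 < y" "y <= 1/2" for y
 proof -
  have D1: "1 <= D y" by (rule D_ge[OF y])
  have wy: "0 < w y" using w_pos y by auto
  have Fy: "y * 1 <= F y" "0 < F y" unfolding F_w using y wy by (auto intro!: mult_left_mono mult_pos_pos)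
  have "\<bar>D2 y\<bar> / D y <= \<bar>D2 y\<bar> / 1" using D1 by (intro divide_left_mono) auto
  then have D2_le: "\<bar>D2 y / D y\<bar> <= \<bar>D2 y\<bar>" using D1 by (simp add: abs_divide)
  have Kp: "K * (F y - y) <= K * ((1 + F y) * D y - (1 + y))"
  proof -
   have "(1 + F y) * 1 <= (1 + F y) * D y" using D1 Fy by (intro mult_left_mono) auto
   then show ?thesis using K by (intro mult_left_mono) auto
  qed
  have Kn: "0 <= K * (F y - y)" using K Fy by auto
  have split: "(1 / F y + K * (1 + F y)) * D y - (1 / y + K * (1 + y)) = (D y / F y - 1 / y) + K * ((1 + F y) * D y - (1 + y))"
   by (simp add: algebra_simps)
  show ?thesis
  proof (cases "y <= r")
   case True
   have w1: "w y <= 1" using near(3)[OF y(1) True] s \<gamma> by auto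
   have "1 / y = (1 + w y) / (y * (1 + w y))" using y wy by simp
   then have "D y / F y - 1 / y = (D y - (1 + w y)) / (y * (1 + w y))"
    by (simp only: F_w diff_divide_distrib)
   moreover have "\<gamma> / 2 * w y / (y * 2) <= (D y - (1 + w y)) / (y * (1 + w y))"
   proof (rule frac_le)
    show "\<gamma> / 2 * w y <= D y - (1 + w y)" using D_low[OF y(1) True] by (simp add: algebra_simps)
    then show "0 <= D y - (1 + w y)" using mult_pos_pos[of "\<gamma> / 2" "w y"] wy \<gamma> by linarith
    show "0 < y * (1 + w y)" using y wy by (intro mult_pos_pos) auto
    show "y * (1 + w y) <= y * 2" using y w1 by (intro mult_left_mono) auto
   qed
   ultimately have g1: "\<gamma> / 4 * (w y / y) <= D y / F y - 1 / y" by (simp add: field_simps)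
   have "\<bar>D2 y\<bar> <= y powr \<gamma> / y * (5 * \<rho> y)"
   proof -
    have p: "0 < \<rho> y" using \<rho>_pos y by auto
    have "\<bar>\<gamma> * (1 + \<gamma>) * \<rho> y + 2 * (1 + \<gamma>) * (y * deriv \<rho> y) + y\<^sup>2 * deriv (deriv \<rho>) y\<bar>
      <= \<gamma> * (1 + \<gamma>) * \<rho> y + 2 * (1 + \<gamma>) * \<bar>y * deriv \<rho> y\<bar> + \<bar>y\<^sup>2 * deriv (deriv \<rho>) y\<bar>"
     using p \<gamma> by (intro order_trans[OF abs_triangle_ineq] add_mono order_trans[OF abs_triangle_ineq]) (auto simp: abs_mult)
    also have "... <= 1 * (1 + 1) * \<rho> y + 2 * (1 + 1) * (1 / 2 * \<rho> y) + \<rho> y"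
    proof (intro add_mono mult_mono)
     show "\<bar>y * deriv \<rho> y\<bar> <= 1 / 2 * \<rho> y"
     proof -
      have "e0 * \<rho> y <= 1 / 2 * \<rho> y" using e0 \<gamma> p by (intro mult_right_mono) auto
      then show ?thesis using near(1)[OF y(1) True] by linarith
     qed
    qed (use near[OF y(1) True] p \<gamma> in auto)
    also have "... = 5 * \<rho> y" by simp
    finally have "y powr \<gamma> / y * \<bar>\<gamma> * (1 + \<gamma>) * \<rho> y + 2 * (1 + \<gamma>) * (y * deriv \<rho> y) + y\<^sup>2 * deriv (deriv \<rho>) y\<bar>
      <= y powr \<gamma> / y * (5 * \<rho> y)"
     using y by (intro mult_left_mono) auto
    then show ?thesis using y by (simp only: D2_def abs_mult abs_divide abs_of_pos powr_ge_zero abs_of_nonneg)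
   qed
   then have "\<bar>D2 y\<bar> <= 20 / \<gamma> * (\<gamma> / 4 * (w y / y))" using \<gamma> by (simp add: w_def mult_ac)
   also have "... <= q * (\<gamma> / 4 * (w y / y))" using q \<gamma> wy y by (intro mult_right_mono) auto
   also have "... <= q * ((D y / F y - 1 / y) + K * ((1 + F y) * D y - (1 + y)))"
    using g1 Kp Kn q by (intro mult_left_mono) auto
   finally show ?thesis unfolding split using D2_le by linarith
  next
   case False
   have "1 / y <= 1 / r" using False r by (intro divide_left_mono) auto
   then have "- (1 / r) <= D y / F y - 1 / y" using D1 Fy by (smt (verit) divide_nonneg_pos)
   moreover have "1 + 1 / r <= K * ((1 + F y) * D y - (1 + y))"
   proof -
    have "r * m0 <= y * w y" using False y m0 r by (intro mult_mono) auto
    then have "K * (r * m0) <= K * (F y - y)" using K by (intro mult_left_mono) (auto simp: F_w algebra_simps)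
    moreover have "K * (r * m0) = 1 + 1 / r" using r m0 by (simp add: K_def)
    ultimately show ?thesis using Kp by simp
   qed
   ultimately have "1 <= (D y / F y - 1 / y) + K * ((1 + F y) * D y - (1 + y))" by simp
   then have "q * 1 <= q * ((D y / F y - 1 / y) + K * ((1 + F y) * D y - (1 + y)))" using q by (intro mult_left_mono) auto
   moreover have "\<bar>D2 y\<bar> <= q" using B[of y] False y q by auto
   ultimately show ?thesis unfolding split using D2_le by linarith
  qed
 qed
 have mono: "q * (chart K (F x) - chart K x) + \<sigma> * ln (D x) <= q * (chart K (F y) - chart K y) + \<sigma> * ln (D y)"
  if xy: "0 < x" "x <= y" "y <= 1/2" and \<sigma>: "\<bar>\<sigma>\<bar> = 1" for x y \<sigma>
 proof (rule DERIV_nonneg_imp_nondecreasing[OF xy(2)])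
  fix z assume "x <= z" "z <= y"
  then have z: "0 < z" "z <= 1/2" using xy by auto
  have Fz: "0 < F z" unfolding F_w using z w_pos[of z] by (auto intro!: mult_pos_pos)
  have Dz: "1 <= D z" by (rule D_ge[OF z])
  let ?d = "q * ((1 / F z + K * (1 + F z)) * D z - (1 / z + K * (1 + z))) + \<sigma> * (D2 z / D z)"
  have cd: "(chart K has_real_derivative (1 / x + K * (1 + x))) (at x)" if "0 < x" for x
   unfolding chart_def[abs_def] using that by (auto intro!: derivative_eq_intros simp: field_simps)
  have "((\<lambda>x. q * (chart K (F x) - chart K x) + \<sigma> * ln (D x)) has_real_derivative ?d) (at z)"
   using z Dz by (auto intro!: derivative_eq_intros DERIV_chain2[OF cd[OF Fz] F_deriv] cd D_deriv)
  moreover have "0 <= ?d"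
  proof -
   have "\<bar>\<sigma> * (D2 z / D z)\<bar> <= q * ((1 / F z + K * (1 + F z)) * D z - (1 / z + K * (1 + z)))"
    using gain[OF z] \<sigma> by (simp add: abs_mult)
   then show ?thesis by linarith
  qed
  ultimately show "\<exists>d. ((\<lambda>x. q * (chart K (F x) - chart K x) + \<sigma> * ln (D x)) has_real_derivative d) (at z) \<and> 0 <= d" by blast
 qed
 have "intermittent_map f F D K q s c r (c * (1 - s) / 2)"
 proof
  have "((\<lambda>x. x * (1 + w x)) \<longlongrightarrow> 0) (at_right 0)"
  proof (rule Lim_null_comparison)
   show "eventually (\<lambda>x. norm (x * (1 + w x)) <= 2 * x) (at_right 0)"
    unfolding eventually_at_right_field
   proof (intro exI[of _ r] conjI allI impI)
    fix y assume y: "0 < y" "y < r"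
    then have "w y <= 1" "0 < w y" using near(3,4)[of y] s \<gamma> by auto
    then show "norm (y * (1 + w y)) <= 2 * y" using y by (simp add: abs_mult)
   qed (use r in auto)
   have "((\<lambda>x::real. 2 * x) \<longlongrightarrow> 2 * 0) (at_right 0)" by (intro tendsto_intros)
   then show "((\<lambda>x::real. 2 * x) \<longlongrightarrow> 0) (at_right 0)" by simp
  qed
  then show "(F \<longlongrightarrow> 0) (at_right 0)" by (simp add: F_w[abs_def])
  show "F (1/2) = 1" using f_half f_left[of "1/2"] by (simp add: F_def)
  show "(F has_real_derivative D x) (at x)" if "0 < x" "x <= 1/2" for x using F_deriv that by auto
  show "continuous_on {0<..1/2} D" by (rule continuous_on_subset[OF D_cont]) auto
  show "1 <= D x" if "0 < x" "x <= 1/2" for x by (rule D_ge[OF that])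
  show "f x = F x" if "0 < x" "x <= 1/2" for x using f_left[OF that] by (simp add: F_def)
  show "f x = 2 * x - 1" if "1/2 < x" "x <= 1" for x by (rule f_right[OF that])
  show "\<bar>ln (D y) - ln (D x)\<bar> <= q * (chart K (F y) - chart K (F x) - (chart K y - chart K x))"
   if "0 < x" "x <= y" "y <= 1/2" for x y
   using mono[OF that, of 1] mono[OF that, of "-1"] by (simp add: algebra_simps abs_le_iff)
  show "x * (1 + c * x powr s) <= F x" if "0 < x" "x <= 1/2" for x
   unfolding F_w using w_lower[OF that] that by (intro mult_left_mono) auto
  show "c * (1 - s) / 2 <= F x powr - s - x powr - s / D x" if x: "0 < x" "x <= r" "x <= 1/2" for x
  proof -
   have wx: "0 < w x" "w x <= (1 - s) / 2" using near[OF x(1,2)] by auto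
   have "1 - s * w x <= 1 - s * ln (1 + w x)"
    using ln_add_one_self_le_self[of "w x"] wx s \<gamma> by (auto intro!: mult_left_mono)
   also have "... <= exp (- s * ln (1 + w x))" using exp_ge_add_one_self[of "- s * ln (1 + w x)"] by simp
   also have "... = (1 + w x) powr - s" using wx by (simp add: powr_def)
   finally have 1: "1 - s * w x <= (1 + w x) powr - s" .
   have "1 / D x <= 1 / (1 + w x)"
   proof (rule divide_left_mono)
    have "1 + 1 * w x <= 1 + (1 + \<gamma> / 2) * w x" using wx \<gamma> by (intro add_left_mono mult_right_mono) auto
    then show "1 + w x <= D x" using D_low[OF x(1,2)] by simp
   qed (use wx D_ge[of x] x in \<open>auto intro!: mult_pos_pos\<close>)
   also have "... <= 1 - w x + w x * w x"
   proof -
    have "1 <= (1 - w x + w x * w x) * (1 + w x)" using wx by (simp add: algebra_simps)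
    then show ?thesis using wx by (simp add: divide_le_eq)
   qed
   finally have 2: "1 / D x <= 1 - w x + w x * w x" .
   have "w x * ((1 - s) / 2) <= w x * (1 - s - w x)" using wx by (intro mult_left_mono) auto
   also have "... <= (1 + w x) powr - s - 1 / D x" using 1 2 by (simp add: algebra_simps)
   finally have 3: "w x * ((1 - s) / 2) <= (1 + w x) powr - s - 1 / D x" .
   have "c * (1 - s) / 2 = x powr - s * (c * x powr s * ((1 - s) / 2))"
   proof -
    have "x powr - s * x powr s = 1" using x by (simp add: powr_add[symmetric])
    then show ?thesis by (simp add: mult.left_commute[of _ c])
   qed
   also have "... <= x powr - s * (w x * ((1 - s) / 2))"
    using w_lower[of x] x s by (intro mult_left_mono mult_right_mono) auto
   also have "... <= x powr - s * ((1 + w x) powr - s - 1 / D x)"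
    using 3 by (intro mult_left_mono) auto
   also have "... = F x powr - s - x powr - s / D x"
    unfolding F_w using x wx by (simp add: powr_mult right_diff_distrib)
   finally show ?thesis .
  qed
 qed (use K q c s \<gamma> r in auto)
 then show ?thesis by blast
qed

section \<open>The invariant measure of a Holland map\<close>

text \<open>Passing to \<open>{0<..1}\<close> loses only the Lebesgue null set \<open>{0}\<close>.\<close>
lemma acip_density:
 assumes ac: "acip f \<mu>"
 obtains h where "integrable unit_leb h"
  "!!G :: real => real. G \<in> borel_measurable \<mu> ==> (\<integral>x. G x \<partial>\<mu>) = (LEB x. h x * G x)"
  "!!G :: real => real. G \<in> borel_measurable \<mu> ==> G \<in> borel_measurable unit_leb"
proof -
 let ?L = "restrict_space lborel {0..1::real}"
 interpret \<mu>: prob_space \<mu> using ac by (simp add: acip_def)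
 interpret L: finite_measure ?L
  by (rule finite_measureI) (simp add: emeasure_restrict_space space_restrict_space)
 have sets: "sets \<mu> = sets ?L"
  using ac by (auto simp: acip_def cong: sets_restrict_space_cong)
 obtain h where h[measurable]: "h \<in> borel_measurable ?L" and RN: "AE x in ?L. RN_deriv ?L \<mu> x = ennreal (h x)"
  and h0: "!!x. 0 <= h x"
  using L.real_RN_deriv[OF \<mu>.finite_measure_axioms _ sets] ac unfolding acip_def by metis
 have "\<mu> = density ?L (RN_deriv ?L \<mu>)"
  using L.density_RN_deriv[OF _ sets] ac by (simp add: acip_def)
 also have "... = density ?L h"
  by (intro density_cong RN) auto
 finally have \<mu>_eq: "\<mu> = density ?L h" .
 have U: "unit_leb = restrict_space ?L {0<..1}"
  by (subst restrict_restrict_space) (auto intro!: arg_cong2[of _ _ _ _ restrict_space])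
 have meas: "G \<in> borel_measurable unit_leb" if "G \<in> borel_measurable \<mu>" for G :: "real => real"
  using that unfolding U measurable_cong_sets[OF sets refl] by (rule measurable_restrict_space1)
 have eq: "(\<integral>x. G x \<partial>\<mu>) = (LEB x. h x * G x)" if G: "G \<in> borel_measurable \<mu>" for G :: "real => real"
 proof -
  have [measurable]: "G \<in> borel_measurable ?L" using G measurable_cong_sets[OF sets refl] by blast
  have m: "(\<lambda>x. indicator {0..1} x *\<^sub>R (h x * G x)) \<in> borel_measurable lborel"
   by (subst borel_measurable_restrict_space_iff[symmetric]) auto
  have m': "(\<lambda>x. indicator {0<..1} x *\<^sub>R (h x * G x)) \<in> borel_measurable lborel"
  proof -
   have "(\<lambda>x. indicator {0<..1} x *\<^sub>R (indicator {0..1} x *\<^sub>R (h x * G x))) \<in> borel_measurable lborel"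
    using m by measurable
   then show ?thesis by (rule measurable_cong[THEN iffD1, rotated]) (auto simp: indicator_def)
  qed
  have "(\<integral>x. G x \<partial>\<mu>) = (\<integral>x. h x * G x \<partial>?L)"
   by (subst \<mu>_eq, subst integral_density) (auto simp: h0)
  also have "... = (\<integral>x. indicator {0..1} x *\<^sub>R (h x * G x) \<partial>lborel)"
   by (subst integral_restrict_space) auto
  also have "... = (\<integral>x. indicator {0<..1} x *\<^sub>R (h x * G x) \<partial>lborel)"
  proof (rule integral_cong_AE[OF m m'])
   show "AE x in lborel. indicat_real {0..1} x *\<^sub>R (h x * G x) = indicat_real {0<..1} x *\<^sub>R (h x * G x)"
    using AE_lborel_singleton[of 0] by eventually_elim (auto simp: indicator_def)
  qed
  also have "... = (LEB x. h x * G x)"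
   by (subst integral_restrict_space) auto
  finally show ?thesis .
 qed
 have "integrable unit_leb h"
 proof -
  have "integrable \<mu> (\<lambda>_. 1::real)" by simp
  then have "integrable ?L h" by (subst (asm) \<mu>_eq, subst (asm) integrable_density) (auto simp: h0)
  moreover have "{0<..1} \<in> sets ?L" by (subst sets_restrict_space_iff) auto
  ultimately have "integrable ?L (\<lambda>x. indicator {0<..1} x *\<^sub>R h x)"
   by (intro integrable_mult_indicator)
  then show ?thesis
   unfolding U by (subst integrable_restrict_space) (auto simp: sets_restrict_space_iff)
 qed
 then show thesis using eq meas by (rule that)
qed

lemma acip_space: "acip f \<mu> ==> space \<mu> = {0..1}"
 using sets_eq_imp_space_eq[of \<mu> "restrict_space borel {0..1}"] by (simp add: acip_def space_restrict_space)

lemma acip_invariant: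
 fixes G :: "real => real"
 assumes "acip f \<mu>" "G \<in> borel_measurable \<mu>"
 shows "(\<integral>x. G (f x) \<partial>\<mu>) = (\<integral>x. G x \<partial>\<mu>)"
proof -
 have "(\<integral>x. G x \<partial>\<mu>) = (\<integral>x. G x \<partial>distr \<mu> \<mu> f)" using assms by (simp add: acip_def)
 also have "... = (\<integral>x. G (f x) \<partial>\<mu>)" using assms by (intro integral_distr) (auto simp: acip_def)
 finally show ?thesis by simp
qed

lemma f_pow_measurable_acip: "acip f \<mu> ==> f ^^ n \<in> \<mu> \<rightarrow>\<^sub>M \<mu>"
 by (induction n) (auto simp: id_def[symmetric] o_def acip_def intro: measurable_compose)

lemma holder_bounded_continuous:
 assumes "holder_continuous_on {0..1} \<phi>"
 shows "continuous_on {0..1} \<phi>"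
proof -
 obtain \<alpha> C where \<alpha>: "0 < \<alpha>" and C: "!!x y. x \<in> {0..1} ==> y \<in> {0..1} ==> \<bar>\<phi> x - \<phi> y\<bar> <= C * \<bar>x - y\<bar> powr \<alpha>"
  using assms unfolding holder_continuous_on_def by blast
 show ?thesis
  unfolding continuous_on_def
 proof
  fix y :: real assume y: "y \<in> {0..1}"
  have "((\<lambda>x. \<phi> x - \<phi> y) \<longlongrightarrow> 0) (at y within {0..1})"
  proof (rule Lim_null_comparison)
   show "eventually (\<lambda>x. norm (\<phi> x - \<phi> y) <= C * \<bar>x - y\<bar> powr \<alpha>) (at y within {0..1})"
    using C y by (auto simp: eventually_at_filter intro!: always_eventually)
   have "((\<lambda>x. C * \<bar>x - y\<bar> powr \<alpha>) \<longlongrightarrow> C * \<bar>y - y\<bar> powr \<alpha>) (at y within {0..1})"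
    using \<alpha> by (intro tendsto_intros tendsto_powr') auto
   then show "((\<lambda>x. C * \<bar>x - y\<bar> powr \<alpha>) \<longlongrightarrow> 0) (at y within {0..1})" by simp
  qed
  then show "(\<phi> \<longlongrightarrow> \<phi> y) (at y within {0..1})" by (simp add: LIM_zero_iff)
 qed
qed

lemma holder_measurable:
 assumes "acip f \<mu>" "holder_continuous_on {0..1} \<phi>" shows "\<phi> \<in> borel_measurable \<mu>"
proof -
 have "borel_measurable \<mu> = (borel_measurable (restrict_space borel {0..1}) :: (real => real) set)"
  using assms(1) by (intro measurable_cong_sets) (auto simp: acip_def)
 then show ?thesis
  using borel_measurable_continuous_on_restrict[OF holder_bounded_continuous[OF assms(2)]] by simp
qed

context intermittent_cone
begin

lemma acip_invariant_density:
 assumes ac: "acip f \<mu>"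
 obtains h where "integrable unit_leb h" "(LEB x. h x) = 1"
  "!!G. test_fun G ==> (LEB x. h x * G (f x)) = (LEB x. h x * G x)"
  "!!G :: real => real. G \<in> borel_measurable \<mu> ==> (\<integral>x. G x \<partial>\<mu>) = (LEB x. h x * G x)"
  "!!G :: real => real. G \<in> borel_measurable \<mu> ==> G \<in> borel_measurable unit_leb"
proof -
 interpret \<mu>: prob_space \<mu> using ac by (simp add: acip_def)
 obtain h where h: "integrable unit_leb h"
  "!!G :: real => real. G \<in> borel_measurable \<mu> ==> (\<integral>x. G x \<partial>\<mu>) = (LEB x. h x * G x)"
  "!!G :: real => real. G \<in> borel_measurable \<mu> ==> G \<in> borel_measurable unit_leb"
  using acip_density[OF ac] by blast
 have mass: "(LEB x. h x) = 1" using h(2)[of "\<lambda>_. 1"] \<mu>.prob_space by simp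
 have f\<mu>: "f \<in> \<mu> \<rightarrow>\<^sub>M \<mu>" using ac by (simp add: acip_def)
 have inv: "(LEB x. h x * G (f x)) = (LEB x. h x * G x)" if G: "test_fun G" for G
 proof -
  define G' where "G' x = indicator {0<..1} x * G x" for x
  have "(\<lambda>x. indicator {0<..1} x *\<^sub>R G x) \<in> borel_measurable lborel"
   using G by (subst borel_measurable_restrict_space_iff[symmetric]) (auto simp: test_fun_def)
  then have "G' \<in> borel_measurable borel" by (simp add: G'_def[abs_def])
  then have G': "G' \<in> borel_measurable \<mu>"
  proof -
   have "borel_measurable \<mu> = (borel_measurable (restrict_space borel {0..1}) :: (real => real) set)"
    using ac by (intro measurable_cong_sets) (auto simp: acip_def)
   then show ?thesis using measurable_restrict_space1[OF \<open>G' \<in> borel_measurable borel\<close>] by simp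
  qed
  have fG': "(\<lambda>x. G' (f x)) \<in> borel_measurable \<mu>" by (rule measurable_compose[OF f\<mu> G'])
  have "(LEB x. h x * G (f x)) = (LEB x. h x * G' (f x))"
   using measurable_space[OF f_measurable] by (intro Bochner_Integration.integral_cong) (auto simp: G'_def)
  also have "... = (LEB x. h x * G' x)"
   using acip_invariant[OF ac G'] h(2)[OF G'] h(2)[OF fG'] by simp
  also have "... = (LEB x. h x * G x)"
   by (intro Bochner_Integration.integral_cong) (auto simp: G'_def)
  finally show ?thesis .
 qed
 show thesis using that[OF h(1) mass inv h(2,3)] .
qed

end

theorem holland_mixing:
 fixes \<psi> :: "real => real"
 assumes H: "holland_map \<gamma> \<rho> f" and \<gamma>: "\<gamma> < 1" and ac: "acip f \<mu>"
  and \<psi>: "\<psi> \<in> borel_measurable \<mu>" "!!x. x \<in> space \<mu> ==> \<bar>\<psi> x\<bar> <= 1" and e: "0 < e"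
 shows "\<exists>n0. \<forall>n\<ge>n0. \<forall>G. G \<in> borel_measurable \<mu> --> (\<forall>x\<in>space \<mu>. \<bar>G x\<bar> <= 1) -->
   \<bar>(\<integral>x. \<psi> x * G ((f ^^ n) x) \<partial>\<mu>) - (\<integral>x. \<psi> x \<partial>\<mu>) * (\<integral>x. G x \<partial>\<mu>)\<bar> <= e"
proof -
 obtain s where s: "\<gamma> < s" "s < 1" using \<gamma> dense by blast
 obtain F D K q c b c1 where "intermittent_map f F D K q s c b c1"
  using holland_intermittent_map[OF H s] by blast
 then interpret intermittent_cone f F D K q s c b c1 1 "q + 1"
  by (intro intermittent_cone.intro) (auto simp: intermittent_cone_axioms_def)
 obtain h where h: "integrable unit_leb h" "(LEB x. h x) = 1"
  "!!G. test_fun G ==> (LEB x. h x * G (f x)) = (LEB x. h x * G x)"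
  "!!G :: real => real. G \<in> borel_measurable \<mu> ==> (\<integral>x. G x \<partial>\<mu>) = (LEB x. h x * G x)"
  "!!G :: real => real. G \<in> borel_measurable \<mu> ==> G \<in> borel_measurable unit_leb"
  using acip_invariant_density[OF ac] by blast
 have tf: "test_fun G" if "G \<in> borel_measurable \<mu>" "\<forall>x\<in>space \<mu>. \<bar>G x\<bar> <= 1" for G :: "real => real"
  using h(5)[OF that(1)] that(2) by (auto simp: test_fun_def acip_space[OF ac])
 obtain n0 where n0: "!!n G. n >= n0 ==> test_fun G ==>
   \<bar>(LEB x. h x * (\<psi> x * G ((f ^^ n) x))) - (LEB x. h x * \<psi> x) * (LEB x. h x * G x)\<bar> <= e"
  using invariant_mixing[OF h(1-3) tf[OF \<psi>(1)] e] \<psi>(2) by blast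
 show ?thesis
 proof (intro exI[of _ n0] allI impI)
  fix n and G :: "real => real" assume n: "n0 <= n" and G: "G \<in> borel_measurable \<mu>" "\<forall>x\<in>space \<mu>. \<bar>G x\<bar> <= 1"
  have "(\<lambda>x. \<psi> x * G ((f ^^ n) x)) \<in> borel_measurable \<mu>"
   using \<psi>(1) G(1) by (intro borel_measurable_times measurable_compose[OF f_pow_measurable_acip[OF ac]])
  then show "\<bar>(\<integral>x. \<psi> x * G ((f ^^ n) x) \<partial>\<mu>) - (\<integral>x. \<psi> x \<partial>\<mu>) * (\<integral>x. G x \<partial>\<mu>)\<bar> <= e"
   using n0[OF n tf[OF G]] by (simp add: h(4) \<psi>(1) G(1))
 qed
qed

text \<open>Since \<open>\<gamma> < 1/2\<close> implies \<open>(1 - \<gamma>) / \<gamma> > 1 / (2 * \<gamma>)\<close>, there is room for some \<open>s > \<gamma>\<close>.\<close>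
theorem holland_decay_of_correlations:
 assumes H: "holland_map \<gamma> \<rho> f" and \<gamma>: "\<gamma> < 1/2" and ac: "acip f \<mu>"
  and \<phi>: "holder_continuous_on {0..1} \<phi>" and mean: "(\<integral>x. \<phi> x \<partial>\<mu>) = 0"
 shows "\<exists>\<beta> R. 1 / (2 * \<gamma>) < \<beta> \<and> (\<forall>n\<ge>1. \<forall>G. G \<in> borel_measurable \<mu> --> (\<forall>x\<in>space \<mu>. \<bar>G x\<bar> <= 1) -->
   \<bar>\<integral>x. \<phi> x * G ((f ^^ n) x) \<partial>\<mu>\<bar> <= R * real n powr - \<beta>)"
proof -
 have \<gamma>0: "0 < \<gamma>" using H by (simp add: holland_map_def)
 have lt: "\<gamma> < 2 * \<gamma> / (1 + 2 * \<gamma>)" using \<gamma> \<gamma>0 by (simp add: field_simps)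
 obtain s where s: "\<gamma> < s" "s < 2 * \<gamma> / (1 + 2 * \<gamma>)" using dense[OF lt] by blast
 have s1: "s * (1 + 2 * \<gamma>) < 2 * \<gamma>" using s \<gamma>0 by (simp add: field_simps)
 then have "s < 1" using s \<gamma>0 by (smt (verit) mult_left_less_imp_less mult_less_cancel_right2)
 have rate: "1 / (2 * \<gamma>) < (1 - s) / s" using s1 s \<gamma>0 by (simp add: field_simps)
 obtain F D K q c b c1 where I: "intermittent_map f F D K q s c b c1"
  using holland_intermittent_map[OF H s(1) \<open>s < 1\<close>] by blast
 obtain \<alpha> C where \<alpha>: "0 < \<alpha>" "\<alpha> <= 1" and C: "!!x y. x \<in> {0..1} ==> y \<in> {0..1} ==> \<bar>\<phi> x - \<phi> y\<bar> <= C * \<bar>x - y\<bar> powr \<alpha>"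
  using \<phi> unfolding holder_continuous_on_def by blast
 interpret intermittent_cone f F D K q s c b c1 \<alpha> "q + 1"
  using I \<alpha> by (intro intermittent_cone.intro) (auto simp: intermittent_cone_axioms_def)
 obtain h where h: "integrable unit_leb h" "(LEB x. h x) = 1"
  "!!G. test_fun G ==> (LEB x. h x * G (f x)) = (LEB x. h x * G x)"
  "!!G :: real => real. G \<in> borel_measurable \<mu> ==> (\<integral>x. G x \<partial>\<mu>) = (LEB x. h x * G x)"
  "!!G :: real => real. G \<in> borel_measurable \<mu> ==> G \<in> borel_measurable unit_leb"
  using acip_invariant_density[OF ac] by blast
 have \<phi>m: "\<phi> \<in> borel_measurable \<mu>" by (rule holder_measurable[OF ac \<phi>])
 have "\<exists>R. \<forall>n G. 1 <= n --> test_fun G -->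
   \<bar>LEB x. h x * (\<phi> x * G ((f ^^ n) x))\<bar> <= R * real n powr - ((1 - s) / s)"
 proof (rule invariant_decay[OF h(1-3)])
  show "\<bar>\<phi> x - \<phi> y\<bar> <= \<bar>C\<bar> * \<bar>x - y\<bar> powr \<alpha>" if "0 < x" "x <= 1" "0 < y" "y <= 1" for x y
   using C[of x y] that mult_right_mono[OF abs_ge_self[of C], of "\<bar>x - y\<bar> powr \<alpha>"] by simp
  show "(LEB x. h x * \<phi> x) = 0" using mean h(4)[OF \<phi>m] by simp
 qed auto
 then obtain R where R: "!!n G. 1 <= n ==> test_fun G ==>
   \<bar>LEB x. h x * (\<phi> x * G ((f ^^ n) x))\<bar> <= R * real n powr - ((1 - s) / s)" by blast
 show ?thesis
 proof (rule exI[of _ "(1 - s) / s"], rule exI[of _ R], intro conjI rate allI impI)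
  fix n :: nat and G :: "real => real" assume n: "1 <= n" and G: "G \<in> borel_measurable \<mu>" "\<forall>x\<in>space \<mu>. \<bar>G x\<bar> <= 1"
  have tf: "test_fun G" using h(5)[OF G(1)] G(2) by (auto simp: test_fun_def acip_space[OF ac])
  have "(\<lambda>x. \<phi> x * G ((f ^^ n) x)) \<in> borel_measurable \<mu>"
   using \<phi>m G(1) by (intro borel_measurable_times measurable_compose[OF f_pow_measurable_acip[OF ac]])
  then show "\<bar>\<integral>x. \<phi> x * G ((f ^^ n) x) \<partial>\<mu>\<bar> <= R * real n powr - ((1 - s) / s)"
   using R[OF n tf] by (simp add: h(4))
 qed
qed

section \<open>Moments of Birkhoff sums\<close>

lemma has_derivative_abs_powr:
 fixes p t :: real
 assumes p: "1 < p"
 shows "((\<lambda>t. \<bar>t\<bar> powr p) has_real_derivative p * (sgn t * \<bar>t\<bar> powr (p - 1))) (at t)"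
proof -
 consider "0 < t" | "t < 0" | "t = 0" by linarith
 then show ?thesis
 proof cases
  case 1
  have "((\<lambda>t. t powr p) has_real_derivative p * (sgn t * \<bar>t\<bar> powr (p - 1))) (at t)"
   using 1 by (auto intro!: derivative_eq_intros)
  moreover have "eventually (\<lambda>t. t powr p = \<bar>t\<bar> powr p) (nhds t)"
   using eventually_nhds_in_open[of "{0<..}" t] 1 by (auto elim!: eventually_mono)
  ultimately show ?thesis by (subst (asm) DERIV_cong_ev) auto
 next
  case 2
  have "((\<lambda>t. (- t) powr p) has_real_derivative p * (sgn t * \<bar>t\<bar> powr (p - 1))) (at t)"
   using 2 by (auto intro!: derivative_eq_intros)
  moreover have "eventually (\<lambda>t. (- t) powr p = \<bar>t\<bar> powr p) (nhds t)"
   using eventually_nhds_in_open[of "{..<0}" t] 2 by (auto elim!: eventually_mono)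
  ultimately show ?thesis by (subst (asm) DERIV_cong_ev) auto
 next
  case 3
  have "((\<lambda>h::real. \<bar>h\<bar> powr p / h) \<longlongrightarrow> 0) (at 0)"
  proof (rule Lim_null_comparison)
   show "eventually (\<lambda>h. norm (\<bar>h\<bar> powr p / h) <= \<bar>h\<bar> powr (p - 1)) (at (0::real))"
    by (auto simp: eventually_at_filter powr_diff intro!: always_eventually)
   have "((\<lambda>h::real. \<bar>h\<bar> powr (p - 1)) \<longlongrightarrow> \<bar>0\<bar> powr (p - 1)) (at 0)"
    using p by (intro tendsto_powr' tendsto_intros) auto
   then show "((\<lambda>h::real. \<bar>h\<bar> powr (p - 1)) \<longlongrightarrow> 0) (at 0)" by simp
  qed
  then show ?thesis using 3 by (simp add: DERIV_def)
 qed
qed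

lemma has_derivative_sgn_powr:
 fixes p t :: real
 assumes p: "1 < p"
 shows "((\<lambda>t. sgn t * \<bar>t\<bar> powr p) has_real_derivative p * \<bar>t\<bar> powr (p - 1)) (at t)"
proof -
 consider "0 < t" | "t < 0" | "t = 0" by linarith
 then show ?thesis
 proof cases
  case 1
  have "((\<lambda>t. t powr p) has_real_derivative p * \<bar>t\<bar> powr (p - 1)) (at t)"
   using 1 by (auto intro!: derivative_eq_intros)
  moreover have "eventually (\<lambda>t. t powr p = sgn t * \<bar>t\<bar> powr p) (nhds t)"
   using eventually_nhds_in_open[of "{0<..}" t] 1 by (auto elim!: eventually_mono)
  ultimately show ?thesis by (subst (asm) DERIV_cong_ev) auto
 next
  case 2
  have "((\<lambda>t. - ((- t) powr p)) has_real_derivative p * \<bar>t\<bar> powr (p - 1)) (at t)"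
   using 2 by (auto intro!: derivative_eq_intros)
  moreover have "eventually (\<lambda>t. - ((- t) powr p) = sgn t * \<bar>t\<bar> powr p) (nhds t)"
   using eventually_nhds_in_open[of "{..<0}" t] 2 by (auto elim!: eventually_mono)
  ultimately show ?thesis by (subst (asm) DERIV_cong_ev) auto
 next
  case 3
  have "((\<lambda>h::real. sgn h * \<bar>h\<bar> powr p / h) \<longlongrightarrow> 0) (at 0)"
  proof (rule Lim_null_comparison)
   show "eventually (\<lambda>h. norm (sgn h * \<bar>h\<bar> powr p / h) <= \<bar>h\<bar> powr (p - 1)) (at (0::real))"
    by (auto simp: eventually_at_filter powr_diff abs_mult sgn_if intro!: always_eventually)
   have "((\<lambda>h::real. \<bar>h\<bar> powr (p - 1)) \<longlongrightarrow> \<bar>0\<bar> powr (p - 1)) (at 0)"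
    using p by (intro tendsto_powr' tendsto_intros) auto
   then show "((\<lambda>h::real. \<bar>h\<bar> powr (p - 1)) \<longlongrightarrow> 0) (at 0)" by simp
  qed
  then show ?thesis using 3 p by (simp add: DERIV_def)
 qed
qed

lemma mean_value_abs:
 fixes f f' :: "real => real"
 assumes d: "!!t. (f has_real_derivative f' t) (at t)"
 shows "\<exists>t. \<bar>t - b\<bar> <= \<bar>a\<bar> \<and> f (a + b) - f b = a * f' t"
proof -
 consider "0 < a" | "a < 0" | "a = 0" by linarith
 then show ?thesis
 proof cases
  case 1
  then obtain z where "b < z" "z < a + b" "f (a + b) - f b = (a + b - b) * f' z"
   using MVT2[of b "a + b" f f'] d by auto
  then show ?thesis using 1 by (intro exI[of _ z]) auto
 next
  case 2
  then obtain z where "a + b < z" "z < b" "f b - f (a + b) = (b - (a + b)) * f' z"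
   using MVT2[of "a + b" b f f'] d by auto
  then show ?thesis using 2 by (intro exI[of _ z]) auto
 qed (auto intro: exI[of _ b])
qed

text \<open>The derivative of \<open>\<bar>t\<bar> powr p\<close>.\<close>
definition dpow :: "real => real => real" where "dpow p t = p * (sgn t * \<bar>t\<bar> powr (p - 1))"

lemma dpow_diff:
 assumes p: "2 < p"
 shows "\<bar>dpow p (a + b) - dpow p b\<bar> <= p * (p - 1) * \<bar>a\<bar> * (\<bar>a\<bar> + \<bar>b\<bar>) powr (p - 2)"
proof -
 have "((\<lambda>t. p * (sgn t * \<bar>t\<bar> powr (p - 1))) has_real_derivative p * ((p - 1) * \<bar>t\<bar> powr (p - 1 - 1))) (at t)" for t
  by (intro DERIV_cmult has_derivative_sgn_powr) (use p in auto)
 from mean_value_abs[of "dpow p" "\<lambda>t. p * ((p - 1) * \<bar>t\<bar> powr (p - 1 - 1))" b a] this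
 obtain t where t: "\<bar>t - b\<bar> <= \<bar>a\<bar>" "dpow p (a + b) - dpow p b = a * (p * ((p - 1) * \<bar>t\<bar> powr (p - 2)))"
  by (auto simp: dpow_def[abs_def])
 have "\<bar>t\<bar> powr (p - 2) <= (\<bar>a\<bar> + \<bar>b\<bar>) powr (p - 2)"
  using t(1) p by (intro powr_mono2) auto
 then have "p * (p - 1) * \<bar>a\<bar> * \<bar>t\<bar> powr (p - 2) <= p * (p - 1) * \<bar>a\<bar> * (\<bar>a\<bar> + \<bar>b\<bar>) powr (p - 2)"
  using p by (intro mult_left_mono) auto
 moreover have "\<bar>a * (p * ((p - 1) * \<bar>t\<bar> powr (p - 2)))\<bar> = p * (p - 1) * \<bar>a\<bar> * \<bar>t\<bar> powr (p - 2)"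
  using p by (simp add: abs_mult)
 ultimately show ?thesis by (simp add: t(2))
qed

lemma abs_powr_taylor:
 assumes p: "2 < p"
 shows "\<bar>a + b\<bar> powr p <= \<bar>b\<bar> powr p + a * dpow p b + p * (p - 1) * a\<^sup>2 * (2 * \<bar>a\<bar> + \<bar>b\<bar>) powr (p - 2)"
proof -
 have "((\<lambda>t. \<bar>t\<bar> powr p) has_real_derivative dpow p t) (at t)" for t
  unfolding dpow_def using p by (intro has_derivative_abs_powr) auto
 from mean_value_abs[OF this, of b a] obtain t where t: "\<bar>t - b\<bar> <= \<bar>a\<bar>" "\<bar>a + b\<bar> powr p - \<bar>b\<bar> powr p = a * dpow p t"
  by auto
 have "\<bar>dpow p ((t - b) + b) - dpow p b\<bar> <= p * (p - 1) * \<bar>t - b\<bar> * (\<bar>t - b\<bar> + \<bar>b\<bar>) powr (p - 2)"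
  by (rule dpow_diff[OF p])
 also have "... <= p * (p - 1) * \<bar>a\<bar> * (2 * \<bar>a\<bar> + \<bar>b\<bar>) powr (p - 2)"
  using t(1) p by (intro mult_mono powr_mono2) auto
 finally have "\<bar>a\<bar> * \<bar>dpow p t - dpow p b\<bar> <= \<bar>a\<bar> * (p * (p - 1) * \<bar>a\<bar> * (2 * \<bar>a\<bar> + \<bar>b\<bar>) powr (p - 2))"
  by (intro mult_left_mono) auto
 moreover have "a * (dpow p t - dpow p b) <= \<bar>a\<bar> * \<bar>dpow p t - dpow p b\<bar>"
  using abs_ge_self[of "a * (dpow p t - dpow p b)"] unfolding abs_mult .
 moreover have "\<bar>a\<bar> * (p * (p - 1) * \<bar>a\<bar> * X) = p * (p - 1) * a\<^sup>2 * X" for X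
 proof -
  have "\<bar>a\<bar> * (p * (p - 1) * \<bar>a\<bar> * X) = p * (p - 1) * (\<bar>a\<bar> * \<bar>a\<bar>) * X" by (simp only: mult_ac)
  then show ?thesis by (simp add: power2_eq_square)
 qed
 ultimately have "a * (dpow p t - dpow p b) <= p * (p - 1) * a\<^sup>2 * (2 * \<bar>a\<bar> + \<bar>b\<bar>) powr (p - 2)"
  by simp
 then show ?thesis using t(2) by (simp add: algebra_simps)
qed

lemma summable_Suc_powr: "1 < b ==> summable (\<lambda>k. real (Suc k) powr - b)"
 by (subst summable_Suc_iff[of "\<lambda>k. real k powr - b"]) (simp add: summable_real_powr_iff)

locale mixing_system = prob_space M for M :: "'a measure" +
 fixes T :: "'a => 'a" and \<phi> :: "'a => real" and B C \<beta> :: real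
 assumes T_meas [measurable]: "T \<in> M \<rightarrow>\<^sub>M M"
  and T_inv: "distr M M T = M"
  and phi_meas [measurable]: "\<phi> \<in> borel_measurable M"
  and phi_bound: "!!x. x \<in> space M ==> \<bar>\<phi> x\<bar> <= B"
  and B_pos: "0 < B" and C_nonneg: "0 <= C" and beta_gt_1: "1 < \<beta>"
  and decay: "!!n G. 1 <= n ==> G \<in> borel_measurable M ==> (!!x. x \<in> space M ==> \<bar>G x\<bar> <= 1) ==>
    \<bar>\<integral>x. \<phi> x * G ((T ^^ n) x) \<partial>M\<bar> <= C * real n powr - \<beta>"
begin

abbreviation expect :: "('a => 'b) => 'b :: {banach, second_countable_topology}" (binder "MEAN " 10) where
 "expect F \<equiv> integral\<^sup>L M F"

lemma T_pow_meas [measurable]: "T ^^ n \<in> M \<rightarrow>\<^sub>M M"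
 by (induction n) (auto simp: id_def[symmetric] o_def intro: measurable_compose)

lemma T_pow_space: "x \<in> space M ==> (T ^^ n) x \<in> space M"
 using measurable_space[OF T_pow_meas] by blast

lemma T_invariant:
 fixes G :: "'a => 'b :: {banach, second_countable_topology}"
 assumes "G \<in> borel_measurable M" shows "(MEAN x. G (T x)) = (MEAN x. G x)"
 using integral_distr[OF T_meas assms] by (simp add: T_inv)

lemma T_pow_invariant:
 fixes G :: "'a => 'b :: {banach, second_countable_topology}"
 assumes [measurable]: "G \<in> borel_measurable M" shows "(MEAN x. G ((T ^^ n) x)) = (MEAN x. G x)"
proof (induction n)
 case (Suc n)
 have "(MEAN x. G ((T ^^ n) (T x))) = (MEAN x. G ((T ^^ n) x))" by (rule T_invariant) measurable
 then show ?case using Suc by (simp add: funpow_swap1)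
qed simp

definition S :: "nat => 'a => real" where "S n x = (\<Sum>k<n. \<phi> ((T ^^ k) x))"

lemma S_0 [simp]: "S 0 x = 0" by (simp add: S_def)

lemma S_Suc: "S (Suc n) x = \<phi> x + S n (T x)"
 unfolding S_def sum.lessThan_Suc_shift by (simp add: funpow_swap1)

lemma S_meas [measurable]: "S n \<in> borel_measurable M"
 unfolding S_def[abs_def] by measurable

lemma S_bound: "x \<in> space M ==> \<bar>S n x\<bar> <= real n * B"
 unfolding S_def by (rule order_trans[OF sum_abs]) (use sum_bounded_above[of "{..<n}" "\<lambda>k. \<bar>\<phi> ((T ^^ k) x)\<bar>" B] phi_bound T_pow_space in auto)

lemma integrable_bdd:
 fixes G :: "'a => 'b :: {banach, second_countable_topology}"
 assumes "G \<in> borel_measurable M" "!!x. x \<in> space M ==> norm (G x) <= K"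
 shows "integrable M G"
 using assms by (intro integrable_const_bound[of _ K]) auto

text \<open>Truncate \<open>z\<close> at the level \<open>V = k powr (\<beta> / q) * \<Lambda>\<close>, which balances the bound \<open>V * k powr - \<beta>\<close> for the
truncated part against the size \<open>V powr (1 - q) * \<Lambda> powr q\<close> of the rest.\<close>
lemma decay_Lq:
 fixes z :: "'a => real"
 assumes q: "1 < q" and k: "1 <= k" and z[measurable]: "z \<in> borel_measurable M"
  and bd: "!!x. x \<in> space M ==> \<bar>z x\<bar> <= V0"
  and \<Lambda>: "0 < \<Lambda>" "(MEAN x. \<bar>z x\<bar> powr q) <= \<Lambda> powr q"
 shows "\<bar>MEAN x. \<phi> x * z ((T ^^ k) x)\<bar> <= (C + B) * real k powr (- \<beta> * (1 - 1 / q)) * \<Lambda>"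
proof -
 define V where "V = real k powr (\<beta> / q) * \<Lambda>"
 have V: "0 < V" using k \<Lambda> by (simp add: V_def)
 define z1 where "z1 x = max (- V) (min V (z x))" for x
 have [measurable]: "z1 \<in> borel_measurable M" unfolding z1_def[abs_def] by measurable
 have z1: "\<bar>z1 x / V\<bar> <= 1" for x using V by (auto simp: z1_def abs_le_iff)
 have V00: "0 <= V0"
 proof -
  obtain x where "x \<in> space M" using not_empty by blast
  from bd[OF this] show ?thesis by simp
 qed
 have diff: "\<bar>z x - z1 x\<bar> <= \<bar>z x\<bar> powr q * V powr (1 - q)" for x
 proof (cases "\<bar>z x\<bar> <= V")
  case False
  have "\<bar>z x - z1 x\<bar> <= \<bar>z x\<bar>" using V by (auto simp: z1_def)
  also have "... = \<bar>z x\<bar> powr q * \<bar>z x\<bar> powr (1 - q)" using False V by (simp add: powr_add[symmetric])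
  also have "... <= \<bar>z x\<bar> powr q * V powr (1 - q)"
   using False V q by (intro mult_left_mono powr_mono2') auto
  finally show ?thesis .
 qed (auto simp: z1_def abs_le_iff)
 have "(MEAN x. \<phi> x * z ((T ^^ k) x)) = (MEAN x. \<phi> x * z1 ((T ^^ k) x) + \<phi> x * (z ((T ^^ k) x) - z1 ((T ^^ k) x)))"
  by (intro Bochner_Integration.integral_cong) (auto simp: algebra_simps)
 also have "... = (MEAN x. \<phi> x * z1 ((T ^^ k) x)) + (MEAN x. \<phi> x * (z ((T ^^ k) x) - z1 ((T ^^ k) x)))"
 proof (rule Bochner_Integration.integral_add)
  have b1: "\<bar>z1 x\<bar> <= V" for x using V by (auto simp: z1_def abs_le_iff)
  show "integrable M (\<lambda>x. \<phi> x * z1 ((T ^^ k) x))"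
   using phi_bound b1 V B_pos by (intro integrable_bdd[of _ "B * V"]) (auto simp: abs_mult intro!: mult_mono)
  show "integrable M (\<lambda>x. \<phi> x * (z ((T ^^ k) x) - z1 ((T ^^ k) x)))"
   using phi_bound b1 V V00 B_pos bd[OF T_pow_space]
   by (intro integrable_bdd[of _ "B * (V0 + V)"]) (auto simp: abs_mult intro!: mult_mono order_trans[OF abs_triangle_ineq4] add_mono)
 qed
 finally have split: "(MEAN x. \<phi> x * z ((T ^^ k) x)) = (MEAN x. \<phi> x * z1 ((T ^^ k) x)) + (MEAN x. \<phi> x * (z ((T ^^ k) x) - z1 ((T ^^ k) x)))" .
 have kp: "real k powr - \<beta> * V = real k powr (- \<beta> * (1 - 1 / q)) * \<Lambda>"
  by (simp add: V_def powr_add[symmetric] algebra_simps)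
 have "\<bar>MEAN x. \<phi> x * (z1 ((T ^^ k) x) / V)\<bar> <= C * real k powr - \<beta>"
  by (rule decay[OF k, of "\<lambda>x. z1 x / V"]) (use z1 in auto)
 then have "V * \<bar>MEAN x. \<phi> x * (z1 ((T ^^ k) x) / V)\<bar> <= V * (C * real k powr - \<beta>)"
  using V by (intro mult_left_mono) auto
 moreover have "V * \<bar>MEAN x. \<phi> x * (z1 ((T ^^ k) x) / V)\<bar> = \<bar>MEAN x. \<phi> x * z1 ((T ^^ k) x)\<bar>"
  using V by simp
 ultimately have 1: "\<bar>MEAN x. \<phi> x * z1 ((T ^^ k) x)\<bar> <= C * (real k powr (- \<beta> * (1 - 1 / q)) * \<Lambda>)"
  unfolding kp[symmetric] by (simp add: mult_ac)
 have "\<bar>MEAN x. \<phi> x * (z ((T ^^ k) x) - z1 ((T ^^ k) x))\<bar> <= (MEAN x. B * (\<bar>z ((T ^^ k) x)\<bar> powr q * V powr (1 - q)))"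
 proof (intro order_trans[OF integral_abs_bound] integral_mono')
  show "integrable M (\<lambda>x. B * (\<bar>z ((T ^^ k) x)\<bar> powr q * V powr (1 - q)))"
   using bd[OF T_pow_space] B_pos q
   by (intro integrable_bdd[of _ "B * (V0 powr q * V powr (1 - q))"]) (auto simp: abs_mult intro!: mult_mono powr_mono2)
  show "\<bar>\<phi> x * (z ((T ^^ k) x) - z1 ((T ^^ k) x))\<bar> <= B * (\<bar>z ((T ^^ k) x)\<bar> powr q * V powr (1 - q))" if "x \<in> space M" for x
   using phi_bound[OF that] diff B_pos by (auto simp: abs_mult intro!: mult_mono)
 qed (use B_pos in auto)
 also have "... = B * ((MEAN x. \<bar>z ((T ^^ k) x)\<bar> powr q) * V powr (1 - q))" by simp
 also have "(MEAN x. \<bar>z ((T ^^ k) x)\<bar> powr q) = (MEAN x. \<bar>z x\<bar> powr q)"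
  by (rule T_pow_invariant) measurable
 also have "B * (... * V powr (1 - q)) <= B * (\<Lambda> powr q * V powr (1 - q))"
  using \<Lambda> B_pos by (intro mult_left_mono mult_right_mono) auto
 also have "\<Lambda> powr q * V powr (1 - q) = real k powr (- \<beta> * (1 - 1 / q)) * \<Lambda>"
 proof -
  have "V powr (1 - q) = real k powr (\<beta> / q * (1 - q)) * \<Lambda> powr (1 - q)"
   using \<Lambda> by (simp add: V_def powr_mult powr_powr)
  moreover have "\<beta> / q * (1 - q) = - \<beta> * (1 - 1 / q)" using q by (simp add: field_simps)
  moreover have "\<Lambda> powr q * \<Lambda> powr (1 - q) = \<Lambda>" using \<Lambda> by (simp add: powr_add[symmetric])
  ultimately show ?thesis by (simp add: mult_ac)
 qed
 finally have 2: "\<bar>MEAN x. \<phi> x * (z ((T ^^ k) x) - z1 ((T ^^ k) x))\<bar> <= B * (real k powr (- \<beta> * (1 - 1 / q)) * \<Lambda>)" .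
 show ?thesis unfolding split using 1 2 by (simp add: algebra_simps)
qed

end

context mixing_system
begin

lemma telescope:
 fixes A :: "nat => 'a => 'b :: real_normed_vector"
 shows "A m y = (\<Sum>k<m. A (m - k) ((T ^^ k) y) - A (m - Suc k) ((T ^^ Suc k) y)) + A 0 ((T ^^ m) y)"
 using sum_lessThan_telescope'[of "\<lambda>k. A (m - k) ((T ^^ k) y)" m] by simp

lemma powr_add_le:
 fixes x y p :: real
 assumes "0 <= x" "0 <= y" "0 < p"
 shows "(x + y) powr p <= 2 powr p * (x powr p + y powr p)"
proof -
 have "(x + y) powr p <= (2 * max x y) powr p" using assms by (intro powr_mono2) auto
 also have "... = 2 powr p * (max x y) powr p" using assms by (simp add: powr_mult)
 also have "... <= 2 powr p * (x powr p + y powr p)"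
  by (intro mult_left_mono) (auto simp: max_def)
 finally show ?thesis .
qed

definition moment :: "real => nat => real" where "moment p m = (MEAN x. \<bar>S m x\<bar> powr p)"

lemma integrable_abs_powr_S:
 assumes "0 <= r" "0 <= K"
 shows "integrable M (\<lambda>x. (K + \<bar>S m x\<bar>) powr r)" "integrable M (\<lambda>x. \<bar>S m x\<bar> powr r)"
proof -
 show "integrable M (\<lambda>x. (K + \<bar>S m x\<bar>) powr r)"
  using S_bound assms by (intro integrable_bdd[of _ "(K + real m * B) powr r"]) (auto intro!: powr_mono2 add_left_mono)
 show "integrable M (\<lambda>x. \<bar>S m x\<bar> powr r)"
  using S_bound assms by (intro integrable_bdd[of _ "(real m * B) powr r"]) (auto intro!: powr_mono2)
qed

text \<open>Expand \<open>\<bar>\<phi> + S i \<circ> T\<bar> powr p\<close> at \<open>S i \<circ> T\<close>. The second order term is bounded by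
a moment of order \<open>p - 2\<close>, hence by a power of \<open>Y\<close>. The first order term is the correlation of
\<open>\<phi>\<close> with \<open>dpow p (S i)\<close> one step later; telescoping over sums that start later and later leaves differences of size \<open>\<bar>S j\<bar> powr (p - 2)\<close> that depend on the
orbit after time \<open>k\<close> only. With \<open>q = p / (p - 2)\<close>, \<open>decay_Lq\<close> bounds them by \<open>k powr - (2 * \<beta> / p)\<close>,
which is summable.\<close>
lemma moment_step:
 assumes p: "2 < p" "p < 2 * \<beta>" and Y: "0 < Y" "!!j. j <= i ==> (MEAN x. (2 * B + \<bar>S j x\<bar>) powr p) <= Y"
 shows "moment p (Suc i) <= moment p i +
  p * (p - 1) * B * ((C + B) * (\<Sum>k. real (Suc k) powr - (2 * \<beta> / p)) + 2 * B) * Y powr (1 - 2 / p)"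
proof -
 define q where "q = p / (p - 2)"
 have q: "1 < q" "1 - 1 / q = 2 / p" "1 / q = 1 - 2 / p" using p by (auto simp: q_def field_simps)
 define \<Lambda> where "\<Lambda> = p * (p - 1) * B * Y powr (1 / q)"
 have \<Lambda>: "0 < \<Lambda>" using p B_pos Y by (simp add: \<Lambda>_def)
 define Z where "Z j y = dpow p (S (Suc j) y) - dpow p (S j (T y))" for j y
 have [measurable]: "dpow p \<in> borel_measurable borel"
  unfolding dpow_def[abs_def] by measurable
 have [measurable]: "Z j \<in> borel_measurable M" for j unfolding Z_def[abs_def] by measurable
 have Z_le: "\<bar>Z j y\<bar> <= p * (p - 1) * B * (B + \<bar>S j (T y)\<bar>) powr (p - 2)" if y: "y \<in> space M" for j y
 proof -
  have "\<bar>Z j y\<bar> <= p * (p - 1) * \<bar>\<phi> y\<bar> * (\<bar>\<phi> y\<bar> + \<bar>S j (T y)\<bar>) powr (p - 2)"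
   unfolding Z_def S_Suc by (rule dpow_diff[OF p(1)])
  also have "... <= p * (p - 1) * B * (B + \<bar>S j (T y)\<bar>) powr (p - 2)"
   using phi_bound[OF y] p B_pos by (intro mult_mono powr_mono2) auto
  finally show ?thesis .
 qed
 have tm: "\<bar>MEAN x. \<phi> x * Z (i - Suc k) ((T ^^ Suc k) x)\<bar> <= (C + B) * \<Lambda> * real (Suc k) powr - (2 * \<beta> / p)" if k: "k < i" for k
 proof -
  let ?j = "i - Suc k"
  have "\<bar>MEAN x. \<phi> x * Z ?j ((T ^^ Suc k) x)\<bar> <= (C + B) * real (Suc k) powr (- \<beta> * (1 - 1 / q)) * \<Lambda>"
  proof (rule decay_Lq[OF q(1)])
   show "\<bar>Z ?j x\<bar> <= p * (p - 1) * B * (B + real ?j * B) powr (p - 2)" if x: "x \<in> space M" for x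
    using S_bound[of "T x" ?j] measurable_space[OF T_meas x] p B_pos
    by (intro order_trans[OF Z_le[OF x]] mult_left_mono powr_mono2) auto
   have "(MEAN x. \<bar>Z ?j x\<bar> powr q) <= (MEAN x. (p * (p - 1) * B) powr q * (2 * B + \<bar>S ?j (T x)\<bar>) powr p)"
   proof (rule integral_mono')
    have "integrable (distr M M T) (\<lambda>x. (2 * B + \<bar>S ?j x\<bar>) powr p)"
     unfolding T_inv using p B_pos by (intro integrable_abs_powr_S) auto
    then show "integrable M (\<lambda>x. (p * (p - 1) * B) powr q * (2 * B + \<bar>S ?j (T x)\<bar>) powr p)"
     by (subst (asm) integrable_distr_eq) auto
    fix x assume x: "x \<in> space M"
    have "\<bar>Z ?j x\<bar> powr q <= (p * (p - 1) * B * (2 * B + \<bar>S ?j (T x)\<bar>) powr (p - 2)) powr q"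
    proof (rule powr_mono2)
     have "(B + \<bar>S ?j (T x)\<bar>) powr (p - 2) <= (2 * B + \<bar>S ?j (T x)\<bar>) powr (p - 2)"
      using p B_pos by (intro powr_mono2) auto
     then show "\<bar>Z ?j x\<bar> <= p * (p - 1) * B * (2 * B + \<bar>S ?j (T x)\<bar>) powr (p - 2)"
      using p B_pos by (intro order_trans[OF Z_le[OF x]] mult_left_mono) auto
    qed (use q in auto)
    also have "... = (p * (p - 1) * B) powr q * (2 * B + \<bar>S ?j (T x)\<bar>) powr ((p - 2) * q)"
     using p B_pos by (simp add: powr_mult powr_powr)
    also have "(p - 2) * q = p" using p by (simp add: q_def)
    finally show "\<bar>Z ?j x\<bar> powr q <= (p * (p - 1) * B) powr q * (2 * B + \<bar>S ?j (T x)\<bar>) powr p" .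
   qed auto
   also have "... = (p * (p - 1) * B) powr q * (MEAN x. (2 * B + \<bar>S ?j (T x)\<bar>) powr p)" by simp
   also have "(MEAN x. (2 * B + \<bar>S ?j (T x)\<bar>) powr p) = (MEAN x. (2 * B + \<bar>S ?j x\<bar>) powr p)"
    by (rule T_invariant) measurable
   also have "(p * (p - 1) * B) powr q * ... <= (p * (p - 1) * B) powr q * Y"
    using Y(2)[of ?j] by (intro mult_left_mono) auto
   also have "... = \<Lambda> powr q" using p B_pos Y(1) q(1) by (simp add: \<Lambda>_def powr_mult powr_powr)
   finally show "(MEAN x. \<bar>Z ?j x\<bar> powr q) <= \<Lambda> powr q" .
  qed (use \<Lambda> in auto)
  also have "- \<beta> * (1 - 1 / q) = - (2 * \<beta> / p)" unfolding q by simp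
  finally show ?thesis by (simp only: mult_ac)
 qed
 have S_T: "(\<lambda>x. h (S i (T x))) \<in> borel_measurable M" if "h \<in> borel_measurable borel" for h :: "real => real"
  using that by measurable
 \<comment> \<open>differences of the derivative along sums that start one step later\<close>
 have dpow_eq: "dpow p (S i (T x)) = (\<Sum>k<i. Z (i - Suc k) ((T ^^ Suc k) x))" for x
 proof -
  have "dpow p (S i (T x)) = (\<Sum>k<i. dpow p (S (i - k) ((T ^^ k) (T x))) - dpow p (S (i - Suc k) ((T ^^ Suc k) (T x)))) + dpow p (S 0 ((T ^^ i) (T x)))"
   by (rule telescope[of "\<lambda>j y. dpow p (S j y)"])
  also have "... = (\<Sum>k<i. Z (i - Suc k) ((T ^^ Suc k) x))"
   using p by (auto simp: Z_def dpow_def Suc_diff_Suc funpow_swap1 intro!: sum.cong)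
  finally show ?thesis .
 qed
 have Z_int: "integrable M (\<lambda>x. \<phi> x * Z j ((T ^^ Suc k) x))" for j k
 proof (rule integrable_bdd[of _ "B * (p * (p - 1) * B * (B + real j * B) powr (p - 2))"])
  fix x assume x: "x \<in> space M"
  have "\<bar>Z j y\<bar> <= p * (p - 1) * B * (B + real j * B) powr (p - 2)" if y: "y \<in> space M" for y
   using S_bound[of "T y" j] measurable_space[OF T_meas y] p B_pos
   by (intro order_trans[OF Z_le[OF y]] mult_left_mono powr_mono2) auto
  from this[OF T_pow_space[OF x, of "Suc k"]] show "norm (\<phi> x * Z j ((T ^^ Suc k) x)) <= B * (p * (p - 1) * B * (B + real j * B) powr (p - 2))"
   unfolding real_norm_def abs_mult using phi_bound[OF x] B_pos by (intro mult_mono) auto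
 qed measurable
 have sm: "summable (\<lambda>k. real (Suc k) powr - (2 * \<beta> / p))" by (rule summable_Suc_powr) (use p in simp)
 have first: "(MEAN x. \<phi> x * dpow p (S i (T x))) <= (C + B) * \<Lambda> * (\<Sum>k. real (Suc k) powr - (2 * \<beta> / p))"
 proof -
  have "(MEAN x. \<phi> x * dpow p (S i (T x))) = (\<Sum>k<i. MEAN x. \<phi> x * Z (i - Suc k) ((T ^^ Suc k) x))"
   unfolding dpow_eq sum_distrib_left using Z_int by (intro Bochner_Integration.integral_sum) auto
  also have "... <= (\<Sum>k<i. (C + B) * \<Lambda> * real (Suc k) powr - (2 * \<beta> / p))"
   using tm by (intro sum_mono) (auto dest: abs_le_D1)
  also have "... = (C + B) * \<Lambda> * (\<Sum>k<i. real (Suc k) powr - (2 * \<beta> / p))" by (simp add: sum_distrib_left)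
  also have "... <= (C + B) * \<Lambda> * (\<Sum>k. real (Suc k) powr - (2 * \<beta> / p))"
   using C_nonneg B_pos \<Lambda> by (intro mult_left_mono sum_le_suminf sm) auto
  finally show ?thesis .
 qed
 have T_int: "integrable M (\<lambda>x. G (T x))" if "integrable M G" for G :: "'a => real"
  using that integrable_distr[of T M M G] by (simp add: T_inv)
 define V where "V = Y powr (1 / p)"
 have V: "0 < V" using Y by (simp add: V_def)
 have U_le: "U powr (p - 2) <= V powr (p - 2) + U powr p * V powr - 2" if "0 <= U" for U
 proof (cases "U <= V")
  case True
  then show ?thesis using that p powr_mono2[of "p - 2" U V] by (auto intro: add_increasing2)
 next
  case False
  have "U powr (p - 2) = U powr p * U powr - 2" using False V by (simp add: powr_add[symmetric])
  also have "... <= U powr p * V powr - 2" using False V by (intro mult_left_mono powr_mono2') auto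
  finally show ?thesis by (auto intro: add_increasing)
 qed
 have iU: "integrable M (\<lambda>x. (2 * B + \<bar>S i (T x)\<bar>) powr r)" if "0 <= r" for r
  using that B_pos by (intro T_int integrable_abs_powr_S) auto
 have second: "(MEAN x. (2 * B + \<bar>S i (T x)\<bar>) powr (p - 2)) <= 2 * Y powr (1 - 2 / p)"
 proof -
  have "(MEAN x. (2 * B + \<bar>S i (T x)\<bar>) powr (p - 2)) <= (MEAN x. V powr (p - 2) + (2 * B + \<bar>S i (T x)\<bar>) powr p * V powr - 2)"
   using iU p B_pos U_le by (intro integral_mono Bochner_Integration.integrable_add integrable_mult_left) auto
  also have "... = V powr (p - 2) + (MEAN x. (2 * B + \<bar>S i (T x)\<bar>) powr p) * V powr - 2"
   using iU[of p] p prob_space by (subst Bochner_Integration.integral_add) auto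
  also have "(MEAN x. (2 * B + \<bar>S i (T x)\<bar>) powr p) = (MEAN x. (2 * B + \<bar>S i x\<bar>) powr p)"
   by (rule T_invariant) measurable
  also have "V powr (p - 2) + ... * V powr - 2 <= V powr (p - 2) + Y * V powr - 2"
   using Y(2)[of i] by (intro add_left_mono mult_right_mono) auto
  also have "V powr (p - 2) = Y powr (1 - 2 / p)" using p by (simp add: V_def powr_powr diff_divide_distrib)
  also have "Y * V powr - 2 = Y powr 1 * Y powr (- 2 / p)" using Y by (simp add: V_def powr_powr)
  also have "... = Y powr (1 - 2 / p)" by (simp only: powr_add[symmetric]) simp
  finally show ?thesis by simp
 qed
 have dI: "integrable M (\<lambda>x. \<phi> x * dpow p (S i (T x)))"
  unfolding dpow_eq sum_distrib_left by (intro Bochner_Integration.integrable_sum Z_int)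
 have i1: "integrable M (\<lambda>x. \<bar>S i (T x)\<bar> powr p)"
  using p by (intro T_int integrable_abs_powr_S(2)[of p 0]) auto
 have i2: "integrable M (\<lambda>x. p * (p - 1) * B\<^sup>2 * (2 * B + \<bar>S i (T x)\<bar>) powr (p - 2))"
  using p by (intro integrable_mult_right iU) auto
 have "moment p (Suc i) <= (MEAN x. \<bar>S i (T x)\<bar> powr p + \<phi> x * dpow p (S i (T x)) + p * (p - 1) * B\<^sup>2 * (2 * B + \<bar>S i (T x)\<bar>) powr (p - 2))"
  unfolding moment_def
 proof (rule integral_mono)
  show "integrable M (\<lambda>x. \<bar>S (Suc i) x\<bar> powr p)" using p by (intro integrable_abs_powr_S(2)[of p 0]) auto
  show "integrable M (\<lambda>x. \<bar>S i (T x)\<bar> powr p + \<phi> x * dpow p (S i (T x)) + p * (p - 1) * B\<^sup>2 * (2 * B + \<bar>S i (T x)\<bar>) powr (p - 2))"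
   by (intro Bochner_Integration.integrable_add i1 dI i2)
  fix x assume x: "x \<in> space M"
  have "\<bar>S (Suc i) x\<bar> powr p <= \<bar>S i (T x)\<bar> powr p + \<phi> x * dpow p (S i (T x)) + p * (p - 1) * (\<phi> x)\<^sup>2 * (2 * \<bar>\<phi> x\<bar> + \<bar>S i (T x)\<bar>) powr (p - 2)"
   unfolding S_Suc by (rule abs_powr_taylor[OF p(1)])
  also have "p * (p - 1) * (\<phi> x)\<^sup>2 * (2 * \<bar>\<phi> x\<bar> + \<bar>S i (T x)\<bar>) powr (p - 2) <= p * (p - 1) * B\<^sup>2 * (2 * B + \<bar>S i (T x)\<bar>) powr (p - 2)"
   using phi_bound[OF x] p B_pos by (intro mult_mono powr_mono2) (auto simp: abs_le_square_iff[symmetric])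
  finally show "\<bar>S (Suc i) x\<bar> powr p <= \<bar>S i (T x)\<bar> powr p + \<phi> x * dpow p (S i (T x)) + p * (p - 1) * B\<^sup>2 * (2 * B + \<bar>S i (T x)\<bar>) powr (p - 2)"
   by simp
 qed
 also have "... = (MEAN x. \<bar>S i (T x)\<bar> powr p) + (MEAN x. \<phi> x * dpow p (S i (T x))) + p * (p - 1) * B\<^sup>2 * (MEAN x. (2 * B + \<bar>S i (T x)\<bar>) powr (p - 2))"
  by (simp only: Bochner_Integration.integral_add[OF Bochner_Integration.integrable_add[OF i1 dI] i2]
    Bochner_Integration.integral_add[OF i1 dI] integral_mult_right_zero)
 also have "(MEAN x. \<bar>S i (T x)\<bar> powr p) = moment p i"
  unfolding moment_def by (rule T_invariant) measurable
 also have "moment p i + (MEAN x. \<phi> x * dpow p (S i (T x))) + p * (p - 1) * B\<^sup>2 * (MEAN x. (2 * B + \<bar>S i (T x)\<bar>) powr (p - 2))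
   <= moment p i + (C + B) * \<Lambda> * (\<Sum>k. real (Suc k) powr - (2 * \<beta> / p)) + p * (p - 1) * B\<^sup>2 * (2 * Y powr (1 - 2 / p))"
  using first second p B_pos by (intro add_mono mult_left_mono) auto
 also have "... = moment p i + p * (p - 1) * B * ((C + B) * (\<Sum>k. real (Suc k) powr - (2 * \<beta> / p)) + 2 * B) * Y powr (1 - 2 / p)"
  unfolding \<Lambda>_def q(3) by (simp add: power2_eq_square algebra_simps)
 finally show ?thesis .
qed

text \<open>Adding \<open>m\<close> increments from \<open>moment_step\<close> with \<open>Y\<close> of the order \<open>K * m powr (p / 2)\<close> gives
\<open>K powr (1 - 2 / p) * m powr (p / 2)\<close>; the exponent of \<open>K\<close> is below 1, so the induction closes for
large \<open>K\<close>.\<close>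
theorem moment_bound:
 assumes p: "2 < p" "p < 2 * \<beta>"
 shows "\<exists>K. \<forall>m. moment p m <= K * real m powr (p / 2)"
proof -
 define K1 where "K1 = p * (p - 1) * B * ((C + B) * (\<Sum>k. real (Suc k) powr - (2 * \<beta> / p)) + 2 * B)"
 have sm: "summable (\<lambda>k. real (Suc k) powr - (2 * \<beta> / p))" by (rule summable_Suc_powr) (use p in simp)
 have K1: "0 <= K1" unfolding K1_def using p B_pos C_nonneg by (intro mult_nonneg_nonneg add_nonneg_nonneg suminf_nonneg sm) auto
 define L :: real where "L = 2 powr p * 2"
 have L: "0 < L" by (simp add: L_def)
 define K where "K = max ((2 * B) powr p) ((K1 * L powr (1 - 2 / p)) powr (p / 2))"
 have K: "0 < K" "(2 * B) powr p <= K" using B_pos by (auto simp: K_def less_max_iff_disj)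
 have K_close: "K1 * (L * K) powr (1 - 2 / p) <= K"
 proof -
  have "K1 * L powr (1 - 2 / p) = ((K1 * L powr (1 - 2 / p)) powr (p / 2)) powr (2 / p)"
   using p K1 by (simp add: powr_powr)
  also have "... <= K powr (2 / p)" using p by (intro powr_mono2) (auto simp: K_def)
  finally have "K1 * L powr (1 - 2 / p) * K powr (1 - 2 / p) <= K powr (2 / p) * K powr (1 - 2 / p)"
   by (intro mult_right_mono) auto
  also have "... = K" using K by (simp add: powr_add[symmetric])
  finally show ?thesis using L K by (simp add: powr_mult mult.assoc)
 qed
 have "\<forall>j\<le>m. moment p j <= K * real j powr (p / 2)" for m
 proof (induction m)
  case 0
  show ?case using p by (simp add: moment_def)
 next
  case (Suc m)
  define Y where "Y = L * K * real (Suc m) powr (p / 2)"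
  have Y: "0 < Y" using L K by (simp add: Y_def)
  have Yj: "(MEAN x. (2 * B + \<bar>S j x\<bar>) powr p) <= Y" if "j <= m" for j
  proof -
   have "(MEAN x. (2 * B + \<bar>S j x\<bar>) powr p) <= (MEAN x. 2 powr p * ((2 * B) powr p + \<bar>S j x\<bar> powr p))"
    using p B_pos by (intro integral_mono integrable_mult_right Bochner_Integration.integrable_add integrable_abs_powr_S(2)[of p 0] integrable_abs_powr_S(1) powr_add_le) auto
   also have "... = 2 powr p * ((2 * B) powr p + moment p j)"
    using integrable_abs_powr_S(2)[of p 0 j] p prob_space by (simp add: moment_def)
   also have "... <= 2 powr p * (K * real (Suc m) powr (p / 2) + K * real (Suc m) powr (p / 2))"
   proof (intro mult_left_mono add_mono)
    have "1 <= real (Suc m) powr (p / 2)" using p by (intro ge_one_powr_ge_zero) auto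
    then have "K * 1 <= K * real (Suc m) powr (p / 2)" using K by (intro mult_left_mono) auto
    then show "(2 * B) powr p <= K * real (Suc m) powr (p / 2)" using K(2) unfolding mult_1_right by linarith
    have "moment p j <= K * real j powr (p / 2)" using Suc that by auto
    also have "... <= K * real (Suc m) powr (p / 2)" using that K p by (intro mult_left_mono powr_mono2) auto
    finally show "moment p j <= K * real (Suc m) powr (p / 2)" .
   qed auto
   also have "... = Y" by (simp add: Y_def L_def)
   finally show ?thesis .
  qed
  have inc: "moment p (Suc i) - moment p i <= K1 * Y powr (1 - 2 / p)" if "i <= m" for i
   using moment_step[OF p Y, of i] Yj that unfolding K1_def by auto
  have "moment p (Suc m) = (\<Sum>i<Suc m. moment p (Suc i) - moment p i)"
   using p by (subst sum_lessThan_telescope) (simp add: moment_def)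
  also have "... <= (\<Sum>i<Suc m. K1 * Y powr (1 - 2 / p))" using inc by (intro sum_mono) auto
  also have "... = real (Suc m) * (K1 * Y powr (1 - 2 / p))" by simp
  also have "Y powr (1 - 2 / p) = (L * K) powr (1 - 2 / p) * real (Suc m) powr (p / 2 - 1)"
  proof -
   have "p / 2 * (1 - 2 / p) = p / 2 - 1" using p by (simp add: field_simps)
   then show ?thesis using L K by (simp add: Y_def powr_mult powr_powr diff_divide_distrib)
  qed
  also have "real (Suc m) * (K1 * ...) = K1 * (L * K) powr (1 - 2 / p) * (real (Suc m) powr 1 * real (Suc m) powr (p / 2 - 1))"
   by (simp add: mult_ac)
  also have "real (Suc m) powr 1 * real (Suc m) powr (p / 2 - 1) = real (Suc m) powr (p / 2)"
   by (simp only: powr_add[symmetric]) simp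
  also have "K1 * (L * K) powr (1 - 2 / p) * real (Suc m) powr (p / 2) <= K * real (Suc m) powr (p / 2)"
   by (intro mult_right_mono K_close) auto
  finally show ?case using Suc by (auto simp: le_Suc_eq)
 qed
 then show ?thesis by blast
qed

end

section \<open>Replacing one summand\<close>

lemma norm_iexp_minus_1: "norm (iexp x - 1) <= \<bar>x\<bar>"
 using iexp_approx1[of x 0] by simp

lemma norm_iexp_minus_linear: "norm (iexp x - (1 + \<i> * x)) <= x\<^sup>2"
proof -
 have "norm (iexp x - (1 + \<i> * x)) * 2 <= x\<^sup>2"
  using iexp_approx1[of x 1] by (simp add: power2_eq_square)
 then show ?thesis using norm_ge_zero[of "iexp x - (1 + \<i> * x)"] by linarith
qed

lemma norm_iexp_minus_quadratic: "norm (iexp x - (1 + \<i> * x - x\<^sup>2 / 2)) <= \<bar>x\<bar> ^ 3"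
proof -
 have "(\<Sum>k\<le>2. (\<i> * x)^k / fact k) = 1 + \<i> * x - x\<^sup>2 / 2"
  by (simp add: numeral_2_eq_2 atMost_Suc power_mult_distrib)
 then have "norm (iexp x - (1 + \<i> * x - x\<^sup>2 / 2)) <= \<bar>x\<bar> ^ 3 / 6"
  using iexp_approx1[of x 2] by (simp add: fact_numeral numeral_3_eq_3 numeral_2_eq_2)
 then show ?thesis using zero_le_power[of "\<bar>x\<bar>" 3] by linarith
qed

context mixing_system
begin

lemma integral_diff_le:
 fixes F G :: "'a => 'b :: {banach, second_countable_topology}"
 assumes "integrable M F" "integrable M G" "!!x. x \<in> space M ==> norm (F x - G x) <= K"
 shows "norm ((MEAN x. F x) - (MEAN x. G x)) <= K"
proof -
 have "norm (MEAN x. F x - G x) <= (MEAN x. norm (F x - G x))" by (rule integral_norm_bound)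
 also have "... <= (MEAN x. K)" using assms by (intro integral_mono) auto
 finally show ?thesis using assms prob_space by (simp add: Bochner_Integration.integral_diff)
qed

lemma integral_norm_le:
 fixes F :: "'a => 'b :: {banach, second_countable_topology}"
 assumes "F \<in> borel_measurable M" "!!x. x \<in> space M ==> norm (F x) <= K"
 shows "norm (MEAN x. F x) <= K"
 using integral_diff_le[of F "\<lambda>_. 0" K] integrable_bdd[OF assms] assms(2) by simp

lemma decay_complex:
 fixes Z :: "'a => complex"
 assumes k: "1 <= k" and Z[measurable]: "Z \<in> borel_measurable M" and V: "0 < V" "!!x. x \<in> space M ==> norm (Z x) <= V"
 shows "norm (MEAN x. \<phi> x * Z ((T ^^ k) x)) <= 2 * C * V * real k powr - \<beta>"
proof -
 have int: "integrable M (\<lambda>x. \<phi> x * Z ((T ^^ k) x))"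
  using phi_bound V T_pow_space B_pos by (intro integrable_bdd[of _ "B * V"]) (auto simp: norm_mult intro!: mult_mono)
 have part: "\<bar>MEAN x. \<phi> x * r (Z ((T ^^ k) x))\<bar> <= C * V * real k powr - \<beta>"
  if r[measurable]: "r \<in> borel_measurable borel" and rz: "!!z. \<bar>r z\<bar> <= norm z" for r :: "complex => real"
 proof -
  have "\<bar>MEAN x. \<phi> x * (r (Z ((T ^^ k) x)) / V)\<bar> <= C * real k powr - \<beta>"
  proof (rule decay[OF k, of "\<lambda>x. r (Z x) / V"])
   show "\<bar>r (Z x) / V\<bar> <= 1" if "x \<in> space M" for x
    using order_trans[OF rz V(2)[OF that]] V(1) by simp
  qed measurable
  then have "V * \<bar>MEAN x. \<phi> x * (r (Z ((T ^^ k) x)) / V)\<bar> <= V * (C * real k powr - \<beta>)"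
   using V(1) by (intro mult_left_mono) auto
  then show ?thesis using V(1) by (simp add: mult_ac)
 qed
 have "norm (MEAN x. \<phi> x * Z ((T ^^ k) x)) <= \<bar>Re (MEAN x. \<phi> x * Z ((T ^^ k) x))\<bar> + \<bar>Im (MEAN x. \<phi> x * Z ((T ^^ k) x))\<bar>"
  by (rule cmod_le)
 also have "Re (MEAN x. \<phi> x * Z ((T ^^ k) x)) = (MEAN x. \<phi> x * Re (Z ((T ^^ k) x)))"
  using integral_Re[OF int] by simp
 also have "Im (MEAN x. \<phi> x * Z ((T ^^ k) x)) = (MEAN x. \<phi> x * Im (Z ((T ^^ k) x)))"
  using integral_Im[OF int] by simp
 also have "\<bar>(MEAN x. \<phi> x * Re (Z ((T ^^ k) x)))\<bar> + \<bar>(MEAN x. \<phi> x * Im (Z ((T ^^ k) x)))\<bar>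
   <= C * V * real k powr - \<beta> + C * V * real k powr - \<beta>"
  by (intro add_mono part) (auto simp: abs_Re_le_cmod abs_Im_le_cmod)
 finally show ?thesis by simp
qed

definition cov :: "nat => real" where "cov k = (MEAN x. \<phi> x * \<phi> ((T ^^ k) x))"

lemma cov_decay: "1 <= k ==> \<bar>cov k\<bar> <= B * C * real k powr - \<beta>"
proof -
 assume k: "1 <= k"
 have "\<bar>MEAN x. \<phi> x * (\<phi> ((T ^^ k) x) / B)\<bar> <= C * real k powr - \<beta>"
  by (rule decay[OF k, of "\<lambda>x. \<phi> x / B"]) (use phi_bound B_pos in auto)
 then have "B * \<bar>MEAN x. \<phi> x * (\<phi> ((T ^^ k) x) / B)\<bar> <= B * (C * real k powr - \<beta>)"
  using B_pos by (intro mult_left_mono) auto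
 then show ?thesis using B_pos by (simp add: cov_def mult_ac)
qed

lemma cov_bound: "\<bar>cov k\<bar> <= B\<^sup>2"
 unfolding cov_def real_norm_def[symmetric]
 using phi_bound T_pow_space B_pos
 by (intro integral_norm_le) (auto simp: abs_mult power2_eq_square intro!: mult_mono)

text \<open>The tails of the series that bounds the covariances.\<close>
definition rest :: "nat => real" where "rest K = (\<Sum>k. real (Suc (k + K)) powr - \<beta>)"

lemmas summable_powr_beta = summable_Suc_powr[OF beta_gt_1]

lemma rest_tendsto: "rest \<longlonglongrightarrow> 0"
 using suminf_exist_split2[OF summable_powr_beta] by (simp add: rest_def[abs_def])

lemma rest_nonneg: "0 <= rest K"
 unfolding rest_def using summable_ignore_initial_segment[OF summable_powr_beta, of K] by (intro suminf_nonneg) auto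

lemma sum_le_rest: "(\<Sum>k\<in>{K..<m}. real (Suc k) powr - \<beta>) <= rest K"
proof (cases "K <= m")
 case True
 have "(\<Sum>k\<in>{K..<m}. real (Suc k) powr - \<beta>) = (\<Sum>k<m - K. real (Suc (k + K)) powr - \<beta>)"
  using True by (intro sum.reindex_bij_witness[of _ "\<lambda>k. k + K" "\<lambda>k. k - K"]) auto
 also have "... <= rest K"
  unfolding rest_def using summable_ignore_initial_segment[OF summable_powr_beta, of K]
  by (intro sum_le_suminf) auto
 finally show ?thesis .
qed (simp add: rest_nonneg)

lemma summable_abs_cov: "summable (\<lambda>k. \<bar>cov (Suc k)\<bar>)"
 using cov_decay[of "Suc _"] by (intro summable_comparison_test[OF _ summable_mult[OF summable_powr_beta, of "B * C"]]) auto

definition sigma2 :: real where "sigma2 = cov 0 + 2 * (\<Sum>k. cov (Suc k))"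

lemma sigma2_partial: "\<bar>sigma2 / 2 - (cov 0 / 2 + (\<Sum>k<K. cov (Suc k)))\<bar> <= B * C * rest K"
proof -
 have s: "summable (\<lambda>k. cov (Suc k))" by (rule summable_rabs_cancel[OF summable_abs_cov])
 have "sigma2 / 2 - (cov 0 / 2 + (\<Sum>k<K. cov (Suc k))) = (\<Sum>k. cov (Suc (k + K)))"
  using suminf_split_initial_segment[OF s, of K] by (simp add: sigma2_def field_simps)
 also have "\<bar>...\<bar> <= (\<Sum>k. \<bar>cov (Suc (k + K))\<bar>)"
  using summable_ignore_initial_segment[OF summable_abs_cov, of K] by (intro summable_rabs) simp
 also have "... <= (\<Sum>k. B * C * real (Suc (k + K)) powr - \<beta>)"
  using summable_ignore_initial_segment[OF summable_abs_cov, of K]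
   summable_ignore_initial_segment[OF summable_powr_beta, of K]
  by (intro suminf_le summable_mult cov_decay) auto
 also have "... = B * C * rest K"
  unfolding rest_def using summable_ignore_initial_segment[OF summable_powr_beta, of K] by (intro suminf_mult) auto
 finally show ?thesis .
qed

text \<open>The characteristic function of a block, weighted with a function \<open>H\<close> of the orbit after the block, is the
mean of this variable.\<close>
definition Zf :: "real => ('a => real) => nat => 'a => complex" where
 "Zf a H m x = iexp (a * S m x) * complex_of_real (H ((T ^^ m) x))"

lemma S_add: "S (l + m) x = S l x + S m ((T ^^ l) x)"
 by (induction l arbitrary: x) (auto simp: S_Suc funpow_swap1)

context
 fixes a :: real and H :: "'a => real"
 assumes H_meas [measurable]: "H \<in> borel_measurable M" and H_bound: "!!x. x \<in> space M ==> \<bar>H x\<bar> <= 1"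
begin

abbreviation "Z \<equiv> Zf a H"

lemma Z_meas [measurable]: "Z m \<in> borel_measurable M"
 unfolding Zf_def[abs_def] by measurable

lemma Z_bound: "x \<in> space M ==> norm (Z m x) <= 1"
 using H_bound T_pow_space by (simp add: Zf_def norm_mult)

lemma Z_T_bound: "x \<in> space M ==> norm (Z m ((T ^^ k) x)) <= 1"
 using Z_bound T_pow_space by blast

lemma Z_add: "Z (l + m) x = iexp (a * S l x) * Z m ((T ^^ l) x)"
proof -
 have "(T ^^ (l + m)) x = (T ^^ m) ((T ^^ l) x)"
  by (simp add: funpow_add[of m l] add.commute[of l m])
 then show ?thesis by (simp add: Zf_def S_add exp_add distrib_left)
qed

lemma Z_shift_diff: "x \<in> space M ==> norm (Z (l + m) x - Z m ((T ^^ l) x)) <= real l * (\<bar>a\<bar> * B)"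
proof -
 assume x: "x \<in> space M"
 have "Z (l + m) x - Z m ((T ^^ l) x) = (iexp (a * S l x) - 1) * Z m ((T ^^ l) x)"
  by (simp add: Z_add left_diff_distrib)
 also have "norm ... <= \<bar>a * S l x\<bar> * 1"
  unfolding norm_mult by (intro mult_mono norm_iexp_minus_1 Z_T_bound x) auto
 also have "... <= real l * (\<bar>a\<bar> * B)"
  using mult_left_mono[OF S_bound[OF x, of l], of "\<bar>a\<bar>"] by (simp add: abs_mult mult_ac)
 finally show ?thesis .
qed

lemma int_mult_Z:
 fixes \<psi> :: "'a => real"
 assumes "\<psi> \<in> borel_measurable M" "!!x. x \<in> space M ==> \<bar>\<psi> x\<bar> <= V"
 shows "integrable M (\<lambda>x. complex_of_real (\<psi> x) * Z m ((T ^^ k) x))"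
proof (rule integrable_bdd[of _ "V * 1"])
 fix x assume x: "x \<in> space M"
 show "norm (complex_of_real (\<psi> x) * Z m ((T ^^ k) x)) <= V * 1"
  unfolding norm_mult norm_of_real using assms(2)[OF x] Z_T_bound[OF x] order_trans[OF abs_ge_zero assms(2)[OF x]]
  by (intro mult_mono) auto
next
 show "(\<lambda>x. complex_of_real (\<psi> x) * Z m ((T ^^ k) x)) \<in> borel_measurable M"
  using assms(1) by (intro borel_measurable_times measurable_compose[OF T_pow_meas Z_meas]) auto
qed

text \<open>Dropping the first terms of the sum makes \<open>Z m\<close> a function of the orbit after time \<open>L\<close>, to which mixing
applies; each dropped term costs at most \<open>\<bar>a\<bar> * B\<close>.\<close>
lemma decouple:
 fixes \<psi> :: "'a => real"
 assumes \<psi>[measurable]: "\<psi> \<in> borel_measurable M" and V: "!!x. x \<in> space M ==> \<bar>\<psi> x\<bar> <= V" "0 <= V"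
  and mix: "!!Z :: 'a => complex. Z \<in> borel_measurable M ==> (!!x. x \<in> space M ==> norm (Z x) <= 1) ==>
    norm ((MEAN x. \<psi> x * Z ((T ^^ L) x)) - (MEAN x. \<psi> x) * (MEAN x. Z x)) <= \<epsilon>"
  and k: "k <= L" "L <= k + m"
 shows "norm ((MEAN x. \<psi> x * Z m ((T ^^ k) x)) - (MEAN x. \<psi> x) * (MEAN x. Z m x)) <= \<epsilon> + 2 * V * (real L * (\<bar>a\<bar> * B))"
proof -
 define l where "l = L - k"
 define m' where "m' = m - l"
 have lm: "m = l + m'" "k + l = L" "l <= L" using k by (auto simp: l_def m'_def)
 have aB: "0 <= \<bar>a\<bar> * B" using B_pos by simp
 have TT: "(T ^^ L) x = (T ^^ l) ((T ^^ k) x)" for x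
  unfolding lm(2)[symmetric] by (simp add: funpow_add[of l k] add.commute[of k l])
 have 1: "norm ((MEAN x. \<psi> x * Z m ((T ^^ k) x)) - (MEAN x. \<psi> x * Z m' ((T ^^ L) x))) <= V * (real L * (\<bar>a\<bar> * B))"
 proof (rule integral_diff_le[OF int_mult_Z[OF \<psi> V(1)] int_mult_Z[OF \<psi> V(1)]])
  fix x assume x: "x \<in> space M"
  have "norm (complex_of_real (\<psi> x) * Z m ((T ^^ k) x) - complex_of_real (\<psi> x) * Z m' ((T ^^ L) x)) =
    \<bar>\<psi> x\<bar> * norm (Z (l + m') ((T ^^ k) x) - Z m' ((T ^^ l) ((T ^^ k) x)))"
   unfolding TT lm(1) by (simp add: right_diff_distrib[symmetric] norm_mult)
  also have "... <= V * (real l * (\<bar>a\<bar> * B))"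
   by (intro mult_mono V Z_shift_diff T_pow_space x x norm_ge_zero)
  also have "... <= V * (real L * (\<bar>a\<bar> * B))" using lm aB V by (intro mult_left_mono mult_right_mono) auto
  finally show "norm (complex_of_real (\<psi> x) * Z m ((T ^^ k) x) - complex_of_real (\<psi> x) * Z m' ((T ^^ L) x)) <= V * (real L * (\<bar>a\<bar> * B))" .
 qed
 have 2: "norm ((MEAN x. \<psi> x * Z m' ((T ^^ L) x)) - (MEAN x. \<psi> x) * (MEAN x. Z m' x)) <= \<epsilon>"
  by (rule mix[OF Z_meas Z_bound])
 have 3: "norm ((MEAN x. Z m x) - (MEAN x. Z m' x)) <= real L * (\<bar>a\<bar> * B)"
 proof -
  have "(MEAN x. Z m' x) = (MEAN x. Z m' ((T ^^ l) x))" by (rule T_pow_invariant[symmetric]) measurable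
  moreover have "norm ((MEAN x. Z m x) - (MEAN x. Z m' ((T ^^ l) x))) <= real L * (\<bar>a\<bar> * B)"
  proof (rule integral_diff_le)
   show "integrable M (Z m)" by (rule integrable_bdd[OF Z_meas Z_bound])
   show "integrable M (\<lambda>x. Z m' ((T ^^ l) x))" by (rule integrable_bdd[of _ 1]) (auto intro: Z_T_bound)
   fix x assume x: "x \<in> space M"
   show "norm (Z m x - Z m' ((T ^^ l) x)) <= real L * (\<bar>a\<bar> * B)"
    unfolding lm(1) by (rule order_trans[OF Z_shift_diff[OF x] mult_right_mono[OF _ aB]]) (use lm(3) in simp)
  qed
  ultimately show ?thesis by simp
 qed
 have P: "norm (complex_of_real (MEAN x. \<psi> x)) <= V"
  using integral_norm_le[OF \<psi>, of V] V by simp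
 have "norm ((MEAN x. \<psi> x) * (MEAN x. Z m' x) - (MEAN x. \<psi> x) * (MEAN x. Z m x)) <= V * (real L * (\<bar>a\<bar> * B))"
  unfolding right_diff_distrib[symmetric] norm_mult
  using 3 P V by (intro mult_mono) (auto simp: norm_minus_commute)
 with 1 2 show ?thesis
  using norm_triangle_ineq[of "(MEAN x. \<psi> x * Z m ((T ^^ k) x)) - (MEAN x. \<psi> x * Z m' ((T ^^ L) x))"
    "(MEAN x. \<psi> x * Z m' ((T ^^ L) x)) - (MEAN x. \<psi> x) * (MEAN x. Z m' x)"]
   norm_triangle_ineq[of "(MEAN x. \<psi> x * Z m ((T ^^ k) x)) - (MEAN x. \<psi> x) * (MEAN x. Z m' x)"
    "(MEAN x. \<psi> x) * (MEAN x. Z m' x) - (MEAN x. \<psi> x) * (MEAN x. Z m x)"]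
  by simp
qed

text \<open>Expand the exponential of the first summand to second order. The second order term decouples and
gives half of the variance. The first order term is the mean of \<open>\<phi>\<close> times \<open>Z m \<circ> T\<close>; telescoping over later and later
starting times turns it into a sum over gaps \<open>k\<close>, in which a second expansion produces the
covariance of \<open>\<phi>\<close> and \<open>\<phi> \<circ> T ^^ Suc k\<close>. For \<open>k < K\<close> mixing decouples it from the rest of the process,
for \<open>k \<ge> K\<close> the decay of correlations makes the contributions small.\<close>
lemma lindeberg_step:
 assumes mix: "!!k (Z :: 'a => complex). k <= K ==> Z \<in> borel_measurable M ==> (!!x. x \<in> space M ==> norm (Z x) <= 1) ==>
    norm ((MEAN x. complex_of_real (\<phi> x * \<phi> ((T ^^ k) x)) * Z ((T ^^ L) x)) - cov k * (MEAN x. Z x)) <= \<epsilon>"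
  and m: "Suc K <= L" "L <= Suc m"
 shows "norm ((MEAN x. Z (Suc m) x) - (1 - a\<^sup>2 * (sigma2 / 2)) * (MEAN x. Z m x)) \<le>
   a\<^sup>2 * ((real K + 1/2) * \<epsilon> + 3 * B * C * rest K)
   + \<bar>a\<bar> ^ 3 * (B ^ 3 * (1 + real K * (1 + 3 * real L) + real L))
   + \<bar>a\<bar> * (2 * C * real (Suc m) powr - \<beta>)"
proof -
 define I where "I m = (MEAN x. Z m x)" for m
 have I_T: "(MEAN x. Z m (T x)) = I m" unfolding I_def by (rule T_invariant) measurable
 have aB: "0 <= \<bar>a\<bar> * B" using B_pos by simp
 have phi2: "\<bar>\<phi> x * \<phi> ((T ^^ k) x)\<bar> <= B\<^sup>2" if "x \<in> space M" for x k
  unfolding abs_mult power2_eq_square using phi_bound[OF that] phi_bound[OF T_pow_space[OF that]] B_pos by (intro mult_mono) auto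
 have covk: "(MEAN x. \<phi> x * \<phi> ((T ^^ k) x)) = cov k" for k by (simp add: cov_def)
 have prod: "norm ((MEAN x. (\<phi> x * \<phi> ((T ^^ k) x)) * Z j ((T ^^ i) x)) - cov k * I j) <= \<epsilon> + 2 * B\<^sup>2 * (real L * (\<bar>a\<bar> * B))"
  if "k <= K" "i <= L" "L <= i + j" for k i j
 proof -
  have "norm ((MEAN x. (\<phi> x * \<phi> ((T ^^ k) x)) * Z j ((T ^^ i) x)) - (MEAN x. \<phi> x * \<phi> ((T ^^ k) x)) * (MEAN x. Z j x)) <= \<epsilon> + 2 * B\<^sup>2 * (real L * (\<bar>a\<bar> * B))"
  proof (rule decouple)
   show "norm ((MEAN x. complex_of_real (\<phi> x * \<phi> ((T ^^ k) x)) * Z ((T ^^ L) x)) - complex_of_real (MEAN x. \<phi> x * \<phi> ((T ^^ k) x)) * (MEAN x. Z x)) <= \<epsilon>"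
    if "Z \<in> borel_measurable M" "!!x. x \<in> space M ==> norm (Z x) <= 1" for Z :: "'a => complex"
    using mix[OF \<open>k <= K\<close> that] unfolding covk .
  qed (use that phi2 in auto)
  then show ?thesis unfolding covk I_def .
 qed
 define D where "D j y = Z (Suc j) y - Z j (T y)" for j y
 have D_meas[measurable]: "D j \<in> borel_measurable M" for j unfolding D_def[abs_def] by measurable
 have D_eq: "D j y = (iexp (a * \<phi> y) - 1) * Z j (T y)" for j y
  using Z_add[of 1 j y] by (simp add: D_def S_def left_diff_distrib)
 have D_bound: "norm (D j y) <= \<bar>a\<bar> * B" if y: "y \<in> space M" for j y
  using Z_shift_diff[OF y, of 1 j] by (simp add: D_def)
 have D_lin: "norm (D j y - \<i> * (a * \<phi> y) * Z j (T y)) <= a\<^sup>2 * B\<^sup>2" if y: "y \<in> space M" for j y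
 proof -
  have "D j y - \<i> * (a * \<phi> y) * Z j (T y) = (iexp (a * \<phi> y) - (1 + \<i> * (a * \<phi> y))) * Z j (T y)"
   by (simp add: D_eq algebra_simps)
  also have "norm ... <= (a * \<phi> y)\<^sup>2 * 1"
   unfolding norm_mult using norm_iexp_minus_linear[of "a * \<phi> y"] Z_T_bound[OF y, of j 1] by (intro mult_mono) auto
  also have "... <= a\<^sup>2 * B\<^sup>2"
   using phi_bound[OF y] B_pos by (auto simp: power_mult_distrib abs_le_square_iff[symmetric] intro!: mult_left_mono)
  finally show ?thesis .
 qed
 define J where "J k = (MEAN x. \<phi> x * D (m - Suc k) ((T ^^ Suc k) x))" for k
 have intD: "integrable M (\<lambda>x. complex_of_real (\<phi> x) * D j ((T ^^ Suc k) x))" for j k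
 proof (rule integrable_bdd[of _ "B * (\<bar>a\<bar> * B)"])
  fix x assume x: "x \<in> space M"
  show "norm (complex_of_real (\<phi> x) * D j ((T ^^ Suc k) x)) <= B * (\<bar>a\<bar> * B)"
   unfolding norm_mult norm_of_real by (intro mult_mono phi_bound x D_bound T_pow_space norm_ge_zero less_imp_le[OF B_pos])
 qed measurable
 \<comment> \<open>gaps k < K: a second expansion, then decoupling\<close>
 have near: "norm (J k - \<i> * a * cov (Suc k) * I m) <= \<bar>a\<bar> * \<epsilon> + a\<^sup>2 * B ^ 3 * (1 + 3 * real L)" if k: "k < K" for k
 proof -
  define j where "j = m - Suc k"
  have j: "m = Suc k + j" using k m by (simp add: j_def)
  have "norm (J k - (MEAN x. \<i> * a * (complex_of_real (\<phi> x * \<phi> ((T ^^ Suc k) x)) * Z j ((T ^^ Suc (Suc k)) x)))) <= B * (a\<^sup>2 * B\<^sup>2)"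
   unfolding J_def j_def[symmetric]
  proof (rule integral_diff_le[OF intD])
   show "integrable M (\<lambda>x. \<i> * a * (complex_of_real (\<phi> x * \<phi> ((T ^^ Suc k) x)) * Z j ((T ^^ Suc (Suc k)) x)))"
    by (intro integrable_mult_right int_mult_Z[of _ "B\<^sup>2"] phi2) measurable
   fix x assume x: "x \<in> space M"
   have "complex_of_real (\<phi> x) * D j ((T ^^ Suc k) x) - \<i> * a * (complex_of_real (\<phi> x * \<phi> ((T ^^ Suc k) x)) * Z j ((T ^^ Suc (Suc k)) x))
     = \<phi> x * (D j ((T ^^ Suc k) x) - \<i> * (a * \<phi> ((T ^^ Suc k) x)) * Z j (T ((T ^^ Suc k) x)))"
    by (simp add: algebra_simps)
   also have "norm ... <= B * (a\<^sup>2 * B\<^sup>2)"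
    unfolding norm_mult norm_of_real by (intro mult_mono phi_bound x D_lin T_pow_space norm_ge_zero less_imp_le[OF B_pos])
   finally show "norm (complex_of_real (\<phi> x) * D j ((T ^^ Suc k) x) - \<i> * a * (complex_of_real (\<phi> x * \<phi> ((T ^^ Suc k) x)) * Z j ((T ^^ Suc (Suc k)) x))) <= B * (a\<^sup>2 * B\<^sup>2)" .
  qed
  then have 1: "norm (J k - \<i> * a * (MEAN x. (\<phi> x * \<phi> ((T ^^ Suc k) x)) * Z j ((T ^^ Suc (Suc k)) x))) <= B * (a\<^sup>2 * B\<^sup>2)"
   by simp
  have 2: "norm ((MEAN x. (\<phi> x * \<phi> ((T ^^ Suc k) x)) * Z j ((T ^^ Suc (Suc k)) x)) - cov (Suc k) * I j) <= \<epsilon> + 2 * B\<^sup>2 * (real L * (\<bar>a\<bar> * B))"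
   using k m j by (intro prod) auto
  have 3: "norm (I j - I m) <= real L * (\<bar>a\<bar> * B)"
  proof -
   have e1: "I j = (MEAN x. Z j ((T ^^ Suc k) x))" unfolding I_def by (rule T_pow_invariant[symmetric]) measurable
   have b1: "norm ((MEAN x. Z m x) - (MEAN x. Z j ((T ^^ Suc k) x))) <= real (Suc k) * (\<bar>a\<bar> * B)"
   proof (rule integral_diff_le)
    show "integrable M (Z m)" by (rule integrable_bdd[OF Z_meas Z_bound])
    show "integrable M (\<lambda>x. Z j ((T ^^ Suc k) x))"
     by (rule integrable_bdd[of _ 1, OF measurable_compose[OF T_pow_meas Z_meas] Z_T_bound])
    show "norm (Z m x - Z j ((T ^^ Suc k) x)) <= real (Suc k) * (\<bar>a\<bar> * B)" if "x \<in> space M" for x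
     using Z_shift_diff[OF that, of "Suc k" j] unfolding j .
   qed
   have b2: "real (Suc k) * (\<bar>a\<bar> * B) <= real L * (\<bar>a\<bar> * B)" using k m aB by (intro mult_right_mono) auto
   show ?thesis unfolding norm_minus_commute[of "I j"] unfolding I_def[of m] e1 by (rule order_trans[OF b1 b2])
  qed
  have "norm (cov (Suc k) * I j - cov (Suc k) * I m) <= B\<^sup>2 * (real L * (\<bar>a\<bar> * B))"
   unfolding right_diff_distrib[symmetric] norm_mult norm_of_real using 3 cov_bound by (intro mult_mono) auto
  from norm_diff_triangle_le[OF 2 this] have 4: "norm ((MEAN x. (\<phi> x * \<phi> ((T ^^ Suc k) x)) * Z j ((T ^^ Suc (Suc k)) x)) - cov (Suc k) * I m) <= \<epsilon> + 3 * B\<^sup>2 * (real L * (\<bar>a\<bar> * B))"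
   by (simp add: algebra_simps)
  have "norm (\<i> * a * ((MEAN x. (\<phi> x * \<phi> ((T ^^ Suc k) x)) * Z j ((T ^^ Suc (Suc k)) x)) - cov (Suc k) * I m)) <= \<bar>a\<bar> * (\<epsilon> + 3 * B\<^sup>2 * (real L * (\<bar>a\<bar> * B)))"
   unfolding norm_mult by (intro mult_mono 4) auto
  then have "norm (\<i> * a * (MEAN x. (\<phi> x * \<phi> ((T ^^ Suc k) x)) * Z j ((T ^^ Suc (Suc k)) x)) - \<i> * a * cov (Suc k) * I m) <= \<bar>a\<bar> * (\<epsilon> + 3 * B\<^sup>2 * (real L * (\<bar>a\<bar> * B)))"
   by (simp only: right_diff_distrib mult.assoc)
  from norm_diff_triangle_le[OF 1 this] have "norm (J k - \<i> * a * cov (Suc k) * I m) <= B * (a\<^sup>2 * B\<^sup>2) + \<bar>a\<bar> * (\<epsilon> + 3 * B\<^sup>2 * (real L * (\<bar>a\<bar> * B)))" .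
  also have "... = \<bar>a\<bar> * \<epsilon> + a\<^sup>2 * B ^ 3 * (1 + 3 * real L)"
   by (simp add: algebra_simps power2_eq_square power3_eq_cube)
  finally show ?thesis .
 qed
 \<comment> \<open>gaps k >= K contribute through the tail of the series of these bounds\<close>
 have far: "norm (J k) <= 2 * C * (\<bar>a\<bar> * B) * real (Suc k) powr - \<beta>" for k
 proof (cases "a = 0")
  case True
  then show ?thesis unfolding J_def D_eq by simp
 next
  case False
  then show ?thesis unfolding J_def using B_pos
   by (intro decay_complex D_bound D_meas) auto
 qed
 have last: "norm (MEAN x. \<phi> x * Z 0 ((T ^^ Suc m) x)) <= 2 * C * real (Suc m) powr - \<beta>"
  using decay_complex[of "Suc m" "Z 0" 1] Z_meas Z_bound by (simp del: funpow.simps)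
 define A where "A = (MEAN x. \<phi> x * Z m (T x))"
 define Q where "Q = (MEAN x. (\<phi> x * \<phi> x) * Z m (T x))"
 define R where "R = (\<Sum>k<K. cov (Suc k))"
 have intZ: "integrable M (\<lambda>x. complex_of_real (\<psi> x) * Z j ((T ^^ k) x))" if "\<psi> \<in> borel_measurable M" "!!x. x \<in> space M ==> \<bar>\<psi> x\<bar> <= B\<^sup>2 + B + 1" for \<psi> j k
  by (rule int_mult_Z[OF that])
 have A_eq: "A = (\<Sum>k<m. J k) + (MEAN x. \<phi> x * Z 0 ((T ^^ Suc m) x))"
 proof -
  have "Z m (T x) = (\<Sum>k<m. D (m - Suc k) ((T ^^ Suc k) x)) + Z 0 ((T ^^ Suc m) x)" for x
  proof -
   have "Z m (T x) = (\<Sum>k<m. Z (m - k) ((T ^^ k) (T x)) - Z (m - Suc k) ((T ^^ Suc k) (T x))) + Z 0 ((T ^^ m) (T x))"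
    by (rule telescope)
   also have "... = (\<Sum>k<m. D (m - Suc k) ((T ^^ Suc k) x)) + Z 0 ((T ^^ Suc m) x)"
    by (auto simp: D_def Suc_diff_Suc funpow_swap1 intro!: sum.cong)
   finally show ?thesis .
  qed
  then have "A = (MEAN x. (\<Sum>k<m. \<phi> x * D (m - Suc k) ((T ^^ Suc k) x)) + \<phi> x * Z 0 ((T ^^ Suc m) x))"
   by (simp only: A_def distrib_left sum_distrib_left)
  also have "... = (\<Sum>k<m. J k) + (MEAN x. \<phi> x * Z 0 ((T ^^ Suc m) x))"
   unfolding J_def using phi_bound
   by (subst Bochner_Integration.integral_add[OF Bochner_Integration.integrable_sum[OF intD] int_mult_Z[OF phi_meas]])
     (auto simp only: Bochner_Integration.integral_sum[OF intD])
  finally show ?thesis .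
 qed
 have Km: "K <= m" using m by simp
 have A_bound: "norm (A - \<i> * a * R * I m) <= real K * (\<bar>a\<bar> * \<epsilon> + a\<^sup>2 * B ^ 3 * (1 + 3 * real L)) + 2 * C * (\<bar>a\<bar> * B) * rest K + 2 * C * real (Suc m) powr - \<beta>"
 proof -
  have "(\<Sum>k<m. J k) = (\<Sum>k<K. J k) + (\<Sum>k\<in>{K..<m}. J k)"
   using Km by (simp add: lessThan_atLeast0 sum.atLeastLessThan_concat)
  moreover have "\<i> * a * R * I m = (\<Sum>k<K. \<i> * a * cov (Suc k) * I m)"
   by (simp add: R_def sum_distrib_left sum_distrib_right)
  ultimately have eq: "A - \<i> * a * R * I m = (\<Sum>k<K. J k - \<i> * a * cov (Suc k) * I m) + (\<Sum>k\<in>{K..<m}. J k) + (MEAN x. \<phi> x * Z 0 ((T ^^ Suc m) x))"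
   unfolding A_eq by (simp add: sum_subtractf)
  have n1: "norm (\<Sum>k<K. J k - \<i> * a * cov (Suc k) * I m) <= real K * (\<bar>a\<bar> * \<epsilon> + a\<^sup>2 * B ^ 3 * (1 + 3 * real L))"
   using sum_norm_le[of "{..<K}" "\<lambda>k. J k - \<i> * a * cov (Suc k) * I m" "\<lambda>_. \<bar>a\<bar> * \<epsilon> + a\<^sup>2 * B ^ 3 * (1 + 3 * real L)"] near by simp
  have n2: "norm (\<Sum>k\<in>{K..<m}. J k) <= 2 * C * (\<bar>a\<bar> * B) * rest K"
  proof -
   have "norm (\<Sum>k\<in>{K..<m}. J k) <= (\<Sum>k\<in>{K..<m}. 2 * C * (\<bar>a\<bar> * B) * real (Suc k) powr - \<beta>)"
    by (intro sum_norm_le far)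
   also have "... = 2 * C * (\<bar>a\<bar> * B) * (\<Sum>k\<in>{K..<m}. real (Suc k) powr - \<beta>)" by (simp add: sum_distrib_left)
   also have "... <= 2 * C * (\<bar>a\<bar> * B) * rest K" using C_nonneg aB by (intro mult_left_mono sum_le_rest) auto
   finally show ?thesis .
  qed
  show ?thesis unfolding eq
   by (intro order_trans[OF norm_triangle_ineq] add_mono n1 n2 last)
 qed
 have Q_bound: "norm (Q - cov 0 * I m) <= \<epsilon> + 2 * B\<^sup>2 * (real L * (\<bar>a\<bar> * B))"
  using prod[of 0 1 m] m by (simp add: Q_def)
 have "norm (I (Suc m) - (MEAN x. complex_of_real 1 * Z m ((T ^^ 1) x) + (\<i> * a * (complex_of_real (\<phi> x) * Z m ((T ^^ 1) x)) - a\<^sup>2 / 2 * (complex_of_real (\<phi> x * \<phi> x) * Z m ((T ^^ 1) x))))) <= \<bar>a\<bar> ^ 3 * B ^ 3"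
  unfolding I_def
 proof (rule integral_diff_le)
  show "integrable M (Z (Suc m))" by (rule integrable_bdd[OF Z_meas Z_bound])
  show "integrable M (\<lambda>x. complex_of_real 1 * Z m ((T ^^ 1) x) + (\<i> * a * (complex_of_real (\<phi> x) * Z m ((T ^^ 1) x)) - a\<^sup>2 / 2 * (complex_of_real (\<phi> x * \<phi> x) * Z m ((T ^^ 1) x))))"
   using phi_bound phi2[of _ 0]
   by (intro Bochner_Integration.integrable_add Bochner_Integration.integrable_diff integrable_mult_right int_mult_Z[of "\<lambda>_. 1" 1] int_mult_Z[of \<phi> B] int_mult_Z[of "\<lambda>x. \<phi> x * \<phi> x" "B\<^sup>2"]) auto
  fix x assume x: "x \<in> space M"
  have "Z (Suc m) x - (complex_of_real 1 * Z m ((T ^^ 1) x) + (\<i> * a * (complex_of_real (\<phi> x) * Z m ((T ^^ 1) x)) - a\<^sup>2 / 2 * (complex_of_real (\<phi> x * \<phi> x) * Z m ((T ^^ 1) x))))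
    = (iexp (a * \<phi> x) - (1 + \<i> * (a * \<phi> x) - complex_of_real ((a * \<phi> x)\<^sup>2) / 2)) * Z m (T x)"
   using Z_add[of 1 m x] by (simp add: S_def algebra_simps power2_eq_square)
  also have "norm ... <= \<bar>a * \<phi> x\<bar> ^ 3 * 1"
   unfolding norm_mult using norm_iexp_minus_quadratic[of "a * \<phi> x"] Z_T_bound[OF x, of m 1] by (intro mult_mono) auto
  also have "... <= \<bar>a\<bar> ^ 3 * B ^ 3"
   using phi_bound[OF x] by (auto simp: abs_mult power_mult_distrib intro!: mult_left_mono power_mono)
  finally show "norm (Z (Suc m) x - (complex_of_real 1 * Z m ((T ^^ 1) x) + (\<i> * a * (complex_of_real (\<phi> x) * Z m ((T ^^ 1) x)) - a\<^sup>2 / 2 * (complex_of_real (\<phi> x * \<phi> x) * Z m ((T ^^ 1) x))))) <= \<bar>a\<bar> ^ 3 * B ^ 3" .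
 qed
 also have "(MEAN x. complex_of_real 1 * Z m ((T ^^ 1) x) + (\<i> * a * (complex_of_real (\<phi> x) * Z m ((T ^^ 1) x)) - a\<^sup>2 / 2 * (complex_of_real (\<phi> x * \<phi> x) * Z m ((T ^^ 1) x))))
   = I m + (\<i> * a * A - a\<^sup>2 / 2 * Q)"
 proof -
  have i: "integrable M (\<lambda>x. complex_of_real 1 * Z m ((T ^^ 1) x))" "integrable M (\<lambda>x. complex_of_real (\<phi> x) * Z m ((T ^^ 1) x))"
   "integrable M (\<lambda>x. complex_of_real (\<phi> x * \<phi> x) * Z m ((T ^^ 1) x))"
   using phi_bound phi2[of _ 0]
   by (intro int_mult_Z[of "\<lambda>_. 1" 1] int_mult_Z[of \<phi> B] int_mult_Z[of "\<lambda>x. \<phi> x * \<phi> x" "B\<^sup>2"]; auto)+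
  show ?thesis
   by (subst Bochner_Integration.integral_add[OF i(1) Bochner_Integration.integrable_diff[OF integrable_mult_right[OF i(2)] integrable_mult_right[OF i(3)]]],
     subst Bochner_Integration.integral_diff[OF integrable_mult_right[OF i(2)] integrable_mult_right[OF i(3)]])
     (simp add: I_T A_def Q_def)
 qed
 finally have first: "norm (I (Suc m) - (I m + (\<i> * a * A - a\<^sup>2 / 2 * Q))) <= \<bar>a\<bar> ^ 3 * B ^ 3" .
 have I_le: "norm (I m) <= 1" unfolding I_def by (rule integral_norm_le[OF Z_meas Z_bound])
 have decomp: "I (Suc m) - (1 - a\<^sup>2 * (sigma2 / 2)) * I m =
   (I (Suc m) - (I m + (\<i> * a * A - a\<^sup>2 / 2 * Q))) + \<i> * a * (A - \<i> * a * R * I m)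
   - a\<^sup>2 / 2 * (Q - cov 0 * I m) + a\<^sup>2 * (sigma2 / 2 - (cov 0 / 2 + R)) * I m"
  by (simp add: algebra_simps power2_eq_square)
 have n2: "norm (\<i> * a * (A - \<i> * a * R * I m)) <= \<bar>a\<bar> * (real K * (\<bar>a\<bar> * \<epsilon> + a\<^sup>2 * B ^ 3 * (1 + 3 * real L)) + 2 * C * (\<bar>a\<bar> * B) * rest K + 2 * C * real (Suc m) powr - \<beta>)"
  unfolding norm_mult[of "\<i> * a"] using A_bound by (intro mult_mono) (auto simp: norm_mult)
 have n3: "norm (a\<^sup>2 / 2 * (Q - cov 0 * I m)) <= a\<^sup>2 / 2 * (\<epsilon> + 2 * B\<^sup>2 * (real L * (\<bar>a\<bar> * B)))"
  unfolding norm_mult using Q_bound by (intro mult_mono) (auto simp: norm_divide norm_power)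
 have n4: "norm (a\<^sup>2 * (sigma2 / 2 - (cov 0 / 2 + R)) * I m) <= a\<^sup>2 * (B * C * rest K) * 1"
 proof -
  have "norm (complex_of_real (a\<^sup>2 * (sigma2 / 2 - (cov 0 / 2 + R))) * I m) <= a\<^sup>2 * (B * C * rest K) * 1"
   unfolding norm_mult norm_of_real abs_mult using sigma2_partial[of K] I_le
   by (intro mult_mono) (auto simp: R_def intro!: mult_nonneg_nonneg rest_nonneg C_nonneg less_imp_le[OF B_pos])
  then show ?thesis by simp
 qed
 have "norm (I (Suc m) - (1 - a\<^sup>2 * (sigma2 / 2)) * I m) <= \<bar>a\<bar> ^ 3 * B ^ 3
   + \<bar>a\<bar> * (real K * (\<bar>a\<bar> * \<epsilon> + a\<^sup>2 * B ^ 3 * (1 + 3 * real L)) + 2 * C * (\<bar>a\<bar> * B) * rest K + 2 * C * real (Suc m) powr - \<beta>)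
   + a\<^sup>2 / 2 * (\<epsilon> + 2 * B\<^sup>2 * (real L * (\<bar>a\<bar> * B))) + a\<^sup>2 * (B * C * rest K) * 1"
  unfolding decomp
  by (rule order_trans[OF norm_triangle_ineq add_mono[OF order_trans[OF norm_triangle_ineq4 add_mono[OF order_trans[OF norm_triangle_ineq add_mono[OF first n2]] n3]] n4]])
 also have "... = a\<^sup>2 * ((real K + 1/2) * \<epsilon> + 3 * B * C * rest K)
   + \<bar>a\<bar> ^ 3 * (B ^ 3 * (1 + real K * (1 + 3 * real L) + real L))
   + \<bar>a\<bar> * (2 * C * real (Suc m) powr - \<beta>)"
 proof -
  have a2: "a\<^sup>2 = \<bar>a\<bar> * \<bar>a\<bar>" by (simp add: power2_eq_square)
  show ?thesis unfolding a2 by (simp add: algebra_simps power2_eq_square power3_eq_cube del: abs_mult_self_eq)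
 qed
 finally show ?thesis unfolding I_def .
qed

end

end

section \<open>The central limit theorem for one block\<close>

lemma abs_exp_minus_linear:
 fixes y :: real
 assumes "\<bar>y\<bar> <= 1/2"
 shows "\<bar>exp y - (1 + y)\<bar> <= 2 * y\<^sup>2"
proof -
 have "1 - y <= exp (- y)" using exp_ge_add_one_self[of "- y"] by simp
 then have "exp y * (1 - y) <= exp y * exp (- y)" by (intro mult_left_mono) auto
 then have 1: "exp y * (1 - y) <= 1" by (simp add: exp_minus)
 have "y ^ 3 <= 1/2 * y\<^sup>2"
 proof -
  have "y * y\<^sup>2 <= 1/2 * y\<^sup>2" using assms by (intro mult_right_mono) auto
  then show ?thesis by (simp add: power3_eq_cube power2_eq_square)
 qed
 then have "1 <= (1 + y + 2 * y\<^sup>2) * (1 - y)" by (simp add: algebra_simps power3_eq_cube power2_eq_square)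
 with 1 have "exp y * (1 - y) <= (1 + y + 2 * y\<^sup>2) * (1 - y)" by simp
 then have "exp y <= 1 + y + 2 * y\<^sup>2" using assms by (subst (asm) mult_le_cancel_right_pos) auto
 then show ?thesis using exp_ge_add_one_self[of y] by simp
qed

lemma discrete_gronwall:
 fixes d r :: "nat => real"
 assumes "d 0 <= 0" "0 <= b" "!!m. 0 <= r m" "!!m. m < N ==> d (Suc m) <= (1 + b) * d m + r m"
 shows "d N <= exp (b * real N) * (\<Sum>m<N. r m)"
proof -
 have "m <= N ==> d m <= exp (b * real m) * (\<Sum>k<m. r k)" for m
 proof (induction m)
  case 0 then show ?case using assms(1) by simp
 next
  case (Suc m)
  have "d (Suc m) <= (1 + b) * d m + r m" using assms(4) Suc.prems by simp
  also have "... <= (1 + b) * (exp (b * real m) * (\<Sum>k<m. r k)) + r m"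
   using Suc assms(2) by (intro add_right_mono mult_left_mono) auto
  also have "... <= exp b * (exp (b * real m) * (\<Sum>k<m. r k)) + exp (b * real (Suc m)) * r m"
  proof (intro add_mono mult_right_mono)
   show "1 + b <= exp b" by (rule exp_ge_add_one_self)
   have "1 <= exp (b * real (Suc m))" using assms(2) by simp
   then show "r m <= exp (b * real (Suc m)) * r m" using assms(3)[of m] mult_right_mono[of 1 _ "r m"] by fastforce
  qed (use assms in \<open>auto intro!: mult_nonneg_nonneg sum_nonneg\<close>)
  also have "... = exp (b * real (Suc m)) * (\<Sum>k<Suc m. r k)"
   by (simp add: distrib_left exp_add mult_ac)
  finally show ?case .
 qed
 then show ?thesis by simp
qed

locale exact_system = mixing_system +
 assumes mix: "!!\<psi> e. \<psi> \<in> borel_measurable M ==> (!!x. x \<in> space M ==> \<bar>\<psi> x\<bar> <= 1) ==> 0 < e ==>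
   \<exists>n0. \<forall>n\<ge>n0. \<forall>G. G \<in> borel_measurable M --> (\<forall>x\<in>space M. \<bar>G x\<bar> <= 1) -->
    \<bar>(MEAN x. \<psi> x * G ((T ^^ n) x)) - (MEAN x. \<psi> x) * (MEAN x. G x)\<bar> <= (e :: real)"
begin

lemma mix_complex:
 fixes \<psi> :: "'a => real"
 assumes \<psi>[measurable]: "\<psi> \<in> borel_measurable M" and V: "0 < V" "!!x. x \<in> space M ==> \<bar>\<psi> x\<bar> <= V" and e: "0 < e"
 shows "\<exists>n0. \<forall>n\<ge>n0. \<forall>Z :: 'a => complex. Z \<in> borel_measurable M --> (\<forall>x\<in>space M. norm (Z x) <= 1) -->
   norm ((MEAN x. \<psi> x * Z ((T ^^ n) x)) - (MEAN x. \<psi> x) * (MEAN x. Z x)) <= e"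
proof -
 have "(\<lambda>x. \<psi> x / V) \<in> borel_measurable M" by measurable
 moreover have "\<bar>\<psi> x / V\<bar> <= 1" if "x \<in> space M" for x using V(2)[OF that] V(1) by simp
 moreover have "0 < e / (2 * V)" using e V by simp
 ultimately obtain n0 where n0: "!!n G. n0 <= n ==> G \<in> borel_measurable M ==> (!!x. x \<in> space M ==> \<bar>G x\<bar> <= 1) ==>
    \<bar>(MEAN x. \<psi> x / V * G ((T ^^ n) x)) - (MEAN x. \<psi> x / V) * (MEAN x. G x)\<bar> <= e / (2 * V)"
  using mix[of "\<lambda>x. \<psi> x / V" "e / (2 * V)"] by blast
 have real: "\<bar>(MEAN x. \<psi> x * G ((T ^^ n) x)) - (MEAN x. \<psi> x) * (MEAN x. G x)\<bar> <= e / 2"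
  if "n0 <= n" "G \<in> borel_measurable M" "!!x. x \<in> space M ==> \<bar>G x\<bar> <= 1" for n G
 proof -
  have "\<bar>(MEAN x. \<psi> x * G ((T ^^ n) x)) / V - (MEAN x. \<psi> x) / V * (MEAN x. G x)\<bar> <= e / (2 * V)"
   using n0[OF that] by simp
  also have "(MEAN x. \<psi> x * G ((T ^^ n) x)) / V - (MEAN x. \<psi> x) / V * (MEAN x. G x)
    = ((MEAN x. \<psi> x * G ((T ^^ n) x)) - (MEAN x. \<psi> x) * (MEAN x. G x)) / V"
   by (simp add: diff_divide_distrib)
  finally show ?thesis using V(1) by (simp add: abs_divide field_simps)
 qed
 show ?thesis
 proof (intro exI[of _ n0] allI impI)
  fix n and Z :: "'a => complex"
  assume n: "n0 <= n" and Z[measurable]: "Z \<in> borel_measurable M" and Z1: "\<forall>x\<in>space M. norm (Z x) <= 1"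
  have int: "integrable M (\<lambda>x. \<psi> x * Z ((T ^^ n) x))"
  proof (rule integrable_bdd[of _ "V * 1"])
   fix x assume x: "x \<in> space M"
   show "norm (complex_of_real (\<psi> x) * Z ((T ^^ n) x)) <= V * 1"
    unfolding norm_mult norm_of_real using Z1 T_pow_space[OF x] V(1) by (intro mult_mono V(2) x) auto
  qed measurable
  have intZ: "integrable M Z" using Z1 by (intro integrable_bdd[of _ 1]) auto
  let ?X = "(MEAN x. \<psi> x * Z ((T ^^ n) x)) - (MEAN x. \<psi> x) * (MEAN x. Z x)"
  have "Re ?X = (MEAN x. \<psi> x * Re (Z ((T ^^ n) x))) - (MEAN x. \<psi> x) * (MEAN x. Re (Z x))"
   using integral_Re[OF int] integral_Re[OF intZ] by simp
  moreover have "Im ?X = (MEAN x. \<psi> x * Im (Z ((T ^^ n) x))) - (MEAN x. \<psi> x) * (MEAN x. Im (Z x))"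
   using integral_Im[OF int] integral_Im[OF intZ] by simp
  moreover have "\<bar>(MEAN x. \<psi> x * Re (Z ((T ^^ n) x))) - (MEAN x. \<psi> x) * (MEAN x. Re (Z x))\<bar> <= e / 2"
   using Z1 by (intro real[OF n, of "\<lambda>x. Re (Z x)"]) (auto intro: order_trans[OF abs_Re_le_cmod])
  moreover have "\<bar>(MEAN x. \<psi> x * Im (Z ((T ^^ n) x))) - (MEAN x. \<psi> x) * (MEAN x. Im (Z x))\<bar> <= e / 2"
   using Z1 by (intro real[OF n, of "\<lambda>x. Im (Z x)"]) (auto intro: order_trans[OF abs_Im_le_cmod])
  ultimately have "\<bar>Re ?X\<bar> + \<bar>Im ?X\<bar> <= e" by simp
  then show "norm ?X <= e" using cmod_le[of ?X] by linarith
 qed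
qed

text \<open>\<open>lindeberg_step\<close> is applied with \<open>a = u / sqrt n\<close> to all but \<open>L\<close> summands. The constants are chosen in the
order \<open>K\<close> (tail of the covariances), \<open>\<epsilon>\<close>, \<open>L\<close> (mixing time), \<open>n\<close>.\<close>
theorem block_clt:
 assumes e: "0 < e"
 shows "\<exists>n0. \<forall>n\<ge>n0. \<forall>N\<le>n. \<forall>H. H \<in> borel_measurable M --> (\<forall>x\<in>space M. \<bar>H x\<bar> <= 1) -->
  norm ((MEAN x. iexp (u / sqrt (real n) * S N x) * complex_of_real (H ((T ^^ N) x)))
   - exp (- (u\<^sup>2 * sigma2 * real N / (2 * real n))) * (MEAN x. H x)) <= e"
proof -
 define U where "U = u\<^sup>2 * \<bar>sigma2\<bar> / 2"
 have U: "0 <= U" by (simp add: U_def)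
 define E where "E = exp U * u\<^sup>2"
 have E: "0 <= E" by (simp add: E_def)
 obtain K where K: "E * (3 * B * C * rest K) <= e / 4"
 proof -
  have "(\<lambda>K. E * (3 * B * C * rest K)) \<longlonglongrightarrow> E * (3 * B * C * 0)"
   by (intro tendsto_intros rest_tendsto)
  then have "eventually (\<lambda>K. E * (3 * B * C * rest K) < e / 4) sequentially"
   using e by (intro order_tendstoD(2)[of _ "E * (3 * B * C * 0)"]) auto
  then show ?thesis using that by (auto simp: eventually_sequentially intro: less_imp_le)
 qed
 define \<epsilon> where "\<epsilon> = e / (4 * (E + 1) * (real K + 1/2))"
 have \<epsilon>: "0 < \<epsilon>" unfolding \<epsilon>_def using e E by (intro divide_pos_pos mult_pos_pos) auto
 define P where "P = (E + 1) * (real K + 1/2)"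
 have P: "0 < P" unfolding P_def using E by (intro mult_pos_pos) auto
 have E\<epsilon>: "E * ((real K + 1/2) * \<epsilon>) <= e / 4"
 proof -
  have "E * ((real K + 1/2) * \<epsilon>) <= (E + 1) * ((real K + 1/2) * \<epsilon>)" using \<epsilon> by (intro mult_right_mono mult_nonneg_nonneg) auto
  also have "... = P * (e / (4 * P))" by (simp only: \<epsilon>_def P_def mult.assoc)
  also have "... = e / 4" using P by simp
  finally show ?thesis .
 qed
 define good where "good k n \<longleftrightarrow> (\<forall>Z :: 'a => complex. Z \<in> borel_measurable M --> (\<forall>x\<in>space M. norm (Z x) <= 1) -->
   norm ((MEAN x. complex_of_real (\<phi> x * \<phi> ((T ^^ k) x)) * Z ((T ^^ n) x)) - cov k * (MEAN x. Z x)) <= \<epsilon>)" for k n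
 have "\<exists>n0. \<forall>n\<ge>n0. good k n" for k
  unfolding good_def cov_def
 proof (rule mix_complex[OF _ _ _ \<epsilon>])
  show "\<bar>\<phi> x * \<phi> ((T ^^ k) x)\<bar> <= B\<^sup>2" if "x \<in> space M" for x
   unfolding abs_mult power2_eq_square using phi_bound[OF that] phi_bound[OF T_pow_space[OF that]] B_pos by (intro mult_mono) auto
 qed (use B_pos in auto)
 then have "\<forall>k\<in>{..K}. eventually (good k) sequentially" by (simp add: eventually_sequentially)
 then have "eventually (\<lambda>n. \<forall>k\<in>{..K}. good k n) sequentially" by (simp add: eventually_ball_finite)
 then obtain L0 where L0': "!!n k. L0 <= n ==> k <= K ==> good k n" by (auto simp: eventually_sequentially)
 have L0: "norm ((MEAN x. complex_of_real (\<phi> x * \<phi> ((T ^^ k) x)) * Z ((T ^^ n) x)) - cov k * (MEAN x. Z x)) <= \<epsilon>"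
  if "L0 <= n" "k <= K" "Z \<in> borel_measurable M" "!!x. x\<in>space M ==> norm (Z x) <= 1" for n k and Z :: "'a => complex"
  using L0'[OF that(1,2)] that(3,4) unfolding good_def by blast
 define L where "L = max L0 (Suc K)"
 have L: "L0 <= L" "Suc K <= L" by (auto simp: L_def)
 define E1 where "E1 = (real K + 1/2) * \<epsilon> + 3 * B * C * rest K"
 define E2 where "E2 = B ^ 3 * (1 + real K * (1 + 3 * real L) + real L)"
 have E1: "0 <= E1" unfolding E1_def using \<epsilon> B_pos C_nonneg rest_nonneg by (intro add_nonneg_nonneg mult_nonneg_nonneg) auto
 have E2: "0 <= E2" unfolding E2_def using B_pos by (intro mult_nonneg_nonneg add_nonneg_nonneg) auto
 define \<delta> where "\<delta> n = exp U * (real L * (\<bar>u\<bar> * B * (1 / sqrt (real n)) + U * (1 / real n))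
   + \<bar>u\<bar> ^ 3 * E2 * (1 / sqrt (real n)) + \<bar>u\<bar> * (2 * C * rest 0) * (1 / sqrt (real n)) + 2 * U\<^sup>2 * exp U * (1 / real n))" for n
 have lim1: "(\<lambda>n. 1 / sqrt (real n)) \<longlonglongrightarrow> 0" by real_asymp
 have lim2: "(\<lambda>n. 1 / real n) \<longlonglongrightarrow> 0" by real_asymp
 have "\<delta> \<longlonglongrightarrow> exp U * (real L * (\<bar>u\<bar> * B * 0 + U * 0) + \<bar>u\<bar> ^ 3 * E2 * 0 + \<bar>u\<bar> * (2 * C * rest 0) * 0 + 2 * U\<^sup>2 * exp U * 0)"
  unfolding \<delta>_def[abs_def] by (intro tendsto_intros lim1 lim2)
 then have "eventually (\<lambda>n. \<delta> n < e / 2) sequentially"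
  using e by (intro order_tendstoD(2)) auto
 moreover have "eventually (\<lambda>n. 1 <= n \<and> 2 * U <= real n) sequentially"
  by (intro eventually_conj eventually_ge_at_top) real_asymp
 ultimately have "eventually (\<lambda>n. \<delta> n < e / 2 \<and> 1 <= n \<and> 2 * U <= real n) sequentially"
  by eventually_elim auto
 then obtain n0 where n0: "!!n. n0 <= n ==> \<delta> n < e / 2 \<and> 1 <= n \<and> 2 * U <= real n"
  by (auto simp: eventually_sequentially)
 show ?thesis
 proof (intro exI[of _ n0] allI impI)
  fix n N :: nat and H :: "'a => real"
  assume n: "n0 <= n" and N: "N <= n" and H[measurable]: "H \<in> borel_measurable M" and H1: "\<forall>x\<in>space M. \<bar>H x\<bar> <= 1"
  have n1: "\<delta> n < e / 2" "1 <= n" "2 * U <= real n" using n0[OF n] by auto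
  define a where "a = u / sqrt (real n)"
  define x where "x = a\<^sup>2 * (sigma2 / 2)"
  have a2: "a\<^sup>2 = u\<^sup>2 / real n" using n1 by (simp add: a_def power_divide)
  have x_abs: "\<bar>x\<bar> = U / real n" using n1 by (simp add: x_def a2 U_def abs_mult abs_divide)
  have x_half: "\<bar>x\<bar> <= 1/2" using n1 unfolding x_abs by (simp add: divide_le_eq)
  have Hb: "!!x. x \<in> space M ==> \<bar>H x\<bar> <= 1" using H1 by auto
  define I where "I m = (MEAN y. Zf a H m y)" for m
  define h where "h = complex_of_real (MEAN y. H y)"
  define \<tau> where "\<tau> m = complex_of_real (exp (- (x * real m))) * h" for m
  have h1: "norm h <= 1" unfolding h_def norm_of_real real_norm_def[symmetric] by (rule integral_norm_le[OF H]) (use Hb in simp)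
  have step: "norm (I (Suc m) - (1 - x) * I m) <= a\<^sup>2 * E1 + \<bar>a\<bar> ^ 3 * E2 + \<bar>a\<bar> * (2 * C * real (Suc m) powr - \<beta>)"
   if "L <= Suc m" for m
   unfolding I_def x_def E1_def E2_def by (rule lindeberg_step[OF H Hb L0[OF L(1)] L(2) that])
  have Zm: "Zf a H m \<in> borel_measurable M" for m by (rule Z_meas[OF H Hb])
  have Zb: "y \<in> space M ==> norm (Zf a H m y) <= 1" for m y by (rule Z_bound[OF H Hb])
  have I_le: "norm (I m) <= 1" for m
   unfolding I_def by (rule integral_norm_le[OF Zm Zb])
  have crude: "norm (I (Suc m) - (1 - x) * I m) <= \<bar>a\<bar> * B + \<bar>x\<bar>" for m
  proof -
   have "norm ((MEAN y. Zf a H (Suc m) y) - (MEAN y. Zf a H m (T y))) <= \<bar>a\<bar> * B"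
   proof (rule integral_diff_le)
    show "integrable M (Zf a H (Suc m))" by (rule integrable_bdd[OF Zm Zb])
    show "integrable M (\<lambda>y. Zf a H m (T y))"
     by (rule integrable_bdd[OF measurable_compose[OF T_meas Zm] Zb[OF measurable_space[OF T_meas]]])
    show "norm (Zf a H (Suc m) y - Zf a H m (T y)) <= \<bar>a\<bar> * B" if "y \<in> space M" for y
     using Z_shift_diff[OF H Hb that, of a 1 m] by simp
   qed
   moreover have "(MEAN y. Zf a H m (T y)) = I m" unfolding I_def by (rule T_invariant[OF Zm])
   ultimately have 1: "norm (I (Suc m) - I m) <= \<bar>a\<bar> * B" by (simp add: I_def)
   have "I (Suc m) - (1 - x) * I m = (I (Suc m) - I m) + x * I m" by (simp add: algebra_simps)
   also have "norm ... <= \<bar>a\<bar> * B + \<bar>x\<bar> * 1"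
    using 1 I_le[of m] by (intro order_trans[OF norm_triangle_ineq] add_mono) (auto simp: norm_mult mult_left_le)
   finally show ?thesis by simp
  qed
  define err where "err m = (if Suc m < L then \<bar>a\<bar> * B + \<bar>x\<bar> else 0) + (a\<^sup>2 * E1 + \<bar>a\<bar> ^ 3 * E2 + \<bar>a\<bar> * (2 * C * real (Suc m) powr - \<beta>))" for m
  have err0: "0 <= a\<^sup>2 * E1 + \<bar>a\<bar> ^ 3 * E2 + \<bar>a\<bar> * (2 * C * real (Suc m) powr - \<beta>)" for m
   using E1 E2 C_nonneg by (intro add_nonneg_nonneg mult_nonneg_nonneg) auto
  have aB0: "0 <= \<bar>a\<bar> * B" using B_pos by simp
  have I_step: "norm (I (Suc m) - (1 - x) * I m) <= err m" for m
  proof (cases "Suc m < L")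
   case True
   then show ?thesis using crude[of m] err0[of m] by (simp add: err_def)
  next
   case False
   then show ?thesis using step[of m] by (simp add: err_def)
  qed
  have \<tau>_le: "norm (\<tau> m) <= exp U" if "m <= n" for m
  proof -
   have "- (x * real m) <= \<bar>x\<bar> * real m" using abs_ge_minus_self[of "x * real m"] by (simp add: abs_mult)
   also have "... <= \<bar>x\<bar> * real n" using that by (intro mult_left_mono) auto
   also have "... = U" using n1 by (simp add: x_abs)
   finally have "exp (- (x * real m)) * norm h <= exp U * 1" using h1 by (intro mult_mono) auto
   then show ?thesis by (simp add: \<tau>_def norm_mult)
  qed
  have d_step: "norm (I (Suc m) - \<tau> (Suc m)) <= (1 + \<bar>x\<bar>) * norm (I m - \<tau> m) + (err m + 2 * x\<^sup>2 * exp U)" if "m < N" for m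
  proof -
   have ex: "exp (- (x * real (Suc m))) = exp (- x) * exp (- (x * real m))"
    by (simp add: exp_add[symmetric] algebra_simps)
   have "I (Suc m) - \<tau> (Suc m) = (I (Suc m) - (1 - x) * I m) + (1 - x) * (I m - \<tau> m) - complex_of_real (exp (- x) - (1 + - x)) * \<tau> m"
    unfolding \<tau>_def ex by (simp add: algebra_simps)
   also have "norm ... <= err m + (1 + \<bar>x\<bar>) * norm (I m - \<tau> m) + (2 * x\<^sup>2) * exp U"
   proof (rule order_trans[OF norm_triangle_ineq4 add_mono[OF order_trans[OF norm_triangle_ineq add_mono]]])
    show "norm (I (Suc m) - (1 - x) * I m) <= err m" by (rule I_step)
    have "norm (1 - complex_of_real x) <= 1 + \<bar>x\<bar>" using norm_triangle_ineq4[of 1 "complex_of_real x"] by simp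
    then show "norm ((1 - x) * (I m - \<tau> m)) <= (1 + \<bar>x\<bar>) * norm (I m - \<tau> m)"
     unfolding norm_mult by (intro mult_right_mono) auto
    show "norm (complex_of_real (exp (- x) - (1 + - x)) * \<tau> m) <= (2 * x\<^sup>2) * exp U"
     unfolding norm_mult norm_of_real using abs_exp_minus_linear[of "- x"] x_half \<tau>_le[of m] that N by (intro mult_mono) auto
   qed
   finally show ?thesis by (simp add: algebra_simps)
  qed
  have d0: "norm (I 0 - \<tau> 0) <= 0"
   by (simp add: I_def \<tau>_def h_def Zf_def)
  have "norm (I N - \<tau> N) <= exp (\<bar>x\<bar> * real N) * (\<Sum>m<N. err m + 2 * x\<^sup>2 * exp U)"
  proof (rule discrete_gronwall[where d = "\<lambda>m. norm (I m - \<tau> m)"])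
   show "norm (I 0 - \<tau> 0) <= 0" by (rule d0)
   show "0 <= err m + 2 * x\<^sup>2 * exp U" for m using err0[of m] aB0 by (auto simp: err_def intro!: add_nonneg_nonneg)
  qed (use d_step in auto)
  also have "... <= exp U * (E1 * u\<^sup>2 + (real L * (\<bar>u\<bar> * B * (1 / sqrt (real n)) + U * (1 / real n))
   + \<bar>u\<bar> ^ 3 * E2 * (1 / sqrt (real n)) + \<bar>u\<bar> * (2 * C * rest 0) * (1 / sqrt (real n)) + 2 * U\<^sup>2 * exp U * (1 / real n)))"
  proof (rule mult_mono)
   have "\<bar>x\<bar> * real N <= \<bar>x\<bar> * real n" using N by (intro mult_left_mono) auto
   also have "... = U" using n1 by (simp add: x_abs)
   finally show "exp (\<bar>x\<bar> * real N) <= exp U" by simp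
   have absa: "\<bar>a\<bar> = \<bar>u\<bar> * (1 / sqrt (real n))" by (simp add: a_def)
   have s1: "(\<Sum>m<N. (if Suc m < L then \<bar>a\<bar> * B + \<bar>x\<bar> else 0)) <= real L * (\<bar>u\<bar> * B * (1 / sqrt (real n)) + U * (1 / real n))"
   proof -
    have "(\<Sum>m<N. (if Suc m < L then \<bar>a\<bar> * B + \<bar>x\<bar> else 0)) = (\<Sum>m\<in>{..<N} \<inter> {m. Suc m < L}. \<bar>a\<bar> * B + \<bar>x\<bar>)"
     by (simp add: sum.If_cases)
    also have "... <= (\<Sum>m<L. \<bar>a\<bar> * B + \<bar>x\<bar>)" using aB0 by (intro sum_mono2) auto
    also have "... = real L * (\<bar>a\<bar> * B + \<bar>x\<bar>)" by simp
    also have "real L * (\<bar>a\<bar> * B + \<bar>x\<bar>) = real L * (\<bar>u\<bar> * B * (1 / sqrt (real n)) + U * (1 / real n))" unfolding absa x_abs by simp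
    finally show ?thesis .
   qed
   have s2: "(\<Sum>m<N. a\<^sup>2 * E1 + \<bar>a\<bar> ^ 3 * E2) <= E1 * u\<^sup>2 + \<bar>u\<bar> ^ 3 * E2 * (1 / sqrt (real n))"
   proof -
    have "(\<Sum>m<N. a\<^sup>2 * E1 + \<bar>a\<bar> ^ 3 * E2) <= real n * (a\<^sup>2 * E1 + \<bar>a\<bar> ^ 3 * E2)"
     using N E1 E2 by (simp add: mult_right_mono)
    also have "... = (real n * a\<^sup>2) * E1 + (real n * a\<^sup>2) * \<bar>a\<bar> * E2" by (simp add: algebra_simps power3_eq_cube power2_eq_square)
    also have "real n * a\<^sup>2 = u\<^sup>2" using n1 by (simp add: a2)
    also have "u\<^sup>2 * E1 + u\<^sup>2 * \<bar>a\<bar> * E2 = E1 * u\<^sup>2 + \<bar>u\<bar> ^ 3 * E2 * (1 / sqrt (real n))"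
     unfolding absa by (simp add: power3_eq_cube power2_eq_square)
    finally show ?thesis .
   qed
   have s3: "(\<Sum>m<N. \<bar>a\<bar> * (2 * C * real (Suc m) powr - \<beta>)) <= \<bar>u\<bar> * (2 * C * rest 0) * (1 / sqrt (real n))"
   proof -
    have "(\<Sum>m<N. \<bar>a\<bar> * (2 * C * real (Suc m) powr - \<beta>)) = \<bar>a\<bar> * (2 * C * (\<Sum>m\<in>{0..<N}. real (Suc m) powr - \<beta>))"
     by (simp add: sum_distrib_left lessThan_atLeast0)
    also have "... <= \<bar>a\<bar> * (2 * C * rest 0)" using C_nonneg by (intro mult_left_mono sum_le_rest) auto
    finally show ?thesis unfolding absa by (simp add: mult_ac)
   qed
   have s4: "(\<Sum>m<N. 2 * x\<^sup>2 * exp U) <= 2 * U\<^sup>2 * exp U * (1 / real n)"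
   proof -
    have "(\<Sum>m<N. 2 * x\<^sup>2 * exp U) <= real n * (2 * x\<^sup>2 * exp U)" using N by (simp add: mult_right_mono)
    also have "real n * (2 * x\<^sup>2 * exp U) = real n * (2 * (U / real n)\<^sup>2 * exp U)" unfolding x_abs[symmetric] by simp
    also have "... = 2 * U\<^sup>2 * exp U * (1 / real n)" using n1 by (simp add: power2_eq_square)
    finally show ?thesis .
   qed
   have "(\<Sum>m<N. err m + 2 * x\<^sup>2 * exp U) = (\<Sum>m<N. (if Suc m < L then \<bar>a\<bar> * B + \<bar>x\<bar> else 0)) + (\<Sum>m<N. a\<^sup>2 * E1 + \<bar>a\<bar> ^ 3 * E2)
     + (\<Sum>m<N. \<bar>a\<bar> * (2 * C * real (Suc m) powr - \<beta>)) + (\<Sum>m<N. 2 * x\<^sup>2 * exp U)"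
    unfolding err_def sum.distrib by (simp only: add.assoc)
   with s1 s2 s3 s4 show "(\<Sum>m<N. err m + 2 * x\<^sup>2 * exp U) <= E1 * u\<^sup>2 + (real L * (\<bar>u\<bar> * B * (1 / sqrt (real n)) + U * (1 / real n))
    + \<bar>u\<bar> ^ 3 * E2 * (1 / sqrt (real n)) + \<bar>u\<bar> * (2 * C * rest 0) * (1 / sqrt (real n)) + 2 * U\<^sup>2 * exp U * (1 / real n))"
    by linarith
   show "0 <= (\<Sum>m<N. err m + 2 * x\<^sup>2 * exp U)"
    using err0 aB0 by (intro sum_nonneg add_nonneg_nonneg) (auto simp: err_def intro!: add_nonneg_nonneg)
  qed auto
  also have "... = E * E1 + \<delta> n" by (simp add: E_def \<delta>_def distrib_left mult_ac)
  also have "... <= e"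
  proof -
   have "E * E1 = E * ((real K + 1/2) * \<epsilon>) + E * (3 * B * C * rest K)" by (simp add: E1_def distrib_left)
   then show ?thesis using K E\<epsilon> n1(1) by linarith
  qed
  finally have fin: "norm (I N - \<tau> N) <= e" .
  have "x * real N = u\<^sup>2 * sigma2 * real N / (2 * real n)" by (simp add: x_def a2)
  then show "norm ((MEAN x. iexp (u / sqrt (real n) * S N x) * complex_of_real (H ((T ^^ N) x)))
   - exp (- (u\<^sup>2 * sigma2 * real N / (2 * real n))) * (MEAN x. H x)) <= e"
   using fin unfolding I_def Zf_def \<tau>_def h_def a_def by (simp del: of_real_exp)
 qed
qed

end

section \<open>Joint limits of consecutive blocks\<close>

text \<open>A weight of absolute value at most 1 becomes a probability density after adding 2 and normalising.
The weighted mean is recovered from this law and the unweighted one.\<close>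
lemma weighted_distribution:
 fixes Y G :: "'a => real" and F :: "real => 'b :: {banach, second_countable_topology, real_normed_field}"
 assumes M: "prob_space M" and Y[measurable]: "Y \<in> borel_measurable M" and G[measurable]: "G \<in> borel_measurable M"
  and G1: "!!x. x \<in> space M ==> \<bar>G x\<bar> <= 1"
 defines "\<nu> \<equiv> distr (density M (\<lambda>x. ennreal ((G x + 2) / ((\<integral>x. G x \<partial>M) + 2)))) borel Y"
 shows "real_distribution \<nu>"
  and "F \<in> borel_measurable borel ==> (!!z. norm (F z) <= 1) ==>
    (\<integral>z. F z \<partial>\<nu>) = ((\<integral>x. F (Y x) * of_real (G x) \<partial>M) + 2 * (\<integral>x. F (Y x) \<partial>M)) / of_real ((\<integral>x. G x \<partial>M) + 2)"
  and "\<bar>\<integral>x. G x \<partial>M\<bar> <= 1"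
proof -
 interpret M: prob_space M by (rule M)
 note intb = M.integrable_const_bound[where B = 1, OF AE_I2]
 define q where "q = (\<integral>x. G x \<partial>M) + 2"
 have intG: "integrable M G" using G1 by (intro intb) auto
 have "\<bar>\<integral>x. G x \<partial>M\<bar> <= (\<integral>x. \<bar>G x\<bar> \<partial>M)" by (rule integral_abs_bound)
 also have "... <= (\<integral>x. 1 \<partial>M)" using G1 by (intro integral_mono integrable_abs intG) auto
 finally show mean: "\<bar>\<integral>x. G x \<partial>M\<bar> <= 1" by (simp add: M.prob_space)
 then have q: "1 <= q" unfolding q_def by linarith
 have nonneg: "AE x in M. 0 <= (G x + 2) / q"
  using G1 q by (intro AE_I2) (fastforce intro!: divide_nonneg_nonneg simp: abs_le_iff)
 have total: "(\<integral>x. (G x + 2) / q \<partial>M) = 1"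
  using intG q by (simp add: M.prob_space q_def)
 have pd: "prob_space (density M (\<lambda>x. ennreal ((G x + 2) / q)))"
 proof
  have "emeasure (density M (\<lambda>x. ennreal ((G x + 2) / q))) (space M) = (\<integral>\<^sup>+x. ennreal ((G x + 2) / q) \<partial>M)"
   by (subst emeasure_density) (auto intro!: nn_integral_cong)
  also have "... = ennreal (\<integral>x. (G x + 2) / q \<partial>M)"
   using intG by (intro nn_integral_eq_integral nonneg) auto
  finally show "emeasure (density M (\<lambda>x. ennreal ((G x + 2) / q))) (space (density M (\<lambda>x. ennreal ((G x + 2) / q)))) = 1"
   using total by simp
 qed
 show "real_distribution \<nu>"
  unfolding \<nu>_def q_def[symmetric]
  using prob_space.real_distribution_distr[OF pd, of Y] by simp
 show "(\<integral>z. F z \<partial>\<nu>) = ((\<integral>x. F (Y x) * of_real (G x) \<partial>M) + 2 * (\<integral>x. F (Y x) \<partial>M)) / of_real ((\<integral>x. G x \<partial>M) + 2)"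
  if F[measurable]: "F \<in> borel_measurable borel" and F1: "!!z. norm (F z) <= 1"
 proof -
  have iF: "integrable M (\<lambda>x. F (Y x))" using F1 by (intro intb) auto
  have iFG: "integrable M (\<lambda>x. F (Y x) * of_real (G x))"
  proof (rule intb)
   fix x assume "x \<in> space M"
   then have "norm (F (Y x)) * \<bar>G x\<bar> <= 1 * 1" using F1 G1 by (intro mult_mono) auto
   then show "norm (F (Y x) * of_real (G x)) <= 1" by (simp add: norm_mult)
  qed measurable
  have "(\<integral>z. F z \<partial>distr (density M (\<lambda>x. ennreal ((G x + 2) / q))) borel Y)
    = (\<integral>x. F (Y x) \<partial>density M (\<lambda>x. ennreal ((G x + 2) / q)))"
   by (rule integral_distr) auto
  also have "... = (\<integral>x. ((G x + 2) / q) *\<^sub>R F (Y x) \<partial>M)"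
   by (rule integral_density) (use nonneg in auto)
  also have "... = (\<integral>x. (F (Y x) * of_real (G x) + 2 * F (Y x)) / of_real q \<partial>M)"
   by (intro Bochner_Integration.integral_cong refl) (simp add: scaleR_conv_of_real algebra_simps)
  also have "... = ((\<integral>x. F (Y x) * of_real (G x) \<partial>M) + 2 * (\<integral>x. F (Y x) \<partial>M)) / of_real q"
   using iF iFG by simp
  finally show ?thesis unfolding \<nu>_def q_def .
 qed
qed

text \<open>The continuity theorem, applied to the laws of \<open>weighted_distribution\<close>, carries the statement over
from characteristic functions to bounded continuous \<open>g\<close>. The means of the weights need not converge, so
both sides are compared with the same mean.\<close>
lemma weighted_levy:
 fixes Y H :: "nat => 'a => real"
 assumes M: "prob_space M" and D: "real_distribution D"
  and Y[measurable]: "!!n. Y n \<in> borel_measurable M" and H[measurable]: "!!n. H n \<in> borel_measurable M"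
  and H1: "!!n x. x \<in> space M ==> \<bar>H n x\<bar> <= 1"
  and lim: "!!u. (\<lambda>n. (\<integral>x. iexp (u * Y n x) * complex_of_real (H n x) \<partial>M) - char D u * (\<integral>x. H n x \<partial>M)) \<longlonglongrightarrow> 0"
  and lim1: "!!u. (\<lambda>n. (\<integral>x. iexp (u * Y n x) \<partial>M)) \<longlonglongrightarrow> char D u"
  and g: "!!z. isCont g z" "!!z. \<bar>g z\<bar> <= 1"
 shows "(\<lambda>n. (\<integral>x. g (Y n x) * H n x \<partial>M) - (\<integral>z. g z \<partial>D) * (\<integral>x. H n x \<partial>M)) \<longlonglongrightarrow> (0 :: real)"
proof -
 interpret M: prob_space M by (rule M)
 interpret D: real_distribution D by (rule D)
 have g_meas[measurable]: "g \<in> borel_measurable borel"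
  using g(1) by (intro borel_measurable_continuous_onI continuous_at_imp_continuous_on) auto
 define h where "h n = (\<integral>x. H n x \<partial>M)" for n
 have h_abs: "\<bar>h n\<bar> <= 1" for n
  unfolding h_def by (rule weighted_distribution(3)[OF M Y H H1])
 have h2: "1 <= h n + 2" for n using h_abs[of n] by linarith
 define \<nu> where "\<nu> G n = distr (density M (\<lambda>x. ennreal ((G n x + 2) / ((\<integral>x. G n x \<partial>M) + 2)))) borel (Y n)" for G and n :: nat
 have conv: "(\<lambda>n. \<integral>z. g z \<partial>\<nu> G n) \<longlonglongrightarrow> (\<integral>z. g z \<partial>D)"
  if G[measurable]: "!!n. G n \<in> borel_measurable M" and G1: "!!n x. x \<in> space M ==> \<bar>G n x\<bar> <= 1"
   and lim: "!!u. (\<lambda>n. (\<integral>x. iexp (u * Y n x) * complex_of_real (G n x) \<partial>M) - char D u * (\<integral>x. G n x \<partial>M)) \<longlonglongrightarrow> 0" for G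
 proof (rule weak_conv_imp_integral_bdd_continuous_conv[OF _ _ _ g(1), where B = 1])
  show rd: "real_distribution (\<nu> G n)" for n
   unfolding \<nu>_def by (rule weighted_distribution(1)[OF M Y G G1])
  show "weak_conv_m (\<nu> G) D"
  proof (rule levy_continuity[OF rd D])
   fix u
   have eq: "char (\<nu> G n) u = ((\<integral>x. iexp (u * Y n x) * complex_of_real (G n x) \<partial>M) + 2 * (\<integral>x. iexp (u * Y n x) \<partial>M)) / of_real ((\<integral>x. G n x \<partial>M) + 2)" for n
    unfolding \<nu>_def char_def by (rule weighted_distribution(2)[OF M Y G G1]) auto
   have bd: "\<bar>\<integral>x. G n x \<partial>M\<bar> <= 1" for n
    by (rule weighted_distribution(3)[OF M Y G G1])
   define p where "p n = ((\<integral>x. iexp (u * Y n x) * complex_of_real (G n x) \<partial>M) - char D u * (\<integral>x. G n x \<partial>M))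
      + 2 * ((\<integral>x. iexp (u * Y n x) \<partial>M) - char D u)" for n
   have p: "p \<longlonglongrightarrow> 0 + 2 * (char D u - char D u)"
    unfolding p_def by (intro tendsto_intros lim lim1)
   have "(\<lambda>n. char (\<nu> G n) u - char D u) \<longlonglongrightarrow> 0"
   proof (rule Lim_null_comparison)
    show "\<forall>\<^sub>F n in sequentially. norm (char (\<nu> G n) u - char D u) <= norm (p n)"
    proof (intro always_eventually allI)
     fix n
     define c where "c = (\<integral>x. G n x \<partial>M) + 2"
     have c: "1 <= c" using bd[of n] by (simp add: c_def abs_le_iff)
     have "char (\<nu> G n) u - char D u = p n / of_real c"
      using c unfolding eq c_def[symmetric]
      by (simp add: p_def divide_simps) (simp add: c_def algebra_simps)
     then have "norm (char (\<nu> G n) u - char D u) = norm (p n) / c" using c by (simp add: norm_divide)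
     also have "... <= norm (p n)" using c by (simp add: divide_le_eq mult_left_le_one_le mult_le_cancel_left1)
     finally show "norm (char (\<nu> G n) u - char D u) <= norm (p n)" .
    qed
    show "(\<lambda>n. norm (p n)) \<longlonglongrightarrow> 0" using tendsto_norm[OF p] by simp
   qed
   then show "(\<lambda>n. char (\<nu> G n) u) \<longlonglongrightarrow> char D u" by (rule Lim_transform2[rotated, OF _ tendsto_const, simplified] LIM_zero_cancel)
  qed
 qed (use D g(2) in auto)
 have 1: "(\<lambda>n. \<integral>z. g z \<partial>\<nu> H n) \<longlonglongrightarrow> (\<integral>z. g z \<partial>D)" by (rule conv[OF H H1 lim])
 have 0: "(\<lambda>n. \<integral>z. g z \<partial>\<nu> (\<lambda>_ _. 0) n) \<longlonglongrightarrow> (\<integral>z. g z \<partial>D)" by (rule conv) auto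
 have e1: "(\<integral>z. g z \<partial>\<nu> H n) = ((\<integral>x. g (Y n x) * H n x \<partial>M) + 2 * (\<integral>x. g (Y n x) \<partial>M)) / (h n + 2)" for n
  using weighted_distribution(2)[OF M Y H H1, of g n n] g(2) unfolding \<nu>_def h_def by simp
 have e0: "(\<integral>z. g z \<partial>\<nu> (\<lambda>_ _. 0) n) = (\<integral>x. g (Y n x) \<partial>M)" for n
  using weighted_distribution(2)[OF M Y, of "\<lambda>_. 0" g n] g(2) unfolding \<nu>_def by simp
 define G where "G = (\<integral>z. g z \<partial>D)"
 have "(\<lambda>n. (h n + 2) * ((\<integral>z. g z \<partial>\<nu> H n) - G) - 2 * ((\<integral>z. g z \<partial>\<nu> (\<lambda>_ _. 0) n) - G)) \<longlonglongrightarrow> 0 - 2 * (G - G)"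
 proof (intro tendsto_intros)
  have "(\<lambda>n. (\<integral>z. g z \<partial>\<nu> H n) - G) \<longlonglongrightarrow> 0" using 1 by (simp add: G_def LIM_zero)
  moreover have "Bfun (\<lambda>n. h n + 2) sequentially"
   using h_abs by (intro BfunI[where K = 3] always_eventually allI) (auto intro: order_trans[OF abs_triangle_ineq])
  ultimately show "(\<lambda>n. (h n + 2) * ((\<integral>z. g z \<partial>\<nu> H n) - G)) \<longlonglongrightarrow> 0"
   using bounded_bilinear.Bfun_prod_Zfun[OF bounded_bilinear_mult] by (simp add: tendsto_Zfun_iff)
  show "(\<lambda>n. \<integral>z. g z \<partial>\<nu> (\<lambda>_ _. 0) n) \<longlonglongrightarrow> G" using 0 by (simp add: G_def)
 qed
 moreover have "(h n + 2) * ((\<integral>z. g z \<partial>\<nu> H n) - G) - 2 * ((\<integral>z. g z \<partial>\<nu> (\<lambda>_ _. 0) n) - G)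
   = (\<integral>x. g (Y n x) * H n x \<partial>M) - G * h n" for n
  using h2[of n] unfolding e1 e0 by (simp add: field_simps)
 ultimately show ?thesis by (simp add: G_def h_def)
qed

definition coord_lipschitz :: "'i set => real => (('i => real) => real) => bool" where
 "coord_lipschitz I L \<Phi> \<longleftrightarrow> (\<forall>v w. \<bar>\<Phi> v - \<Phi> w\<bar> <= L * (\<Sum>i\<in>I. \<bar>v i - w i\<bar>))"

lemma coord_lipschitz_measurable:
 fixes Y :: "'a => 'i :: countable => real"
 assumes \<Phi>: "coord_lipschitz I L \<Phi>" and Y: "!!i. i \<in> I ==> (\<lambda>x. Y x i) \<in> borel_measurable N"
 shows "(\<lambda>x. \<Phi> (Y x)) \<in> borel_measurable N"
proof -
 have "continuous_on UNIV \<Phi>"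
 proof (rule continuous_at_imp_continuous_on, rule ballI)
  fix w :: "'i => real"
  have c: "((\<lambda>v. v i) \<longlongrightarrow> w i) (at w)" for i
   using continuous_on_product_coordinates[of i] by (auto simp: continuous_on_def)
  have "((\<lambda>v. L * (\<Sum>i\<in>I. \<bar>v i - w i\<bar>)) \<longlongrightarrow> L * (\<Sum>i\<in>I. \<bar>w i - w i\<bar>)) (at w)"
   by (intro tendsto_intros c)
  then have "((\<lambda>v. L * (\<Sum>i\<in>I. \<bar>v i - w i\<bar>)) \<longlongrightarrow> 0) (at w)" by simp
  then have "((\<lambda>v. \<Phi> v - \<Phi> w) \<longlongrightarrow> 0) (at w)"
   by (rule Lim_null_comparison[rotated]) (use \<Phi> in \<open>auto simp: coord_lipschitz_def\<close>)
  then show "isCont \<Phi> w" by (simp add: isCont_def LIM_zero_cancel)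
 qed
 then have \<Phi>m: "\<Phi> \<in> borel_measurable borel" by (rule borel_measurable_continuous_onI)
 have "(\<lambda>x. if i \<in> I then Y x i else 0) \<in> borel_measurable N" for i
  using Y by (cases "i \<in> I") auto
 then have "(\<lambda>x i. if i \<in> I then Y x i else 0) \<in> borel_measurable N"
  by (rule measurable_coordinatewise_then_product)
 then have "(\<lambda>x. \<Phi> (\<lambda>i. if i \<in> I then Y x i else 0)) \<in> borel_measurable N"
  by (rule measurable_compose[OF _ \<Phi>m])
 moreover have "\<Phi> (\<lambda>i. if i \<in> I then Y x i else 0) = \<Phi> (Y x)" for x
 proof -
  have "\<bar>\<Phi> (\<lambda>i. if i \<in> I then Y x i else 0) - \<Phi> (Y x)\<bar> <= L * (\<Sum>i\<in>I. \<bar>(if i \<in> I then Y x i else 0) - Y x i\<bar>)"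
   using \<Phi> by (simp only: coord_lipschitz_def)
  also have "... = 0" by simp
  finally show ?thesis by simp
 qed
 ultimately show ?thesis by simp
qed

text \<open>Hat functions of width \<open>h\<close> centred at the multiples of \<open>h\<close>; they form a partition of unity.\<close>
definition tent :: "real => int => real => real" where
 "tent h i z = max 0 (1 - \<bar>z / h - of_int i\<bar>)"

lemma tent_bounds: "0 <= tent h i z" "tent h i z <= 1"
 by (auto simp: tent_def)

lemma isCont_tent: "h \<noteq> 0 ==> isCont (tent h i) z"
 unfolding tent_def[abs_def] by (intro continuous_intros) auto

lemma tent_support: "0 < h ==> tent h i z \<noteq> 0 ==> \<bar>z - of_int i * h\<bar> <= h"
proof -
 assume h: "0 < h" and "tent h i z \<noteq> 0"
 then have "\<bar>z / h - of_int i\<bar> <= 1" by (auto simp: tent_def max_def split: if_splits)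
 then have "h * \<bar>z / h - of_int i\<bar> <= h * 1" using h by (intro mult_left_mono) auto
 also have "h * \<bar>z / h - of_int i\<bar> = \<bar>z - of_int i * h\<bar>"
 proof -
  have "h * \<bar>z / h - of_int i\<bar> = \<bar>h * (z / h - of_int i)\<bar>" using h by (simp only: abs_mult abs_of_pos)
  also have "h * (z / h - of_int i) = z - of_int i * h" using h by (simp add: right_diff_distrib)
  finally show ?thesis .
 qed
 finally show ?thesis by simp
qed

lemma tent_sum:
 fixes K :: nat
 assumes "0 < h"
 shows "(\<Sum>i\<in>{- int K..int K}. tent h i z) <= 1"
  and "\<bar>z\<bar> <= h * real K ==> (\<Sum>i\<in>{- int K..int K}. tent h i z) = 1"
proof -
 define y where "y = z / h"
 define j where "j = \<lfloor>y\<rfloor>"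
 have j: "of_int j <= y" "y < of_int j + 1" unfolding j_def by linarith+
 have t0: "tent h i z = 0" if "i \<noteq> j" "i \<noteq> j + 1" for i
 proof -
  have "i <= j - 1 \<or> j + 2 <= i" using that by linarith
  then have "real_of_int i <= of_int (j - 1) \<or> of_int (j + 2) <= real_of_int i" by (simp only: of_int_le_iff)
  then have "1 <= \<bar>y - of_int i\<bar>" using j by auto
  then show ?thesis by (simp add: tent_def y_def)
 qed
 have tj: "tent h j z = 1 - (y - of_int j)" "tent h (j + 1) z = y - of_int j"
  using j by (auto simp: tent_def y_def[symmetric] max_def)
 have eq: "(\<Sum>i\<in>{- int K..int K}. tent h i z) = (\<Sum>i\<in>{- int K..int K} \<inter> {j, j + 1}. tent h i z)"
  by (rule sum.mono_neutral_right) (use t0 in auto)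
 have two: "(\<Sum>i\<in>{j, j + 1}. tent h i z) = 1" using tj by simp
 show "(\<Sum>i\<in>{- int K..int K}. tent h i z) <= 1"
  unfolding eq two[symmetric] by (rule sum_mono2) (auto simp: tent_bounds)
 assume z: "\<bar>z\<bar> <= h * real K"
 then have y: "\<bar>y\<bar> <= real K" unfolding y_def using assms by (simp add: abs_divide divide_le_eq mult.commute)
 have j1: "- int K <= j" unfolding j_def using y by linarith
 have j2: "j <= int K" unfolding j_def using y by linarith
 show "(\<Sum>i\<in>{- int K..int K}. tent h i z) = 1"
 proof (cases "j = int K")
  case True
  then have "y = of_int j" using y j by auto
  then have "tent h j z = 1" using tj by simp
  moreover have "{- int K..int K} \<inter> {j, j + 1} = {j}" using True by auto
  ultimately show ?thesis unfolding eq by simp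
 next
  case False
  then have "{- int K..int K} \<inter> {j, j + 1} = {j, j + 1}" using j1 j2 by auto
  then show ?thesis unfolding eq two[symmetric] by simp
 qed
qed

lemma tent_interpolation:
 fixes g :: "real => real" and K :: nat
 assumes h: "0 < h" and g: "!!z. \<bar>g z\<bar> <= 1" "!!z w. \<bar>g z - g w\<bar> <= L * \<bar>z - w\<bar>" "0 <= L"
 shows "\<bar>g z - (\<Sum>i\<in>{- int K..int K}. tent h i z * g (of_int i * h))\<bar> <= L * h + (1 - (\<Sum>i\<in>{- int K..int K}. tent h i z))"
proof -
 let ?J = "{- int K..int K}"
 have "g z - (\<Sum>i\<in>?J. tent h i z * g (of_int i * h))
   = (\<Sum>i\<in>?J. tent h i z * (g z - g (of_int i * h))) + (1 - (\<Sum>i\<in>?J. tent h i z)) * g z"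
  by (simp add: right_diff_distrib sum_subtractf sum_distrib_right left_diff_distrib)
 also have "\<bar>...\<bar> <= (\<Sum>i\<in>?J. tent h i z * (L * h)) + (1 - (\<Sum>i\<in>?J. tent h i z)) * 1"
 proof (rule order_trans[OF abs_triangle_ineq add_mono])
  have "tent h i z * \<bar>g z - g (of_int i * h)\<bar> <= tent h i z * (L * h)" for i
  proof (cases "tent h i z = 0")
   case False
   have "\<bar>g z - g (of_int i * h)\<bar> <= L * \<bar>z - of_int i * h\<bar>" by (rule g(2))
   also have "... <= L * h" using tent_support[OF h False] g(3) by (intro mult_left_mono) auto
   finally show ?thesis using tent_bounds by (intro mult_left_mono) auto
  qed simp
  then show "\<bar>\<Sum>i\<in>?J. tent h i z * (g z - g (of_int i * h))\<bar> <= (\<Sum>i\<in>?J. tent h i z * (L * h))"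
   by (intro order_trans[OF sum_abs] sum_mono) (simp add: abs_mult tent_bounds)
  show "\<bar>(1 - (\<Sum>i\<in>?J. tent h i z)) * g z\<bar> <= (1 - (\<Sum>i\<in>?J. tent h i z)) * 1"
   unfolding abs_mult using tent_sum(1)[OF h, of z K] g(1)[of z] by (intro mult_mono) auto
 qed
 also have "(\<Sum>i\<in>?J. tent h i z * (L * h)) <= L * h"
  unfolding sum_distrib_right[symmetric] using tent_sum(1)[OF h, of z K] g(3) h tent_bounds
  by (intro mult_left_le_one_le sum_nonneg) auto
 finally show ?thesis by simp
qed

text \<open>A single law is tight, so finitely many hat functions suffice up to a small error.\<close>
lemma tent_tail:
 assumes h: "0 < h" and D: "real_distribution D"
 shows "(\<lambda>K :: nat. \<integral>z. 1 - (\<Sum>i\<in>{- int K..int K}. tent h i z) \<partial>D) \<longlonglongrightarrow> 0"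
proof -
 interpret real_distribution D by (rule D)
 have "(\<lambda>K :: nat. \<integral>z. 1 - (\<Sum>i\<in>{- int K..int K}. tent h i z) \<partial>D) \<longlonglongrightarrow> (\<integral>z. 0 \<partial>D)"
 proof (rule integral_dominated_convergence[where w = "\<lambda>_. 1"])
  show "AE z in D. (\<lambda>K. 1 - (\<Sum>i\<in>{- int K..int K}. tent h i z)) \<longlonglongrightarrow> 0"
  proof (rule AE_I2)
   fix z
   obtain K0 :: nat where "\<bar>z\<bar> / h <= real K0" using real_arch_simple by blast
   then have "\<bar>z\<bar> <= h * real K" if "K0 <= K" for K
   proof -
    have "\<bar>z\<bar> / h <= real K" using \<open>\<bar>z\<bar> / h <= real K0\<close> that by linarith
    then show ?thesis using h by (simp add: divide_le_eq mult.commute)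
   qed
   then have "eventually (\<lambda>K. 1 - (\<Sum>i\<in>{- int K..int K}. tent h i z) = 0) sequentially"
    using tent_sum(2)[OF h] by (auto simp: eventually_sequentially)
   then show "(\<lambda>K. 1 - (\<Sum>i\<in>{- int K..int K}. tent h i z)) \<longlonglongrightarrow> 0" by (rule tendsto_eventually)
  qed
  show "AE z in D. norm (1 - (\<Sum>i\<in>{- int K..int K}. tent h i z)) <= 1" for K
  proof (rule AE_I2)
   fix z
   have "0 <= (\<Sum>i\<in>{- int K..int K}. tent h i z)" by (intro sum_nonneg tent_bounds)
   then show "norm (1 - (\<Sum>i\<in>{- int K..int K}. tent h i z)) <= 1" using tent_sum(1)[OF h, of z K] by simp
  qed
 qed (auto simp: tent_def[abs_def])
 then show ?thesis by simp
qed

context exact_system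
begin

text \<open>Otherwise \<open>block_clt\<close> would produce characteristic functions of absolute value above 1.\<close>
lemma sigma2_nonneg: "0 <= sigma2"
proof (rule ccontr)
 assume neg: "\<not> 0 <= sigma2"
 define r where "r = exp (- (sigma2 / 2)) - 1"
 have r: "0 < r" using neg by (simp add: r_def)
 obtain n0 where n0: "\<forall>n\<ge>n0. \<forall>N\<le>n. \<forall>H. H \<in> borel_measurable M --> (\<forall>x\<in>space M. \<bar>H x\<bar> <= 1) -->
  norm ((MEAN x. iexp (1 / sqrt (real n) * S N x) * complex_of_real (H ((T ^^ N) x)))
   - exp (- (1\<^sup>2 * sigma2 * real N / (2 * real n))) * (MEAN x. H x)) <= r / 2"
  using block_clt[of "r / 2" 1] r by auto
 define n where "n = Suc n0"
 define I where "I = (MEAN x. iexp (1 / sqrt (real n) * S n x))"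
 have "norm (I - complex_of_real (exp (- (sigma2 / 2)))) <= r / 2"
  using n0[rule_format, of n n "\<lambda>_. 1"] by (simp add: n_def I_def prob_space del: of_nat_Suc of_real_exp)
 moreover have "norm I <= 1" unfolding I_def by (rule integral_norm_le) auto
 moreover have "norm (complex_of_real (exp (- (sigma2 / 2)))) <= norm I + norm (I - complex_of_real (exp (- (sigma2 / 2))))"
  using norm_triangle_sub[of "complex_of_real (exp (- (sigma2 / 2)))" I] by (simp only: norm_minus_commute)
 ultimately have "exp (- (sigma2 / 2)) <= 1 + r / 2" by (simp del: of_real_exp)
 moreover have False if "0 < y - 1" "y <= 1 + (y - 1) / 2" for y :: real using that by (simp add: field_simps)
 ultimately show False using r unfolding r_def by blast
qed

lemma block_limit:
 fixes l :: "nat => nat" and H :: "nat => 'a => real"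
 assumes D: "real_distribution D" and char: "!!u. char D u = exp (- (u\<^sup>2 * sigma2 * \<theta> / 2))"
  and l: "!!n. l n <= n" "(\<lambda>n. real (l n) / real n) \<longlonglongrightarrow> \<theta>"
  and H[measurable]: "!!n. H n \<in> borel_measurable M" and H1: "!!n x. x \<in> space M ==> \<bar>H n x\<bar> <= 1"
  and g: "!!z. isCont g z" "!!z. \<bar>g z\<bar> <= 1"
 shows "(\<lambda>n. (MEAN x. g (S (l n) x / sqrt (real n)) * H n ((T ^^ l n) x)) - (\<integral>z. g z \<partial>D) * (MEAN x. H n x)) \<longlonglongrightarrow> (0 :: real)"
proof -
 have gen: "(\<lambda>n. (MEAN x. iexp (u * (S (l n) x / sqrt (real n))) * complex_of_real (H n ((T ^^ l n) x)))
    - char D u * (MEAN x. H n x)) \<longlonglongrightarrow> 0"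
  if H[measurable]: "!!n. H n \<in> borel_measurable M" and H1: "!!n x. x \<in> space M ==> \<bar>H n x\<bar> <= 1"
  for H :: "nat => 'a => real" and u
 proof -
  define J where "J n = (MEAN x. iexp (u * (S (l n) x / sqrt (real n))) * complex_of_real (H n ((T ^^ l n) x)))" for n
  define c where "c n = exp (- (u\<^sup>2 * sigma2 * real (l n) / (2 * real n)))" for n
  define h where "h n = (MEAN x. H n x)" for n
  have h1: "\<bar>h n\<bar> <= 1" for n
   using integral_norm_le[OF H, of n 1] H1 unfolding h_def by auto
  have "(\<lambda>n. J n - complex_of_real (c n) * h n) \<longlonglongrightarrow> 0"
  proof (rule LIMSEQ_I)
   fix e :: real assume e: "0 < e"
   then obtain n0 where n0: "\<forall>n\<ge>n0. \<forall>N\<le>n. \<forall>H. H \<in> borel_measurable M --> (\<forall>x\<in>space M. \<bar>H x\<bar> <= 1) -->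
    norm ((MEAN x. iexp (u / sqrt (real n) * S N x) * complex_of_real (H ((T ^^ N) x)))
     - exp (- (u\<^sup>2 * sigma2 * real N / (2 * real n))) * (MEAN x. H x)) <= e / 2"
    using block_clt[of "e / 2" u] by auto
   have "norm (J n - complex_of_real (c n) * h n) <= e / 2" if "n0 <= n" for n
    unfolding J_def c_def h_def
    using n0[rule_format, OF that l(1) H H1, of n] by (simp only: times_divide_eq_right times_divide_eq_left of_real_mult)
   then show "\<exists>n0. \<forall>n\<ge>n0. norm (J n - complex_of_real (c n) * h n - 0) < e"
    using e by (intro exI[of _ n0] allI impI) (fastforce intro: le_less_trans[of _ "e / 2"])
  qed
  moreover have "(\<lambda>n. complex_of_real ((c n - exp (- (u\<^sup>2 * sigma2 * \<theta> / 2))) * h n)) \<longlonglongrightarrow> 0"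
  proof (rule Lim_null_comparison)
   have "(\<lambda>n. exp (- (u\<^sup>2 * sigma2 * (real (l n) / real n) / 2)) - exp (- (u\<^sup>2 * sigma2 * \<theta> / 2))) \<longlonglongrightarrow> exp (- (u\<^sup>2 * sigma2 * \<theta> / 2)) - exp (- (u\<^sup>2 * sigma2 * \<theta> / 2))"
    by (intro tendsto_intros l(2)) auto
   moreover have "exp (- (u\<^sup>2 * sigma2 * (real (l n) / real n) / 2)) = c n" for n
    by (simp add: c_def)
   ultimately have "(\<lambda>n. c n - exp (- (u\<^sup>2 * sigma2 * \<theta> / 2))) \<longlonglongrightarrow> 0" by simp
   then show "(\<lambda>n. \<bar>c n - exp (- (u\<^sup>2 * sigma2 * \<theta> / 2))\<bar>) \<longlonglongrightarrow> 0" by (rule tendsto_rabs_zero)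
   show "\<forall>\<^sub>F n in sequentially. norm (complex_of_real ((c n - exp (- (u\<^sup>2 * sigma2 * \<theta> / 2))) * h n)) <= \<bar>c n - exp (- (u\<^sup>2 * sigma2 * \<theta> / 2))\<bar>"
    unfolding norm_of_real abs_mult using h1 by (intro always_eventually allI mult_left_le) auto
  qed
  ultimately have "(\<lambda>n. (J n - complex_of_real (c n) * h n) + complex_of_real ((c n - exp (- (u\<^sup>2 * sigma2 * \<theta> / 2))) * h n)) \<longlonglongrightarrow> 0 + 0"
   by (rule tendsto_add)
  then show ?thesis unfolding J_def[symmetric] h_def[symmetric] char
   by (simp add: algebra_simps del: of_real_exp)
 qed
 have "(\<lambda>n. (MEAN x. g (S (l n) x / sqrt (real n)) * H n ((T ^^ l n) x)) - (\<integral>z. g z \<partial>D) * (MEAN x. H n ((T ^^ l n) x))) \<longlonglongrightarrow> 0"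
 proof (rule weighted_levy[OF prob_space_axioms D _ _ _ _ _ g])
  show "(\<lambda>n. (MEAN x. iexp (u * (S (l n) x / sqrt (real n))) * complex_of_real (H n ((T ^^ l n) x)))
    - char D u * (MEAN x. H n ((T ^^ l n) x))) \<longlonglongrightarrow> 0" for u
   using gen[OF H H1] by (simp add: T_pow_invariant)
  have "(\<lambda>n. (MEAN x. iexp (u * (S (l n) x / sqrt (real n)))) - char D u) \<longlonglongrightarrow> 0" for u
   using gen[of "\<lambda>_ _. 1" u] by (simp add: prob_space)
  then show "(\<lambda>n. (MEAN x. iexp (u * (S (l n) x / sqrt (real n))))) \<longlonglongrightarrow> char D u" for u
   by (rule LIM_zero_cancel)
 qed (use H1 T_pow_space in auto)
 then show ?thesis by (simp add: T_pow_invariant)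
qed

text \<open>Only the coordinate of the first block has to be discretised, by hat functions, since the weights in
\<open>block_limit\<close> are arbitrary bounded functions of the later blocks.\<close>
lemma peel_first_block:
 fixes l :: "nat => nat" and R :: "nat => 'a => 'r" and \<Phi> :: "real => 'r => real"
 assumes D: "real_distribution D" and char: "!!u. char D u = exp (- (u\<^sup>2 * sigma2 * \<theta> / 2))"
  and l: "!!n. l n <= n" "(\<lambda>n. real (l n) / real n) \<longlonglongrightarrow> \<theta>"
  and meas[measurable]: "!!n z. (\<lambda>x. \<Phi> z (R n x)) \<in> borel_measurable M"
   "!!n. (\<lambda>x. \<Phi> (S (l n) x / sqrt (real n)) (R n ((T ^^ l n) x))) \<in> borel_measurable M"
   "!!n. (\<lambda>x. \<integral>z. \<Phi> z (R n x) \<partial>D) \<in> borel_measurable M"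
  and \<Phi>1: "!!z r. \<bar>\<Phi> z r\<bar> <= 1" and \<Phi>L: "!!z w r. \<bar>\<Phi> z r - \<Phi> w r\<bar> <= L * \<bar>z - w\<bar>" and L: "0 <= L"
 shows "(\<lambda>n. (MEAN x. \<Phi> (S (l n) x / sqrt (real n)) (R n ((T ^^ l n) x))) - (MEAN x. (\<integral>z. \<Phi> z (R n x) \<partial>D))) \<longlonglongrightarrow> 0"
proof (rule LIMSEQ_I)
 fix e :: real assume e: "0 < e"
 interpret D: real_distribution D by (rule D)
 define h where "h = e / (6 * (L + 1))"
 have h: "0 < h" unfolding h_def using e L by (intro divide_pos_pos) auto
 have Lh: "L * h <= e / 6" unfolding h_def using e L by (simp add: field_simps)
 have t[measurable]: "tent h i \<in> borel_measurable borel" for i unfolding tent_def[abs_def] by measurable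
 have cont: "continuous_on UNIV (\<lambda>z. \<Phi> z r)" for r
  by (rule lipschitz_on_continuous_on[of L]) (use \<Phi>L L in \<open>auto simp: lipschitz_on_def dist_real_def\<close>)
 have \<Phi>m[measurable]: "(\<lambda>z. \<Phi> z r) \<in> borel_measurable borel" for r
  by (rule borel_measurable_continuous_onI[OF cont])
 have int\<Phi>: "integrable D (\<lambda>z. \<Phi> z r)" for r
  using \<Phi>1 by (intro D.integrable_const_bound[of _ 1]) auto
 have intt: "integrable D (tent h i)" for i
  using tent_bounds by (intro D.integrable_const_bound[of _ 1]) auto
 from order_tendstoD(2)[OF tent_tail[OF h D], of "e / 6"] e
 obtain K :: nat where K: "(\<integral>z. 1 - (\<Sum>i\<in>{- int K..int K}. tent h i z) \<partial>D) < e / 6"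
  by (auto simp: eventually_sequentially)
 define J where "J = {- int K..int K}"
 define rem where "rem z = 1 - (\<Sum>i\<in>J. tent h i z)" for z
 have rem: "0 <= rem z" "rem z <= 1" for z
  using tent_sum(1)[OF h, of z K] sum_nonneg[of J "\<lambda>i. tent h i z"] tent_bounds by (auto simp: rem_def J_def)
 have rem_cont: "isCont rem z" for z
  unfolding rem_def[abs_def] using h by (intro continuous_intros isCont_tent) auto
 have rem_meas[measurable]: "rem \<in> borel_measurable borel" unfolding rem_def[abs_def] by measurable
 have interp: "\<bar>\<Phi> z r - (\<Sum>i\<in>J. tent h i z * \<Phi> (of_int i * h) r)\<bar> <= L * h + rem z" for z r
  unfolding J_def rem_def by (rule tent_interpolation[OF h \<Phi>1 \<Phi>L L])
 have intrem: "integrable D rem" using rem by (intro D.integrable_const_bound[of _ 1]) auto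
 define Y where "Y n x = S (l n) x / sqrt (real n)" for n x
 have Ym[measurable]: "Y n \<in> borel_measurable M" for n unfolding Y_def[abs_def] by measurable
 define A where "A i n = (MEAN x. tent h i (Y n x) * \<Phi> (of_int i * h) (R n ((T ^^ l n) x)))" for i n
 define A' where "A' i n = (\<integral>z. tent h i z \<partial>D) * (MEAN x. \<Phi> (of_int i * h) (R n x))" for i n
 define r where "r n = (MEAN x. rem (Y n x))" for n
 define r' where "r' = (\<integral>z. rem z \<partial>D)"
 have "(\<lambda>n. A i n - A' i n) \<longlonglongrightarrow> 0" for i
  unfolding A_def A'_def Y_def
  by (rule block_limit[OF D char l]) (use tent_bounds \<Phi>1 h in \<open>auto intro: isCont_tent\<close>)
 then have "(\<lambda>n. \<Sum>i\<in>J. A i n - A' i n) \<longlonglongrightarrow> (\<Sum>i\<in>J. 0)" by (intro tendsto_sum) auto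
 then have ev1: "eventually (\<lambda>n. \<bar>\<Sum>i\<in>J. A i n - A' i n\<bar> < e / 6) sequentially"
  using e unfolding tendsto_iff dist_real_def by (elim allE[of _ "e / 6"]) simp
 have "(\<lambda>n. r n * 1 - r' * 1) \<longlonglongrightarrow> 0"
  using block_limit[OF D char l, of "\<lambda>_ _. 1" rem] rem rem_cont unfolding r_def r'_def Y_def by (simp add: prob_space)
 then have ev2: "eventually (\<lambda>n. \<bar>r n - r'\<bar> < e / 6) sequentially"
  using e unfolding tendsto_iff dist_real_def by (elim allE[of _ "e / 6"]) simp
 have r'e: "r' < e / 6" using K by (simp add: r'_def rem_def[abs_def] J_def)
 have lower: "\<bar>(MEAN x. (\<integral>z. \<Phi> z (R n x) \<partial>D)) - (\<Sum>i\<in>J. A' i n)\<bar> <= L * h + r'" for n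
 proof -
  have "\<bar>(\<integral>z. \<Phi> z s \<partial>D) - (\<Sum>i\<in>J. (\<integral>z. tent h i z \<partial>D) * \<Phi> (of_int i * h) s)\<bar> <= L * h + r'" for s
  proof -
   have "(\<integral>z. \<Phi> z s \<partial>D) - (\<Sum>i\<in>J. (\<integral>z. tent h i z \<partial>D) * \<Phi> (of_int i * h) s)
    = (\<integral>z. \<Phi> z s - (\<Sum>i\<in>J. tent h i z * \<Phi> (of_int i * h) s) \<partial>D)"
    using int\<Phi> intt by simp
   also have "\<bar>...\<bar> <= (\<integral>z. \<bar>\<Phi> z s - (\<Sum>i\<in>J. tent h i z * \<Phi> (of_int i * h) s)\<bar> \<partial>D)" by (rule integral_abs_bound)
   also have "... <= (\<integral>z. L * h + rem z \<partial>D)"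
    using int\<Phi> intt intrem interp by (intro integral_mono) auto
   also have "... = L * h + r'" using intrem D.prob_space by (simp add: r'_def)
   finally show ?thesis .
  qed
  note pt = this
  have i1: "integrable M (\<lambda>x. \<Phi> z (R n x))" for z using \<Phi>1 by (intro integrable_bdd[of _ 1]) auto
  have "\<bar>\<integral>z. \<Phi> z s \<partial>D\<bar> <= 1" for s
   using D.integral_le_const[OF integrable_abs[OF int\<Phi>[of s]], of 1] \<Phi>1 by (intro order_trans[OF integral_abs_bound]) auto
  then have i2: "integrable M (\<lambda>x. \<integral>z. \<Phi> z (R n x) \<partial>D)" by (intro integrable_bdd[of _ 1]) auto
  have "(\<Sum>i\<in>J. A' i n) = (MEAN x. (\<Sum>i\<in>J. (\<integral>z. tent h i z \<partial>D) * \<Phi> (of_int i * h) (R n x)))"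
   using i1 by (simp add: A'_def)
  then show ?thesis
   using integral_diff_le[of "\<lambda>x. \<integral>z. \<Phi> z (R n x) \<partial>D" "\<lambda>x. \<Sum>i\<in>J. (\<integral>z. tent h i z \<partial>D) * \<Phi> (of_int i * h) (R n x)" "L * h + r'"] i1 i2 pt by simp
 qed
 have upper: "\<bar>(MEAN x. \<Phi> (Y n x) (R n ((T ^^ l n) x))) - (\<Sum>i\<in>J. A i n)\<bar> <= L * h + r n" for n
 proof -
  have i1: "integrable M (\<lambda>x. tent h i (Y n x) * \<Phi> z (R n ((T ^^ l n) x)))" for i z
  proof (rule integrable_bdd[of _ "1 * 1"])
   show "(\<lambda>x. tent h i (Y n x) * \<Phi> z (R n ((T ^^ l n) x))) \<in> borel_measurable M"
    using measurable_compose[OF T_pow_meas meas(1)] by (intro borel_measurable_times) auto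
   show "norm (tent h i (Y n x) * \<Phi> z (R n ((T ^^ l n) x))) <= 1 * 1" for x
    unfolding norm_mult using tent_bounds \<Phi>1 by (intro mult_mono) auto
  qed
  have i2: "integrable M (\<lambda>x. \<Phi> (Y n x) (R n ((T ^^ l n) x)))" using meas(2)[of n] \<Phi>1 by (intro integrable_bdd[of _ 1]) (auto simp: Y_def)
  have i3: "integrable M (\<lambda>x. rem (Y n x))" using rem by (intro integrable_bdd[of _ 1]) auto
  have "(MEAN x. \<Phi> (Y n x) (R n ((T ^^ l n) x))) - (\<Sum>i\<in>J. A i n)
    = (MEAN x. \<Phi> (Y n x) (R n ((T ^^ l n) x)) - (\<Sum>i\<in>J. tent h i (Y n x) * \<Phi> (of_int i * h) (R n ((T ^^ l n) x))))"
   using i1 i2 by (simp add: A_def)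
  also have "\<bar>...\<bar> <= (MEAN x. \<bar>\<Phi> (Y n x) (R n ((T ^^ l n) x)) - (\<Sum>i\<in>J. tent h i (Y n x) * \<Phi> (of_int i * h) (R n ((T ^^ l n) x)))\<bar>)"
   by (rule integral_abs_bound)
  also have "... <= (MEAN x. L * h + rem (Y n x))"
   using i1 i2 i3 interp by (intro integral_mono) auto
  also have "... = L * h + r n" using i3 by (simp add: r_def prob_space)
  finally show ?thesis .
 qed
 have "eventually (\<lambda>n. norm ((MEAN x. \<Phi> (S (l n) x / sqrt (real n)) (R n ((T ^^ l n) x))) - (MEAN x. (\<integral>z. \<Phi> z (R n x) \<partial>D)) - 0) < e) sequentially"
  using ev1 ev2
 proof eventually_elim
  case (elim n)
  have "\<bar>(MEAN x. \<Phi> (Y n x) (R n ((T ^^ l n) x))) - (MEAN x. (\<integral>z. \<Phi> z (R n x) \<partial>D))\<bar> < e"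
   using upper[of n] lower[of n] elim Lh r'e unfolding sum_subtractf by linarith
  then show ?case by (simp add: Y_def)
 qed
 then show "\<exists>n0. \<forall>n\<ge>n0. norm ((MEAN x. \<Phi> (S (l n) x / sqrt (real n)) (R n ((T ^^ l n) x))) - (MEAN x. (\<integral>z. \<Phi> z (R n x) \<partial>D)) - 0) < e"
  by (simp add: eventually_sequentially)
qed

text \<open>Integrating out the first coordinate leaves a function of the remaining ones of the same kind, and
invariance lets the remaining blocks start at time 0 again.\<close>
lemma blocks_limit:
 fixes N :: "nat => nat => nat" and \<Phi> :: "(nat => real) => real"
 assumes D: "!!i. real_distribution (D i)" "!!i u. i < k ==> char (D i) u = exp (- (u\<^sup>2 * sigma2 * \<theta> i / 2))"
  and N: "!!n i. i < k ==> N n i <= N n (Suc i)" "!!n. N n k <= n"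
   "!!i. i < k ==> (\<lambda>n. real (N n (Suc i) - N n i) / real n) \<longlonglongrightarrow> \<theta> i"
  and \<Phi>: "coord_lipschitz {j..<k} L \<Phi>" "0 <= L" "!!v. \<bar>\<Phi> v\<bar> <= 1" and j: "j <= k"
 shows "(\<lambda>n. MEAN x. \<Phi> (\<lambda>i. S (N n (Suc i) - N n i) ((T ^^ (N n i - N n j)) x) / sqrt (real n))) \<longlonglongrightarrow> (\<integral>v. \<Phi> v \<partial>PiM {j..<k} D)"
 using j \<Phi>
proof (induction j arbitrary: \<Phi> rule: inc_induct)
 case base
 have c: "\<Phi> v = \<Phi> w" for v w using base by (auto simp: coord_lipschitz_def)
 have "\<Phi> = (\<lambda>_. \<Phi> (\<lambda>_. 0))" using c by auto
 interpret PD: prob_space "PiM {k..<k} D" by (intro prob_space_PiM real_distribution.axioms(1) D)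
 have "(MEAN x. \<Phi> (Y x)) = \<Phi> (\<lambda>_. 0)" for Y using c[of "Y _" "\<lambda>_. 0"] by (simp add: prob_space)
 moreover have "(\<integral>v. \<Phi> v \<partial>PiM {k..<k} D) = (\<integral>v. \<Phi> (\<lambda>_. 0) \<partial>PiM {k..<k} D)"
  by (intro Bochner_Integration.integral_cong refl c)
 ultimately show ?case using PD.prob_space by simp
next
 case (step j)
 interpret Dj: real_distribution "D j" by (rule D)
 interpret Di: prob_space "D i" for i by (rule real_distribution.axioms(1)[OF D(1)])
 interpret PD: product_prob_space D by unfold_locales
 define \<Phi>' where "\<Phi>' r = (\<integral>z. \<Phi> (r(j := z)) \<partial>D j)" for r
 have I: "{j..<k} = insert j {Suc j..<k}" using step.hyps by auto
 have lip: "\<bar>\<Phi> v - \<Phi> w\<bar> <= L * (\<Sum>i\<in>{j..<k}. \<bar>v i - w i\<bar>)" for v w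
  using step.prems(1) by (simp add: coord_lipschitz_def)
 have lip1: "\<bar>\<Phi> (r(j := z)) - \<Phi> (r(j := w))\<bar> <= L * \<bar>z - w\<bar>" for r z w
  using lip[of "r(j := z)" "r(j := w)"] unfolding I by simp
 have lip2: "\<bar>\<Phi> (v(j := z)) - \<Phi> (w(j := z))\<bar> <= L * (\<Sum>i\<in>{Suc j..<k}. \<bar>v i - w i\<bar>)" for v w z
  using lip[of "v(j := z)" "w(j := z)"] unfolding I by simp
 have m: "(\<lambda>z. \<Phi> (r(j := z))) \<in> borel_measurable (D j)" for r
  by (rule coord_lipschitz_measurable[OF step.prems(1)]) auto
 have int: "integrable (D j) (\<lambda>z. \<Phi> (r(j := z)))" for r
  using step.prems(3) m by (intro Dj.integrable_const_bound[of _ 1]) auto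
 have \<Phi>': "coord_lipschitz {Suc j..<k} L \<Phi>'"
  unfolding coord_lipschitz_def
 proof (intro allI)
  fix v w
  have "\<Phi>' v - \<Phi>' w = (\<integral>z. \<Phi> (v(j := z)) - \<Phi> (w(j := z)) \<partial>D j)"
   using int by (simp add: \<Phi>'_def)
  also have "\<bar>...\<bar> <= (\<integral>z. \<bar>\<Phi> (v(j := z)) - \<Phi> (w(j := z))\<bar> \<partial>D j)" by (rule integral_abs_bound)
  also have "... <= (\<integral>z. L * (\<Sum>i\<in>{Suc j..<k}. \<bar>v i - w i\<bar>) \<partial>D j)"
   using int lip2 by (intro integral_mono) auto
  also have "... = L * (\<Sum>i\<in>{Suc j..<k}. \<bar>v i - w i\<bar>)" using Dj.prob_space by simp
  finally show "\<bar>\<Phi>' v - \<Phi>' w\<bar> <= L * (\<Sum>i\<in>{Suc j..<k}. \<bar>v i - w i\<bar>)" .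
 qed
 have \<Phi>'1: "\<bar>\<Phi>' r\<bar> <= 1" for r
  unfolding \<Phi>'_def using Dj.integral_le_const[OF integrable_abs[OF int[of r]], of 1] step.prems(3)
  by (intro order_trans[OF integral_abs_bound]) auto
 have mono: "N n i <= N n i'" if "i <= i'" "i' <= k" for n i i'
  using that by (induction i' rule: dec_induct) (auto intro: order_trans[OF _ N(1)])
 define R where "R n x = (\<lambda>i. S (N n (Suc i) - N n i) ((T ^^ (N n i - N n (Suc j))) x) / sqrt (real n))" for n x
 define l where "l n = N n (Suc j) - N n j" for n
 have Rm: "(\<lambda>x. R n x i) \<in> borel_measurable M" for n i unfolding R_def by measurable
 have upd: "(\<lambda>x. ((Y x)(j := g x)) i) \<in> borel_measurable M"
  if "(\<lambda>x. Y x i) \<in> borel_measurable M" "g \<in> borel_measurable M" for Y :: "'a => nat => real" and g i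
  using that by (cases "i = j") auto
 have "(\<lambda>n. (MEAN x. \<Phi> ((R n ((T ^^ l n) x))(j := S (l n) x / sqrt (real n)))) - (MEAN x. \<Phi>' (R n x))) \<longlonglongrightarrow> 0"
  unfolding \<Phi>'_def
 proof (rule peel_first_block[where \<Phi> = "\<lambda>z r. \<Phi> (r(j := z))" and l = l and R = R, OF D(1) D(2)[OF step.hyps(2)]])
  show "l n <= n" for n using N(2)[of n] mono[of "Suc j" k n] step.hyps by (simp add: l_def)
  show "(\<lambda>n. real (l n) / real n) \<longlonglongrightarrow> \<theta> j" unfolding l_def by (rule N(3)[OF step.hyps(2)])
  show "(\<lambda>x. \<Phi> ((R n x)(j := z))) \<in> borel_measurable M" for n z
   by (rule coord_lipschitz_measurable[OF step.prems(1) upd]) (simp_all add: Rm)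
  show "(\<lambda>x. \<Phi> ((R n ((T ^^ l n) x))(j := S (l n) x / sqrt (real n)))) \<in> borel_measurable M" for n
   by (rule coord_lipschitz_measurable[OF step.prems(1) upd]) (simp_all add: measurable_compose[OF T_pow_meas Rm])
  show "(\<lambda>x. \<integral>z. \<Phi> ((R n x)(j := z)) \<partial>D j) \<in> borel_measurable M" for n
   unfolding \<Phi>'_def[symmetric] by (rule coord_lipschitz_measurable[OF \<Phi>']) (simp add: Rm)
 qed (use step.prems lip1 in auto)
 moreover have "(\<lambda>n. MEAN x. \<Phi>' (R n x)) \<longlonglongrightarrow> (\<integral>v. \<Phi>' v \<partial>PiM {Suc j..<k} D)"
  unfolding R_def by (rule step.IH[OF \<Phi>' step.prems(2) \<Phi>'1])
 ultimately have "(\<lambda>n. MEAN x. \<Phi> ((R n ((T ^^ l n) x))(j := S (l n) x / sqrt (real n)))) \<longlonglongrightarrow> (\<integral>v. \<Phi>' v \<partial>PiM {Suc j..<k} D)"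
  by (rule Lim_transform[rotated])
 moreover have "(\<integral>v. \<Phi>' v \<partial>PiM {Suc j..<k} D) = (\<integral>v. \<Phi> v \<partial>PiM {j..<k} D)"
  unfolding \<Phi>'_def I
 proof (rule PD.product_integral_insert[symmetric])
  interpret P: prob_space "PiM (insert j {Suc j..<k}) D" by (intro prob_space_PiM real_distribution.axioms(1) D)
  show "integrable (PiM (insert j {Suc j..<k}) D) \<Phi>"
  proof (rule P.integrable_const_bound[of _ 1])
   have "(\<lambda>v. \<Phi> v) \<in> borel_measurable (PiM (insert j {Suc j..<k}) D)"
    by (rule coord_lipschitz_measurable[OF step.prems(1)])
      (use measurable_component_singleton[of _ "insert j {Suc j..<k}" D] real_distribution.events_eq_borel[OF D(1)] in \<open>auto simp: I cong: measurable_cong_sets\<close>)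
   then show "\<Phi> \<in> borel_measurable (PiM (insert j {Suc j..<k}) D)" .
  qed (use step.prems(3) in auto)
 qed auto
 moreover have "\<Phi> ((R n ((T ^^ l n) x))(j := S (l n) x / sqrt (real n)))
  = \<Phi> (\<lambda>i. S (N n (Suc i) - N n i) ((T ^^ (N n i - N n j)) x) / sqrt (real n))" for n x
 proof -
  have eq: "((R n ((T ^^ l n) x))(j := S (l n) x / sqrt (real n))) i = S (N n (Suc i) - N n i) ((T ^^ (N n i - N n j)) x) / sqrt (real n)"
   if "i \<in> {j..<k}" for i
  proof (cases "i = j")
   case False
   then have "N n j <= N n (Suc j)" "N n (Suc j) <= N n i" using that mono[of j "Suc j"] mono[of "Suc j" i] by auto
   then have "N n i - N n (Suc j) + l n = N n i - N n j" by (simp add: l_def)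
   then show ?thesis using False by (simp add: R_def funpow_add[symmetric, THEN fun_cong, unfolded o_def])
  qed (simp add: l_def)
  have "\<bar>\<Phi> ((R n ((T ^^ l n) x))(j := S (l n) x / sqrt (real n)))
   - \<Phi> (\<lambda>i. S (N n (Suc i) - N n i) ((T ^^ (N n i - N n j)) x) / sqrt (real n))\<bar> <= 0"
   by (rule order_trans[OF lip]) (simp add: eq del: fun_upd_apply)
  then show ?thesis by simp
 qed
 ultimately show ?case by simp
qed

end

section \<open>Dyadic polygons in Hoelder spaces\<close>

lemma powr_unit_ge:
 fixes x :: real assumes "0 <= x" "x <= 1" "0 < \<eta>" "\<eta> <= 1" shows "x <= x powr \<eta>"
 using powr_mono'[of \<eta> 1 x] assms by simp

lemma holder_norm_le:
 assumes "0 <= A" "!!s t. s \<in> {0..1} ==> t \<in> {0..1} ==> \<bar>y s - y t\<bar> <= A * \<bar>s - t\<bar> powr \<eta>"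
 shows "holder_norm \<eta> y <= A + \<bar>y 0\<bar>"
proof -
 have "holder_modulus \<eta> y 1 <= ennreal A"
  unfolding holder_modulus_def
  by (intro SUP_least) (use assms in \<open>auto intro!: ennreal_leI simp: divide_le_eq\<close>)
 then have "enn2real (holder_modulus \<eta> y 1) <= A" using assms(1) by (simp add: enn2real_leI)
 then show ?thesis by (simp add: holder_norm_def)
qed

lemma lipschitz_in_holder0:
 assumes ext: "x \<in> extensional {0..1}" and \<eta>: "0 < \<eta>" "\<eta> < 1"
  and lip: "!!s t. s \<in> {0..1} ==> t \<in> {0..1} ==> \<bar>x s - x t\<bar> <= K * \<bar>s - t\<bar>"
 shows "x \<in> holder0_space \<eta>"
proof -
 define L where "L = max K 0"
 have quot: "\<bar>x s - x t\<bar> / \<bar>s - t\<bar> powr \<eta> <= L * \<bar>s - t\<bar> powr (1 - \<eta>)"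
  if "s \<in> {0..1}" "t \<in> {0..1}" "s \<noteq> t" for s t
 proof -
  have "\<bar>x s - x t\<bar> <= L * \<bar>s - t\<bar>"
   by (rule order_trans[OF lip[OF that(1,2)]]) (auto simp: L_def intro!: mult_right_mono)
  also have "\<bar>s - t\<bar> = \<bar>s - t\<bar> powr \<eta> * \<bar>s - t\<bar> powr (1 - \<eta>)"
   using that by (simp add: powr_add[symmetric])
  finally show ?thesis using that by (simp add: divide_le_eq mult_ac)
 qed
 have "holder_seminorm \<eta> x <= ennreal L"
  unfolding holder_seminorm_def
 proof (intro SUP_least, clarify, rule ennreal_leI)
  fix s t :: real assume st: "s \<in> {0..1}" "t \<in> {0..1}" "s \<noteq> t"
  have "\<bar>s - t\<bar> powr (1 - \<eta>) <= 1" using st \<eta> by (intro powr_le1) auto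
  then have "L * \<bar>s - t\<bar> powr (1 - \<eta>) <= L * 1" by (intro mult_left_mono) (auto simp: L_def)
  then show "\<bar>x s - x t\<bar> / \<bar>s - t\<bar> powr \<eta> <= L" using quot[OF st] by linarith
 qed
 then have "x \<in> holder_space \<eta>" using ext by (auto simp: holder_space_def intro: le_less_trans)
 moreover have "(holder_modulus \<eta> x \<longlongrightarrow> 0) (at_right 0)"
 proof (rule tendsto_sandwich[of "\<lambda>_. 0"])
  have "((\<lambda>\<delta>. \<delta> powr (1 - \<eta>)) \<longlongrightarrow> 0) (at_right 0)" using \<eta> by real_asymp
  then have "((\<lambda>\<delta>. L * \<delta> powr (1 - \<eta>)) \<longlongrightarrow> L * 0) (at_right 0)" by (intro tendsto_intros)
  then show "((\<lambda>\<delta>. ennreal (L * \<delta> powr (1 - \<eta>))) \<longlongrightarrow> 0) (at_right 0)"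
   using tendsto_ennrealI by fastforce
  have "holder_modulus \<eta> x \<delta> <= ennreal (L * \<delta> powr (1 - \<eta>))" for \<delta>
   unfolding holder_modulus_def
  proof (intro SUP_least, clarify, rule ennreal_leI)
   fix s t :: real assume st: "s \<in> {0..1}" "t \<in> {0..1}" "0 < \<bar>s - t\<bar>" "\<bar>s - t\<bar> < \<delta>"
   have "L * \<bar>s - t\<bar> powr (1 - \<eta>) <= L * \<delta> powr (1 - \<eta>)"
    using st \<eta> by (intro mult_left_mono powr_mono2) (auto simp: L_def)
   then show "\<bar>x s - x t\<bar> / \<bar>s - t\<bar> powr \<eta> <= L * \<delta> powr (1 - \<eta>)" using quot[of s t] st by auto
  qed
  then show "\<forall>\<^sub>F \<delta> in at_right 0. holder_modulus \<eta> x \<delta> <= ennreal (L * \<delta> powr (1 - \<eta>))" by simp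
 qed auto
 ultimately show ?thesis by (simp add: holder0_space_def)
qed

lemma holder0_small_increments:
 assumes "x \<in> holder0_space \<eta>" "0 < e"
 obtains \<delta> where "0 < \<delta>" "!!s t. s \<in> {0..1} ==> t \<in> {0..1} ==> \<bar>s - t\<bar> < \<delta> ==> \<bar>x s - x t\<bar> <= e * \<bar>s - t\<bar> powr \<eta>"
proof -
 have "(holder_modulus \<eta> x \<longlongrightarrow> 0) (at_right 0)" using assms by (simp add: holder0_space_def)
 then have "eventually (\<lambda>\<delta>. holder_modulus \<eta> x \<delta> < ennreal e) (at_right 0)"
  using assms by (intro order_tendstoD(2)) auto
 then obtain b where b: "0 < b" "!!\<delta>. 0 < \<delta> ==> \<delta> < b ==> holder_modulus \<eta> x \<delta> < ennreal e"
  by (auto simp: eventually_at_right_field)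
 have "\<bar>x s - x t\<bar> <= e * \<bar>s - t\<bar> powr \<eta>" if "s \<in> {0..1}" "t \<in> {0..1}" "\<bar>s - t\<bar> < b / 2" for s t
 proof (cases "s = t")
  case False
  have "ennreal (\<bar>x s - x t\<bar> / \<bar>s - t\<bar> powr \<eta>) <= holder_modulus \<eta> x (b / 2)"
   unfolding holder_modulus_def using that False by (intro SUP_upper2[of "(s, t)"]) auto
  also have "... < ennreal e" using b by simp
  finally have "\<bar>x s - x t\<bar> / \<bar>s - t\<bar> powr \<eta> < e" using assms(2) by (simp add: ennreal_less_iff)
  then show ?thesis using False by (simp add: divide_less_eq)
 qed simp
 then show ?thesis using b(1) by (intro that[of "b / 2"]) auto
qed

lemma holder0_continuous:
 assumes "x \<in> holder0_space \<eta>" "0 < \<eta>" shows "continuous_on {0..1} x"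
proof -
 obtain \<delta> where \<delta>: "0 < \<delta>" "!!s t. s \<in> {0..1} ==> t \<in> {0..1} ==> \<bar>s - t\<bar> < \<delta> ==> \<bar>x s - x t\<bar> <= 1 * \<bar>s - t\<bar> powr \<eta>"
  using holder0_small_increments[OF assms(1), of 1] by auto
 show ?thesis
  unfolding continuous_on_def
 proof
  fix t :: real assume t: "t \<in> {0..1}"
  have "((\<lambda>s. \<bar>s - t\<bar> powr \<eta>) \<longlongrightarrow> \<bar>t - t\<bar> powr \<eta>) (at t within {0..1})"
   using assms(2) by (intro tendsto_intros) auto
  then have lim: "((\<lambda>s. \<bar>s - t\<bar> powr \<eta>) \<longlongrightarrow> 0) (at t within {0..1})" using assms(2) by simp
  have "((\<lambda>s. x s - x t) \<longlongrightarrow> 0) (at t within {0..1})"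
  proof (rule Lim_null_comparison[OF _ lim])
   have "eventually (\<lambda>s. s \<in> {0..1} \<and> dist s t < \<delta>) (at t within {0..1})"
    unfolding eventually_at using \<delta>(1) by (intro exI[of _ \<delta>]) auto
   then show "\<forall>\<^sub>F s in at t within {0..1}. norm (x s - x t) <= \<bar>s - t\<bar> powr \<eta>"
    by eventually_elim (use \<delta>(2) t in \<open>auto simp: dist_real_def\<close>)
  qed
  then show "(x \<longlongrightarrow> x t) (at t within {0..1})" by (rule LIM_zero_cancel)
 qed
qed

text \<open>Both points are reached from neighbouring points of the dyadic level that matches \<open>\<bar>s - t\<bar>\<close> through
finer and finer levels, whose increments form a geometric series.\<close>
lemma dyadic_chaining:
 fixes y :: "real => real"
 assumes cont: "continuous_on {0..1} y" and \<eta>: "0 < \<eta>" "\<eta> <= 1" and A: "0 <= A"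
  and inc: "!!j k. k < 2 ^ j ==> \<bar>y (real (Suc k) / 2 ^ j) - y (real k / 2 ^ j)\<bar> <= A * (2 powr - \<eta>) ^ j"
  and s: "s \<in> {0..1}" and t: "t \<in> {0..1}"
 shows "\<bar>y s - y t\<bar> <= 4 / (1 - 2 powr - \<eta>) * A * \<bar>s - t\<bar> powr \<eta>"
proof -
 define q :: real where "q = 2 powr - \<eta>"
 have q: "0 < q" "q < 1" using \<eta> by (auto simp: q_def powr_less_one)
 have inc': "k < 2 ^ j ==> \<bar>y (real (Suc k) / 2 ^ j) - y (real k / 2 ^ j)\<bar> <= A * q ^ j" for j k
  using inc by (simp add: q_def)
 define c where "c m t = nat \<lfloor>2 ^ m * t\<rfloor>" for m and t :: real
 define r where "r m t = real (c m t) / 2 ^ m" for m and t :: real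
 have c: "real (c m t) <= 2 ^ m * t" "2 ^ m * t < real (c m t) + 1" "c m t <= 2 ^ m" if "t \<in> {0..1}" for m t
 proof -
  have "0 <= 2 ^ m * t" "2 ^ m * t <= 2 ^ m" using that by (auto intro: mult_left_le)
  then show "real (c m t) <= 2 ^ m * t" "2 ^ m * t < real (c m t) + 1" unfolding c_def by linarith+
  then have "real (c m t) <= 2 ^ m" using \<open>2 ^ m * t <= 2 ^ m\<close> by linarith
  then show "c m t <= 2 ^ m" using of_nat_le_iff[where 'a = real, of "c m t" "2 ^ m"] by simp
 qed
 have neighbours: "\<bar>y (real a / 2 ^ m) - y (real b / 2 ^ m)\<bar> <= A * q ^ m"
  if ab: "a <= Suc b" "b <= Suc a" "a <= 2 ^ m" "b <= 2 ^ m" for a b m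
 proof -
  consider "a = b" | "a = Suc b" | "b = Suc a" using ab by linarith
  then show ?thesis
  proof cases
   case 1 then show ?thesis using A q by simp
  next
   case 2 then show ?thesis using inc'[of b m] that by simp
  next
   case 3 then show ?thesis using inc'[of a m] that by (simp add: abs_minus_commute)
  qed
 qed
 have r_tendsto: "(\<lambda>m. y (r m t)) \<longlonglongrightarrow> y t" if t: "t \<in> {0..1}" for t
 proof (rule continuous_on_tendsto_compose[OF cont _ t])
  show "(\<lambda>m. r m t) \<longlonglongrightarrow> t"
  proof (rule tendsto_sandwich[of "\<lambda>m. t - (1/2) ^ m" _ _ "\<lambda>_. t"])
   have "(\<lambda>m. t - (1/2) ^ m) \<longlonglongrightarrow> t - 0" by (intro tendsto_intros LIMSEQ_realpow_zero) auto
   then show "(\<lambda>m. t - (1/2) ^ m) \<longlonglongrightarrow> t" by simp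
   show "\<forall>\<^sub>F m in sequentially. t - (1/2) ^ m <= r m t"
   proof (intro always_eventually allI)
    fix m
    have "t <= (real (c m t) + 1) / 2 ^ m" using c(2)[OF t, of m] by (simp add: le_divide_eq mult.commute less_imp_le)
    then show "t - (1/2) ^ m <= r m t" by (simp add: r_def add_divide_distrib power_one_over)
   qed
   show "\<forall>\<^sub>F m in sequentially. r m t <= t"
    using c(1)[OF t] by (intro always_eventually allI) (simp add: r_def divide_le_eq mult.commute)
  qed auto
  show "\<forall>\<^sub>F m in sequentially. r m t \<in> {0..1}"
  proof (intro always_eventually allI)
   fix m
   have "real (c m t) <= real (2 ^ m)" using c(3)[OF t, of m] of_nat_mono by blast
   then show "r m t \<in> {0..1}" by (simp add: r_def divide_le_eq)
  qed
 qed
 have r_step: "\<bar>y (r (Suc m) t) - y (r m t)\<bar> <= A * q ^ Suc m" if t: "t \<in> {0..1}" for t m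
 proof -
  have "r m t = real (2 * c m t) / 2 ^ Suc m" by (simp add: r_def)
  moreover have "2 * c m t <= c (Suc m) t" "c (Suc m) t <= Suc (2 * c m t)"
  proof -
   have "real (2 * c m t) < real (c (Suc m) t) + 1" "real (c (Suc m) t) < real (2 * c m t) + 2"
    using c(1,2)[OF t, of m] c(1,2)[OF t, of "Suc m"] by auto
   then show "2 * c m t <= c (Suc m) t" "c (Suc m) t <= Suc (2 * c m t)" by linarith+
  qed
  moreover have "c (Suc m) t <= 2 ^ Suc m" "2 * c m t <= 2 ^ Suc m" using c(3)[OF t, of m] c(3)[OF t, of "Suc m"] by simp_all
  ultimately show ?thesis using neighbours[of "c (Suc m) t" "2 * c m t" "Suc m"] by (simp only: r_def)
 qed
 have tail: "\<bar>y t - y (r m t)\<bar> <= A * q ^ Suc m / (1 - q)" if t: "t \<in> {0..1}" for t m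
 proof (rule LIMSEQ_le_const2)
  have "(\<lambda>l. y (r (l + m) t)) \<longlonglongrightarrow> y t" using r_tendsto[OF t] by (rule LIMSEQ_ignore_initial_segment)
  then show "(\<lambda>l. \<bar>y (r (l + m) t) - y (r m t)\<bar>) \<longlonglongrightarrow> \<bar>y t - y (r m t)\<bar>" by (intro tendsto_intros)
  have "\<bar>y (r (l + m) t) - y (r m t)\<bar> <= (\<Sum>i<l. A * q ^ Suc (i + m))" for l
  proof (induction l)
   case (Suc l)
   then show ?case using r_step[OF t, of "l + m"] by simp
  qed simp
  also have "(\<Sum>i<l. A * q ^ Suc (i + m)) <= A * q ^ Suc m / (1 - q)" for l
  proof -
   have "(\<Sum>i<l. A * q ^ Suc (i + m)) = A * q ^ Suc m * (\<Sum>i<l. q ^ i)"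
    by (simp add: sum_distrib_left power_add mult_ac)
   also have "(\<Sum>i<l. q ^ i) <= 1 / (1 - q)" using q by (simp add: sum_gp_strict divide_right_mono)
   finally show ?thesis using A q by (simp add: mult_left_mono)
  qed
  finally show "\<exists>N. \<forall>l\<ge>N. \<bar>y (r (l + m) t) - y (r m t)\<bar> <= A * q ^ Suc m / (1 - q)" by blast
 qed
 show ?thesis
 proof (cases "s = t")
  case False
  define D where "D = \<bar>s - t\<bar>"
  have D: "0 < D" "D <= 1" using False s t by (auto simp: D_def)
  obtain m where m: "(1/2) ^ Suc m < D" "D <= (1/2) ^ m"
  proof -
   obtain M :: nat where "(1/2) ^ M < D" using real_arch_pow_inv[OF D(1), of "1/2"] by auto
   moreover define l where "l = (LEAST l :: nat. (1/2) ^ l < D)"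
   ultimately have l: "(1/2) ^ l < D" using LeastI[of "\<lambda>l. (1/2) ^ l < D" M] by simp
   have "l \<noteq> 0" using l D by (cases l) auto
   then obtain m where lm: "l = Suc m" by (cases l) auto
   have "\<not> (1/2) ^ m < D" using not_less_Least[of m "\<lambda>l. (1/2) ^ l < D"] by (simp add: l_def[symmetric] lm)
   then show ?thesis using l lm that[of m] by simp
  qed
  have near: "c m s <= Suc (c m t)" "c m t <= Suc (c m s)"
  proof -
   have "2 ^ m * D <= 2 ^ m * (1/2) ^ m" using m(2) by (intro mult_left_mono) auto
   also have "... = 1" by (simp add: power_mult_distrib[symmetric])
   finally have "2 ^ m * D <= 1" .
   then have "\<bar>2 ^ m * s - 2 ^ m * t\<bar> <= 1" by (simp add: D_def right_diff_distrib[symmetric] abs_mult)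
   then have "real (c m s) < real (c m t) + 2" "real (c m t) < real (c m s) + 2"
    using c(1,2)[OF s, of m] c(1,2)[OF t, of m] by linarith+
   then show "c m s <= Suc (c m t)" "c m t <= Suc (c m s)" by linarith+
  qed
  have mid: "\<bar>y (r m s) - y (r m t)\<bar> <= A * q ^ m"
   unfolding r_def by (rule neighbours) (use near c(3)[OF s] c(3)[OF t] in auto)
  have "\<bar>y s - y t\<bar> <= A * q ^ Suc m / (1 - q) + A * q ^ m + A * q ^ Suc m / (1 - q)"
   using mid tail[OF s, of m] tail[OF t, of m] by linarith
  also have "... = A * q ^ m * (1 + 2 * q / (1 - q))" by (simp add: algebra_simps)
  also have "1 + 2 * q / (1 - q) = (1 + q) / (1 - q)" using q by (simp add: field_simps)
  also have "A * q ^ m * ((1 + q) / (1 - q)) <= (A * (2 * D powr \<eta>)) * (2 / (1 - q))"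
  proof (intro mult_mono divide_right_mono)
   have "q ^ m = ((1/2) ^ m) powr \<eta>"
   proof -
    have "q ^ m = 2 powr (- \<eta> * real m)" by (simp add: q_def powr_power mult.commute)
    also have "... = (2 powr (- real m)) powr \<eta>" by (simp add: powr_powr mult.commute)
    also have "2 powr (- real m) = (1/2 :: real) ^ m" by (simp add: powr_minus powr_realpow power_one_over inverse_eq_divide)
    finally show ?thesis .
   qed
   also have "... <= (2 * D) powr \<eta>" using m(1) \<eta> by (intro powr_mono2) auto
   also have "... = 2 powr \<eta> * D powr \<eta>" using D by (simp add: powr_mult)
   also have "... <= 2 powr 1 * D powr \<eta>" using \<eta> by (intro mult_right_mono powr_mono) auto
   finally show "q ^ m <= 2 * D powr \<eta>" by simp
  qed (use A q in auto)
  also have "... = 4 / (1 - q) * A * D powr \<eta>" by simp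
  finally show ?thesis by (simp add: q_def D_def)
 qed simp
qed

text \<open>Piecewise linear with value \<open>v k\<close> at \<open>k / 2 ^ m\<close>. Writing it as a sum of hat functions makes the linear
dependence on \<open>v\<close> visible.\<close>
definition polygon :: "nat => (nat => real) => real => real" where
 "polygon m v = (\<lambda>t\<in>{0..1}. \<Sum>k\<le>2 ^ m. v k * max 0 (1 - \<bar>2 ^ m * t - real k\<bar>))"

lemma polygon_extensional [simp]: "polygon m v \<in> extensional {0..1}"
 by (simp add: polygon_def)

lemma polygon_cell:
 assumes k: "k < 2 ^ m" "real k <= 2 ^ m * t" "2 ^ m * t <= real k + 1"
 shows "polygon m v t = v k * (real k + 1 - 2 ^ m * t) + v (Suc k) * (2 ^ m * t - real k)"
proof -
 have "real k + 1 <= 2 ^ m"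
 proof -
  have "real (Suc k) <= real (2 ^ m)" using k(1) by (simp only: of_nat_le_iff)
  then show ?thesis by simp
 qed
 then have "2 ^ m * t <= 2 ^ m * 1" using k by linarith
 then have "t <= 1" by (rule mult_left_le_imp_le) simp
 moreover have "0 <= t"
 proof (rule ccontr)
  assume "\<not> 0 <= t"
  then have "2 ^ m * t < 0" by (intro mult_pos_neg) auto
  then show False using k(2) by linarith
 qed
 ultimately have "polygon m v t = (\<Sum>i\<le>2 ^ m. v i * max 0 (1 - \<bar>2 ^ m * t - real i\<bar>))" by (simp add: polygon_def)
 also have "... = (\<Sum>i\<in>{k, Suc k}. v i * max 0 (1 - \<bar>2 ^ m * t - real i\<bar>))"
 proof (rule sum.mono_neutral_right)
  show "{k, Suc k} \<subseteq> {..2 ^ m}" using k by auto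
  show "\<forall>i\<in>{..2 ^ m} - {k, Suc k}. v i * max 0 (1 - \<bar>2 ^ m * t - real i\<bar>) = 0"
  proof
   fix i assume "i \<in> {..2 ^ m} - {k, Suc k}"
   then have "Suc i <= k \<or> k + 2 <= i" by auto
   then have "real i + 1 <= real k \<or> real k + 2 <= real i" by linarith
   then have "1 <= \<bar>2 ^ m * t - real i\<bar>" using k by linarith
   then show "v i * max 0 (1 - \<bar>2 ^ m * t - real i\<bar>) = 0" by simp
  qed
 qed auto
 also have "... = v k * (real k + 1 - 2 ^ m * t) + v (Suc k) * (2 ^ m * t - real k)"
  using k by (simp add: max_def)
 finally show ?thesis .
qed

lemma polygon_dyadic: "k <= 2 ^ m ==> polygon m v (real k / 2 ^ m) = v k"
proof (cases "k = 2 ^ m")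
 case True
 then show ?thesis using polygon_cell[of "k - 1" m "real k / 2 ^ m" v] by (simp add: of_nat_diff)
next
 case False
 assume "k <= 2 ^ m"
 then show ?thesis using False polygon_cell[of k m "real k / 2 ^ m" v] by simp
qed

lemma polygon_diff: "t \<in> {0..1} ==> polygon m v t - polygon m w t = polygon m (\<lambda>k. v k - w k) t"
 by (simp add: polygon_def sum_subtractf left_diff_distrib)

lemma polygon_lipschitz:
 assumes "s \<in> {0..1}" "t \<in> {0..1}"
 shows "\<bar>polygon m v s - polygon m v t\<bar> <= 2 ^ m * (\<Sum>k\<le>2 ^ m. \<bar>v k\<bar>) * \<bar>s - t\<bar>"
proof -
 have "polygon m v s - polygon m v t
  = (\<Sum>k\<le>2 ^ m. v k * (max 0 (1 - \<bar>2 ^ m * s - real k\<bar>) - max 0 (1 - \<bar>2 ^ m * t - real k\<bar>)))"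
  using assms by (simp add: polygon_def sum_subtractf right_diff_distrib)
 also have "\<bar>...\<bar> <= (\<Sum>k\<le>2 ^ m. \<bar>v k\<bar> * (2 ^ m * \<bar>s - t\<bar>))"
 proof (rule order_trans[OF sum_abs sum_mono])
  fix k
  have "\<bar>max 0 (1 - \<bar>2 ^ m * s - real k\<bar>) - max 0 (1 - \<bar>2 ^ m * t - real k\<bar>)\<bar> <= \<bar>2 ^ m * s - 2 ^ m * t\<bar>"
   by linarith
  also have "... = 2 ^ m * \<bar>s - t\<bar>" by (simp add: right_diff_distrib[symmetric] abs_mult)
  finally show "\<bar>v k * (max 0 (1 - \<bar>2 ^ m * s - real k\<bar>) - max 0 (1 - \<bar>2 ^ m * t - real k\<bar>))\<bar> <= \<bar>v k\<bar> * (2 ^ m * \<bar>s - t\<bar>)"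
   unfolding abs_mult by (intro mult_left_mono) auto
 qed
 finally show ?thesis by (simp add: sum_distrib_right[symmetric] mult_ac)
qed

lemma polygon_in_holder0: "0 < \<eta> ==> \<eta> < 1 ==> polygon m v \<in> holder0_space \<eta>"
 by (rule lipschitz_in_holder0[OF _ _ _ polygon_lipschitz]) auto

lemma polygon_continuous: "continuous_on {0..1} (polygon m v)"
proof -
 have "continuous_on {0..1} (\<lambda>t. \<Sum>k\<le>2 ^ m. v k * max 0 (1 - \<bar>2 ^ m * t - real k\<bar>))"
  by (intro continuous_intros)
 then show ?thesis by (subst continuous_on_cong[OF refl]) (auto simp: polygon_def)
qed

lemma polygon_dist_le:
 assumes "0 < \<eta>" "\<eta> <= 1"
 shows "holder_dist \<eta> (polygon m v) (polygon m w) <= (2 ^ m + 1) * (\<Sum>k\<le>2 ^ m. \<bar>v k - w k\<bar>)"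
proof -
 let ?u = "\<lambda>k. v k - w k"
 have "holder_dist \<eta> (polygon m v) (polygon m w)
   <= 2 ^ m * (\<Sum>k\<le>2 ^ m. \<bar>?u k\<bar>) + \<bar>polygon m v 0 - polygon m w 0\<bar>"
  unfolding holder_dist_def
 proof (rule holder_norm_le)
  fix s t :: real assume st: "s \<in> {0..1}" "t \<in> {0..1}"
  have "\<bar>s - t\<bar> <= \<bar>s - t\<bar> powr \<eta>" using st assms by (intro powr_unit_ge) auto
  then show "\<bar>(polygon m v s - polygon m w s) - (polygon m v t - polygon m w t)\<bar> <= 2 ^ m * (\<Sum>k\<le>2 ^ m. \<bar>?u k\<bar>) * \<bar>s - t\<bar> powr \<eta>"
   unfolding polygon_diff[OF st(1)] polygon_diff[OF st(2)]
   by (intro order_trans[OF polygon_lipschitz[OF st]] mult_left_mono) (auto intro: sum_nonneg)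
 qed (auto intro: sum_nonneg)
 also have "polygon m v 0 - polygon m w 0 = ?u 0" using polygon_dyadic[of 0 m v] polygon_dyadic[of 0 m w] by simp
 also have "\<bar>?u 0\<bar> <= (\<Sum>k\<le>2 ^ m. \<bar>?u k\<bar>)" by (rule member_le_sum) auto
 finally show ?thesis by (simp add: algebra_simps)
qed

text \<open>The difference vanishes at the points of level \<open>m\<close>. From each finer level to the next the
increments of the polygon are halved, so they obey the bound for those of \<open>x\<close> too; hence a factor 2.\<close>
lemma polygon_approx:
 fixes x :: "real => real"
 assumes cont: "continuous_on {0..1} x" and \<eta>: "0 < \<eta>" "\<eta> <= 1" and A: "0 <= A"
  and inc: "!!j k. m <= j ==> k < 2 ^ j ==> \<bar>x (real (Suc k) / 2 ^ j) - x (real k / 2 ^ j)\<bar> <= A * (2 powr - \<eta>) ^ j"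
 shows "holder_dist \<eta> x (polygon m (\<lambda>k. x (real k / 2 ^ m))) <= 8 / (1 - 2 powr - \<eta>) * A"
proof -
 define v where "v k = x (real k / 2 ^ m)" for k :: nat
 define y where "y t = x t - polygon m v t" for t
 have q: "1/2 <= (2 powr - \<eta> :: real)" "(2 powr - \<eta> :: real) < 1"
  using powr_mono[of "- 1" "- \<eta>" "2 :: real"] \<eta> by (auto simp: powr_less_one powr_minus_divide)
 have y0: "y (real k / 2 ^ j) = 0" if "j <= m" "k <= 2 ^ j" for j k
 proof -
  have "k * 2 ^ (m - j) <= 2 ^ j * 2 ^ (m - j)" using that by (intro mult_right_mono) auto
  also have "... = (2 ^ m :: nat)" using that by (simp add: power_add[symmetric])
  finally have le: "k * 2 ^ (m - j) <= 2 ^ m" .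
  have "(2 ^ m :: real) = 2 ^ j * 2 ^ (m - j)" using that by (simp add: power_add[symmetric])
  then have eq: "real k / 2 ^ j = real (k * 2 ^ (m - j)) / 2 ^ m" by simp
  show ?thesis unfolding eq y_def polygon_dyadic[OF le] by (simp add: v_def)
 qed
 have incy: "\<bar>y (real (Suc k) / 2 ^ j) - y (real k / 2 ^ j)\<bar> <= 2 * A * (2 powr - \<eta>) ^ j" if k: "k < 2 ^ j" for j k
 proof (cases "j <= m")
  case True
  then show ?thesis using y0[of j k] y0[of j "Suc k"] k A by simp
 next
  case False
  define d where "d = j - m"
  have j: "j = m + d" using False by (simp add: d_def)
  define i where "i = k div 2 ^ d"
  have i: "i < 2 ^ m" unfolding i_def using k by (simp add: j power_add less_mult_imp_div_less)
  have i1: "i * 2 ^ d <= k" unfolding i_def by (simp add: mult.commute)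
  have i2: "Suc k <= (i + 1) * 2 ^ d" unfolding i_def using dividend_less_div_times[of "2 ^ d" k] by (intro Suc_leI) (simp add: algebra_simps)
  have r1: "real i <= real k / 2 ^ d"
   using of_nat_mono[OF i1, where 'a = real] by (simp add: le_divide_eq)
  have r2: "real (Suc k) / 2 ^ d <= real i + 1"
   using of_nat_mono[OF i2, where 'a = real] by (simp add: divide_le_eq algebra_simps)
  have r3: "real k / 2 ^ d <= real (Suc k) / 2 ^ d" by (intro divide_right_mono) auto
  have sc: "2 ^ m * (real l / 2 ^ j) = real l / 2 ^ d" for l by (simp add: j power_add)
  have p1: "polygon m v (real k / 2 ^ j) = v i * (real i + 1 - real k / 2 ^ d) + v (Suc i) * (real k / 2 ^ d - real i)"
   using polygon_cell[of i m "real k / 2 ^ j" v] i r1 r2 r3 unfolding sc by linarith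
  have p2: "polygon m v (real (Suc k) / 2 ^ j) = v i * (real i + 1 - real (Suc k) / 2 ^ d) + v (Suc i) * (real (Suc k) / 2 ^ d - real i)"
   using polygon_cell[of i m "real (Suc k) / 2 ^ j" v] i r1 r2 r3 unfolding sc by linarith
  have pd: "polygon m v (real (Suc k) / 2 ^ j) - polygon m v (real k / 2 ^ j) = (v (Suc i) - v i) / 2 ^ d"
   unfolding p1 p2 by (simp add: algebra_simps add_divide_distrib diff_divide_distrib)
  have "\<bar>v (Suc i) - v i\<bar> <= A * (2 powr - \<eta>) ^ m" unfolding v_def by (rule inc) (use i in auto)
  then have "\<bar>(v (Suc i) - v i) / 2 ^ d\<bar> <= A * (2 powr - \<eta>) ^ m * (1/2) ^ d"
   by (simp add: abs_divide power_one_over divide_right_mono)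
  also have "... <= A * (2 powr - \<eta>) ^ m * (2 powr - \<eta>) ^ d"
   using A q by (intro mult_left_mono power_mono mult_nonneg_nonneg) auto
  also have "... = A * (2 powr - \<eta>) ^ j" by (simp add: j power_add)
  finally have "\<bar>polygon m v (real (Suc k) / 2 ^ j) - polygon m v (real k / 2 ^ j)\<bar> <= A * (2 powr - \<eta>) ^ j" unfolding pd .
  moreover have "\<bar>x (real (Suc k) / 2 ^ j) - x (real k / 2 ^ j)\<bar> <= A * (2 powr - \<eta>) ^ j" using inc k False by simp
  ultimately show ?thesis unfolding y_def by linarith
 qed
 have "holder_norm \<eta> y <= 4 / (1 - 2 powr - \<eta>) * (2 * A) + \<bar>y 0\<bar>"
 proof (rule holder_norm_le)
  show "0 <= 4 / (1 - 2 powr - \<eta>) * (2 * A)" using q A by (intro mult_nonneg_nonneg divide_nonneg_nonneg) auto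
  show "\<bar>y s - y t\<bar> <= 4 / (1 - 2 powr - \<eta>) * (2 * A) * \<bar>s - t\<bar> powr \<eta>" if "s \<in> {0..1}" "t \<in> {0..1}" for s t
  proof (rule dyadic_chaining[OF _ \<eta> _ _ that])
   show "continuous_on {0..1} y" unfolding y_def by (intro continuous_intros cont polygon_continuous)
  qed (use A incy in auto)
 qed
 moreover have "y 0 = 0" using y0[of 0 0] by simp
 ultimately show ?thesis by (simp add: holder_dist_def y_def[abs_def] v_def[abs_def])
qed

text \<open>In the little Hoelder space increments on fine levels satisfy the Hoelder bound with an arbitrarily small
constant.\<close>
lemma polygon_tendsto:
 assumes x: "x \<in> holder0_space \<eta>" and \<eta>: "0 < \<eta>" "\<eta> <= 1"
 shows "(\<lambda>m. holder_dist \<eta> x (polygon m (\<lambda>k. x (real k / 2 ^ m)))) \<longlonglongrightarrow> 0"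
proof (rule LIMSEQ_I)
 fix e :: real assume e: "0 < e"
 define c where "c = 8 / (1 - 2 powr - \<eta> :: real)"
 have c: "0 < c" using \<eta> by (simp add: c_def powr_less_one)
 define A where "A = e / (2 * c)"
 have A: "0 < A" using e c by (simp add: A_def)
 obtain \<delta> where \<delta>: "0 < \<delta>" "!!s t. s \<in> {0..1} ==> t \<in> {0..1} ==> \<bar>s - t\<bar> < \<delta> ==> \<bar>x s - x t\<bar> <= A * \<bar>s - t\<bar> powr \<eta>"
  using holder0_small_increments[OF x A] by blast
 obtain m0 :: nat where m0: "(1/2) ^ m0 < \<delta>" using real_arch_pow_inv[OF \<delta>(1), of "1/2"] by auto
 have "norm (holder_dist \<eta> x (polygon m (\<lambda>k. x (real k / 2 ^ m))) - 0) < e" if m: "m0 <= m" for m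
 proof -
  have "holder_dist \<eta> x (polygon m (\<lambda>k. x (real k / 2 ^ m))) <= 8 / (1 - 2 powr - \<eta>) * A"
  proof (rule polygon_approx[OF holder0_continuous[OF x \<eta>(1)] \<eta> less_imp_le[OF A]])
   fix j k :: nat assume j: "m <= j" and k: "k < 2 ^ j"
   have "real (Suc k) <= real (2 ^ j)" using k by (simp only: of_nat_le_iff)
   then have k': "real (Suc k) <= 2 ^ j" by simp
   then have mem: "real (Suc k) / 2 ^ j \<in> {0..1}" "real k / 2 ^ j \<in> {0..1}" using k by (simp_all add: divide_le_eq)
   have dist: "real (Suc k) / 2 ^ j - real k / 2 ^ j = (1/2) ^ j" by (simp add: add_divide_distrib power_one_over)
   have "(1/2 :: real) ^ j <= (1/2) ^ m0" using j m by (intro power_decreasing) auto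
   then have "\<bar>real (Suc k) / 2 ^ j - real k / 2 ^ j\<bar> < \<delta>" unfolding dist using le_less_trans[OF _ m0] by simp
   then have "\<bar>x (real (Suc k) / 2 ^ j) - x (real k / 2 ^ j)\<bar> <= A * \<bar>real (Suc k) / 2 ^ j - real k / 2 ^ j\<bar> powr \<eta>"
    using mem by (intro \<delta>(2))
   also have "\<bar>real (Suc k) / 2 ^ j - real k / 2 ^ j\<bar> powr \<eta> = (2 powr - \<eta>) ^ j"
    unfolding dist by (simp add: powr_power powr_minus powr_realpow[symmetric] powr_powr power_one_over inverse_eq_divide powr_divide mult.commute)
   finally show "\<bar>x (real (Suc k) / 2 ^ j) - x (real k / 2 ^ j)\<bar> <= A * (2 powr - \<eta>) ^ j" .
  qed
  also have "... = e / 2" using c by (simp add: c_def[symmetric] A_def)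
  moreover have "0 <= holder_dist \<eta> x (polygon m (\<lambda>k. x (real k / 2 ^ m)))"
   by (rule Metric_space.nonneg[OF Metric_space_holder0])
  ultimately show ?thesis using e by simp
 qed
 then show "\<exists>m0. \<forall>m\<ge>m0. norm (holder_dist \<eta> x (polygon m (\<lambda>k. x (real k / 2 ^ m))) - 0) < e" by blast
qed

section \<open>Weak convergence by Lipschitz functions\<close>

definition lip_on :: "'a set => ('a => 'a => real) => real => ('a => real) => bool" where
 "lip_on A d L F \<longleftrightarrow> 0 <= L \<and> (\<forall>x\<in>A. \<forall>y\<in>A. \<bar>F x - F y\<bar> <= L * d x y)"

context Metric_space
begin

text \<open>The functions \<open>G k x = (INF y\<in>M. F y + k * d x y)\<close> are \<open>k\<close>-Lipschitz and increase to \<open>F\<close>.\<close>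
lemma inf_convolution:
 fixes F :: "'a => real"
 assumes F: "!!x. x \<in> M ==> 0 <= F x" "!!x. x \<in> M ==> F x <= 1"
  and lsc: "!!x e. x \<in> M ==> 0 < e ==> \<exists>r>0. \<forall>y\<in>M. d x y < r --> F x - e < F y"
 obtains G :: "nat => 'a => real"
 where "!!k. lip_on M d (real k) (G k)" "!!k x. x \<in> M ==> 0 <= G k x" "!!k x. x \<in> M ==> G k x <= F x"
  "!!x. x \<in> M ==> (\<lambda>k. G k x) \<longlonglongrightarrow> F x"
proof -
 define G where "G k x = (INF y\<in>M. F y + real k * d x y)" for k :: nat and x
 have bdd: "bdd_below ((\<lambda>y. F y + real k * d x y) ` M)" for k x
  using F(1) by (intro bdd_belowI2[of _ 0]) auto
 have G_le: "G k x <= F y + real k * d x y" if "y \<in> M" for k x y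
  unfolding G_def using that by (intro cINF_lower bdd)
 have G_ge: "c <= G k x" if "x \<in> M" "!!y. y \<in> M ==> c <= F y + real k * d x y" for c k x
  unfolding G_def using that by (intro cINF_greatest) auto
 have le: "G k x <= F x" if "x \<in> M" for k x using G_le[OF that, of k x] that by simp
 have lip: "G k x - real k * d x y <= G k y" if "x \<in> M" "y \<in> M" for k x y
 proof (rule G_ge[OF that(2)])
  fix z assume z: "z \<in> M"
  have "real k * d x z <= real k * (d x y + d y z)" using that z by (intro mult_left_mono triangle) auto
  then show "G k x - real k * d x y <= F z + real k * d y z" using G_le[OF z, of k x] by (simp add: distrib_left)
 qed
 show ?thesis
 proof
  show "lip_on M d (real k) (G k)" for k
   unfolding lip_on_def
  proof (intro conjI ballI)
   fix x y assume "x \<in> M" "y \<in> M"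
   then show "\<bar>G k x - G k y\<bar> <= real k * d x y"
    using lip[of x y k] lip[of y x k] commute[of y x] by (simp add: abs_le_iff)
  qed simp
  show "0 <= G k x" if "x \<in> M" for k x using F(1) that by (intro G_ge) auto
  show "G k x <= F x" if "x \<in> M" for k x by (rule le[OF that])
  show "(\<lambda>k. G k x) \<longlonglongrightarrow> F x" if x: "x \<in> M" for x
  proof (rule LIMSEQ_I)
   fix e :: real assume e: "0 < e"
   obtain r where r: "0 < r" "!!y. y \<in> M ==> d x y < r ==> F x - e / 2 < F y"
    using lsc[OF x, of "e / 2"] e by auto
   obtain k0 :: nat where k0: "1 / r <= real k0" using real_arch_simple by blast
   have "F x - e / 2 <= G k x" if "k0 <= k" for k
   proof (rule G_ge[OF x])
    fix y assume y: "y \<in> M"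
    show "F x - e / 2 <= F y + real k * d x y"
    proof (cases "d x y < r")
     case True
     have "0 <= real k * d x y" by simp
     then show ?thesis using r(2)[OF y True] by linarith
    next
     case False
     have "1 = 1 / r * r" using r by simp
     also have "... <= real k * d x y" using k0 that False r by (intro mult_mono) auto
     finally show ?thesis using F(1)[OF y] F(2)[OF x] e by linarith
    qed
   qed
   then show "\<exists>k0. \<forall>k\<ge>k0. norm (G k x - F x) < e" using le[OF x] e by (intro exI[of _ k0]) (fastforce simp: abs_less_iff)
  qed
 qed
qed

text \<open>Indicators of open sets are lower semicontinuous, hence limits of Lipschitz functions.\<close>
lemma measurable_borel_of_topology:
 assumes X: "X \<in> space P \<rightarrow> M"
  and meas: "!!F L. lip_on M d L F ==> (!!x. x \<in> M ==> \<bar>F x\<bar> <= 1) ==> (\<lambda>\<omega>. F (X \<omega>)) \<in> borel_measurable P"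
 shows "X \<in> P \<rightarrow>\<^sub>M borel_of_topology mtopology"
 unfolding borel_of_topology_def
proof (rule measurable_measure_of)
 show "{U. openin mtopology U} \<subseteq> Pow (topspace mtopology)" using openin_subset[of mtopology] by auto
 show "X \<in> space P \<rightarrow> topspace mtopology" using X by simp
 fix U assume "U \<in> {U. openin mtopology U}"
 then have U: "U \<subseteq> M" "!!x. x \<in> U ==> \<exists>r>0. mball x r \<subseteq> U" by (auto simp: openin_mtopology)
 obtain G where G: "!!k. lip_on M d (real k) (G k)" "!!k x. x \<in> M ==> 0 <= G k x" "!!k x. x \<in> M ==> G k x <= indicator U x"
  "!!x. x \<in> M ==> (\<lambda>k. G k x) \<longlonglongrightarrow> indicat_real U x"
 proof (rule inf_convolution[of "indicat_real U"])
  fix x and e :: real assume x: "x \<in> M" and e: "0 < e"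
  show "\<exists>r>0. \<forall>y\<in>M. d x y < r --> indicat_real U x - e < indicat_real U y"
  proof (cases "x \<in> U")
   case True
   then obtain r where "0 < r" "mball x r \<subseteq> U" using U by blast
   then show ?thesis using x e True by (intro exI[of _ r]) (auto simp: subset_iff)
  next
   case False
   then show ?thesis using e by (intro exI[of _ 1]) (auto simp: indicator_def)
  qed
 qed (auto simp: indicator_def)
 have "(\<lambda>\<omega>. indicat_real U (X \<omega>)) \<in> borel_measurable P"
 proof (rule borel_measurable_LIMSEQ_real)
  show "(\<lambda>\<omega>. G k (X \<omega>)) \<in> borel_measurable P" for k
  proof (rule meas[OF G(1)])
   show "\<bar>G k x\<bar> <= 1" if "x \<in> M" for x
    using G(2,3)[OF that, of k] by (cases "x \<in> U") auto
  qed
  show "(\<lambda>k. G k (X \<omega>)) \<longlonglongrightarrow> indicat_real U (X \<omega>)" if "\<omega> \<in> space P" for \<omega>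
   using X that by (intro G(4)) auto
 qed
 then have "{\<omega> \<in> space P. indicat_real U (X \<omega>) = 1} \<in> sets P" by measurable
 also have "{\<omega> \<in> space P. indicat_real U (X \<omega>) = 1} = X -` U \<inter> space P" by (auto simp: indicator_def split: if_splits)
 finally show "X -` U \<inter> space P \<in> sets P" .
qed

text \<open>A continuous function and its negative are both limits from below of Lipschitz functions; the
two lower bounds for the limit give the convergence.\<close>
lemma weak_convergence_from_lipschitz:
 assumes P: "prob_space P" and Q: "prob_space Q"
  and X: "!!n. X n \<in> space P \<rightarrow> M" and Y: "Y \<in> space Q \<rightarrow> M"
  and measX: "!!F L n. lip_on M d L F ==> (!!x. x \<in> M ==> \<bar>F x\<bar> <= 1) ==> (\<lambda>\<omega>. F (X n \<omega>)) \<in> borel_measurable P"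
  and measY: "!!F L. lip_on M d L F ==> (!!x. x \<in> M ==> \<bar>F x\<bar> <= 1) ==> (\<lambda>\<omega>. F (Y \<omega>)) \<in> borel_measurable Q"
  and conv: "!!F L. lip_on M d L F ==> (!!x. x \<in> M ==> \<bar>F x\<bar> <= 1) ==>
   (\<lambda>n. \<integral>\<omega>. F (X n \<omega>) \<partial>P) \<longlonglongrightarrow> (\<integral>\<omega>. F (Y \<omega>) \<partial>Q)"
 shows "converges_in_distribution mtopology P X Q Y"
proof -
 interpret P: prob_space P by (rule P)
 interpret Q: prob_space Q by (rule Q)
 have lower: "eventually (\<lambda>n. (\<integral>\<omega>. F (Y \<omega>) \<partial>Q) - e < (\<integral>\<omega>. F (X n \<omega>) \<partial>P)) sequentially"
   "(\<lambda>\<omega>. F (Y \<omega>)) \<in> borel_measurable Q" "!!n. (\<lambda>\<omega>. F (X n \<omega>)) \<in> borel_measurable P"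
  if F: "!!x. x \<in> M ==> 0 <= F x" "!!x. x \<in> M ==> F x <= 1"
  and cont: "!!x e. x \<in> M ==> 0 < e ==> \<exists>r>0. \<forall>y\<in>M. d x y < r --> \<bar>F x - F y\<bar> < e" and e: "0 < e" for F :: "'a => real" and e :: real
 proof -
  obtain G where G: "!!k. lip_on M d (real k) (G k)" "!!k x. x \<in> M ==> 0 <= G k x" "!!k x. x \<in> M ==> G k x <= F x"
   "!!x. x \<in> M ==> (\<lambda>k. G k x) \<longlonglongrightarrow> F x"
  proof (rule inf_convolution[OF F])
   fix x and e :: real assume "x \<in> M" "0 < e"
   then obtain r where "0 < r" "\<forall>y\<in>M. d x y < r --> \<bar>F x - F y\<bar> < e" using cont by blast
   then show "\<exists>r>0. \<forall>y\<in>M. d x y < r --> F x - e < F y" by (intro exI[of _ r]) (force simp: abs_less_iff)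
  qed auto
  have G1: "\<bar>G k x\<bar> <= 1" if "x \<in> M" for k x using G(2,3)[OF that, of k] F(2)[OF that] by simp
  have mX[measurable]: "(\<lambda>\<omega>. G k (X n \<omega>)) \<in> borel_measurable P" for k n by (rule measX[OF G(1) G1])
  have mY[measurable]: "(\<lambda>\<omega>. G k (Y \<omega>)) \<in> borel_measurable Q" for k by (rule measY[OF G(1) G1])
  have YM: "Y \<omega> \<in> M" if "\<omega> \<in> space Q" for \<omega> using Y that by auto
  have XM: "X n \<omega> \<in> M" if "\<omega> \<in> space P" for n \<omega> using X that by auto
  show FY[measurable]: "(\<lambda>\<omega>. F (Y \<omega>)) \<in> borel_measurable Q"
   by (rule borel_measurable_LIMSEQ_real[OF G(4)[OF YM] mY])
  show FX[measurable]: "(\<lambda>\<omega>. F (X n \<omega>)) \<in> borel_measurable P" for n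
   by (rule borel_measurable_LIMSEQ_real[OF G(4)[OF XM] mX])
  have "(\<lambda>k. \<integral>\<omega>. G k (Y \<omega>) \<partial>Q) \<longlonglongrightarrow> (\<integral>\<omega>. F (Y \<omega>) \<partial>Q)"
   by (rule integral_dominated_convergence[where w = "\<lambda>_. 1"]) (use G(4) G1 YM in auto)
  from order_tendstoD(1)[OF this, of "(\<integral>\<omega>. F (Y \<omega>) \<partial>Q) - e / 2"] e
  obtain k where k: "(\<integral>\<omega>. F (Y \<omega>) \<partial>Q) - e / 2 < (\<integral>\<omega>. G k (Y \<omega>) \<partial>Q)" by (auto simp: eventually_sequentially)
  have "eventually (\<lambda>n. (\<integral>\<omega>. G k (Y \<omega>) \<partial>Q) - e / 2 < (\<integral>\<omega>. G k (X n \<omega>) \<partial>P)) sequentially"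
   using e by (intro order_tendstoD(1)[OF conv[OF G(1) G1]]) auto
  then show "eventually (\<lambda>n. (\<integral>\<omega>. F (Y \<omega>) \<partial>Q) - e < (\<integral>\<omega>. F (X n \<omega>) \<partial>P)) sequentially"
  proof eventually_elim
   case (elim n)
   have "(\<integral>\<omega>. G k (X n \<omega>) \<partial>P) <= (\<integral>\<omega>. F (X n \<omega>) \<partial>P)"
   proof (rule integral_mono)
    show "integrable P (\<lambda>\<omega>. G k (X n \<omega>))" using G1 XM by (intro P.integrable_const_bound[of _ 1]) auto
    show "integrable P (\<lambda>\<omega>. F (X n \<omega>))" using F XM by (intro P.integrable_const_bound[of _ 1]) auto
   qed (use G(3) XM in auto)
   then show ?case using elim k by linarith
  qed
 qed
 have conv': "(\<lambda>n. \<integral>\<omega>. F (X n \<omega>) \<partial>P) \<longlonglongrightarrow> (\<integral>\<omega>. F (Y \<omega>) \<partial>Q)"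
  if F: "!!x. x \<in> M ==> 0 <= F x" "!!x. x \<in> M ==> F x <= 1"
  and cont: "!!x e. x \<in> M ==> 0 < e ==> \<exists>r>0. \<forall>y\<in>M. d x y < r --> \<bar>F x - F y\<bar> < e" for F :: "'a => real"
 proof (rule LIMSEQ_I)
  fix e :: real assume e: "0 < e"
  have 1: "eventually (\<lambda>n. (\<integral>\<omega>. F (Y \<omega>) \<partial>Q) - e < (\<integral>\<omega>. F (X n \<omega>) \<partial>P)) sequentially"
   by (rule lower(1)[OF F cont e])
  have mY: "(\<lambda>\<omega>. F (Y \<omega>)) \<in> borel_measurable Q" by (rule lower(2)[OF F cont e])
  have mX: "(\<lambda>\<omega>. F (X n \<omega>)) \<in> borel_measurable P" for n by (rule lower(3)[OF F cont e])
  have c': "\<exists>r>0. \<forall>y\<in>M. d x y < r --> \<bar>(1 - F x) - (1 - F y)\<bar> < e" if "x \<in> M" "0 < e" for x e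
   using cont[OF that] by (simp add: abs_minus_commute)
  have 2: "eventually (\<lambda>n. (\<integral>\<omega>. 1 - F (Y \<omega>) \<partial>Q) - e < (\<integral>\<omega>. 1 - F (X n \<omega>) \<partial>P)) sequentially"
   by (rule lower(1)[OF _ _ c' e]) (use F in auto)
  have iX: "integrable P (\<lambda>\<omega>. F (X n \<omega>))" for n
   using F X by (intro P.integrable_const_bound[of _ 1] mX) (auto simp: Pi_iff)
  have iY: "integrable Q (\<lambda>\<omega>. F (Y \<omega>))"
   using F Y by (intro Q.integrable_const_bound[of _ 1] mY) (auto simp: Pi_iff)
  have e1: "(\<integral>\<omega>. 1 - F (X n \<omega>) \<partial>P) = 1 - (\<integral>\<omega>. F (X n \<omega>) \<partial>P)" for n using iX by (simp add: P.prob_space)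
  have e2: "(\<integral>\<omega>. 1 - F (Y \<omega>) \<partial>Q) = 1 - (\<integral>\<omega>. F (Y \<omega>) \<partial>Q)" using iY by (simp add: Q.prob_space)
  have "eventually (\<lambda>n. 1 - (\<integral>\<omega>. F (Y \<omega>) \<partial>Q) - e < 1 - (\<integral>\<omega>. F (X n \<omega>) \<partial>P)) sequentially"
   using 2 unfolding e1 e2 .
  with 1 have "eventually (\<lambda>n. norm ((\<integral>\<omega>. F (X n \<omega>) \<partial>P) - (\<integral>\<omega>. F (Y \<omega>) \<partial>Q)) < e) sequentially"
   by eventually_elim (simp add: abs_less_iff)
  then show "\<exists>n0. \<forall>n\<ge>n0. norm ((\<integral>\<omega>. F (X n \<omega>) \<partial>P) - (\<integral>\<omega>. F (Y \<omega>) \<partial>Q)) < e" by (simp add: eventually_sequentially)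
 qed
 have "(\<lambda>n. \<integral>\<omega>. F (X n \<omega>) \<partial>P) \<longlonglongrightarrow> (\<integral>\<omega>. F (Y \<omega>) \<partial>Q)"
  if cm: "continuous_map mtopology euclideanreal F" and bF: "bounded (F ` topspace mtopology)" for F :: "'a => real"
 proof -
  obtain B where B: "0 < B" "!!x. x \<in> M ==> \<bar>F x\<bar> <= B"
   using bF by (auto simp: bounded_pos)
  define G where "G x = F x / (2 * B) + 1/2" for x
  have cont: "\<exists>r>0. \<forall>y\<in>M. d x y < r --> \<bar>F x - F y\<bar> < e" if x: "x \<in> M" and e: "0 < e" for x and e :: real
  proof -
   have "openin mtopology {y \<in> topspace mtopology. F y \<in> ball (F x) e}"
    using cm by (intro openin_continuous_map_preimage) (auto simp: open_openin[symmetric])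
   moreover have "x \<in> {y \<in> topspace mtopology. F y \<in> ball (F x) e}" using x e by simp
   ultimately obtain r where "0 < r" "mball x r \<subseteq> {y \<in> topspace mtopology. F y \<in> ball (F x) e}"
    unfolding openin_mtopology by blast
   then show ?thesis using x by (intro exI[of _ r]) (auto simp: subset_iff dist_real_def)
  qed
  have "(\<lambda>n. \<integral>\<omega>. G (X n \<omega>) \<partial>P) \<longlonglongrightarrow> (\<integral>\<omega>. G (Y \<omega>) \<partial>Q)"
   and mG: "(\<lambda>\<omega>. G (Y \<omega>)) \<in> borel_measurable Q" "!!n. (\<lambda>\<omega>. G (X n \<omega>)) \<in> borel_measurable P"
  proof -
   have G: "0 <= G x" "G x <= 1" if "x \<in> M" for x
    using B(2)[OF that] B(1) by (auto simp: G_def abs_le_iff field_simps)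
   have Gc: "\<exists>r>0. \<forall>y\<in>M. d x y < r --> \<bar>G x - G y\<bar> < e" if x: "x \<in> M" and e: "0 < e" for x and e :: real
   proof -
    obtain r where r: "0 < r" "!!y. y \<in> M ==> d x y < r ==> \<bar>F x - F y\<bar> < e * (2 * B)"
     using cont[OF x, of "e * (2 * B)"] e B(1) by auto
    have "\<bar>G x - G y\<bar> < e" if "y \<in> M" "d x y < r" for y
    proof -
     have "G x - G y = (F x - F y) / (2 * B)" by (simp add: G_def diff_divide_distrib)
     then have "\<bar>G x - G y\<bar> = \<bar>F x - F y\<bar> / (2 * B)" using B(1) by (simp add: abs_divide)
     also have "... < e" using r(2)[OF that] B(1) by (simp add: divide_less_eq)
     finally show ?thesis .
    qed
    then show ?thesis using r(1) by blast
   qed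
   show "(\<lambda>n. \<integral>\<omega>. G (X n \<omega>) \<partial>P) \<longlonglongrightarrow> (\<integral>\<omega>. G (Y \<omega>) \<partial>Q)" by (rule conv'[OF G Gc])
   show "(\<lambda>\<omega>. G (Y \<omega>)) \<in> borel_measurable Q" by (rule lower(2)[OF G Gc zero_less_one])
   show "(\<lambda>\<omega>. G (X n \<omega>)) \<in> borel_measurable P" for n by (rule lower(3)[OF G Gc zero_less_one])
  qed
  then have "(\<lambda>n. (2 * B) * (\<integral>\<omega>. G (X n \<omega>) \<partial>P) - B) \<longlonglongrightarrow> (2 * B) * (\<integral>\<omega>. G (Y \<omega>) \<partial>Q) - B"
   by (intro tendsto_intros)
  moreover have Feq: "F x = 2 * B * G x - B" for x using B(1) by (simp add: G_def distrib_left)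
  have GB: "\<bar>G x\<bar> <= 1" if "x \<in> M" for x using B(2)[OF that] B(1) by (auto simp: G_def abs_le_iff field_simps)
  have "(\<integral>\<omega>. F (X n \<omega>) \<partial>P) = (2 * B) * (\<integral>\<omega>. G (X n \<omega>) \<partial>P) - B" for n
  proof -
   have "integrable P (\<lambda>\<omega>. G (X n \<omega>))" using GB X mG by (intro P.integrable_const_bound[of _ 1]) (auto simp: Pi_iff)
   then show ?thesis unfolding Feq by (simp add: P.prob_space)
  qed
  moreover have "(\<integral>\<omega>. F (Y \<omega>) \<partial>Q) = (2 * B) * (\<integral>\<omega>. G (Y \<omega>) \<partial>Q) - B"
  proof -
   have "integrable Q (\<lambda>\<omega>. G (Y \<omega>))" using GB Y mG by (intro Q.integrable_const_bound[of _ 1]) (auto simp: Pi_iff)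
   then show ?thesis unfolding Feq by (simp add: Q.prob_space)
  qed
  ultimately show ?thesis by simp
 qed
 moreover have "X n \<in> P \<rightarrow>\<^sub>M borel_of_topology mtopology" for n by (rule measurable_borel_of_topology[OF X measX])
 moreover have "Y \<in> Q \<rightarrow>\<^sub>M borel_of_topology mtopology" by (rule measurable_borel_of_topology[OF Y measY])
 ultimately show ?thesis unfolding converges_in_distribution_def by blast
qed

end

lemma coord_lipschitz_polygon:
 assumes \<eta>: "0 < \<eta>" "\<eta> < 1" and F: "lip_on (holder0_space \<eta>) (holder_dist \<eta>) L F"
 shows "coord_lipschitz {..2 ^ m} (L * (2 ^ m + 1)) (\<lambda>v. F (polygon m v))"
 unfolding coord_lipschitz_def
proof (intro allI)
 fix v w
 have "\<bar>F (polygon m v) - F (polygon m w)\<bar> <= L * holder_dist \<eta> (polygon m v) (polygon m w)"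
  using F polygon_in_holder0[OF \<eta>] by (simp add: lip_on_def)
 also have "... <= L * ((2 ^ m + 1) * (\<Sum>k\<le>2 ^ m. \<bar>v k - w k\<bar>))"
  using F \<eta> by (intro mult_left_mono polygon_dist_le) (auto simp: lip_on_def)
 finally show "\<bar>F (polygon m v) - F (polygon m w)\<bar> <= L * (2 ^ m + 1) * (\<Sum>k\<le>2 ^ m. \<bar>v k - w k\<bar>)" by simp
qed

lemma lip_on_polygon_tendsto:
 assumes \<eta>: "0 < \<eta>" "\<eta> < 1" and F: "lip_on (holder0_space \<eta>) (holder_dist \<eta>) L F" and x: "x \<in> holder0_space \<eta>"
 shows "(\<lambda>m. F (polygon m (\<lambda>k. x (real k / 2 ^ m)))) \<longlonglongrightarrow> F x"
proof -
 have "(\<lambda>m. L * holder_dist \<eta> x (polygon m (\<lambda>k. x (real k / 2 ^ m)))) \<longlonglongrightarrow> L * 0"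
  using \<eta> by (intro tendsto_intros polygon_tendsto[OF x]) auto
 then have lim: "(\<lambda>m. L * holder_dist \<eta> x (polygon m (\<lambda>k. x (real k / 2 ^ m)))) \<longlonglongrightarrow> 0" by simp
 have "(\<lambda>m. F (polygon m (\<lambda>k. x (real k / 2 ^ m))) - F x) \<longlonglongrightarrow> 0"
  by (rule Lim_null_comparison[OF _ lim])
    (use F x polygon_in_holder0[OF \<eta>] in \<open>auto simp: lip_on_def abs_minus_commute\<close>)
 then show ?thesis by (rule LIM_zero_cancel)
qed

text \<open>The polygons of a path depend on finitely many of its values and converge to it. Thus measurable
coordinates suffice.\<close>
lemma lip_on_measurable:
 assumes \<eta>: "0 < \<eta>" "\<eta> < 1" and F: "lip_on (holder0_space \<eta>) (holder_dist \<eta>) L F"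
  and Y: "!!\<omega>. \<omega> \<in> space P ==> Y \<omega> \<in> holder0_space \<eta>" "!!t. t \<in> {0..1} ==> (\<lambda>\<omega>. Y \<omega> t) \<in> borel_measurable P"
 shows "(\<lambda>\<omega>. F (Y \<omega>)) \<in> borel_measurable P" "(\<lambda>\<omega>. F (polygon m (\<lambda>k. Y \<omega> (real k / 2 ^ m)))) \<in> borel_measurable P"
proof -
 show pm: "(\<lambda>\<omega>. F (polygon m (\<lambda>k. Y \<omega> (real k / 2 ^ m)))) \<in> borel_measurable P" for m
 proof (rule coord_lipschitz_measurable[OF coord_lipschitz_polygon[OF \<eta> F]])
  fix k :: nat assume "k \<in> {..2 ^ m}"
  then have "real k <= real (2 ^ m)" by (simp only: of_nat_le_iff) simp
  then show "(\<lambda>\<omega>. Y \<omega> (real k / 2 ^ m)) \<in> borel_measurable P" by (intro Y(2)) (simp add: divide_le_eq)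
 qed
 show "(\<lambda>\<omega>. F (Y \<omega>)) \<in> borel_measurable P"
  by (rule borel_measurable_LIMSEQ_real[OF lip_on_polygon_tendsto[OF \<eta> F Y(1)] pm])
qed

section \<open>Tightness of the Birkhoff process\<close>

lemma holder0_scale:
 assumes "(\<lambda>t\<in>{0..1}. x t) \<in> holder0_space \<eta>"
 shows "(\<lambda>t\<in>{0..1}. c * x t) \<in> holder0_space \<eta>"
proof -
 have quot: "ennreal (\<bar>(\<lambda>t\<in>{0..1}. c * x t) s - (\<lambda>t\<in>{0..1}. c * x t) t\<bar> / \<bar>s - t\<bar> powr \<eta>)
   = ennreal \<bar>c\<bar> * ennreal (\<bar>(\<lambda>t\<in>{0..1}. x t) s - (\<lambda>t\<in>{0..1}. x t) t\<bar> / \<bar>s - t\<bar> powr \<eta>)"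
  if "s \<in> {0..1}" "t \<in> {0..1}" for s t
  using that by (simp add: ennreal_mult[symmetric] right_diff_distrib[symmetric] abs_mult)
 have modl: "holder_modulus \<eta> (\<lambda>t\<in>{0..1}. c * x t) \<delta> <= ennreal \<bar>c\<bar> * holder_modulus \<eta> (\<lambda>t\<in>{0..1}. x t) \<delta>" for \<delta>
  unfolding holder_modulus_def
 proof (intro SUP_least, clarify)
  fix s t :: real assume st: "s \<in> {0..1}" "t \<in> {0..1}" "0 < \<bar>s - t\<bar>" "\<bar>s - t\<bar> < \<delta>"
  show "ennreal (\<bar>(\<lambda>t\<in>{0..1}. c * x t) s - (\<lambda>t\<in>{0..1}. c * x t) t\<bar> / \<bar>s - t\<bar> powr \<eta>) <= ennreal \<bar>c\<bar> *
   (SUP (s, t)\<in>{(s, t). s \<in> {0..1} \<and> t \<in> {0..1} \<and> 0 < \<bar>s - t\<bar> \<and> \<bar>s - t\<bar> < \<delta>}.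
     ennreal (\<bar>(\<lambda>t\<in>{0..1}. x t) s - (\<lambda>t\<in>{0..1}. x t) t\<bar> / \<bar>s - t\<bar> powr \<eta>))"
   unfolding quot[OF st(1,2)] using st by (intro mult_left_mono SUP_upper2[of "(s, t)"]) auto
 qed
 have seml: "holder_seminorm \<eta> (\<lambda>t\<in>{0..1}. c * x t) <= ennreal \<bar>c\<bar> * holder_seminorm \<eta> (\<lambda>t\<in>{0..1}. x t)"
  unfolding holder_seminorm_def
 proof (intro SUP_least, clarify)
  fix s t :: real assume st: "s \<in> {0..1}" "t \<in> {0..1}" "s \<noteq> t"
  show "ennreal (\<bar>(\<lambda>t\<in>{0..1}. c * x t) s - (\<lambda>t\<in>{0..1}. c * x t) t\<bar> / \<bar>s - t\<bar> powr \<eta>) <= ennreal \<bar>c\<bar> *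
   (SUP (s, t)\<in>{(s, t). s \<in> {0..1} \<and> t \<in> {0..1} \<and> s \<noteq> t}.
     ennreal (\<bar>(\<lambda>t\<in>{0..1}. x t) s - (\<lambda>t\<in>{0..1}. x t) t\<bar> / \<bar>s - t\<bar> powr \<eta>))"
   unfolding quot[OF st(1,2)] using st by (intro mult_left_mono SUP_upper2[of "(s, t)"]) auto
 qed
 have "holder_seminorm \<eta> (\<lambda>t\<in>{0..1}. x t) < \<infinity>" using assms by (simp add: holder0_space_def holder_space_def)
 then have "holder_seminorm \<eta> (\<lambda>t\<in>{0..1}. c * x t) < \<infinity>"
  using seml by (auto intro: le_less_trans simp: ennreal_mult_less_top)
 moreover have "(holder_modulus \<eta> (\<lambda>t\<in>{0..1}. c * x t) \<longlongrightarrow> 0) (at_right 0)"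
 proof (rule tendsto_sandwich[of "\<lambda>_. 0"])
  have "(holder_modulus \<eta> (\<lambda>t\<in>{0..1}. x t) \<longlongrightarrow> 0) (at_right 0)" using assms by (simp add: holder0_space_def)
  then have "((\<lambda>\<delta>. ennreal \<bar>c\<bar> * holder_modulus \<eta> (\<lambda>t\<in>{0..1}. x t) \<delta>) \<longlongrightarrow> ennreal \<bar>c\<bar> * 0) (at_right 0)"
   by (intro ennreal_tendsto_cmult) auto
  then show "((\<lambda>\<delta>. ennreal \<bar>c\<bar> * holder_modulus \<eta> (\<lambda>t\<in>{0..1}. x t) \<delta>) \<longlongrightarrow> 0) (at_right 0)" by simp
 qed (use modl in auto)
 ultimately show ?thesis by (simp add: holder0_space_def holder_space_def)
qed

context exact_system
begin

text \<open>The Birkhoff sum up to a real time, interpolated linearly.\<close>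
definition partial :: "real => 'a => real" where
 "partial u x = S (nat \<lfloor>u\<rfloor>) x + (u - real (nat \<lfloor>u\<rfloor>)) * \<phi> ((T ^^ nat \<lfloor>u\<rfloor>) x)"

definition path :: "nat => real => 'a => real" where
 "path n t x = partial (real n * t) x / sqrt (real n)"

lemma path_meas [measurable]: "path n t \<in> borel_measurable M"
 unfolding path_def[abs_def] partial_def by measurable

lemma partial_near_S: "0 <= u ==> x \<in> space M ==> \<bar>partial u x - S (nat \<lfloor>u\<rfloor>) x\<bar> <= B"
proof -
 assume u: "0 <= u" and x: "x \<in> space M"
 have "0 <= u - real (nat \<lfloor>u\<rfloor>)" "u - real (nat \<lfloor>u\<rfloor>) <= 1" using u by linarith+
 then have "\<bar>u - real (nat \<lfloor>u\<rfloor>)\<bar> * \<bar>\<phi> ((T ^^ nat \<lfloor>u\<rfloor>) x)\<bar> <= 1 * B"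
  using phi_bound[OF T_pow_space[OF x]] by (intro mult_mono) auto
 then show ?thesis by (simp add: partial_def abs_mult)
qed

lemma partial_lipschitz:
 assumes "0 <= u" "u <= v" and x: "x \<in> space M"
 shows "\<bar>partial v x - partial u x\<bar> <= B * (v - u)"
proof -
 define a b where "a = nat \<lfloor>u\<rfloor>" and "b = nat \<lfloor>v\<rfloor>"
 have ab: "a <= b" using assms by (auto simp: a_def b_def intro!: nat_mono floor_mono)
 have a: "real a <= u" "u < real a + 1" using assms unfolding a_def by linarith+
 have b: "real b <= v" "v < real b + 1" using assms unfolding b_def by linarith+
 have ph: "\<bar>c * \<phi> ((T ^^ k) x)\<bar> <= B * c" if "0 <= c" for c k
  using mult_right_mono[OF phi_bound[OF T_pow_space[OF x, of k]] that] that by (simp add: abs_mult mult.commute)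
 show ?thesis
 proof (cases "a = b")
  case True
  have "partial v x - partial u x = (v - u) * \<phi> ((T ^^ a) x)"
   unfolding partial_def a_def[symmetric] b_def[symmetric] True by (simp add: left_diff_distrib)
  then show ?thesis using ph assms by simp
 next
  case False
  then have ab': "Suc a <= b" using ab by simp
  have "S b x = S (Suc a + (b - Suc a)) x" using ab' by simp
  also have "... = S (Suc a) x + S (b - Suc a) ((T ^^ Suc a) x)" by (rule S_add)
  also have "S (Suc a) x = S a x + \<phi> ((T ^^ a) x)" unfolding S_def by simp
  finally have "partial v x - partial u x
    = (real a + 1 - u) * \<phi> ((T ^^ a) x) + S (b - Suc a) ((T ^^ Suc a) x) + (v - real b) * \<phi> ((T ^^ b) x)"
   unfolding partial_def a_def[symmetric] b_def[symmetric] by (simp add: algebra_simps)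
  also have "\<bar>...\<bar> <= B * (real a + 1 - u) + real (b - Suc a) * B + B * (v - real b)"
  proof (intro order_trans[OF abs_triangle_ineq add_mono] order_trans[OF abs_triangle_ineq])
   show "\<bar>S (b - Suc a) ((T ^^ Suc a) x)\<bar> <= real (b - Suc a) * B" by (rule S_bound[OF T_pow_space[OF x]])
  qed (use ph a b in auto)
  also have "... = B * (v - u)" using ab' by (simp add: of_nat_diff algebra_simps)
  finally show ?thesis .
 qed
qed

lemma path_lipschitz:
 assumes st: "s \<in> {0..1}" "t \<in> {0..1}" and x: "x \<in> space M"
 shows "\<bar>path n s x - path n t x\<bar> <= B * sqrt (real n) * \<bar>s - t\<bar>"
proof (cases "n = 0")
 case False
 have main: "\<bar>path n s x - path n t x\<bar> <= B * sqrt (real n) * \<bar>s - t\<bar>" if "0 <= t" "t <= s" for s t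
 proof -
  have "\<bar>partial (real n * s) x - partial (real n * t) x\<bar> <= B * (real n * s - real n * t)"
   using that x by (intro partial_lipschitz mult_left_mono) auto
  then have "\<bar>partial (real n * s) x - partial (real n * t) x\<bar> / sqrt (real n) <= B * (real n * s - real n * t) / sqrt (real n)"
   by (rule divide_right_mono) simp
  also have "... = B * (real n / sqrt (real n)) * (s - t)" by (simp add: right_diff_distrib diff_divide_distrib)
  also have "real n / sqrt (real n) = sqrt (real n)" by (simp add: real_div_sqrt)
  finally show ?thesis using that by (simp add: path_def diff_divide_distrib[symmetric] abs_divide)
 qed
 show ?thesis using main[of t s] main[of s t] st by (cases "t <= s") (auto simp: abs_minus_commute)
qed (simp add: path_def)

text \<open>For \<open>\<kappa> \<le> 4 * B * sqrt (t - s)\<close> the bound is at least 1. Otherwise, if \<open>n * (t - s) \<le> 1\<close>, the slope of the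
path is too small for the event to occur, and if \<open>n * (t - s) > 1\<close> interpolation costs at most half of \<open>\<kappa>\<close>
and Markov's inequality applies to \<open>moment_bound\<close>.\<close>
lemma increment_tail:
 assumes p: "2 < p" "p < 2 * \<beta>"
 shows "\<exists>K'\<ge>0. \<forall>n s t \<kappa>. 0 < n --> s \<in> {0..1} --> t \<in> {0..1} --> s < t --> 0 < \<kappa> -->
  prob {x \<in> space M. \<kappa> < \<bar>path n t x - path n s x\<bar>} <= K' * (t - s) powr (p / 2) * \<kappa> powr - p"
proof -
 obtain K0 where K0: "!!m. moment p m <= K0 * real m powr (p / 2)" using moment_bound[OF p] by blast
 define K where "K = max K0 0"
 have K: "0 <= K" "moment p m <= K * real m powr (p / 2)" for m
  using order_trans[OF K0[of m] mult_right_mono[of K0 K "real m powr (p / 2)"]] by (auto simp: K_def)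
 define K' where "K' = (4 * B) powr p + K * 2 powr (p / 2) * 2 powr p"
 have K': "0 <= K'" using K by (auto simp: K'_def)
 have "prob {x \<in> space M. \<kappa> < \<bar>path n t x - path n s x\<bar>} <= K' * (t - s) powr (p / 2) * \<kappa> powr - p"
  if n: "0 < n" and st: "s \<in> {0..1}" "t \<in> {0..1}" "s < t" and \<kappa>: "0 < \<kappa>" for n s t \<kappa>
 proof -
  define \<delta> where "\<delta> = t - s"
  have \<delta>: "0 < \<delta>" using st by (simp add: \<delta>_def)
  define E where "E = {x \<in> space M. \<kappa> < \<bar>path n t x - path n s x\<bar>}"
  have nonneg: "0 <= \<delta> powr (p / 2) * \<kappa> powr - p" by simp
  have crude: "prob E <= K' * \<delta> powr (p / 2) * \<kappa> powr - p" if "\<kappa> <= 4 * B * sqrt \<delta>"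
  proof -
   have "\<kappa> powr p <= (4 * B * sqrt \<delta>) powr p" using that \<kappa> p by (intro powr_mono2) auto
   also have "... = (4 * B) powr p * \<delta> powr (p / 2)"
    using B_pos \<delta> by (simp add: powr_mult powr_half_sqrt[symmetric] powr_powr)
   finally have "\<kappa> powr p * \<kappa> powr - p <= (4 * B) powr p * \<delta> powr (p / 2) * \<kappa> powr - p" by (rule mult_right_mono) simp
   then have "1 <= (4 * B) powr p * (\<delta> powr (p / 2) * \<kappa> powr - p)" using \<kappa> by (simp add: powr_add[symmetric] mult.assoc)
   also have "... <= K' * (\<delta> powr (p / 2) * \<kappa> powr - p)"
    using K by (intro mult_right_mono nonneg) (auto simp: K'_def)
   finally show ?thesis unfolding mult.assoc using prob_le_1[of E] by linarith
  qed
  show ?thesis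
  proof (cases "\<kappa> <= 4 * B * sqrt \<delta>")
   case True
   then show ?thesis using crude by (simp add: E_def \<delta>_def)
  next
   case big: False
   show ?thesis
   proof (cases "real n * \<delta> <= 1")
    case True
    have "E = {}"
    proof (rule ccontr)
     assume "E \<noteq> {}"
     then obtain x where x: "x \<in> space M" "\<kappa> < \<bar>path n t x - path n s x\<bar>" by (auto simp: E_def)
     note x(2)
     also have "\<bar>path n t x - path n s x\<bar> <= B * sqrt (real n) * \<bar>t - s\<bar>" by (rule path_lipschitz[OF st(2,1) x(1)])
     also have "... = B * (sqrt (real n * \<delta>) * sqrt \<delta>)" using \<delta> by (simp add: \<delta>_def real_sqrt_mult)
     also have "... <= B * (1 * sqrt \<delta>)" using True B_pos \<delta> by (intro mult_left_mono mult_right_mono) auto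
     also have "... <= 4 * B * sqrt \<delta>" using B_pos \<delta> by simp
     finally show False using big by simp
    qed
    then show ?thesis unfolding E_def[symmetric] \<delta>_def[symmetric] using K' by simp
   next
    case large: False
    define a l where "a = nat \<lfloor>real n * s\<rfloor>" and "l = nat \<lfloor>real n * t\<rfloor> - nat \<lfloor>real n * s\<rfloor>"
    have al: "nat \<lfloor>real n * t\<rfloor> = a + l"
     using st by (auto simp: a_def l_def intro!: le_add_diff_inverse[symmetric] nat_mono floor_mono mult_left_mono)
    have ns: "0 <= real n * s" "0 <= real n * t" using st by auto
    have l_le: "real l <= 2 * (real n * \<delta>)"
    proof -
     have "real (a + l) <= real n * t" using ns unfolding al[symmetric] by linarith
     moreover have "real n * s < real a + 1" using ns unfolding a_def by linarith
     ultimately have "real l <= real n * \<delta> + 1" by (simp add: \<delta>_def right_diff_distrib)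
     then show ?thesis using large by linarith
    qed
    have sub: "E \<subseteq> {x \<in> space M. (\<kappa> * sqrt (real n) / 2) powr p <= \<bar>S l ((T ^^ a) x)\<bar> powr p}"
    proof
     fix x assume "x \<in> E"
     then have x: "x \<in> space M" and gt: "\<kappa> < \<bar>path n t x - path n s x\<bar>" by (auto simp: E_def)
     have "\<kappa> * sqrt (real n) < \<bar>partial (real n * t) x - partial (real n * s) x\<bar>"
      using gt n by (simp add: path_def diff_divide_distrib[symmetric] abs_divide less_divide_eq)
     moreover have "\<bar>partial (real n * t) x - S (a + l) x\<bar> <= B" "\<bar>partial (real n * s) x - S a x\<bar> <= B"
      using partial_near_S[OF ns(2) x] partial_near_S[OF ns(1) x] by (simp_all add: al a_def[symmetric])
     moreover have "S (a + l) x = S a x + S l ((T ^^ a) x)" by (rule S_add)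
     moreover have "4 * B <= \<kappa> * sqrt (real n)"
     proof -
      have "4 * B * 1 <= 4 * B * sqrt (real n * \<delta>)" using large B_pos by (intro mult_left_mono) auto
      also have "... = 4 * B * sqrt \<delta> * sqrt (real n)" by (simp add: real_sqrt_mult)
      also have "... <= \<kappa> * sqrt (real n)" using big by (intro mult_right_mono) auto
      finally show ?thesis by simp
     qed
     ultimately have "\<kappa> * sqrt (real n) / 2 <= \<bar>S l ((T ^^ a) x)\<bar>" by linarith
     then show "x \<in> {x \<in> space M. (\<kappa> * sqrt (real n) / 2) powr p <= \<bar>S l ((T ^^ a) x)\<bar> powr p}"
      using x \<kappa> p by (auto intro!: powr_mono2)
    qed
    have "prob E <= prob {x \<in> space M. (\<kappa> * sqrt (real n) / 2) powr p <= \<bar>S l ((T ^^ a) x)\<bar> powr p}"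
     using sub by (rule finite_measure_mono) measurable
    also have "... <= (MEAN x. \<bar>S l ((T ^^ a) x)\<bar> powr p) / (\<kappa> * sqrt (real n) / 2) powr p"
    proof (rule integral_Markov_inequality_measure[where A = "{}"])
     show "integrable M (\<lambda>x. \<bar>S l ((T ^^ a) x)\<bar> powr p)"
     proof (rule integrable_bdd[of _ "(real l * B) powr p"])
      show "norm (\<bar>S l ((T ^^ a) x)\<bar> powr p) <= (real l * B) powr p" if "x \<in> space M" for x
       using S_bound[OF T_pow_space[OF that]] p by (auto intro!: powr_mono2)
     qed measurable
    qed (use \<kappa> n in auto)
    also have "(MEAN x. \<bar>S l ((T ^^ a) x)\<bar> powr p) = moment p l"
     unfolding moment_def by (rule T_pow_invariant) measurable
    also have "moment p l / (\<kappa> * sqrt (real n) / 2) powr p <= (K * (2 * (real n * \<delta>)) powr (p / 2)) / (\<kappa> * sqrt (real n) / 2) powr p"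
     using K p l_le by (intro divide_right_mono order_trans[OF K(2)] mult_left_mono powr_mono2) auto
    also have "(2 * (real n * \<delta>)) powr (p / 2) = 2 powr (p / 2) * (real n powr (p / 2) * \<delta> powr (p / 2))"
     using \<delta> by (simp add: powr_mult)
    also have "(\<kappa> * sqrt (real n) / 2) powr p = \<kappa> powr p * real n powr (p / 2) / 2 powr p"
     using \<kappa> by (simp add: powr_mult powr_divide powr_half_sqrt[symmetric] powr_powr)
    also have "K * (2 powr (p / 2) * (real n powr (p / 2) * \<delta> powr (p / 2))) / (\<kappa> powr p * real n powr (p / 2) / 2 powr p)
     = (K * 2 powr (p / 2) * 2 powr p) * (\<delta> powr (p / 2) * \<kappa> powr - p)"
     using n \<kappa> by (simp add: powr_minus divide_simps)
    also have "... <= K' * (\<delta> powr (p / 2) * \<kappa> powr - p)"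
     by (intro mult_right_mono nonneg) (simp add: K'_def)
    finally show ?thesis by (simp add: E_def \<delta>_def mult.assoc)
   qed
  qed
 qed
 then show ?thesis using K' by (intro exI[of _ K']) auto
qed

text \<open>The event that some dyadic increment of level at least \<open>m\<close> violates the hypothesis of \<open>polygon_approx\<close>.\<close>
definition rough :: "real => real => nat => nat => 'a set" where
 "rough \<eta> A m n = {x \<in> space M. \<exists>i. \<exists>k<2 ^ (m + i).
   A * (2 powr - \<eta>) ^ (m + i) < \<bar>path n (real (Suc k) / 2 ^ (m + i)) x - path n (real k / 2 ^ (m + i)) x\<bar>}"

lemma rough_sets: "rough \<eta> A m n \<in> sets M"
 unfolding rough_def by measurable

text \<open>There are \<open>2 ^ j\<close> increments of level \<open>j\<close>, each violating the bound with probability of the order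
\<open>2 powr (- j * p * (1/2 - \<eta>))\<close>, so the probabilities are summable over all increments.\<close>
lemma rough_unlikely:
 assumes p: "2 < p" "p < 2 * \<beta>" "p * (1 / 2 - \<eta>) > 1" and A: "0 < A" and e: "0 < e"
 shows "\<exists>m0. \<forall>m\<ge>m0. \<forall>n>0. prob (rough \<eta> A m n) <= e"
proof -
 obtain K where K: "0 <= K" "!!n s t \<kappa>. 0 < n ==> s \<in> {0..1} ==> t \<in> {0..1} ==> s < t ==> 0 < \<kappa> ==>
  prob {x \<in> space M. \<kappa> < \<bar>path n t x - path n s x\<bar>} <= K * (t - s) powr (p / 2) * \<kappa> powr - p"
  using increment_tail[OF p(1,2)] by blast
 define r :: real where "r = 2 powr (1 - p * (1 / 2 - \<eta>))"
 have r: "0 < r" "r < 1" using p(3) by (auto simp: r_def powr_less_one)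
 define c where "c = K * A powr - p"
 have c: "0 <= c" using K by (simp add: c_def)
 define E where "E n j k = {x \<in> space M. A * (2 powr - \<eta>) ^ j < \<bar>path n (real (Suc k) / 2 ^ j) x - path n (real k / 2 ^ j) x\<bar>}" for n j k
 have Em[measurable]: "E n j k \<in> sets M" for n j k unfolding E_def by measurable
 have one: "prob (E n j k) <= c * ((1 / 2) ^ j * r ^ j)" if n: "0 < n" and k: "k < 2 ^ j" for n j k
 proof -
  have "real (Suc k) <= real (2 ^ j)" using k by (simp only: of_nat_le_iff)
  then have mem: "real (Suc k) / 2 ^ j \<in> {0..1}" "real k / 2 ^ j \<in> {0..1}" using k by (simp_all add: divide_le_eq)
  have dist: "real (Suc k) / 2 ^ j - real k / 2 ^ j = (1/2) ^ j" by (simp add: add_divide_distrib power_one_over)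
  have "prob (E n j k) <= K * ((1/2) ^ j) powr (p / 2) * (A * (2 powr - \<eta>) ^ j) powr - p"
   unfolding E_def dist[symmetric] by (rule K(2)[OF n mem(2,1)]) (use A in \<open>auto simp: divide_strict_right_mono\<close>)
  also have "... = c * (((1/2) ^ j) powr (p / 2) * ((2 powr - \<eta>) ^ j) powr - p)"
   using A by (simp add: powr_mult c_def)
  also have "((1/2) ^ j) powr (p / 2) * ((2 powr - \<eta>) ^ j) powr - p = (1/2) ^ j * r ^ j"
  proof -
   have h: "(1/2 :: real) ^ j = 2 powr (- real j)" by (simp add: powr_minus powr_realpow power_one_over inverse_eq_divide)
   have "((1/2) ^ j) powr (p / 2) * ((2 powr - \<eta>) ^ j) powr - p = 2 powr (- real j * (p / 2)) * 2 powr (- \<eta> * real j * - p)"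
    unfolding h by (simp add: powr_powr powr_power mult_ac)
   also have "... = 2 powr (- real j + (1 - p * (1 / 2 - \<eta>)) * real j)"
    unfolding powr_add[symmetric] by (rule arg_cong[where f = "\<lambda>z. 2 powr z"]) (simp add: algebra_simps)
   also have "... = (1/2) ^ j * r ^ j" unfolding powr_add h r_def by (simp add: powr_power mult.commute)
   finally show ?thesis .
  qed
  finally show ?thesis .
 qed
 have level: "prob (\<Union>k\<in>{..<2 ^ j}. E n j k) <= c * r ^ j" if n: "0 < n" for n j
 proof -
  have "prob (\<Union>k\<in>{..<2 ^ j}. E n j k) <= (\<Sum>k<2 ^ j. prob (E n j k))"
   by (rule finite_measure_subadditive_finite) auto
  also have "... <= (\<Sum>k<(2::nat) ^ j. c * ((1 / 2) ^ j * r ^ j))" using one[OF n] by (intro sum_mono) auto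
  also have "... = c * r ^ j" by (simp add: power_one_over)
  finally show ?thesis .
 qed
 have bound: "prob (rough \<eta> A m n) <= c * r ^ m / (1 - r)" if n: "0 < n" for m n
 proof -
  have sm: "summable (\<lambda>i. c * r ^ (m + i))" unfolding power_add using r by (intro summable_mult summable_geometric) auto
  have eq: "rough \<eta> A m n = (\<Union>i. \<Union>k\<in>{..<2 ^ (m + i)}. E n (m + i) k)"
   by (auto simp: rough_def E_def)
  have sm': "summable (\<lambda>i. prob (\<Union>k\<in>{..<2 ^ (m + i)}. E n (m + i) k))"
   by (rule summable_comparison_test'[OF sm, of 0]) (use level[OF n] in auto)
  have "prob (rough \<eta> A m n) <= (\<Sum>i. prob (\<Union>k\<in>{..<2 ^ (m + i)}. E n (m + i) k))"
   unfolding eq by (rule finite_measure_subadditive_countably[OF _ sm']) auto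
  also have "... <= (\<Sum>i. c * r ^ (m + i))" by (rule suminf_le[OF level[OF n] sm' sm])
  also have "... = c * r ^ m / (1 - r)"
   using r by (simp add: power_add suminf_mult suminf_geometric mult.assoc[symmetric] summable_geometric)
  finally show ?thesis .
 qed
 have "(\<lambda>m. c * r ^ m / (1 - r)) \<longlonglongrightarrow> c * 0 / (1 - r)" using r by (intro tendsto_intros LIMSEQ_realpow_zero) auto
 from order_tendstoD(2)[OF this, of e] e
 obtain m0 where "!!m. m0 <= m ==> c * r ^ m / (1 - r) < e" by (auto simp: eventually_sequentially)
 then show ?thesis using bound by (intro exI[of _ m0]) (meson less_imp_le order_trans)
qed

lemma path_in_holder0:
 assumes "0 < \<eta>" "\<eta> < 1" "x \<in> space M"
 shows "(\<lambda>t\<in>{0..1}. path n t x) \<in> holder0_space \<eta>"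
 by (rule lipschitz_in_holder0[where K = "B * sqrt (real n)"]) (use assms path_lipschitz in auto)

lemma path_truncation:
 assumes \<eta>: "0 < \<eta>" "\<eta> < 1" and F: "lip_on (holder0_space \<eta>) (holder_dist \<eta>) L F" and F1: "!!x. x \<in> holder0_space \<eta> ==> \<bar>F x\<bar> <= 1"
  and A: "0 <= A"
 shows "\<bar>(MEAN x. F (\<lambda>t\<in>{0..1}. path n t x)) - (MEAN x. F (polygon m (\<lambda>k. path n (real k / 2 ^ m) x)))\<bar>
  <= L * (8 / (1 - 2 powr - \<eta>) * A) + 2 * prob (rough \<eta> A m n)"
proof -
 define X where "X x = (\<lambda>t\<in>{0..1}. path n t x)" for x
 define P where "P x = polygon m (\<lambda>k. path n (real k / 2 ^ m) x)" for x
 have X0: "X x \<in> holder0_space \<eta>" if "x \<in> space M" for x unfolding X_def by (rule path_in_holder0[OF \<eta> that])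
 have PX: "P x = polygon m (\<lambda>k. X x (real k / 2 ^ m))" for x
  unfolding P_def polygon_def X_def
 proof (intro restrict_ext sum.cong refl)
  fix k :: nat and t :: real assume "k \<in> {..2 ^ m}"
  then have "real k <= real (2 ^ m)" by (simp only: of_nat_le_iff) simp
  then show "path n (real k / 2 ^ m) x * max 0 (1 - \<bar>2 ^ m * t - real k\<bar>)
   = (\<lambda>t\<in>{0..1}. path n t x) (real k / 2 ^ m) * max 0 (1 - \<bar>2 ^ m * t - real k\<bar>)" by (simp add: divide_le_eq)
 qed
 have mX: "(\<lambda>x. F (X x)) \<in> borel_measurable M" and mP: "(\<lambda>x. F (P x)) \<in> borel_measurable M"
  unfolding PX by (rule lip_on_measurable[OF \<eta> F X0]; simp add: X_def)+
 have P0: "P x \<in> holder0_space \<eta>" for x unfolding P_def by (rule polygon_in_holder0[OF \<eta>])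
 have iX: "integrable M (\<lambda>x. F (X x))" using X0 F1 by (intro integrable_bdd[OF mX, of 1]) auto
 have iP: "integrable M (\<lambda>x. F (P x))" using P0 F1 by (intro integrable_bdd[OF mP, of 1]) auto
 define C where "C = 8 / (1 - 2 powr - \<eta>) * A"
 have C: "0 <= C" unfolding C_def using \<eta> A by (intro mult_nonneg_nonneg divide_nonneg_nonneg) (auto simp: powr_le1 powr_less_one less_imp_le)
 have L: "0 <= L" using F by (simp add: lip_on_def)
 have pt: "\<bar>F (X x) - F (P x)\<bar> <= L * C + 2 * indicator (rough \<eta> A m n) x" if x: "x \<in> space M" for x
 proof (cases "x \<in> rough \<eta> A m n")
  case True
  then have "indicator (rough \<eta> A m n) x = (1 :: real)" by simp
  then show ?thesis using F1[OF X0[OF x]] F1[OF P0[of x]] mult_nonneg_nonneg[OF L C] by linarith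
 next
  case False
  have "holder_dist \<eta> (X x) (P x) <= C"
   unfolding PX C_def
  proof (rule polygon_approx[OF holder0_continuous[OF X0[OF x] \<eta>(1)] \<eta>(1) _ A])
   fix j k :: nat assume jk: "m <= j" "k < 2 ^ j"
   have "real (Suc k) <= real (2 ^ j)" using jk by (simp only: of_nat_le_iff)
   then have "real (Suc k) / 2 ^ j \<in> {0..1}" "real k / 2 ^ j \<in> {0..1}" using jk by (simp_all add: divide_le_eq)
   moreover have "\<bar>path n (real (Suc k) / 2 ^ j) x - path n (real k / 2 ^ j) x\<bar> <= A * (2 powr - \<eta>) ^ j"
   proof -
    obtain i where j: "j = m + i" using le_Suc_ex[OF jk(1)] by blast
    show ?thesis
    proof (rule ccontr)
     assume "\<not> ?thesis"
     then have "x \<in> rough \<eta> A m n"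
      unfolding rough_def not_le j using x jk(2)[unfolded j] by blast
     then show False using False by blast
    qed
   qed
   ultimately show "\<bar>X x (real (Suc k) / 2 ^ j) - X x (real k / 2 ^ j)\<bar> <= A * (2 powr - \<eta>) ^ j"
    by (simp only: X_def restrict_apply if_True)
  qed (use \<eta> in auto)
  then have "L * holder_dist \<eta> (X x) (P x) <= L * C" using L by (rule mult_left_mono)
  moreover have "\<bar>F (X x) - F (P x)\<bar> <= L * holder_dist \<eta> (X x) (P x)" using F X0[OF x] P0[of x] by (simp add: lip_on_def)
  ultimately show ?thesis using False by simp
 qed
 have "(MEAN x. F (X x)) - (MEAN x. F (P x)) = (MEAN x. F (X x) - F (P x))" using iX iP by simp
 also have "\<bar>...\<bar> <= (MEAN x. \<bar>F (X x) - F (P x)\<bar>)" by (rule integral_abs_bound)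
 also have "... <= (MEAN x. L * C + 2 * indicator (rough \<eta> A m n) x)"
  using iX iP pt rough_sets by (intro integral_mono) (auto simp: emeasure_eq_measure)
 also have "... = L * C + 2 * prob (rough \<eta> A m n)"
  using rough_sets by (simp add: prob_space emeasure_eq_measure)
 finally show ?thesis by (simp add: X_def P_def C_def)
qed

end

section \<open>Invariance principle in Hoelder spaces\<close>

lemma (in prob_space) char_scaled_increment:
 assumes Z: "distributed M lborel Z (normal_density 0 (sqrt \<theta>))" and \<theta>: "0 < \<theta>"
 shows "char (distr M borel (\<lambda>\<omega>. s * Z \<omega>)) u = exp (- (u\<^sup>2 * s\<^sup>2 * \<theta> / 2))"
proof -
 have Zm: "Z \<in> borel_measurable M" using distributed_measurable[OF Z] by simp
 have sd: "distributed M lborel (\<lambda>\<omega>. (Z \<omega> - 0) / sqrt \<theta>) std_normal_density"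
  using normal_standard_normal_convert[of "sqrt \<theta>" Z 0] Z \<theta> by simp
 define Y where "Y \<omega> = Z \<omega> / sqrt \<theta>" for \<omega>
 have Ym[measurable]: "Y \<in> borel_measurable M" unfolding Y_def[abs_def] using Zm by measurable
 have "distr M lborel Y = std_normal_distribution"
  using distributed_distr_eq_density[OF sd] by (simp add: Y_def[abs_def])
 then have dY: "distr M borel Y = std_normal_distribution" by (metis distr_cong sets_lborel)
 have "char (distr M borel (\<lambda>\<omega>. s * Z \<omega>)) u = (\<integral>\<omega>. iexp (u * (s * Z \<omega>)) \<partial>M)"
  unfolding char_def using Zm by (subst integral_distr) auto
 also have "... = (\<integral>\<omega>. iexp ((u * s * sqrt \<theta>) * Y \<omega>) \<partial>M)"
  using \<theta> by (intro Bochner_Integration.integral_cong refl) (simp add: Y_def)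
 also have "... = char (distr M borel Y) (u * s * sqrt \<theta>)"
  unfolding char_def by (subst integral_distr) auto
 also have "... = exp (- (u * s * sqrt \<theta>)\<^sup>2 / 2)" unfolding dY char_std_normal_distribution ..
 also have "(u * s * sqrt \<theta>)\<^sup>2 = u\<^sup>2 * s\<^sup>2 * \<theta>" using \<theta> by (simp add: power_mult_distrib)
 finally show ?thesis by simp
qed

context exact_system
begin

lemma dyadic_blocks:
 fixes m n :: nat
 defines "N \<equiv> \<lambda>i. (n * i) div 2 ^ m"
 shows "N i <= N (Suc i)" "N (2 ^ m) = n"
  "nat \<lfloor>real n * (real i / 2 ^ m)\<rfloor> = N i"
  "\<bar>real (N (Suc i) - N i) - real n * (1 / 2 ^ m)\<bar> <= 1"
proof -
 show mono: "N i <= N (Suc i)" unfolding N_def by (intro div_le_mono) simp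
 show "N (2 ^ m) = n" by (simp add: N_def)
 show fl: "nat \<lfloor>real n * (real i / 2 ^ m)\<rfloor> = N i" for i
  using floor_divide_of_nat_eq[of "n * i" "2 ^ m", where 'a = real] by (simp add: N_def)
 have nn: "0 <= real n * (real i / 2 ^ m)" for i by simp
 have b: "real (N i) <= real n * (real i / 2 ^ m)" "real n * (real i / 2 ^ m) < real (N i) + 1" for i
  using nn[of i] unfolding fl[symmetric] by linarith+
 have "real n * (real (Suc i) / 2 ^ m) = real n * (real i / 2 ^ m) + real n * (1 / 2 ^ m)"
  by (simp add: add_divide_distrib distrib_left)
 then show "\<bar>real (N (Suc i) - N i) - real n * (1 / 2 ^ m)\<bar> <= 1"
  using b[of i] b[of "Suc i"] mono by (simp only: of_nat_diff)
qed

text \<open>At dyadic times the path agrees, up to one summand, with Birkhoff sums, whose increments are sums over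
blocks of about \<open>n / 2 ^ m\<close> terms; the polygon is a Lipschitz function of them. \<open>blocks_limit\<close> gives
independent Gaussian increments, as for Brownian motion.\<close>
lemma polygon_distribution_limit:
 assumes \<eta>: "0 < \<eta>" "\<eta> < 1" and F: "lip_on (holder0_space \<eta>) (holder_dist \<eta>) L F" and F1: "!!x. x \<in> holder0_space \<eta> ==> \<bar>F x\<bar> <= 1"
  and W: "standard_brownian_motion Q W"
 shows "(\<lambda>n. MEAN x. F (polygon m (\<lambda>k. path n (real k / 2 ^ m) x))) \<longlonglongrightarrow>
   (\<integral>\<omega>. F (polygon m (\<lambda>k. sqrt sigma2 * W (real k / 2 ^ m) \<omega>)) \<partial>Q)"
proof -
 interpret Q: prob_space Q using W by (simp add: standard_brownian_motion_def)
 have L: "0 <= L" using F by (simp add: lip_on_def)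
 define K :: nat where "K = 2 ^ m"
 have K: "0 < K" by (simp add: K_def)
 define Lc where "Lc = L * (2 ^ m + 1)"
 have Lc: "0 <= Lc" using L by (simp add: Lc_def)
 have pl: "\<bar>F (polygon m v) - F (polygon m w)\<bar> <= Lc * (\<Sum>k\<le>K. \<bar>v k - w k\<bar>)" for v w
  using coord_lipschitz_polygon[OF \<eta> F, of m] by (simp add: coord_lipschitz_def Lc_def K_def)
 define \<Phi> where "\<Phi> v = F (polygon m (\<lambda>k. \<Sum>i<k. v i))" for v :: "nat => real"
 have \<Phi>1: "\<bar>\<Phi> v\<bar> <= 1" for v unfolding \<Phi>_def by (intro F1 polygon_in_holder0 \<eta>)
 have \<Phi>L: "coord_lipschitz {0..<K} (Lc * real (Suc K)) \<Phi>"
  unfolding coord_lipschitz_def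
 proof (intro allI)
  fix v w :: "nat => real"
  have "\<bar>\<Phi> v - \<Phi> w\<bar> <= Lc * (\<Sum>k\<le>K. \<bar>(\<Sum>i<k. v i) - (\<Sum>i<k. w i)\<bar>)" unfolding \<Phi>_def by (rule pl)
  also have "... <= Lc * (\<Sum>k\<le>K. \<Sum>i\<in>{0..<K}. \<bar>v i - w i\<bar>)"
  proof (intro mult_left_mono[OF _ Lc] sum_mono)
   fix k assume k: "k \<in> {..K}"
   have "\<bar>(\<Sum>i<k. v i) - (\<Sum>i<k. w i)\<bar> = \<bar>\<Sum>i<k. v i - w i\<bar>" by (simp add: sum_subtractf)
   also have "... <= (\<Sum>i<k. \<bar>v i - w i\<bar>)" by (rule sum_abs)
   also have "... <= (\<Sum>i\<in>{0..<K}. \<bar>v i - w i\<bar>)" using k by (intro sum_mono2) auto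
   finally show "\<bar>(\<Sum>i<k. v i) - (\<Sum>i<k. w i)\<bar> <= (\<Sum>i\<in>{0..<K}. \<bar>v i - w i\<bar>)" .
  qed
  finally show "\<bar>\<Phi> v - \<Phi> w\<bar> <= Lc * real (Suc K) * (\<Sum>i\<in>{0..<K}. \<bar>v i - w i\<bar>)" by simp
 qed
 define \<tau> where "\<tau> i = real i / 2 ^ m" for i :: nat
 have \<tau>: "0 <= \<tau> i" "\<tau> i < \<tau> (Suc i)" "\<tau> 0 = 0" for i by (auto simp: \<tau>_def divide_strict_right_mono)
 have \<tau>1: "\<tau> i <= 1" if "i <= K" for i
 proof -
  have "real i <= real K" using that by simp
  then show ?thesis by (simp add: \<tau>_def K_def divide_le_eq)
 qed
 have \<tau>d: "\<tau> (Suc i) - \<tau> i = 1 / 2 ^ m" for i by (simp add: \<tau>_def add_divide_distrib)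
 define X where "X i \<omega> = sqrt sigma2 * (W (\<tau> (Suc i)) \<omega> - W (\<tau> i) \<omega>)" for i \<omega>
 have Wm: "W (\<tau> i) \<in> borel_measurable Q" if "i <= K" for i
  using W \<tau>(1) \<tau>1[OF that] by (simp add: standard_brownian_motion_def)
 have Xm: "X i \<in> borel_measurable Q" if "i < K" for i
  unfolding X_def using Wm[of i] Wm[of "Suc i"] that by simp
 define D where "D i = (if i < K then distr Q borel (X i) else return borel 0)" for i
 have Dr: "real_distribution (D i)" for i
 proof (cases "i < K")
  case True
  then show ?thesis using Q.real_distribution_distr[OF Xm[OF True]] by (simp add: D_def)
 next
  case False
  then show ?thesis by (auto simp: D_def real_distribution_def real_distribution_axioms_def prob_space_return)
 qed
 have Dc: "char (D i) u = exp (- (u\<^sup>2 * sigma2 * (1 / 2 ^ m) / 2))" if "i < K" for i u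
 proof -
  have "distributed Q lborel (\<lambda>\<omega>. W (\<tau> (Suc i)) \<omega> - W (\<tau> i) \<omega>) (normal_density 0 (sqrt (\<tau> (Suc i) - \<tau> i)))"
   using W \<tau>(1,2)[of i] \<tau>1[of "Suc i"] that by (simp add: standard_brownian_motion_def)
  from Q.char_scaled_increment[OF this, of "sqrt sigma2" u] show ?thesis
   using \<tau>(2)[of i] sigma2_nonneg that by (simp add: D_def X_def[abs_def] \<tau>d)
 qed
 have indep: "Q.indep_vars (\<lambda>_. borel) X {..<K}"
 proof -
  have "Q.indep_vars (\<lambda>_. borel) (\<lambda>i \<omega>. W (\<tau> (Suc i)) \<omega> - W (\<tau> i) \<omega>) {..<K}"
   using W \<tau> \<tau>1[of K] less_imp_le[OF \<tau>(2)] by (simp add: standard_brownian_motion_def)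
  then show ?thesis unfolding X_def[abs_def] by (rule Q.indep_vars_compose2) simp
 qed
 have target: "(\<integral>v. \<Phi> v \<partial>PiM {0..<K} D) = (\<integral>\<omega>. F (polygon m (\<lambda>k. sqrt sigma2 * W (real k / 2 ^ m) \<omega>)) \<partial>Q)"
 proof -
  have "distr Q (PiM {0..<K} (\<lambda>_. borel)) (\<lambda>\<omega>. \<lambda>i\<in>{0..<K}. X i \<omega>) = PiM {0..<K} (\<lambda>i. distr Q borel (X i))"
   using indep Xm K by (subst Q.indep_vars_iff_distr_eq_PiM'[symmetric]) (auto simp: lessThan_atLeast0)
  also have "... = PiM {0..<K} D" by (intro PiM_cong) (auto simp: D_def)
  finally have eq: "PiM {0..<K} D = distr Q (PiM {0..<K} (\<lambda>_. borel)) (\<lambda>\<omega>. \<lambda>i\<in>{0..<K}. X i \<omega>)" ..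
  have "(\<lambda>v. \<Phi> v) \<in> borel_measurable (PiM {0..<K} (\<lambda>_. borel))"
   by (rule coord_lipschitz_measurable[OF \<Phi>L]) simp
  moreover have "(\<lambda>\<omega>. \<lambda>i\<in>{0..<K}. X i \<omega>) \<in> Q \<rightarrow>\<^sub>M PiM {0..<K} (\<lambda>_. borel)"
   using Xm by (intro measurable_restrict) auto
  ultimately have "(\<integral>v. \<Phi> v \<partial>PiM {0..<K} D) = (\<integral>\<omega>. \<Phi> (\<lambda>i\<in>{0..<K}. X i \<omega>) \<partial>Q)"
   unfolding eq by (subst integral_distr) auto
  also have "... = (\<integral>\<omega>. F (polygon m (\<lambda>k. sqrt sigma2 * W (real k / 2 ^ m) \<omega>)) \<partial>Q)"
  proof (rule integral_cong_AE)
   show "(\<lambda>\<omega>. \<Phi> (\<lambda>i\<in>{0..<K}. X i \<omega>)) \<in> borel_measurable Q"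
    by (rule coord_lipschitz_measurable[OF \<Phi>L]) (use Xm in auto)
   show "(\<lambda>\<omega>. F (polygon m (\<lambda>k. sqrt sigma2 * W (real k / 2 ^ m) \<omega>))) \<in> borel_measurable Q"
    by (rule coord_lipschitz_measurable[OF coord_lipschitz_polygon[OF \<eta> F]])
      (use Wm in \<open>auto simp: \<tau>_def K_def\<close>)
   have "AE \<omega> in Q. W 0 \<omega> = 0" using W by (simp add: standard_brownian_motion_def)
   then show "AE \<omega> in Q. \<Phi> (\<lambda>i\<in>{0..<K}. X i \<omega>) = F (polygon m (\<lambda>k. sqrt sigma2 * W (real k / 2 ^ m) \<omega>))"
   proof eventually_elim
    case (elim \<omega>)
    have "(\<Sum>i<k. (\<lambda>i\<in>{0..<K}. X i \<omega>) i) = sqrt sigma2 * W (real k / 2 ^ m) \<omega>" if "k <= K" for k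
    proof -
     have "(\<Sum>i<k. (\<lambda>i\<in>{0..<K}. X i \<omega>) i) = (\<Sum>i<k. X i \<omega>)" using that by (intro sum.cong) auto
     also have "... = sqrt sigma2 * (W (\<tau> k) \<omega> - W (\<tau> 0) \<omega>)"
      by (induction k) (auto simp: X_def algebra_simps)
     finally show ?thesis using elim \<tau>(3) by (simp add: \<tau>_def)
    qed
    then have "\<bar>\<Phi> (\<lambda>i\<in>{0..<K}. X i \<omega>) - F (polygon m (\<lambda>k. sqrt sigma2 * W (real k / 2 ^ m) \<omega>))\<bar> <= 0"
     unfolding \<Phi>_def by (intro order_trans[OF pl]) simp
    then show ?case by simp
   qed
  qed
  finally show ?thesis .
 qed
 define N where "N n i = (n * i) div 2 ^ m" for n i :: nat
 note Np = dyadic_blocks[where m = m, folded N_def]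
 have N0: "N n 0 = 0" for n by (simp add: N_def)
 have "(\<lambda>n. MEAN x. \<Phi> (\<lambda>i. S (N n (Suc i) - N n i) ((T ^^ (N n i - N n 0)) x) / sqrt (real n))) \<longlonglongrightarrow> (\<integral>v. \<Phi> v \<partial>PiM {0..<K} D)"
 proof (rule blocks_limit[where \<theta> = "\<lambda>_. 1 / 2 ^ m" and L = "Lc * real (Suc K)", OF Dr Dc])
  show "coord_lipschitz {0..<K} (Lc * real (Suc K)) \<Phi>" by (rule \<Phi>L)
  show "N n K <= n" for n by (simp add: K_def Np)
  show "(\<lambda>n. real (N n (Suc i) - N n i) / real n) \<longlonglongrightarrow> 1 / 2 ^ m" for i
  proof -
   have "(\<lambda>n. real (N n (Suc i) - N n i) / real n - 1 / 2 ^ m) \<longlonglongrightarrow> 0"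
   proof (rule Lim_null_comparison[OF _ lim_1_over_n])
    show "\<forall>\<^sub>F n in sequentially. norm (real (N n (Suc i) - N n i) / real n - 1 / 2 ^ m) <= 1 / real n"
     using eventually_gt_at_top[of 0]
    proof eventually_elim
     case (elim n)
     have "real (N n (Suc i) - N n i) / real n - 1 / 2 ^ m = (real (N n (Suc i) - N n i) - real n * (1 / 2 ^ m)) / real n"
      using elim by (simp add: diff_divide_distrib)
     then have "norm (real (N n (Suc i) - N n i) / real n - 1 / 2 ^ m) = \<bar>real (N n (Suc i) - N n i) - real n * (1 / 2 ^ m)\<bar> / real n"
      by (simp add: abs_divide)
     also have "... <= 1 / real n" by (intro divide_right_mono Np(4)) simp
     finally show ?case .
    qed
   qed
   then show ?thesis by (rule LIM_zero_cancel)
  qed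
 qed (use Np \<Phi>1 Lc in auto)
 moreover have "(\<lambda>n. (MEAN x. F (polygon m (\<lambda>k. path n (real k / 2 ^ m) x)))
   - (MEAN x. \<Phi> (\<lambda>i. S (N n (Suc i) - N n i) ((T ^^ (N n i - N n 0)) x) / sqrt (real n)))) \<longlonglongrightarrow> 0"
 proof (rule Lim_null_comparison[OF always_eventually, OF allI])
  fix n
  define V where "V i x = S (N n (Suc i) - N n i) ((T ^^ (N n i - N n 0)) x) / sqrt (real n)" for i x
  have Vm: "V i \<in> borel_measurable M" for i unfolding V_def[abs_def] by measurable
  have sumV: "(\<Sum>i<k. V i x) = S (N n k) x / sqrt (real n)" for k x
  proof (induction k)
   case (Suc k)
   have "S (N n (Suc k)) x = S (N n k + (N n (Suc k) - N n k)) x" using Np(1)[of n k] by simp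
   also have "... = S (N n k) x + S (N n (Suc k) - N n k) ((T ^^ N n k) x)" by (rule S_add)
   finally show ?case using Suc by (simp add: V_def N0 add_divide_distrib)
  qed (simp add: N0)
  have pt: "\<bar>F (polygon m (\<lambda>k. path n (real k / 2 ^ m) x)) - \<Phi> (\<lambda>i. V i x)\<bar> <= Lc * (real (Suc K) * (B * (1 / sqrt (real n))))" if x: "x \<in> space M" for x
  proof -
   have "\<bar>path n (real k / 2 ^ m) x - (\<Sum>i<k. V i x)\<bar> <= B * (1 / sqrt (real n))" for k
   proof -
    have "\<bar>partial (real n * (real k / 2 ^ m)) x - S (N n k) x\<bar> / sqrt (real n) <= B / sqrt (real n)"
     using partial_near_S[of "real n * (real k / 2 ^ m)" x, OF _ x] unfolding Np(3) by (intro divide_right_mono) simp_all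
    then show ?thesis unfolding sumV path_def by (simp add: diff_divide_distrib[symmetric] abs_divide)
   qed
   then have "(\<Sum>k\<le>K. \<bar>path n (real k / 2 ^ m) x - (\<Sum>i<k. V i x)\<bar>) <= (\<Sum>k\<le>K. B * (1 / sqrt (real n)))" by (intro sum_mono)
   then have "Lc * (\<Sum>k\<le>K. \<bar>path n (real k / 2 ^ m) x - (\<Sum>i<k. V i x)\<bar>) <= Lc * (real (Suc K) * (B * (1 / sqrt (real n))))"
    using Lc by (intro mult_left_mono) auto
   then show ?thesis unfolding \<Phi>_def by (rule order_trans[OF pl])
  qed
  have m1: "(\<lambda>x. F (polygon m (\<lambda>k. path n (real k / 2 ^ m) x))) \<in> borel_measurable M"
   by (rule coord_lipschitz_measurable[OF coord_lipschitz_polygon[OF \<eta> F]]) simp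
  have m2: "(\<lambda>x. \<Phi> (\<lambda>i. V i x)) \<in> borel_measurable M"
   by (rule coord_lipschitz_measurable[OF \<Phi>L]) (rule Vm)
  have "integrable M (\<lambda>x. F (polygon m (\<lambda>k. path n (real k / 2 ^ m) x)))"
   by (rule integrable_bdd[OF m1, of 1]) (simp add: F1 polygon_in_holder0 \<eta>)
  moreover have "integrable M (\<lambda>x. \<Phi> (\<lambda>i. V i x))" by (rule integrable_bdd[OF m2, of 1]) (simp add: \<Phi>1)
  ultimately show "norm ((MEAN x. F (polygon m (\<lambda>k. path n (real k / 2 ^ m) x)))
    - (MEAN x. \<Phi> (\<lambda>i. S (N n (Suc i) - N n i) ((T ^^ (N n i - N n 0)) x) / sqrt (real n)))) <= Lc * (real (Suc K) * (B * (1 / sqrt (real n))))"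
   unfolding V_def[symmetric] using pt by (intro integral_diff_le) auto
 next
  have lim1: "(\<lambda>n. 1 / sqrt (real n)) \<longlonglongrightarrow> 0" by real_asymp
  have "(\<lambda>n. Lc * (real (Suc K) * (B * (1 / sqrt (real n))))) \<longlonglongrightarrow> Lc * (real (Suc K) * (B * 0))"
   by (intro tendsto_intros lim1)
  then show "(\<lambda>n. Lc * (real (Suc K) * (B * (1 / sqrt (real n))))) \<longlonglongrightarrow> 0" by simp
 qed
 ultimately show ?thesis unfolding target by (rule Lim_transform)
qed

text \<open>Choose the level \<open>m\<close> such that the polygons of level \<open>m\<close> are close to the paths outside an event of small
probability, uniformly in \<open>n\<close>, and likewise for the Brownian motion; then let \<open>n\<close> tend to infinity.\<close>
theorem holder_invariance_principle:
 assumes \<eta>: "0 < \<eta>" "\<eta> < 1" and p: "2 < p" "p < 2 * \<beta>" "p * (1 / 2 - \<eta>) > 1"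
  and W: "standard_brownian_motion Q W" and WH: "\<forall>\<omega>\<in>space Q. (\<lambda>t\<in>{0..1}. W t \<omega>) \<in> holder0_space \<eta>"
 shows "converges_in_distribution (holder0_topology \<eta>) M (\<lambda>n x. \<lambda>t\<in>{0..1}. path (Suc n) t x)
   Q (\<lambda>\<omega>. \<lambda>t\<in>{0..1}. sqrt sigma2 * W t \<omega>)"
 unfolding holder0_topology_def
proof (rule Metric_space.weak_convergence_from_lipschitz[OF Metric_space_holder0 prob_space_axioms])
 show Q: "prob_space Q" using W by (simp add: standard_brownian_motion_def)
 interpret Q: prob_space Q by (rule Q)
 define Y where "Y \<omega> = (\<lambda>t\<in>{0..1}. sqrt sigma2 * W t \<omega>)" for \<omega>
 define X where "X n x = (\<lambda>t\<in>{0..1}. path n t x)" for n x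
 have X0: "X n x \<in> holder0_space \<eta>" if "x \<in> space M" for n x unfolding X_def by (rule path_in_holder0[OF \<eta> that])
 have Y0: "Y \<omega> \<in> holder0_space \<eta>" if "\<omega> \<in> space Q" for \<omega>
 proof -
  have "(\<lambda>t\<in>{0..1}. W t \<omega>) \<in> holder0_space \<eta>" using WH that by blast
  then show ?thesis unfolding Y_def by (rule holder0_scale)
 qed
 have Ym: "(\<lambda>\<omega>. Y \<omega> t) \<in> borel_measurable Q" if "t \<in> {0..1}" for t
 proof -
  have [measurable]: "W t \<in> borel_measurable Q" using W that unfolding standard_brownian_motion_def by blast
  show ?thesis using that by (simp add: Y_def)
 qed
 have Xm: "(\<lambda>x. X n x t) \<in> borel_measurable M" for n t by (cases "t \<in> {0..1}") (simp_all add: X_def)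
 show "(\<lambda>x. \<lambda>t\<in>{0..1}. path (Suc n) t x) \<in> space M \<rightarrow> holder0_space \<eta>" for n
  using X0 by (auto simp: X_def)
 show "(\<lambda>\<omega>. \<lambda>t\<in>{0..1}. sqrt sigma2 * W t \<omega>) \<in> space Q \<rightarrow> holder0_space \<eta>"
  using Y0 by (auto simp: Y_def)
 fix F :: "(real => real) => real" and L assume F: "lip_on (holder0_space \<eta>) (holder_dist \<eta>) L F"
 show mX: "(\<lambda>x. F (\<lambda>t\<in>{0..1}. path (Suc n) t x)) \<in> borel_measurable M" for n
  unfolding X_def[symmetric] by (rule lip_on_measurable(1)[OF \<eta> F X0 Xm])
 show mY: "(\<lambda>\<omega>. F (\<lambda>t\<in>{0..1}. sqrt sigma2 * W t \<omega>)) \<in> borel_measurable Q"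
  unfolding Y_def[symmetric] by (rule lip_on_measurable(1)[OF \<eta> F Y0 Ym])
 assume F1: "!!x. x \<in> holder0_space \<eta> ==> \<bar>F x\<bar> <= 1"
 define E where "E n = (MEAN x. F (X n x))" for n
 define EP where "EP m n = (MEAN x. F (polygon m (\<lambda>k. path n (real k / 2 ^ m) x)))" for m n
 define G where "G = (\<integral>\<omega>. F (Y \<omega>) \<partial>Q)"
 define GP where "GP m = (\<integral>\<omega>. F (polygon m (\<lambda>k. sqrt sigma2 * W (real k / 2 ^ m) \<omega>)) \<partial>Q)" for m
 have GP: "GP \<longlonglongrightarrow> G"
  unfolding GP_def G_def
 proof (rule integral_dominated_convergence[where w = "\<lambda>_. 1"])
  have PY: "polygon m (\<lambda>k. sqrt sigma2 * W (real k / 2 ^ m) \<omega>) = polygon m (\<lambda>k. Y \<omega> (real k / 2 ^ m))" for m \<omega>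
   unfolding polygon_def Y_def
  proof (intro restrict_ext sum.cong refl)
   fix k :: nat and t :: real assume "k \<in> {..2 ^ m}"
   then have "real k <= real (2 ^ m)" by (simp only: of_nat_le_iff) simp
   then show "sqrt sigma2 * W (real k / 2 ^ m) \<omega> * max 0 (1 - \<bar>2 ^ m * t - real k\<bar>)
    = (\<lambda>t\<in>{0..1}. sqrt sigma2 * W t \<omega>) (real k / 2 ^ m) * max 0 (1 - \<bar>2 ^ m * t - real k\<bar>)" by (simp add: divide_le_eq)
  qed
  show "(\<lambda>\<omega>. F (polygon m (\<lambda>k. sqrt sigma2 * W (real k / 2 ^ m) \<omega>))) \<in> borel_measurable Q" for m
   unfolding PY by (rule lip_on_measurable(2)[OF \<eta> F Y0 Ym])
  show "AE \<omega> in Q. (\<lambda>m. F (polygon m (\<lambda>k. sqrt sigma2 * W (real k / 2 ^ m) \<omega>))) \<longlonglongrightarrow> F (Y \<omega>)"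
   unfolding PY by (intro AE_I2 lip_on_polygon_tendsto[OF \<eta> F Y0])
  show "(\<lambda>\<omega>. F (Y \<omega>)) \<in> borel_measurable Q" using mY by (simp add: Y_def)
  show "AE \<omega> in Q. norm (F (polygon m (\<lambda>k. sqrt sigma2 * W (real k / 2 ^ m) \<omega>))) <= 1" for m
   by (intro AE_I2) (simp add: F1 polygon_in_holder0 \<eta>)
 qed simp
 have L: "0 <= L" using F by (simp add: lip_on_def)
 have "E \<longlonglongrightarrow> G"
 proof (rule LIMSEQ_I)
  fix e :: real assume e: "0 < e"
  define c where "c = 8 / (1 - 2 powr - \<eta> :: real)"
  have c: "0 < c" using \<eta> by (simp add: c_def powr_less_one)
  define A where "A = e / (4 * (c * (L + 1)))"
  have A: "0 < A" unfolding A_def using e c L by (intro divide_pos_pos mult_pos_pos) auto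
  have LcA: "L * (c * A) <= e / 4"
  proof -
   have "L * (c * A) <= (L + 1) * (c * A)" using A c by (intro mult_right_mono) auto
   also have "... = (c * (L + 1)) * A" by (simp only: mult_ac)
   also have "... = e / 4"
   proof -
    have "c * (L + 1) \<noteq> 0" using c L by simp
    then show ?thesis unfolding A_def by (simp del: mult_eq_0_iff)
   qed
   finally show ?thesis .
  qed
  have "0 < e / 8" using e by simp
  then obtain m0 where m0: "!!m n. m0 <= m ==> 0 < n ==> prob (rough \<eta> A m n) <= e / 8"
   using rough_unlikely[OF p A] by blast
  have "eventually (\<lambda>m. \<bar>GP m - G\<bar> < e / 4) sequentially"
   using GP e unfolding tendsto_iff dist_real_def by (elim allE[of _ "e / 4"]) simp
  then obtain m1 where m1: "!!m. m1 <= m ==> \<bar>GP m - G\<bar> < e / 4" by (auto simp: eventually_sequentially)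
  define m where "m = max m0 m1"
  have "(\<lambda>n. EP m n) \<longlonglongrightarrow> GP m" unfolding EP_def GP_def by (rule polygon_distribution_limit[OF \<eta> F F1 W])
  then have "eventually (\<lambda>n. \<bar>EP m n - GP m\<bar> < e / 4) sequentially"
   using e unfolding tendsto_iff dist_real_def by (elim allE[of _ "e / 4"]) simp
  with eventually_gt_at_top[of 0] have "eventually (\<lambda>n. norm (E n - G) < e) sequentially"
  proof eventually_elim
   case (elim n)
   have "\<bar>E n - EP m n\<bar> <= L * (8 / (1 - 2 powr - \<eta>) * A) + 2 * prob (rough \<eta> A m n)"
    unfolding E_def EP_def X_def using A by (intro path_truncation[OF \<eta> F F1]) auto
   also have "... <= e / 4 + 2 * (e / 8)"
    using LcA m0[of m n] elim by (intro add_mono mult_left_mono) (auto simp: c_def m_def)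
   finally have "\<bar>E n - EP m n\<bar> <= e / 2" by simp
   moreover have "m1 <= m" by (simp add: m_def)
   ultimately show ?case using elim(2) m1[of m] unfolding real_norm_def by linarith
  qed
  then show "\<exists>n0. \<forall>n\<ge>n0. norm (E n - G) < e" by (simp add: eventually_sequentially)
 qed
 then have "(\<lambda>n. E (Suc n)) \<longlonglongrightarrow> G" by (rule LIMSEQ_Suc)
 then show "(\<lambda>n. MEAN x. F (\<lambda>t\<in>{0..1}. path (Suc n) t x)) \<longlonglongrightarrow> (\<integral>\<omega>. F (\<lambda>t\<in>{0..1}. sqrt sigma2 * W t \<omega>) \<partial>Q)"
  by (simp add: E_def G_def X_def Y_def)
qed

end

section \<open>Holland maps with exponent below one half\<close>

text \<open>The moment exponent \<open>p\<close> is taken between \<open>1 / \<gamma>\<close>, as tightness requires, and \<open>2 * \<beta>\<close>.\<close>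
theorem corollary1p2:
  fixes \<gamma> :: real and \<rho> f \<phi> :: "real \<Rightarrow> real" and \<mu> :: "real measure"
  assumes "0 < \<gamma>" and "\<gamma> < 1/2"
    and "holland_map \<gamma> \<rho> f"
    and "acip f \<mu>"
    and "holder_continuous_on {0..1} \<phi>"
    and "(\<integral>x. \<phi> x \<partial>\<mu>) = 0"
  shows "summable (\<lambda>k. \<bar>covariance \<mu> \<phi> (\<phi> \<circ> (f ^^ Suc k))\<bar>) \<and>
    (\<forall>(N :: 'w measure) W.
       standard_brownian_motion N W \<and>
       (\<forall>\<omega>\<in>space N. (\<lambda>t\<in>{0..1}. W t \<omega>) \<in> holder0_space (1/2 - \<gamma>)) \<longrightarrow>
       converges_in_distribution (holder0_topology (1/2 - \<gamma>))
         \<mu> (\<lambda>n x. \<lambda>t\<in>{0..1}. birkhoff_process f \<phi> (Suc n) t x)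
         N (\<lambda>\<omega>. \<lambda>t\<in>{0..1}. sqrt (asymptotic_variance \<mu> f \<phi>) * W t \<omega>))"
proof -
 note \<gamma> = assms(1,2) and ac = assms(4)
 obtain \<beta> R where \<beta>: "1 / (2 * \<gamma>) < \<beta>"
  and R: "!!n G. 1 <= n ==> G \<in> borel_measurable \<mu> ==> (!!x. x \<in> space \<mu> ==> \<bar>G x\<bar> <= 1) ==>
   \<bar>\<integral>x. \<phi> x * G ((f ^^ n) x) \<partial>\<mu>\<bar> <= R * real n powr - \<beta>"
  using holland_decay_of_correlations[OF assms(3,2,4,5,6)] by blast
 have "1 < 1 / (2 * \<gamma>)" using \<gamma> by simp
 then have \<beta>1: "1 < \<beta>" using \<beta> by simp
 have "compact (\<phi> ` {0..1})"
  by (rule compact_continuous_image[OF holder_bounded_continuous[OF assms(5)]]) simp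
 then obtain B where B: "0 < B" "!!x. x \<in> {0..1} ==> \<bar>\<phi> x\<bar> <= B"
  using compact_imp_bounded[of "\<phi> ` {0..1}"] by (auto simp: bounded_pos)
 interpret prob_space \<mu> using ac by (simp add: acip_def)
 interpret exact_system \<mu> f \<phi> B "max R 0" \<beta>
 proof unfold_locales
  fix n :: nat and G :: "real => real" assume n: "1 <= n" and G: "G \<in> borel_measurable \<mu>" "!!x. x \<in> space \<mu> ==> \<bar>G x\<bar> <= 1"
  have "R * real n powr - \<beta> <= max R 0 * real n powr - \<beta>" by (intro mult_right_mono) auto
  with R[OF n G] show "\<bar>\<integral>x. \<phi> x * G ((f ^^ n) x) \<partial>\<mu>\<bar> <= max R 0 * real n powr - \<beta>" by linarith
 next
  fix \<psi> :: "real => real" and e :: real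
  assume "\<psi> \<in> borel_measurable \<mu>" "!!x. x \<in> space \<mu> ==> \<bar>\<psi> x\<bar> <= 1" "0 < e"
  then show "\<exists>n0. \<forall>n\<ge>n0. \<forall>G. G \<in> borel_measurable \<mu> --> (\<forall>x\<in>space \<mu>. \<bar>G x\<bar> <= 1) -->
    \<bar>(\<integral>x. \<psi> x * G ((f ^^ n) x) \<partial>\<mu>) - (\<integral>x. \<psi> x \<partial>\<mu>) * (\<integral>x. G x \<partial>\<mu>)\<bar> <= e"
   using \<gamma> by (intro holland_mixing[OF assms(3) _ ac]) auto
 qed (use ac B \<beta>1 holder_measurable[OF ac assms(5)] in \<open>auto simp: acip_def acip_space[OF ac]\<close>)
 have cov_eq: "covariance \<mu> \<phi> (\<phi> \<circ> (f ^^ k)) = cov k" for k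
  unfolding covariance_def cov_def using T_pow_invariant[OF phi_meas, of k] assms(6) by (simp add: o_def)
 have "covariance \<mu> \<phi> \<phi> = cov 0" using cov_eq[of 0] by (simp add: comp_def id_def)
 then have var: "asymptotic_variance \<mu> f \<phi> = sigma2"
  unfolding asymptotic_variance_def sigma2_def cov_eq by simp
 have path_eq: "birkhoff_process f \<phi> n t x = path n t x" for n t x
  by (simp add: birkhoff_process_def birkhoff_sum_def path_def partial_def S_def Let_def)
 have "1 / \<gamma> < 2 * \<beta>" using \<beta> \<gamma> by (simp add: field_simps)
 then obtain p where p: "1 / \<gamma> < p" "p < 2 * \<beta>" using dense by blast
 have "2 < 1 / \<gamma>" using \<gamma> by (simp add: field_simps)
 then have p2: "2 < p" using p by linarith
 have p\<gamma>: "1 < p * (1 / 2 - (1 / 2 - \<gamma>))" using p \<gamma> by (simp add: field_simps)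
 show ?thesis
  unfolding var path_eq cov_eq
  using summable_abs_cov holder_invariance_principle[OF _ _ p2 p(2) p\<gamma>] \<gamma> by auto
qed

end
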